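(* Let $K$ be a connected p.c.f. self-similar set and $\boldsymbol r$ a positive vector such that there is $E\in\mathcal M$ with $\inf_{n\ge0}\delta(\mathcal T^nE)>0$ and there is $E\in\mathcal Q$ with $\mathcal TE=E$. Let $\mu$ be a given probability Radon measure on $K$ such that $\sum_{m=0}^\infty\kappa_m^{1/p}<\infty$, where $\kappa_m=\max_{w\in W_m}r_w\mu(F_wK)$. Let $(\mathcal E,\mathcal F)$ be the limit form defined in the context. Let $\mathcal F_c=\{f\in\mathcal F: f\text{ is uniformly continuous}\}$, and consider the natural embedding (by continuous extension) $\Psi:\mathcal F_c\to C(K)\subset L^p(K,\mu)$. Then $\Psi$ can be extended continuously to $\mathcal F\to L^p(K,\mu)$ in the sense that if $\{f_n\}\subset\mathcal F_c$, $f\in\mathcal F$, $f_n\to f$ pointwise on $V_*$ and $\mathcal E(f_n-f)\to0$, then $\Psi(f_n)\to\Psi(f)$ under the $L^p(K,\mu)$ norm. In addition, $\Psi$ is self-similar: $$\Psi(f\circ F_w)=\Psi(f)\circ F_w,\quad\forall w\in W_*,\ f\in\mathcal F.$$ By identifying $\mathcal F$ with $\Psi(\mathcal F)$, $(\mathcal E,\mathcal F)$ becomes a closed $p$-energy form on $L^p(K,\mu)$ in the sense that $\mathcal E$ has the Markov property and is uniformly convex, and $(\mathcal F,\mathcal E_1^{1/p})$ is closed and separable, where $\mathcal E_1$ is defined by $\mathcal E_1(f)=\mathcal E(f)+\|f\|_{L^p(K,\mu)}^p$. In addition, $(\mathcal E,\mathcal F)$ is regular and strongly local in the following senses: (regular)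 Let $\mathscr C=\mathcal F\cap C(K)$. Then $\mathscr C$ is dense in $C(K)$, and $\mathscr C$ is dense in $\mathcal F$ with respect to the norm $\mathcal E_1^{1/p}$. (strongly local) For $f,g\in\mathscr C$, if $f$ is constant on a neighbourhood of $\mathrm{supp}(g)$, then $\mathcal E(f+g)=\mathcal E(f)+\mathcal E(g)$.
   Context: Discrete energies. Fix $1<p<\infty$. For a set $X$, $l(X)$ is the space of real-valued functions on $X$; for a metric space $X$, $C(X)$ is the space of continuous functions on $X$. For a finite set $A$ with $\#A\ge2$, $\mathcal M_p(A)$ is the set of functionals $E:l(A)\to\mathbb R$ such that for all $f,g\in l(A)$: (i) $E(f)\ge0$; (ii) $E(tf+(1-t)g)\le tE(f)+(1-t)E(g)$ for $t\in(0,1)$; (iii) $E(tf)=|t|^pE(f)$ for $t\in\mathbb R$; (iv) $E(f+t)=E(f)$ for $t\in\mathbb R$; (v) $E((f\vee0)\wedge1)\le E(f)$; (vi) $E(f)=0$ iff $f$ is constant. $\widetilde{\mathcal M}_p(A)$ is the set of functionals satisfying (i)-(v) and $E(1)=0$. For $B\subset A$, the trace of $E$ to $B$ is $[E]_B(f)=\inf\{E(f'):f'\in l(A),f'|_B=f\}$, $f\in l(B)$. The $p$-resistance of $E$ is $R(x,y)=1/\inf\{E(f):f(x)=0,f(y)=1\}\in(0,\infty]$ for $x\ne y$, $R(x,x)=0$. $\mathcal S_p(A)$ is the set of $E\in\mathcal M_p(A)$ of the form $E(f)=\sum_{x,y\in A}c_{x,y}|f(x)-f(y)|^p$ with constants $c_{x,y}\ge0$.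 $\mathcal Q_p'(A)$ is the set of $E\in\mathcal M_p(A)$ for which there are a finite $B\supset A$ and $E_B\in\mathcal S_p(B)$ with $E=[E_B]_A$. $\mathcal Q_p(A)$ is the closure of $\mathcal Q_p'(A)$ in $\mathcal M_p(A)$ with respect to the norm $\|E\|=\sup\{|E(f)|/\max_{x,y}|f(x)-f(y)|^p: f\in l(A)\text{ non-constant}\}$ (applied to differences of functionals). Fractals. $F_i(x)=\alpha_iU_ix+a_i$, $1\le i\le N$, $N\ge2$, are similitudes of $\mathbb R^d$ with $\alpha_i\in(0,1)$, $U_i$ orthogonal, $a_i\in\mathbb R^d$; $K$ is the unique non-empty compact set with $K=\bigcup_iF_iK$. $W_n=\{1,\dots,N\}^n$, $W_0=\{\emptyset\}$, $W_*=\bigcup_{n\ge0}W_n$; for $w=w_1\cdots w_n$, $F_w=F_{w_1}\circ\cdots\circ F_{w_n}$ and $r_w=r_{w_1}\cdots r_{w_n}$. $\Sigma=\{1,\dots,N\}^{\mathbb N}$, $\pi:\Sigma\to K$ with $\{\pi(\omega)\}=\bigcap_nF_{\omega_1\cdots\omega_n}K$, $\tau$ is the left shift on $\Sigma$, $\mathcal C=\pi^{-1}(\bigcup_{i\ne j}(F_iK\cap F_jK))$, $\mathcal P=\bigcup_{m\ge1}\tau^m(\mathcal C)$. $K$ is p.c.f. if $\mathcal P$ is finite. $V_0=\pi(\mathcal P)$, $V_n=\bigcup_iF_iV_{n-1}$, $V_*=\bigcup_{n\ge0}V_n$ (dense in $K$). $\mathcal M,\mathcal Q$ denote $\mathcal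 M_p(V_0),\mathcal Q_p(V_0)$. Renormalization. For a positive vector $\boldsymbol r=(r_1,\dots,r_N)$ and $E\in\widetilde{\mathcal M}_p(V_n)$, $\Lambda E\in\widetilde{\mathcal M}_p(V_{n+1})$ is $\Lambda E(f)=\sum_{i=1}^Nr_i^{-1}E(f\circ F_i)$ and $\mathcal TE=[\Lambda E]_{V_n}$. For $E\in\mathcal M$ with $p$-resistance $R$, $\delta(E)=\min_{x\ne y\in V_0}R(x,y)/\max_{x\ne y\in V_0}R(x,y)$. The limit form. Let $E_0(f)=\frac12\sum_{x\ne y}|f(x)-f(y)|^p$ for $f\in l(V_0)$ and $\mathcal F=\{f\in l(V_* ):\sup_{n\ge1}\Lambda^nE_0(f|_{V_n})<\infty\}$. Under the stated assumptions on $K,\boldsymbol r$ there is a subsequence $(n_l)$ such that $\mathcal E(f)=\lim_{l\to\infty}\frac1{n_l+1}\sum_{m=0}^{n_l}\Lambda^mE_0(f|_{V_m})$ exists for every $f\in\mathcal F$; such a subsequence is fixed and this defines $\mathcal E$. Under the identification of $\mathcal F$ with $\Psi(\mathcal F)\subset L^p(K,\mu)$, $\mathcal E(\Psi(f))=\mathcal E(f)$. Terminology. Markov property: if $f\in\mathcal F$ then $\bar f=(f\vee0)\wedge1\in\mathcal F$ and $\mathcal E(\bar f)\le\mathcal E(f)$. Uniformly convex: for any $\delta>0$ there is $\varepsilon>0$ (depending on $p,\delta$) such that $\mathcal E(f)=\mathcal E(g)=1$ and $\mathcal E(f-g)\ge\delta$ imply $\mathcal E(\frac{f+g}2)\le1-\varepsilon$.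 *)

theory Defs
  imports "HOL-Analysis.Analysis" "HOL-Probability.Probability"
begin

section \<open>Discrete p-energies\<close>

text \<open>A real function on a set \<open>A\<close> is represented by a total function, of which only the
  values on \<open>A\<close> matter. Accordingly a functional on \<open>l(A)\<close> is a functional on total functions
  that factors through the restriction to \<open>A\<close>; equality of two such functionals is then
  equality on \<open>l(A)\<close>.\<close>

definition functional_on :: "'a set \<Rightarrow> (('a \<Rightarrow> real) \<Rightarrow> real) \<Rightarrow> bool" where
  "functional_on A E \<longleftrightarrow> (\<forall>f g. (\<forall>x\<in>A. f x = g x) \<longrightarrow> E f = E g)"

definition constant_on_set :: "'a set \<Rightarrow> ('a \<Rightarrow> real) \<Rightarrow> bool" where
  "constant_on_set A f \<longleftrightarrow> (\<forall>x\<in>A. \<forall>y\<in>A. f x = f y)"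

definition unit_cut :: "('a \<Rightarrow> real) \<Rightarrow> 'a \<Rightarrow> real" where
  "unit_cut f = (\<lambda>x. min (max (f x) 0) 1)"

definition energies_M :: "real \<Rightarrow> 'a set \<Rightarrow> (('a \<Rightarrow> real) \<Rightarrow> real) set" where
  "energies_M p A = {E. functional_on A E \<and>
     (\<forall>f. 0 \<le> E f) \<and>
     (\<forall>f g t. 0 < t \<and> t < 1 \<longrightarrow>
        E (\<lambda>x. t * f x + (1 - t) * g x) \<le> t * E f + (1 - t) * E g) \<and>
     (\<forall>f t. E (\<lambda>x. t * f x) = \<bar>t\<bar> powr p * E f) \<and>
     (\<forall>f t. E (\<lambda>x. f x + t) = E f) \<and>
     (\<forall>f. E (unit_cut f) \<le> E f) \<and>
     (\<forall>f. E f = 0 \<longleftrightarrow> constant_on_set A f)}"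

definition trace_energy :: "'a set \<Rightarrow> (('a \<Rightarrow> real) \<Rightarrow> real) \<Rightarrow> ('a \<Rightarrow> real) \<Rightarrow> real" where
  "trace_energy B E f = Inf {E f' | f'. \<forall>x\<in>B. f' x = f x}"

definition resistance :: "(('a \<Rightarrow> real) \<Rightarrow> real) \<Rightarrow> 'a \<Rightarrow> 'a \<Rightarrow> ereal" where
  "resistance E x y =
     (if x = y then 0 else 1 / ereal (Inf {E f | f. f x = 0 \<and> f y = 1}))"

definition resistance_ratio :: "'a set \<Rightarrow> (('a \<Rightarrow> real) \<Rightarrow> real) \<Rightarrow> ereal" where
  "resistance_ratio A E =
     Min {resistance E x y | x y. x \<in> A \<and> y \<in> A \<and> x \<noteq> y} /
     Max {resistance E x y | x y. x \<in> A \<and> y \<in> A \<and> x \<noteq> y}"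

definition energies_S :: "real \<Rightarrow> 'a set \<Rightarrow> (('a \<Rightarrow> real) \<Rightarrow> real) set" where
  "energies_S p A = {E \<in> energies_M p A. \<exists>c. (\<forall>x\<in>A. \<forall>y\<in>A. 0 \<le> c x y) \<and>
     (\<forall>f. E f = (\<Sum>x\<in>A. \<Sum>y\<in>A. c x y * \<bar>f x - f y\<bar> powr p))}"

text \<open>The enlarged set \<open>B\<close> is taken inside the type \<open>'a\<close>. This loses nothing when \<open>'a\<close> is
  infinite, as every Euclidean space is.\<close>

definition energies_Q' :: "real \<Rightarrow> 'a set \<Rightarrow> (('a \<Rightarrow> real) \<Rightarrow> real) set" where
  "energies_Q' p A = {E \<in> energies_M p A.
     \<exists>B E\<^sub>B. finite B \<and> A \<subseteq> B \<and> E\<^sub>B \<in> energies_S p B \<and> E = trace_energy A E\<^sub>B}"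

definition functional_norm :: "real \<Rightarrow> 'a set \<Rightarrow> (('a \<Rightarrow> real) \<Rightarrow> real) \<Rightarrow> ereal" where
  "functional_norm p A E = (SUP f \<in> {f. \<not> constant_on_set A f}.
     ereal (\<bar>E f\<bar> / Max {\<bar>f x - f y\<bar> powr p | x y. x \<in> A \<and> y \<in> A}))"

definition energies_Q :: "real \<Rightarrow> 'a set \<Rightarrow> (('a \<Rightarrow> real) \<Rightarrow> real) set" where
  "energies_Q p A = {E \<in> energies_M p A.
     \<forall>\<epsilon>>0. \<exists>E'\<in>energies_Q' p A. functional_norm p A (\<lambda>f. E f - E' f) < ereal \<epsilon>}"


section \<open>Self-similar sets\<close>

definition contracting_similitude :: "('a::euclidean_space \<Rightarrow> 'a) \<Rightarrow> bool" where
  "contracting_similitude G \<longleftrightarrow> (\<exists>\<alpha> U a. 0 < \<alpha> \<and> \<alpha> < 1 \<and> orthogonal_transformation U \<and>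
     G = (\<lambda>x. \<alpha> *\<^sub>R U x + a))"

definition self_similar_set :: "nat \<Rightarrow> (nat \<Rightarrow> 'a::euclidean_space \<Rightarrow> 'a) \<Rightarrow> 'a set \<Rightarrow> bool" where
  "self_similar_set N F K \<longleftrightarrow> 2 \<le> N \<and> (\<forall>i\<in>{1..N}. contracting_similitude (F i)) \<and>
     compact K \<and> K \<noteq> {} \<and> K = (\<Union>i\<in>{1..N}. F i ` K)"

definition words :: "nat \<Rightarrow> nat \<Rightarrow> nat list set" where
  "words N n = {w. length w = n \<and> set w \<subseteq> {1..N}}"

definition word_map :: "(nat \<Rightarrow> 'a \<Rightarrow> 'a) \<Rightarrow> nat list \<Rightarrow> 'a \<Rightarrow> 'a" where
  "word_map F w = foldr (\<lambda>i G. F i \<circ> G) w id"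

definition word_weight :: "(nat \<Rightarrow> real) \<Rightarrow> nat list \<Rightarrow> real" where
  "word_weight r w = prod_list (map r w)"

definition shift_space :: "nat \<Rightarrow> (nat \<Rightarrow> nat) set" where
  "shift_space N = {\<omega>. \<forall>n. \<omega> n \<in> {1..N}}"

definition shift :: "(nat \<Rightarrow> nat) \<Rightarrow> nat \<Rightarrow> nat" where
  "shift \<omega> = (\<lambda>n. \<omega> (Suc n))"

definition coding_map :: "(nat \<Rightarrow> 'a \<Rightarrow> 'a) \<Rightarrow> 'a set \<Rightarrow> (nat \<Rightarrow> nat) \<Rightarrow> 'a" where
  "coding_map F K \<omega> = (THE x. x \<in> (\<Inter>n. word_map F (map \<omega> [0..<n]) ` K))"

definition critical_set :: "nat \<Rightarrow> (nat \<Rightarrow> 'a \<Rightarrow> 'a) \<Rightarrow> 'a set \<Rightarrow> (nat \<Rightarrow> nat) set" where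
  "critical_set N F K = {\<omega> \<in> shift_space N.
     \<exists>i\<in>{1..N}. \<exists>j\<in>{1..N}. i \<noteq> j \<and> coding_map F K \<omega> \<in> F i ` K \<inter> F j ` K}"

definition post_critical_set :: "nat \<Rightarrow> (nat \<Rightarrow> 'a \<Rightarrow> 'a) \<Rightarrow> 'a set \<Rightarrow> (nat \<Rightarrow> nat) set" where
  "post_critical_set N F K = (\<Union>m\<in>{1..}. (shift ^^ m) ` critical_set N F K)"

definition pcf :: "nat \<Rightarrow> (nat \<Rightarrow> 'a \<Rightarrow> 'a) \<Rightarrow> 'a set \<Rightarrow> bool" where
  "pcf N F K \<longleftrightarrow> finite (post_critical_set N F K)"

primrec vertices :: "nat \<Rightarrow> (nat \<Rightarrow> 'a \<Rightarrow> 'a) \<Rightarrow> 'a set \<Rightarrow> nat \<Rightarrow> 'a set" where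
  "vertices N F K 0 = coding_map F K ` post_critical_set N F K"
| "vertices N F K (Suc n) = (\<Union>i\<in>{1..N}. F i ` vertices N F K n)"

definition all_vertices :: "nat \<Rightarrow> (nat \<Rightarrow> 'a \<Rightarrow> 'a) \<Rightarrow> 'a set \<Rightarrow> 'a set" where
  "all_vertices N F K = (\<Union>n. vertices N F K n)"


section \<open>Renormalization and the limit form\<close>

definition energy_lift :: "nat \<Rightarrow> (nat \<Rightarrow> 'a \<Rightarrow> 'a) \<Rightarrow> (nat \<Rightarrow> real) \<Rightarrow>
    (('a \<Rightarrow> real) \<Rightarrow> real) \<Rightarrow> ('a \<Rightarrow> real) \<Rightarrow> real" where
  "energy_lift N F r E f = (\<Sum>i=1..N. inverse (r i) * E (f \<circ> F i))"

definition renorm :: "nat \<Rightarrow> (nat \<Rightarrow> 'a \<Rightarrow> 'a) \<Rightarrow> 'a set \<Rightarrow> (nat \<Rightarrow> real) \<Rightarrow>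
    (('a \<Rightarrow> real) \<Rightarrow> real) \<Rightarrow> ('a \<Rightarrow> real) \<Rightarrow> real" where
  "renorm N F K r E = trace_energy (vertices N F K 0) (energy_lift N F r E)"

definition initial_energy :: "real \<Rightarrow> 'a set \<Rightarrow> ('a \<Rightarrow> real) \<Rightarrow> real" where
  "initial_energy p A f = (1/2) * (\<Sum>x\<in>A. \<Sum>y\<in>A - {x}. \<bar>f x - f y\<bar> powr p)"

definition level_energy :: "real \<Rightarrow> nat \<Rightarrow> (nat \<Rightarrow> 'a \<Rightarrow> 'a) \<Rightarrow> 'a set \<Rightarrow> (nat \<Rightarrow> real) \<Rightarrow>
    nat \<Rightarrow> ('a \<Rightarrow> real) \<Rightarrow> real" where
  "level_energy p N F K r m = (energy_lift N F r ^^ m) (initial_energy p (vertices N F K 0))"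

definition limit_domain :: "real \<Rightarrow> nat \<Rightarrow> (nat \<Rightarrow> 'a \<Rightarrow> 'a) \<Rightarrow> 'a set \<Rightarrow> (nat \<Rightarrow> real) \<Rightarrow>
    ('a \<Rightarrow> real) set" where
  "limit_domain p N F K r = {f. bdd_above ((\<lambda>n. level_energy p N F K r n f) ` {1..})}"

definition cesaro_energy :: "real \<Rightarrow> nat \<Rightarrow> (nat \<Rightarrow> 'a \<Rightarrow> 'a) \<Rightarrow> 'a set \<Rightarrow> (nat \<Rightarrow> real) \<Rightarrow>
    nat \<Rightarrow> ('a \<Rightarrow> real) \<Rightarrow> real" where
  "cesaro_energy p N F K r n f = (1 / (real n + 1)) * (\<Sum>m=0..n. level_energy p N F K r m f)"

definition limit_form :: "real \<Rightarrow> nat \<Rightarrow> (nat \<Rightarrow> 'a \<Rightarrow> 'a) \<Rightarrow> 'a set \<Rightarrow> (nat \<Rightarrow> real) \<Rightarrow>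
    (nat \<Rightarrow> nat) \<Rightarrow> ('a \<Rightarrow> real) \<Rightarrow> real" where
  "limit_form p N F K r s f = lim (\<lambda>l. cesaro_energy p N F K r (s l) f)"


section \<open>Measures and energy forms\<close>

text \<open>On a compact subset of a Euclidean space every Borel probability measure is Radon.\<close>

definition radon_probability_on :: "'a::euclidean_space set \<Rightarrow> 'a measure \<Rightarrow> bool" where
  "radon_probability_on K \<mu> \<longleftrightarrow> prob_space \<mu> \<and> sets \<mu> = sets (restrict_space borel K)"

definition kappa :: "nat \<Rightarrow> (nat \<Rightarrow> 'a \<Rightarrow> 'a) \<Rightarrow> 'a set \<Rightarrow> (nat \<Rightarrow> real) \<Rightarrow> 'a measure \<Rightarrow>
    nat \<Rightarrow> real" where
  "kappa N F K r \<mu> m =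
     Max ((\<lambda>w. word_weight r w * measure \<mu> (word_map F w ` K)) ` words N m)"

definition Lp_functions :: "real \<Rightarrow> 'a measure \<Rightarrow> ('a \<Rightarrow> real) set" where
  "Lp_functions p \<mu> =
     {u. u \<in> borel_measurable \<mu> \<and> integrable \<mu> (\<lambda>x. \<bar>u x\<bar> powr p)}"

definition Lp_norm :: "real \<Rightarrow> 'a measure \<Rightarrow> ('a \<Rightarrow> real) \<Rightarrow> real" where
  "Lp_norm p \<mu> u = (\<integral>x. \<bar>u x\<bar> powr p \<partial>\<mu>) powr (1 / p)"

definition uc_domain :: "'a::metric_space set \<Rightarrow> ('a \<Rightarrow> real) set \<Rightarrow> ('a \<Rightarrow> real) set" where
  "uc_domain V \<D> = {f \<in> \<D>. uniformly_continuous_on V f}"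

text \<open>\<open>\<D>\<close> is a set of functions on \<open>V\<close>, a dense subset of \<open>K\<close>, and \<open>\<Psi> f\<close> is a
  representative of a class in \<open>L\<^sup>p(K,\<mu>)\<close>. For uniformly continuous \<open>f\<close>, \<open>\<Psi> f\<close> has to be the
  (unique) continuous extension of \<open>f\<close> to \<open>K\<close>.\<close>

definition Lp_extension :: "real \<Rightarrow> 'a::metric_space set \<Rightarrow> 'a set \<Rightarrow> 'a measure \<Rightarrow>
    ('a \<Rightarrow> real) set \<Rightarrow> (('a \<Rightarrow> real) \<Rightarrow> real) \<Rightarrow> (('a \<Rightarrow> real) \<Rightarrow> 'a \<Rightarrow> real) \<Rightarrow> bool" where
  "Lp_extension p K V \<mu> \<D> \<E> \<Psi> \<longleftrightarrow>
     (\<forall>f g. (\<forall>x\<in>V. f x = g x) \<longrightarrow> \<Psi> f = \<Psi> g) \<and>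
     (\<forall>f\<in>\<D>. \<Psi> f \<in> Lp_functions p \<mu>) \<and>
     (\<forall>f\<in>\<D>. \<forall>g\<in>\<D>. \<forall>a b. (\<lambda>x. a * f x + b * g x) \<in> \<D> \<and>
        (AE x in \<mu>. \<Psi> (\<lambda>x. a * f x + b * g x) x = a * \<Psi> f x + b * \<Psi> g x)) \<and>
     (\<forall>f\<in>uc_domain V \<D>. continuous_on K (\<Psi> f) \<and> (\<forall>x\<in>V. \<Psi> f x = f x)) \<and>
     (\<forall>h f. (\<forall>n. h n \<in> uc_domain V \<D>) \<and> f \<in> \<D> \<and>
        (\<forall>x\<in>V. (\<lambda>n. h n x) \<longlonglongrightarrow> f x) \<and>
        (\<lambda>n::nat. \<E> (\<lambda>x. h n x - f x)) \<longlonglongrightarrow> 0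
        \<longrightarrow> (\<lambda>n. Lp_norm p \<mu> (\<lambda>x. \<Psi> (h n) x - \<Psi> f x)) \<longlonglongrightarrow> 0)"

text \<open>\<open>\<Psi> f \<circ> F\<^sub>w\<close> depends on the representative \<open>\<Psi> f\<close> unless the image of \<open>\<mu>\<close> under \<open>F\<^sub>w\<close> is
  absolutely continuous with respect to \<open>\<mu>\<close>; hence the identity is one about
  representatives, required to hold almost everywhere.\<close>

definition self_similar_embedding :: "nat \<Rightarrow> (nat \<Rightarrow> 'a \<Rightarrow> 'a) \<Rightarrow> 'a measure \<Rightarrow>
    ('a \<Rightarrow> real) set \<Rightarrow> (('a \<Rightarrow> real) \<Rightarrow> 'a \<Rightarrow> real) \<Rightarrow> bool" where
  "self_similar_embedding N F \<mu> \<D> \<Psi> \<longleftrightarrow>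
     (\<forall>n. \<forall>w\<in>words N n. \<forall>f\<in>\<D>. f \<circ> word_map F w \<in> \<D> \<and>
        (AE x in \<mu>. \<Psi> (f \<circ> word_map F w) x = (\<Psi> f \<circ> word_map F w) x))"

text \<open>The truncation of \<open>f\<close> as a function on the vertices and that of its class in \<open>L\<^sup>p\<close>
  have to agree under the identification of \<open>f\<close> with \<open>\<Psi> f\<close>.\<close>

definition markov_property :: "'a measure \<Rightarrow> ('a \<Rightarrow> real) set \<Rightarrow> (('a \<Rightarrow> real) \<Rightarrow> real) \<Rightarrow>
    (('a \<Rightarrow> real) \<Rightarrow> 'a \<Rightarrow> real) \<Rightarrow> bool" where
  "markov_property \<mu> \<D> \<E> \<Psi> \<longleftrightarrow>
     (\<forall>f\<in>\<D>. unit_cut f \<in> \<D> \<and> \<E> (unit_cut f) \<le> \<E> f \<and>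
        (AE x in \<mu>. \<Psi> (unit_cut f) x = unit_cut (\<Psi> f) x))"

definition uniformly_convex_form :: "('a \<Rightarrow> real) set \<Rightarrow> (('a \<Rightarrow> real) \<Rightarrow> real) \<Rightarrow> bool" where
  "uniformly_convex_form \<D> \<E> \<longleftrightarrow>
     (\<forall>\<delta>>0. \<exists>\<epsilon>>0. \<forall>f\<in>\<D>. \<forall>g\<in>\<D>.
        \<E> f = 1 \<and> \<E> g = 1 \<and> \<E> (\<lambda>x. f x - g x) \<ge> \<delta>
        \<longrightarrow> \<E> (\<lambda>x. (f x + g x) / 2) \<le> 1 - \<epsilon>)"

definition energy1 :: "real \<Rightarrow> 'a measure \<Rightarrow> (('a \<Rightarrow> real) \<Rightarrow> real) \<Rightarrow>
    (('a \<Rightarrow> real) \<Rightarrow> 'a \<Rightarrow> real) \<Rightarrow> ('a \<Rightarrow> real) \<Rightarrow> real" where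
  "energy1 p \<mu> \<E> \<Psi> f = \<E> f + Lp_norm p \<mu> (\<Psi> f) powr p"

definition energy1_dist :: "real \<Rightarrow> 'a measure \<Rightarrow> (('a \<Rightarrow> real) \<Rightarrow> real) \<Rightarrow>
    (('a \<Rightarrow> real) \<Rightarrow> 'a \<Rightarrow> real) \<Rightarrow> ('a \<Rightarrow> real) \<Rightarrow> ('a \<Rightarrow> real) \<Rightarrow> real" where
  "energy1_dist p \<mu> \<E> \<Psi> f g = energy1 p \<mu> \<E> \<Psi> (\<lambda>x. f x - g x) powr (1 / p)"

definition dense_for :: "('b \<Rightarrow> 'b \<Rightarrow> real) \<Rightarrow> 'b set \<Rightarrow> 'b set \<Rightarrow> bool" where
  "dense_for d S \<D> \<longleftrightarrow> S \<subseteq> \<D> \<and> (\<forall>f\<in>\<D>. \<forall>\<epsilon>>0. \<exists>g\<in>S. d f g < \<epsilon>)"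

definition complete_for :: "('b \<Rightarrow> 'b \<Rightarrow> real) \<Rightarrow> 'b set \<Rightarrow> bool" where
  "complete_for d \<D> \<longleftrightarrow> (\<forall>h. (\<forall>n::nat. h n \<in> \<D>) \<and>
       (\<forall>\<epsilon>>0. \<exists>M. \<forall>m\<ge>M. \<forall>n\<ge>M. d (h m) (h n) < \<epsilon>)
       \<longrightarrow> (\<exists>f\<in>\<D>. (\<lambda>n. d (h n) f) \<longlonglongrightarrow> 0))"

definition separable_for :: "('b \<Rightarrow> 'b \<Rightarrow> real) \<Rightarrow> 'b set \<Rightarrow> bool" where
  "separable_for d \<D> \<longleftrightarrow> (\<exists>S. countable S \<and> dense_for d S \<D>)"

text \<open>\<open>\<D> \<inter> C(K)\<close>, as functions on \<open>K\<close>: continuous functions whose restriction to the vertices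
  lies in \<open>\<D>\<close> (membership in \<open>\<D>\<close> depends on the values at the vertices only).\<close>

definition continuous_core :: "'a::topological_space set \<Rightarrow> ('a \<Rightarrow> real) set \<Rightarrow>
    ('a \<Rightarrow> real) set" where
  "continuous_core K \<D> = {f \<in> \<D>. continuous_on K f}"

definition regular_form :: "real \<Rightarrow> 'a::topological_space set \<Rightarrow> 'a measure \<Rightarrow> ('a \<Rightarrow> real) set \<Rightarrow>
    (('a \<Rightarrow> real) \<Rightarrow> real) \<Rightarrow> (('a \<Rightarrow> real) \<Rightarrow> 'a \<Rightarrow> real) \<Rightarrow> bool" where
  "regular_form p K \<mu> \<D> \<E> \<Psi> \<longleftrightarrow>
     (\<forall>u. continuous_on K u \<longrightarrow>
        (\<forall>\<epsilon>>0. \<exists>v\<in>continuous_core K \<D>. \<forall>x\<in>K. \<bar>u x - v x\<bar> < \<epsilon>)) \<and>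
     dense_for (energy1_dist p \<mu> \<E> \<Psi>) (continuous_core K \<D>) \<D>"

definition support_in :: "'a::topological_space set \<Rightarrow> ('a \<Rightarrow> real) \<Rightarrow> 'a set" where
  "support_in K g = K \<inter> closure {x \<in> K. g x \<noteq> 0}"

definition strongly_local :: "'a::topological_space set \<Rightarrow> ('a \<Rightarrow> real) set \<Rightarrow>
    (('a \<Rightarrow> real) \<Rightarrow> real) \<Rightarrow> bool" where
  "strongly_local K \<D> \<E> \<longleftrightarrow>
     (\<forall>f\<in>continuous_core K \<D>. \<forall>g\<in>continuous_core K \<D>.
        (\<exists>U. openin (top_of_set K) U \<and> support_in K g \<subseteq> U \<and> constant_on_set U f)
        \<longrightarrow> \<E> (\<lambda>x. f x + g x) = \<E> f + \<E> g)"

end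

(*
  Let E be the fixed form. Since TE = E, near-minimal extensions from V_0 to V_1 can be iterated with
  errors whose product stays bounded, so that every function on V_0 extends to V_* with almost the
  same energy. These extensions can be chosen uniformly continuous: they oscillate by more than 1/2
  only on a set of cells whose capacity is controlled by their energy, and damping the function
  towards 1/2 with a cutoff 1 - eta/M costs, by the Leibniz rule and because of p > 1, only a small
  energy when M is large. Hence one step contracts oscillations by a fixed factor. The last argument
  requires that cells touching V_0 have small weights, which holds since a cell of weight at least 1
  around a fixed vertex would make the capacity of that vertex vanish.

  The limit form is comparable with the supremum of the Lambda^m E. Its uniform convexity follows
  from a pointwise inequality which is linear in p-th powers, and gives density of the functions
  that extend continuously: among those which interpolate f on V_m, near-minimizers of the distance
  to f form a Cauchy sequence. Locality holds because f is constant or g vanishes on every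
  sufficiently small cell. The embedding is defined almost everywhere as the limit of the values of f
  at vertices of the cells shrinking to a point; the summability of kappa_m^(1/p) makes the
  increments summable, and forces this limit to be f(x) at every vertex x which is an atom of mu.
*)
theory Submission
  imports Defs
begin

section \<open>Post-critically finite self-similar sets\<close>

text \<open>For p other than 2 the energy-minimizing extension is not linear, so no linear space of
  piecewise harmonic functions is at hand. Two kinds of extension share its work. Near-minimizers
  keep the range and nearly the energy. A fixed combination of extensions of indicator functions is
  linear in the data and keeps the energy only up to a constant; it serves where midpoints and
  countable families are needed. The energies built from E_0 need not be monotone in the level,
  because \<open>renorm\<close> need not fix E_0. They are therefore compared with those of the
  fixed form E, which are monotone, at the price of constants. Where constants matter (Markov
  property, convexity, locality) the inequality is proved for each single |f(x) - f(y)|^p, since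
  such inequalities survive sums and averages. Beyond being an energy in M_p(V_0), E has one more
  property that is exploited: the Leibniz rule. It holds for sums of p-th powers and passes to
  traces and norm limits, hence to the class Q.\<close>

lemma word_map_Nil [simp]: "word_map F [] = id"
  and word_map_Cons [simp]: "word_map F (i # w) = F i \<circ> word_map F w"
  by (simp_all add: word_map_def)

lemma word_map_append: "word_map F (u @ w) = word_map F u \<circ> word_map F w"
  by (induction u) (auto simp: fun_eq_iff)

lemma word_weight_Nil [simp]: "word_weight r [] = 1"
  and word_weight_Cons [simp]: "word_weight r (i # w) = r i * word_weight r w"
  by (simp_all add: word_weight_def)

lemma word_weight_append: "word_weight r (u @ w) = word_weight r u * word_weight r w"
  by (simp add: word_weight_def)

lemma word_weight_pos:
  assumes "\<forall>i\<in>{1..N}. 0 < r i" "set w \<subseteq> {1..N}"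
  shows "0 < word_weight r w"
  using assms(2) by (induction w) (use assms(1) in auto)

lemma words_0 [simp]: "words N 0 = {[]}"
  by (auto simp: words_def)

lemma Nil_in_words [simp]: "[] \<in> words N n \<longleftrightarrow> n = 0"
  by (auto simp: words_def)

lemma Cons_in_words [simp]: "i # w \<in> words N (Suc n) \<longleftrightarrow> i \<in> {1..N} \<and> w \<in> words N n"
  by (auto simp: words_def)

lemma finite_words [simp]: "finite (words N n)"
  using finite_lists_length_eq[of "{1..N}" n] by (simp add: words_def conj_commute)

lemma append_in_words: "u \<in> words N m \<Longrightarrow> w \<in> words N n \<Longrightarrow> u @ w \<in> words N (m + n)"
  by (auto simp: words_def)

lemma words_append_obtain:
  assumes "w \<in> words N (m + n)"
  obtains u v where "u \<in> words N m" "v \<in> words N n" "w = u @ v"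
proof
  have "set (take m w) \<subseteq> set w" "set (drop m w) \<subseteq> set w"
    by (rule set_take_subset set_drop_subset)+
  then show "take m w \<in> words N m" "drop m w \<in> words N n" "w = take m w @ drop m w"
    using assms by (auto simp: words_def)
qed

lemma sum_words_append:
  "(\<Sum>w\<in>words N (m + n). g w) = (\<Sum>u\<in>words N m. \<Sum>w\<in>words N n. g (u @ w))"
proof -
  have "bij_betw (\<lambda>(u, w). u @ w) (words N m \<times> words N n) (words N (m + n))"
    unfolding bij_betw_def
  proof
    show "inj_on (\<lambda>(u, w). u @ w) (words N m \<times> words N n)"
      by (auto simp: inj_on_def words_def)
    show "(\<lambda>(u, w). u @ w) ` (words N m \<times> words N n) = words N (m + n)"
      by (force elim: words_append_obtain intro: append_in_words)
  qed
  from sum.reindex_bij_betw[OF this, of g]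
  show ?thesis by (simp add: sum.cartesian_product case_prod_unfold)
qed

lemma words_1: "words N (Suc 0) = (\<lambda>i. [i]) ` {1..N}"
proof -
  have "length w = Suc 0 \<longleftrightarrow> (\<exists>i. w = [i])" for w :: "nat list"
    by (cases w) auto
  then show ?thesis by (auto simp: words_def)
qed

lemma sum_words_1: "(\<Sum>w\<in>words N (Suc 0). g w) = (\<Sum>i=1..N. g [i])"
  unfolding words_1 by (subst sum.reindex) (auto simp: inj_on_def)

text \<open>Turns the iterate, which unfolds one letter at a time, into a sum over words that can be
  cut after any number of letters.\<close>

lemma energy_lift_power:
  "(energy_lift N F r ^^ n) E f =
     (\<Sum>w\<in>words N n. inverse (word_weight r w) * E (f \<circ> word_map F w))"
proof (induction n arbitrary: f)
  case 0
  then show ?case by simp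
next
  case (Suc n)
  have "(energy_lift N F r ^^ Suc n) E f = (\<Sum>i=1..N. inverse (r i) *
      (\<Sum>w\<in>words N n. inverse (word_weight r w) * E (f \<circ> F i \<circ> word_map F w)))"
  proof -
    have "(energy_lift N F r ^^ Suc n) E f = energy_lift N F r ((energy_lift N F r ^^ n) E) f" by simp
    then show ?thesis by (simp only: energy_lift_def[of N F r "(energy_lift N F r ^^ n) E"] Suc)
  qed
  also have "\<dots> = (\<Sum>i=1..N. \<Sum>w\<in>words N n.
      inverse (word_weight r (i # w)) * E (f \<circ> word_map F (i # w)))"
    by (simp add: sum_distrib_left mult.assoc o_assoc)
  also have "\<dots> = (\<Sum>w\<in>words N (Suc 0 + n). inverse (word_weight r w) * E (f \<circ> word_map F w))"
    unfolding sum_words_append sum_words_1 by simp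
  finally show ?case unfolding plus_nat.add_Suc plus_nat.add_0 .
qed

section \<open>Infinite addresses and the shift\<close>

lemma shift_power: "(shift ^^ m) \<omega> n = \<omega> (m + n)"
  by (induction m arbitrary: n) (auto simp: shift_def)

lemma shift_case_nat [simp]: "shift (case_nat i \<omega>) = \<omega>"
  by (simp add: shift_def)

lemma case_nat_shift [simp]: "case_nat (\<omega> 0) (shift \<omega>) = \<omega>"
  by (auto simp: shift_def fun_eq_iff split: nat.split)

lemma shift_in_shift_space: "\<omega> \<in> shift_space N \<Longrightarrow> shift \<omega> \<in> shift_space N"
  by (simp add: shift_space_def shift_def)

lemma shift_power_in_shift_space: "\<omega> \<in> shift_space N \<Longrightarrow> (shift ^^ m) \<omega> \<in> shift_space N"
  by (simp add: shift_space_def shift_power)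

lemma case_nat_in_shift_space:
  "case_nat i \<omega> \<in> shift_space N \<longleftrightarrow> i \<in> {1..N} \<and> \<omega> \<in> shift_space N"
  by (auto simp: shift_space_def split: nat.splits)

abbreviation address_prefix :: "(nat \<Rightarrow> nat) \<Rightarrow> nat \<Rightarrow> nat list" where
  "address_prefix \<omega> n \<equiv> map \<omega> [0..<n]"

lemma address_prefix_Suc: "address_prefix \<omega> (Suc n) = \<omega> 0 # address_prefix (shift \<omega>) n"
  by (subst upt_conv_Cons) (auto simp: shift_def map_Suc_upt[symmetric] simp del: upt_Suc)

lemma address_prefix_in_words: "\<omega> \<in> shift_space N \<Longrightarrow> address_prefix \<omega> n \<in> words N n"
  by (auto simp: words_def shift_space_def)

text \<open>Realizes F_w on addresses, see \<open>code_cat_word\<close>; it is a right inverse of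
  the iterated shift.\<close>

definition cat_word :: "nat list \<Rightarrow> (nat \<Rightarrow> nat) \<Rightarrow> nat \<Rightarrow> nat" where
  "cat_word w \<omega> = foldr case_nat w \<omega>"

lemma cat_word_simps [simp]:
  "cat_word [] \<omega> = \<omega>" "cat_word (i # w) \<omega> = case_nat i (cat_word w \<omega>)"
  by (simp_all add: cat_word_def)

lemma shift_cat_word: "(shift ^^ length w) (cat_word w \<omega>) = \<omega>"
  by (induction w) (simp_all add: funpow_Suc_right del: funpow.simps)

lemma cat_word_nth: "cat_word w \<omega> k = (if k < length w then w ! k else \<omega> (k - length w))"
  by (induction w arbitrary: k) (auto split: nat.split)

lemma cat_word_in_shift_space:
  "set w \<subseteq> {1..N} \<Longrightarrow> \<omega> \<in> shift_space N \<Longrightarrow> cat_word w \<omega> \<in> shift_space N"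
  by (induction w) (auto simp: case_nat_in_shift_space)

lemma vertices_eq: "vertices N F K n = (\<Union>w\<in>words N n. word_map F w ` vertices N F K 0)"
proof (induction n)
  case 0
  then show ?case by simp
next
  case (Suc n)
  have "words N (Suc n) = (\<Union>i\<in>{1..N}. (#) i ` words N n)"
  proof -
    have "w \<in> words N (Suc n) \<longleftrightarrow> (\<exists>i v. w = i # v \<and> i \<in> {1..N} \<and> v \<in> words N n)" for w
      by (cases w) (auto simp: words_def)
    then show ?thesis by blast
  qed
  then show ?case unfolding vertices.simps(2) Suc by (auto simp del: vertices.simps)
qed

section \<open>Cells and the coding map\<close>

locale pcf_set =
  fixes F :: "nat \<Rightarrow> 'a::euclidean_space \<Rightarrow> 'a" and K :: "'a set" and N :: nat
  assumes self_similar: "self_similar_set N F K"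
    and connected: "connected K"
    and post_critically_finite: "pcf N F K"
begin

abbreviation "W \<equiv> words N"
abbreviation "V \<equiv> vertices N F K"
abbreviation "VS \<equiv> all_vertices N F K"
abbreviation "fw \<equiv> word_map F"
abbreviation "code \<equiv> coding_map F K"
abbreviation "P \<equiv> post_critical_set N F K"
abbreviation "C \<equiv> critical_set N F K"
abbreviation "\<Sigma> \<equiv> shift_space N"

lemma N_ge_2: "2 \<le> N" and compact: "compact K" and nonempty: "K \<noteq> {}"
  and K_eq: "K = (\<Union>i\<in>{1..N}. F i ` K)"
  using self_similar by (auto simp: self_similar_set_def)

lemma similitude:
  assumes "i \<in> {1..N}"
  obtains \<alpha> where "0 < \<alpha>" "\<alpha> < 1" "\<And>x y. dist (F i x) (F i y) = \<alpha> * dist x y"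
proof -
  obtain \<alpha> U a where *: "0 < \<alpha>" "\<alpha> < 1" "orthogonal_transformation U"
      "F i = (\<lambda>x. \<alpha> *\<^sub>R U x + a)"
    using self_similar assms unfolding self_similar_set_def contracting_similitude_def by meson
  then have "dist (F i x) (F i y) = \<alpha> * dist x y" for x y
    using orthogonal_transformation_linear[OF *(3)] orthogonal_transformation_norm[OF *(3)]
    by (simp add: dist_norm flip: scaleR_diff_right linear_diff)
  with *(1,2) that show thesis by blast
qed

lemma inj_F: "i \<in> {1..N} \<Longrightarrow> inj (F i)"
proof (rule injI)
  fix x y assume i: "i \<in> {1..N}" and eq: "F i x = F i y"
  obtain \<alpha> where "0 < \<alpha>" "\<And>x y. dist (F i x) (F i y) = \<alpha> * dist x y"
    using similitude[OF i] by metis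
  then show "x = y" using eq by (metis dist_eq_0_iff mult_eq_0_iff less_irrefl)
qed

lemma contraction_ratio:
  obtains \<rho> where "0 \<le> \<rho>" "\<rho> < 1" "\<And>i x y. i \<in> {1..N} \<Longrightarrow> dist (F i x) (F i y) \<le> \<rho> * dist x y"
proof -
  have "\<forall>i\<in>{1..N}. \<exists>\<alpha>. 0 < \<alpha> \<and> \<alpha> < 1 \<and> (\<forall>x y. dist (F i x) (F i y) = \<alpha> * dist x y)"
    using similitude by metis
  then obtain \<alpha> where \<alpha>: "\<And>i. i \<in> {1..N} \<Longrightarrow>
      0 < \<alpha> i \<and> \<alpha> i < 1 \<and> (\<forall>x y. dist (F i x) (F i y) = \<alpha> i * dist x y)"
    by metis
  define \<rho> where "\<rho> = Max (\<alpha> ` {1..N})"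
  have ne: "{1..N} \<noteq> {}" using N_ge_2 by auto
  have le: "\<alpha> i \<le> \<rho>" if "i \<in> {1..N}" for i
    using that by (auto simp: \<rho>_def)
  have "\<rho> \<in> \<alpha> ` {1..N}" unfolding \<rho>_def using ne by (intro Max_in) auto
  then have "0 \<le> \<rho>" "\<rho> < 1" using \<alpha> by (auto simp: less_imp_le)
  moreover have "dist (F i x) (F i y) \<le> \<rho> * dist x y" if "i \<in> {1..N}" for i x y
    using \<alpha>[OF that] le[OF that] by (simp add: mult_right_mono)
  ultimately show thesis by (rule that)
qed

lemma F_in_K: "i \<in> {1..N} \<Longrightarrow> x \<in> K \<Longrightarrow> F i x \<in> K"
  using K_eq by blast

lemma set_words: "w \<in> W n \<Longrightarrow> set w \<subseteq> {1..N}"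
  by (simp add: words_def)

lemma inj_fw: "set w \<subseteq> {1..N} \<Longrightarrow> inj (fw w)"
  by (induction w) (auto intro!: inj_compose inj_F)

lemma fw_in_K: "set w \<subseteq> {1..N} \<Longrightarrow> x \<in> K \<Longrightarrow> fw w x \<in> K"
  by (induction w) (auto intro: F_in_K)

lemma continuous_F: "i \<in> {1..N} \<Longrightarrow> continuous_on A (F i)"
proof -
  assume i: "i \<in> {1..N}"
  obtain \<alpha> where "0 < \<alpha>" "\<And>x y. dist (F i x) (F i y) = \<alpha> * dist x y"
    using similitude[OF i] by metis
  then have "\<alpha>-lipschitz_on A (F i)" by (intro lipschitz_onI) auto
  then show ?thesis by (rule lipschitz_on_continuous_on)
qed

lemma continuous_fw: "set w \<subseteq> {1..N} \<Longrightarrow> continuous_on A (fw w)"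
proof (induction w)
  case Nil
  then show ?case by simp
next
  case (Cons i w)
  then show ?case
    using continuous_F[of i "fw w ` A"] by (auto simp del: o_apply intro!: continuous_on_compose)
qed

lemma compact_cell: "set w \<subseteq> {1..N} \<Longrightarrow> compact (fw w ` K)"
  by (intro compact_continuous_image continuous_fw compact)

lemma cells_small:
  assumes "0 < \<epsilon>"
  obtains n0 where "\<And>n w x y. n0 \<le> n \<Longrightarrow> w \<in> W n \<Longrightarrow> x \<in> K \<Longrightarrow> y \<in> K \<Longrightarrow> dist (fw w x) (fw w y) < \<epsilon>"
proof -
  obtain \<rho> where \<rho>: "0 \<le> \<rho>" "\<rho> < 1" "\<And>i x y. i \<in> {1..N} \<Longrightarrow> dist (F i x) (F i y) \<le> \<rho> * dist x y"
    using contraction_ratio by metis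
  have le: "dist (fw w x) (fw w y) \<le> \<rho> ^ length w * dist x y" if "set w \<subseteq> {1..N}" for w x y
    using that
  proof (induction w)
    case (Cons i w)
    then have "dist (F i (fw w x)) (F i (fw w y)) \<le> \<rho> * (\<rho> ^ length w * dist x y)"
      using \<rho>(3)[of i "fw w x" "fw w y"] \<rho>(1) by (auto intro: order_trans mult_left_mono)
    then show ?case by (simp add: mult.assoc)
  qed simp
  have "bounded K" using compact by (rule compact_imp_bounded)
  then obtain D where D: "\<And>x y. x \<in> K \<Longrightarrow> y \<in> K \<Longrightarrow> dist x y \<le> D"
    using bounded_two_points by metis
  have "(\<lambda>n. \<rho> ^ n * D) \<longlonglongrightarrow> 0 * D" using \<rho> by (intro tendsto_intros LIMSEQ_power_zero) auto
  then have "eventually (\<lambda>n. \<rho> ^ n * D < \<epsilon>) sequentially"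
    using assms by (simp add: order_tendstoD(2))
  then obtain n0 where n0: "\<And>n. n0 \<le> n \<Longrightarrow> \<rho> ^ n * D < \<epsilon>" by (auto simp: eventually_sequentially)
  show thesis
  proof (rule that)
    fix n w x y assume *: "n0 \<le> n" "w \<in> W n" "x \<in> K" "y \<in> K"
    have "dist (fw w x) (fw w y) \<le> \<rho> ^ n * dist x y" using le[of w x y] *(2) by (auto simp: words_def)
    also have "\<dots> \<le> \<rho> ^ n * D" using D[OF *(3,4)] \<rho>(1) by (intro mult_left_mono) auto
    also have "\<dots> < \<epsilon>" by (rule n0[OF *(1)])
    finally show "dist (fw w x) (fw w y) < \<epsilon>" .
  qed
qed

lemma cells_cover: "x \<in> K \<Longrightarrow> \<exists>w\<in>W n. \<exists>y\<in>K. x = fw w y"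
proof (induction n arbitrary: x)
  case 0
  then show ?case by simp
next
  case (Suc n)
  then obtain i y where i: "i \<in> {1..N}" "y \<in> K" "x = F i y" using K_eq by blast
  obtain w z where w: "w \<in> W n" "z \<in> K" "y = fw w z" using Suc.IH[OF i(2)] by blast
  have "i # w \<in> W (Suc n)" "x = fw (i # w) z" using i w by auto
  with w(2) show ?case by blast
qed

text \<open>The identities for \<open>coding_map\<close> are proved through this criterion: two
  candidates for the point coded by \<omega> coincide once both lie in all the nested cells, whose
  diameters tend to 0.\<close>

lemma code_unique:
  assumes \<omega>: "\<omega> \<in> \<Sigma>" and x: "\<And>n. x \<in> fw (address_prefix \<omega> n) ` K"
    and y: "\<And>n. y \<in> fw (address_prefix \<omega> n) ` K"
  shows "x = y"
proof (rule ccontr)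
  assume "x \<noteq> y"
  then have "0 < dist x y" by simp
  then obtain n0 where n0: "\<And>n w u v. n0 \<le> n \<Longrightarrow> w \<in> W n \<Longrightarrow> u \<in> K \<Longrightarrow> v \<in> K \<Longrightarrow>
      dist (fw w u) (fw w v) < dist x y"
    using cells_small by metis
  from x[of n0] y[of n0] n0[OF order_refl address_prefix_in_words[OF \<omega>]] show False by auto
qed

lemma code_in_cell:
  assumes "\<omega> \<in> \<Sigma>"
  shows "code \<omega> \<in> fw (address_prefix \<omega> n) ` K"
proof -
  let ?A = "\<lambda>n. fw (address_prefix \<omega> n) ` K"
  have words: "set (address_prefix \<omega> n) \<subseteq> {1..N}" for n
    using assms by (auto simp: shift_space_def)
  have "?A (Suc n) \<subseteq> ?A n" for n
  proof -
    have "\<omega> n \<in> {1..N}" using assms by (simp add: shift_space_def)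
    then show ?thesis by (auto simp: word_map_append F_in_K intro!: imageI)
  qed
  then have dec: "?A n \<subseteq> ?A m" if "m \<le> n" for m n
    using that by (rule lift_Suc_antimono_le)
  have "(\<Inter>n. ?A n) \<noteq> {}"
    by (rule compact_nest) (use compact_cell[OF words] nonempty dec in auto)
  then obtain x where x: "x \<in> (\<Inter>n. ?A n)" by blast
  have "code \<omega> = x" unfolding coding_map_def
  proof (rule the_equality)
    fix y assume "y \<in> (\<Inter>n. ?A n)"
    then show "y = x" using x by (intro code_unique[OF assms]) auto
  qed (use x in simp)
  then show ?thesis using x by blast
qed

lemma code_in_K: "\<omega> \<in> \<Sigma> \<Longrightarrow> code \<omega> \<in> K"
  using code_in_cell[of \<omega> 0] by simp

lemma code_case_nat:
  assumes "i \<in> {1..N}" "\<omega> \<in> \<Sigma>"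
  shows "code (case_nat i \<omega>) = F i (code \<omega>)"
proof (rule code_unique)
  show sp: "case_nat i \<omega> \<in> \<Sigma>" using assms by (simp add: case_nat_in_shift_space)
  show "code (case_nat i \<omega>) \<in> fw (address_prefix (case_nat i \<omega>) n) ` K" for n
    by (rule code_in_cell[OF sp])
  show "F i (code \<omega>) \<in> fw (address_prefix (case_nat i \<omega>) n) ` K" for n
  proof (cases n)
    case 0
    then show ?thesis using assms by (auto intro: F_in_K code_in_K)
  next
    case (Suc m)
    show ?thesis unfolding Suc address_prefix_Suc
      using code_in_cell[OF assms(2), of m] by (auto simp del: upt_Suc)
  qed
qed

lemma code_shift: "\<omega> \<in> \<Sigma> \<Longrightarrow> code \<omega> = F (\<omega> 0) (code (shift \<omega>))"
  using code_case_nat[of "\<omega> 0" "shift \<omega>"] shift_in_shift_space[of \<omega> N]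
  by (simp add: shift_space_def)

lemma code_shift_power:
  "\<omega> \<in> \<Sigma> \<Longrightarrow> code \<omega> = fw (address_prefix \<omega> n) (code ((shift ^^ n) \<omega>))"
proof (induction n arbitrary: \<omega>)
  case 0
  then show ?case by simp
next
  case (Suc n)
  from code_shift[OF Suc.prems] Suc.IH[OF shift_in_shift_space[OF Suc.prems]]
  show ?case unfolding address_prefix_Suc by (simp add: funpow_Suc_right del: upt_Suc funpow.simps)
qed

lemma code_cat_word:
  "set w \<subseteq> {1..N} \<Longrightarrow> \<omega> \<in> \<Sigma> \<Longrightarrow> code (cat_word w \<omega>) = fw w (code \<omega>)"
  by (induction w) (auto simp: code_case_nat cat_word_in_shift_space)

lemma code_surj:
  assumes "x \<in> K"
  obtains \<omega> where "\<omega> \<in> \<Sigma>" "code \<omega> = x"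
proof -
  have "\<forall>y\<in>K. \<exists>i z. i \<in> {1..N} \<and> z \<in> K \<and> y = F i z" using K_eq by blast
  then obtain i g where ig: "\<And>y. y \<in> K \<Longrightarrow> i y \<in> {1..N} \<and> g y \<in> K \<and> y = F (i y) (g y)"
    by metis
  \<comment> \<open>The address follows the orbit of y under a choice g of inverse branches. It is
    kept as a function of y because the induction on the level shifts the address and moves y to g
    y.\<close>
  define \<omega> where "\<omega> y = (\<lambda>n. i ((g ^^ n) y))" for y
  have gK: "(g ^^ n) y \<in> K" if "y \<in> K" for n y
    using that ig by (induction n) auto
  then have sp: "\<omega> y \<in> \<Sigma>" if "y \<in> K" for y
    using that ig by (auto simp: \<omega>_def shift_space_def)
  have "shift (\<omega> y) = \<omega> (g y)" for y
    by (simp add: \<omega>_def shift_def funpow_swap1)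
  then have "y \<in> fw (address_prefix (\<omega> y) n) ` K" if "y \<in> K" for n y
    using that
  proof (induction n arbitrary: y)
    case (Suc n)
    obtain z where z: "z \<in> K" "g y = fw (address_prefix (\<omega> (g y)) n) z"
      using Suc.IH[of "g y"] Suc.prems ig by blast
    have "fw (address_prefix (\<omega> y) (Suc n)) z = F (i y) (g y)"
      unfolding address_prefix_Suc Suc.prems(1) using z(2) by (simp add: \<omega>_def del: upt_Suc)
    then have "F (i y) (g y) \<in> fw (address_prefix (\<omega> y) (Suc n)) ` K"
      using z(1) by (metis imageI)
    then show ?case using ig[OF Suc.prems(2)] by simp
  qed simp
  then have "code (\<omega> x) = x"
    using assms by (intro code_unique[OF sp]) (auto intro: code_in_cell sp)
  with sp[OF assms] that show thesis by blast
qed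

section \<open>The post-critical set and the vertices V_n\<close>

lemma shift_P: "\<omega> \<in> P \<Longrightarrow> shift \<omega> \<in> P"
proof -
  assume "\<omega> \<in> P"
  then obtain m c where "1 \<le> m" "c \<in> C" "\<omega> = (shift ^^ m) c"
    by (auto simp: post_critical_set_def)
  then show "shift \<omega> \<in> P"
    unfolding post_critical_set_def by (intro UN_I[of "Suc m"] image_eqI[of _ _ c]) auto
qed

lemma shift_power_P: "\<omega> \<in> P \<Longrightarrow> (shift ^^ m) \<omega> \<in> P"
  by (induction m) (auto intro: shift_P)

lemma shift_C: "\<omega> \<in> C \<Longrightarrow> 1 \<le> m \<Longrightarrow> (shift ^^ m) \<omega> \<in> P"
  by (auto simp: post_critical_set_def)

lemma C_subset: "C \<subseteq> \<Sigma>" and P_subset: "P \<subseteq> \<Sigma>"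
  by (auto simp: post_critical_set_def critical_set_def intro: shift_power_in_shift_space)

lemma finite_P: "finite P"
  using post_critically_finite by (simp add: pcf_def)

text \<open>A critical address is determined by its first letter and its shift, which is
  post-critical.\<close>

lemma finite_C: "finite C"
proof (rule finite_subset)
  show "C \<subseteq> (\<lambda>(i, \<omega>). case_nat i \<omega>) ` ({1..N} \<times> P)"
  proof
    fix \<omega> assume "\<omega> \<in> C"
    then have "shift \<omega> \<in> P" "\<omega> 0 \<in> {1..N}"
      using shift_C[of \<omega> 1] C_subset by (auto simp: shift_space_def)
    then show "\<omega> \<in> (\<lambda>(i, \<omega>). case_nat i \<omega>) ` ({1..N} \<times> P)"
      by (intro image_eqI[of _ _ "(\<omega> 0, shift \<omega>)"]) auto
  qed
qed (use finite_P in auto)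

lemma finite_V: "finite (V n)"
proof (induction n)
  case 0
  then show ?case using finite_P by simp
qed auto

lemma V0_obtain:
  assumes "x \<in> V 0"
  obtains \<omega> where "\<omega> \<in> P" "\<omega> \<in> \<Sigma>" "x = code \<omega>"
  using assms P_subset by auto

lemma V0_subset_K: "V 0 \<subseteq> K"
  using P_subset by (auto intro: code_in_K)

lemma V_subset_K: "V n \<subseteq> K"
proof -
  have "fw w x \<in> K" if "w \<in> W n" "x \<in> V 0" for w x
    using that V0_subset_K set_words by (intro fw_in_K) blast+
  then show ?thesis by (subst vertices_eq) blast
qed

lemma VS_subset_K: "VS \<subseteq> K"
  unfolding all_vertices_def using V_subset_K by blast

lemma V_mono_Suc: "V n \<subseteq> V (Suc n)"
proof (induction n)
  case 0
  show ?case
  proof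
    fix x assume "x \<in> V 0"
    then obtain \<omega> where \<omega>: "\<omega> \<in> P" "\<omega> \<in> \<Sigma>" "x = code \<omega>" by (rule V0_obtain)
    then have "x = F (\<omega> 0) (code (shift \<omega>))" "shift \<omega> \<in> P" "\<omega> 0 \<in> {1..N}"
      using code_shift[of \<omega>] shift_P by (auto simp: shift_space_def)
    moreover have "code (shift \<omega>) \<in> V 0" using \<open>shift \<omega> \<in> P\<close> by simp
    ultimately show "x \<in> V (Suc 0)" unfolding vertices.simps(2) by blast
  qed
next
  case (Suc n)
  have "V (Suc n) = (\<Union>i\<in>{1..N}. F i ` V n)" "V (Suc (Suc n)) = (\<Union>i\<in>{1..N}. F i ` V (Suc n))"
    by simp_all
  with Suc show ?case by blast
qed

lemma V_mono: "m \<le> n \<Longrightarrow> V m \<subseteq> V n"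
  using V_mono_Suc by (rule lift_Suc_mono_le)

lemma V_subset_VS: "V n \<subseteq> VS"
  unfolding all_vertices_def by blast

lemma fw_in_V: "w \<in> W n \<Longrightarrow> x \<in> V m \<Longrightarrow> fw w x \<in> V (n + m)"
proof (induction n arbitrary: w)
  case 0
  then show ?case by simp
next
  case (Suc n)
  then obtain i u where "w = i # u" "i \<in> {1..N}" "u \<in> W n" by (cases w) auto
  moreover have "fw u x \<in> V (n + m)" using Suc.IH[OF \<open>u \<in> W n\<close> Suc.prems(2)] .
  ultimately show ?case by (auto intro!: bexI[of _ i])
qed

lemma V_add: "V (n + m) = (\<Union>w\<in>W n. fw w ` V m)"
proof
  show "V (n + m) \<subseteq> (\<Union>w\<in>W n. fw w ` V m)"
  proof
    fix x assume "x \<in> V (n + m)"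
    then obtain w q where "w \<in> W (n + m)" "q \<in> V 0" "x = fw w q" unfolding vertices_eq[of _ _ _ "n + m"] by blast
    then obtain u v where "u \<in> W n" "v \<in> W m" "x = fw u (fw v q)"
      by (metis words_append_obtain word_map_append comp_apply)
    moreover have "fw v q \<in> V m" using \<open>v \<in> W m\<close> \<open>q \<in> V 0\<close> fw_in_V[of v m q 0] by simp
    ultimately show "x \<in> (\<Union>w\<in>W n. fw w ` V m)" by blast
  qed
qed (auto intro: fw_in_V)

lemma fw_in_VS: "w \<in> W n \<Longrightarrow> x \<in> VS \<Longrightarrow> fw w x \<in> VS"
  unfolding all_vertices_def using fw_in_V by blast

lemma VS_obtain:
  assumes "x \<in> VS"
  obtains w y where "w \<in> W n" "y \<in> VS" "x = fw w y"
proof -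
  obtain m where m: "x \<in> V m" using assms unfolding all_vertices_def by blast
  have "x \<in> V (n + m)" using V_mono[of m "n + m"] m by auto
  then obtain w y where "w \<in> W n" "y \<in> V m" "x = fw w y" unfolding V_add by blast
  with that V_subset_VS show thesis by blast
qed

text \<open>Two different cells of the same level only meet in images of \<open>V\<^sub>0\<close>: an address passing
  through a point of \<open>F\<^sub>i K \<inter> F\<^sub>j K\<close> is critical, and all its shifts are post-critical.\<close>

lemma cells_meet:
  assumes "w \<in> W n" "v \<in> W n" "w \<noteq> v" "x \<in> K" "y \<in> K" "fw w x = fw v y"
  shows "x \<in> V 0"
  using assms
proof (induction n arbitrary: w v)
  case 0
  then show ?case by simp
next
  case (Suc n)
  obtain i u where w: "w = i # u" "i \<in> {1..N}" "u \<in> W n" using Suc.prems(1) by (cases w) auto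
  obtain j t where v: "v = j # t" "j \<in> {1..N}" "t \<in> W n" using Suc.prems(2) by (cases v) auto
  have eq: "F i (fw u x) = F j (fw t y)" using Suc.prems(6) w v by simp
  show ?case
  proof (cases "i = j")
    case True
    then have "fw u x = fw t y" using inj_F[OF w(2)] eq by (simp add: inj_eq)
    with True Suc w v show ?thesis by blast
  next
    case False
    obtain \<omega> where \<omega>: "\<omega> \<in> \<Sigma>" "code \<omega> = x" using code_surj[OF Suc.prems(4)] .
    have c: "code (cat_word w \<omega>) = fw w x" using w \<omega> set_words by (subst code_cat_word) auto
    have "fw u x \<in> K" "fw t y \<in> K"
      using fw_in_K[OF set_words[OF w(3)] Suc.prems(4)] fw_in_K[OF set_words[OF v(3)] Suc.prems(5)] .
    moreover have "fw w x = F i (fw u x)" "fw w x = F j (fw t y)" using w v Suc.prems(6) by simp_all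
    ultimately have "fw w x \<in> F i ` K" "fw w x \<in> F j ` K" by (metis imageI)+
    moreover have "cat_word w \<omega> \<in> \<Sigma>" using set_words[OF Suc.prems(1)] \<omega>(1) by (rule cat_word_in_shift_space)
    ultimately have "cat_word w \<omega> \<in> C" using False w(2) v(2) c
      unfolding critical_set_def mem_Collect_eq by (intro conjI bexI[of _ i] bexI[of _ j]) auto
    then have "(shift ^^ length w) (cat_word w \<omega>) \<in> P" using w by (intro shift_C) auto
    then show ?thesis using \<omega> by (auto simp: shift_cat_word)
  qed
qed

text \<open>A point of V_0 has a post-critical address, and its shifts are post-critical again. If
  the resulting cell of level n is not that of w, then y is mapped into the intersection of two
  cells and \<open>cells_meet\<close> applies.\<close>

lemma V0_preimage:
  assumes "w \<in> W n" "y \<in> K" "fw w y \<in> V 0"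
  shows "y \<in> V 0"
proof -
  obtain \<sigma> where \<sigma>: "\<sigma> \<in> P" "\<sigma> \<in> \<Sigma>" "fw w y = code \<sigma>" using assms(3) by (rule V0_obtain)
  let ?v = "address_prefix \<sigma> n" and ?z = "code ((shift ^^ n) \<sigma>)"
  have v: "?v \<in> W n" using \<sigma> by (intro address_prefix_in_words)
  have z: "?z \<in> V 0" using shift_power_P[OF \<sigma>(1)] by simp
  have eq: "fw w y = fw ?v ?z" using \<sigma> code_shift_power[of \<sigma> n] by simp
  show ?thesis
  proof (cases "w = ?v")
    case True
    then show ?thesis using eq z inj_fw[OF set_words[OF v]] by (metis inj_eq)
  next
    case False
    then show ?thesis using cells_meet[OF assms(1) v False assms(2) _ eq] z V0_subset_K by blast
  qed
qed

lemma VS_preimage: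
  assumes "w \<in> W n" "y \<in> K" "fw w y \<in> VS"
  shows "y \<in> VS"
proof -
  obtain v z where v: "v \<in> W n" "z \<in> VS" "fw w y = fw v z" using assms(3) by (rule VS_obtain)
  show ?thesis
  proof (cases "w = v")
    case True
    then show ?thesis using v inj_fw[OF set_words[OF v(1)]] by (metis inj_eq)
  next
    case False
    then have "y \<in> V 0" using cells_meet[OF assms(1) v(1)] assms(2) v VS_subset_K by blast
    then show ?thesis using V_subset_VS by blast
  qed
qed

text \<open>At the first discrepancy the shifted point is fixed by the map of the rotated period and
  lies in two cells of level 1, so all its addresses are critical. Prepending the period again and
  again to the deviating address would give infinitely many critical addresses.\<close>

lemma periodic_address_unique:
  assumes c: "c \<in> \<Sigma>" "(shift ^^ n) c = c" "1 \<le> n" and d: "d \<in> \<Sigma>" "code d = code c"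
  shows "d = c"
proof (rule ccontr)
  assume "d \<noteq> c"
  then obtain k0 where "d k0 \<noteq> c k0" by (auto simp: fun_eq_iff)
  define k where "k = (LEAST k. d k \<noteq> c k)"
  have k: "d k \<noteq> c k" unfolding k_def using \<open>d k0 \<noteq> c k0\<close> by (rule LeastI)
  have less: "d j = c j" if "j < k" for j using not_less_Least[of j "\<lambda>k. d k \<noteq> c k"] that by (auto simp: k_def)
  let ?c = "(shift ^^ k) c" and ?d = "(shift ^^ k) d"
  have sp: "?c \<in> \<Sigma>" "?d \<in> \<Sigma>" using c d by (auto intro: shift_power_in_shift_space)
  have "address_prefix d k = address_prefix c k" using less by auto
  then have eq: "code ?d = code ?c"
    using code_shift_power[OF c(1), of k] code_shift_power[OF d(1), of k] d(2)
      inj_fw[OF set_words[OF address_prefix_in_words[OF c(1), of k]]]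
    by (metis injD)
  let ?w = "address_prefix ?c n"
  have w: "set ?w \<subseteq> {1..N}" using sp by (auto simp: shift_space_def)
  have "(shift ^^ n) ?c = ?c"
    using c(2) by (metis add.commute comp_apply funpow_add)
  then have fix_code: "fw ?w (code ?c) = code ?c" using code_shift_power[OF sp(1), of n] by simp
  have "?d 0 \<noteq> ?c 0" using k by (simp add: shift_power)
  have crit: "e \<in> C" if e: "e \<in> \<Sigma>" "code e = code ?c" for e
  proof -
    have "code ?c \<in> F (?c 0) ` K" "code ?d \<in> F (?d 0) ` K"
      using code_shift[OF sp(1)] code_shift[OF sp(2)] code_in_K shift_in_shift_space sp by auto
    moreover have "?c 0 \<in> {1..N}" "?d 0 \<in> {1..N}" using sp unfolding shift_space_def by blast+
    ultimately show ?thesis using e eq \<open>?d 0 \<noteq> ?c 0\<close> unfolding critical_set_def mem_Collect_eq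
      by (intro conjI bexI[of _ "?c 0"] bexI[of _ "?d 0"]) auto
  qed
  define e where "e j = ((cat_word ?w) ^^ j) ?d" for j
  have e: "e j \<in> \<Sigma> \<and> code (e j) = code ?c" for j
  proof (induction j)
    case 0
    then show ?case using sp eq by (simp add: e_def)
  next
    case (Suc j)
    then show ?case using w fix_code by (simp add: e_def cat_word_in_shift_space code_cat_word)
  qed
  \<comment> \<open>Every n-th letter suffices to tell the \<open>e j\<close> apart: at position m *
    n the first j of them show the letter \<open>?c 0\<close>, and at m = j the different letter
    \<open>?d 0\<close> appears.\<close>
  have en: "e j (m * n) = (if m < j then ?c 0 else ?d ((m - j) * n))" for j m
  proof (induction j arbitrary: m)
    case 0
    then show ?case by (simp add: e_def)
  next
    case (Suc j)
    show ?case
    proof (cases m)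
      case 0
      then show ?thesis using \<open>1 \<le> n\<close> by (simp add: e_def cat_word_nth)
    next
      case m: (Suc l)
      have "e (Suc j) (m * n) = e j (l * n)" using m by (simp add: e_def cat_word_nth)
      then show ?thesis using Suc.IH[of l] m by simp
    qed
  qed
  have "inj e"
  proof (rule injI)
    have ne: "e i \<noteq> e j" if "i < j" for i j
    proof -
      have "e i (i * n) = ?d 0" "e j (i * n) = ?c 0" using en[of i i] en[of j i] that by simp_all
      with \<open>?d 0 \<noteq> ?c 0\<close> show ?thesis by metis
    qed
    fix i j assume "e i = e j"
    then show "i = j" using ne[of i j] ne[of j i] by (metis linorder_neqE_nat)
  qed
  moreover have "range e \<subseteq> C" using crit e by blast
  ultimately show False using finite_C finite_subset infinite_UNIV_nat by (metis finite_imageD)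
qed

text \<open>A fixed point of F_w has the periodic address w w w ..., and another cell of level n
  containing it would provide a second address.\<close>

lemma fixed_vertex_unique_cell:
  assumes w: "w \<in> W n" "1 \<le> n" and x: "x \<in> K" "fw w x = x" and v: "v \<in> W n" "y \<in> K" "fw v y = x"
  shows "v = w"
proof -
  define c where "c = (\<lambda>k. w ! (k mod n))"
  have len: "length w = n" "length v = n" using w v by (auto simp: words_def)
  have "c k \<in> {1..N}" for k
  proof -
    have "w ! (k mod n) \<in> set w" using w(2) len by (intro nth_mem) simp
    then show ?thesis using set_words[OF w(1)] by (auto simp: c_def)
  qed
  then have c: "c \<in> \<Sigma>" by (simp add: shift_space_def)
  have per: "(shift ^^ n) c = c" by (auto simp: shift_power c_def)
  have pre: "address_prefix c n = w" using len by (auto simp: c_def intro: nth_equalityI)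
  have fixn: "((fw w) ^^ m) x = x" for m using x(2) by (induction m) auto
  have "x \<in> fw (address_prefix c k) ` K" for k
  proof -
    obtain m where m: "k \<le> m * n" using w(2) by (metis mult.right_neutral mult_le_mono2)
    have mult: "fw (address_prefix c (m * n)) = fw w ^^ m" for m
    proof (induction m)
      case (Suc m)
      have "address_prefix c (Suc m * n) = address_prefix c (m * n) @ w"
      proof -
        have "[0..<Suc m * n] = [0..<m * n] @ map (\<lambda>i. i + m * n) [0..<n]"
          by (metis add.commute map_add_upt mult_Suc upt_add_eq_append zero_le)
        moreover have "map (\<lambda>i. c (i + m * n)) [0..<n] = w"
          using pre by (simp add: c_def)
        ultimately show ?thesis by (simp add: o_def)
      qed
      then show ?case using Suc by (simp add: word_map_append funpow_Suc_right del: funpow.simps)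
    qed (auto)
    have "address_prefix c (m * n) = address_prefix c k @ map c [k..<m * n]"
      using m by (metis le0 le_add_diff_inverse map_append upt_add_eq_append)
    moreover have "set (map c [k..<m * n]) \<subseteq> {1..N}" using c by (auto simp: shift_space_def)
    ultimately have "fw (address_prefix c (m * n)) x \<in> fw (address_prefix c k) ` K"
      using x(1) fw_in_K by (simp add: word_map_append)
    then show ?thesis by (simp add: mult fixn)
  qed
  then have cx: "code c = x" by (intro code_unique[OF c] code_in_cell[OF c])
  obtain \<omega> where \<omega>: "\<omega> \<in> \<Sigma>" "code \<omega> = y" using code_surj[OF v(2)] .
  have "cat_word v \<omega> = c"
    using v \<omega> cx set_words[OF v(1)] by (intro periodic_address_unique[OF c per w(2)])
      (auto simp: code_cat_word cat_word_in_shift_space)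
  then have "c k = v ! k" if "k < n" for k using cat_word_nth[of v \<omega> k] that len by simp
  then show ?thesis using len by (auto simp: c_def intro!: nth_equalityI)
qed

text \<open>Connectedness of K enters through this lemma: otherwise the cells in S and the remaining
  ones would cover K by two disjoint nonempty closed sets.\<close>

lemma locally_constant_cells:
  assumes "S \<subseteq> {1..N}" "S \<noteq> {}" "\<And>i j. i \<in> S \<Longrightarrow> j \<in> {1..N} - S \<Longrightarrow> F i ` K \<inter> F j ` K = {}"
  shows "S = {1..N}"
proof (rule ccontr)
  assume "S \<noteq> {1..N}"
  let ?A = "\<Union>i\<in>S. F i ` K" and ?B = "\<Union>i\<in>{1..N} - S. F i ` K"
  have fin: "finite S" "finite ({1..N} - S)" using assms(1) finite_subset by auto
  have "closed (F i ` K)" if "i \<in> {1..N}" for i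
    using that compact_cell[of "[i]"] by (auto intro: compact_imp_closed)
  then have "closed ?A" "closed ?B" using assms(1) fin by (auto intro!: closed_UN)
  moreover have "K \<subseteq> ?A \<union> ?B"
  proof
    fix x assume "x \<in> K"
    then obtain i where "i \<in> {1..N}" "x \<in> F i ` K" using K_eq by blast
    then show "x \<in> ?A \<union> ?B" by blast
  qed
  moreover have "?A \<inter> ?B = {}" using assms(3) by blast
  moreover have "?A \<noteq> {}" "?B \<noteq> {}" "?A \<subseteq> K" "?B \<subseteq> K"
    using assms \<open>S \<noteq> {1..N}\<close> nonempty F_in_K by blast+
  ultimately show False using connected unfolding connected_closed by (metis Int_absorb1 inf.absorb_iff2 Int_commute inf_bot_left)
qed

lemma V0_nonempty: "V 0 \<noteq> {}"
proof
  assume empty: "V 0 = {}"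
  have "{1} = {1..N}"
  proof (rule locally_constant_cells)
    show "F i ` K \<inter> F j ` K = {}" if "i \<in> {1}" "j \<in> {1..N} - {1}" for i j
    proof (rule ccontr)
      assume "F i ` K \<inter> F j ` K \<noteq> {}"
      then obtain x y where "x \<in> K" "y \<in> K" "F i x = F j y" by blast
      then have "x \<in> V 0" using that cells_meet[of "[i]" 1 "[j]" x y] N_ge_2 by auto
      with empty show False by blast
    qed
  qed (use N_ge_2 in auto)
  then have "2 \<in> {1::nat}" using N_ge_2 by auto
  then show False by simp
qed

text \<open>If q were the only vertex, cells could meet only in the points F_i q, and connectedness
  would make these all equal. Some F_i fixes q, hence all do. Then every address codes q, all of
  \<Sigma> is critical, and the critical set is infinite.\<close>

lemma V0_not_singleton: "V 0 \<noteq> {q}"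
proof
  assume q: "V 0 = {q}"
  have "{i\<in>{1..N}. F i q = F 1 q} = {1..N}"
  proof (rule locally_constant_cells)
    fix i j assume i: "i \<in> {i\<in>{1..N}. F i q = F 1 q}" and j: "j \<in> {1..N} - {i\<in>{1..N}. F i q = F 1 q}"
    show "F i ` K \<inter> F j ` K = {}"
    proof (rule ccontr)
      assume "F i ` K \<inter> F j ` K \<noteq> {}"
      then obtain x y where xy: "x \<in> K" "y \<in> K" "F i x = F j y" by blast
      then have "x \<in> V 0" "y \<in> V 0"
        using i j cells_meet[of "[i]" 1 "[j]" x y] cells_meet[of "[j]" 1 "[i]" y x] by auto
      then show False using q xy i j by auto
    qed
  next
    have "1 \<in> {i\<in>{1..N}. F i q = F 1 q}" using N_ge_2 by simp
    then show "{i\<in>{1..N}. F i q = F 1 q} \<noteq> {}" by blast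
  qed blast
  then have same: "F i q = F 1 q" if "i \<in> {1..N}" for i using that by blast
  have "q \<in> V 0" using q by simp
  then obtain \<sigma> where \<sigma>: "\<sigma> \<in> P" "\<sigma> \<in> \<Sigma>" "q = code \<sigma>" by (rule V0_obtain)
  have "code (shift \<sigma>) \<in> V 0" using shift_P[OF \<sigma>(1)] by simp
  then have "q = F (\<sigma> 0) q" using code_shift[OF \<sigma>(2)] \<sigma>(3) q by simp
  then have fixq: "F i q = q" if "i \<in> {1..N}" for i
    using same[OF that] same[of "\<sigma> 0"] \<sigma>(2) by (auto simp: shift_space_def)
  have qK: "q \<in> K" using V0_subset_K q by auto
  have "code \<omega> = q" if "\<omega> \<in> \<Sigma>" for \<omega>
  proof (rule code_unique[OF that code_in_cell[OF that]])
    fix n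
    have "fw w q = q" if "set w \<subseteq> {1..N}" for w using that by (induction w) (auto simp: fixq)
    then have "fw (address_prefix \<omega> n) q = q" using set_words[OF address_prefix_in_words[OF that]] by blast
    then show "q \<in> fw (address_prefix \<omega> n) ` K" using qK by (metis imageI)
  qed
  moreover have "q \<in> F 1 ` K \<inter> F 2 ` K"
    using qK N_ge_2 fixq[of 1] fixq[of 2] by (auto intro!: image_eqI[of q _ q])
  ultimately have "\<exists>i\<in>{1..N}. \<exists>j\<in>{1..N}. i \<noteq> j \<and> code \<omega> \<in> F i ` K \<inter> F j ` K" if "\<omega> \<in> \<Sigma>" for \<omega>
    using N_ge_2 that by (intro bexI[of _ 1] bexI[of _ 2]) auto
  then have "\<Sigma> \<subseteq> C" unfolding critical_set_def by blast
  then have "finite \<Sigma>" using finite_C finite_subset by blast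
  moreover have "inj (\<lambda>(k::nat) j. if j = k then 2 else (1::nat))"
  proof (rule injI)
    fix k l :: nat assume "(\<lambda>j. if j = k then 2 else (1::nat)) = (\<lambda>j. if j = l then 2 else 1)"
    from fun_cong[OF this, of k] show "k = l" by (simp split: if_splits)
  qed
  moreover have "range (\<lambda>(k::nat) j. if j = k then 2 else (1::nat)) \<subseteq> \<Sigma>" using N_ge_2 by (auto simp: shift_space_def)
  ultimately show False using finite_subset infinite_UNIV_nat by (metis finite_imageD)
qed

lemma V0_other: "x \<in> V 0 \<Longrightarrow> \<exists>y\<in>V 0. y \<noteq> x"
  using V0_not_singleton[of x] by blast

end

declare vertices.simps(1) [simp del]

section \<open>Gluing functions, and continuity across cells\<close>

context pcf_set
begin

text \<open>A point in several n-cells takes its value from an arbitrary one of them. This is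
  harmless when the pieces share boundary values b, because such points are images of V_0.\<close>

definition glue :: "nat \<Rightarrow> (nat list \<Rightarrow> 'a \<Rightarrow> real) \<Rightarrow> 'a \<Rightarrow> real" where
  "glue n g x = (let w = SOME w. w \<in> W n \<and> x \<in> fw w ` K in g w (inv_into K (fw w) x))"

lemma glue_cell:
  assumes b: "\<And>w q. w \<in> W n \<Longrightarrow> q \<in> V 0 \<Longrightarrow> g w q = b (fw w q)" and w: "w \<in> W n" "y \<in> K"
  shows "glue n g (fw w y) = g w y"
proof -
  define v where "v = (SOME v. v \<in> W n \<and> fw w y \<in> fw v ` K)"
  have "\<exists>v. v \<in> W n \<and> fw w y \<in> fw v ` K" using w by blast
  from someI_ex[OF this] have v: "v \<in> W n" "fw w y \<in> fw v ` K" by (auto simp: v_def)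
  define z where "z = inv_into K (fw v) (fw w y)"
  have z: "z \<in> K" "fw v z = fw w y" unfolding z_def using v by (auto intro: inv_into_into f_inv_into_f)
  have glue: "glue n g (fw w y) = g v z" by (simp add: glue_def z_def v_def[symmetric])
  show ?thesis
  proof (cases "v = w")
    case True
    then have "z = y" using z inj_fw[OF set_words[OF w(1)]] by (metis injD)
    with True glue show ?thesis by simp
  next
    case False
    have "y \<in> V 0" "z \<in> V 0"
      using cells_meet[OF w(1) v(1) _ w(2) z(1)] cells_meet[OF v(1) w(1) _ z(1) w(2)] False z by auto
    then show ?thesis using glue b[OF v(1)] b[OF w(1)] z(2) by metis
  qed
qed

lemma glue_vertex:
  assumes b: "\<And>w q. w \<in> W n \<Longrightarrow> q \<in> V 0 \<Longrightarrow> g w q = b (fw w q)" and x: "x \<in> V n"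
  shows "glue n g x = b x"
proof -
  obtain w q where w: "w \<in> W n" "q \<in> V 0" "x = fw w q" using x vertices_eq[of N F K n] by blast
  moreover have "q \<in> K" using w V0_subset_K by blast
  ultimately show ?thesis using glue_cell[where b = b and g = g, OF b w(1)] b by simp
qed

lemma K_subset_closure_VS: "K \<subseteq> closure VS"
proof
  fix x assume x: "x \<in> K"
  obtain q where q: "q \<in> V 0" using V0_nonempty by blast
  show "x \<in> closure VS" unfolding closure_approachable
  proof (intro allI impI)
    fix e :: real assume "0 < e"
    then obtain n where n: "\<And>w x y. w \<in> W n \<Longrightarrow> x \<in> K \<Longrightarrow> y \<in> K \<Longrightarrow> dist (fw w x) (fw w y) < e"
      by (metis cells_small order_refl)
    obtain w y where w: "w \<in> W n" "y \<in> K" "x = fw w y" using cells_cover[OF x] by blast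
    then have "dist (fw w q) x < e" using n q V0_subset_K by blast
    moreover have "fw w q \<in> VS" using w(1) q V_subset_VS by (blast intro: fw_in_VS)
    ultimately show "\<exists>y\<in>VS. dist y x < e" by blast
  qed
qed

text \<open>Disjoint n-cells have positive distance, so two sufficiently close vertices lie in the
  same n-cell or in two n-cells with a common vertex. Passing through that vertex costs at most
  twice the oscillation on a cell.\<close>

lemma uniformly_continuous_cells:
  fixes u :: "'a \<Rightarrow> real"
  assumes osc: "\<And>\<epsilon>. 0 < \<epsilon> \<Longrightarrow>
    \<exists>n. \<forall>w\<in>W n. \<forall>x\<in>VS. \<forall>y\<in>VS. \<bar>u (fw w x) - u (fw w y)\<bar> \<le> \<epsilon>"
  shows "uniformly_continuous_on VS u"
  unfolding uniformly_continuous_on_def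
proof (intro allI impI)
  fix e :: real assume e: "0 < e"
  then have "0 < e / 3" by simp
  from osc[OF this] obtain n where
    n: "\<And>w x y. w \<in> W n \<Longrightarrow> x \<in> VS \<Longrightarrow> y \<in> VS \<Longrightarrow> \<bar>u (fw w x) - u (fw w y)\<bar> \<le> e / 3" by blast
  have "\<forall>q\<in>W n \<times> W n. \<exists>d>0. fw (fst q) ` K \<inter> fw (snd q) ` K = {} \<longrightarrow>
      (\<forall>x\<in>fw (fst q) ` K. \<forall>y\<in>fw (snd q) ` K. d \<le> dist x y)"
  proof
    fix q assume "q \<in> W n \<times> W n"
    then obtain w v where w: "w \<in> W n" "v \<in> W n" and q: "q = (w, v)" by blast
    show "\<exists>d>0. fw (fst q) ` K \<inter> fw (snd q) ` K = {} \<longrightarrow>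
      (\<forall>x\<in>fw (fst q) ` K. \<forall>y\<in>fw (snd q) ` K. d \<le> dist x y)"
    proof (cases "fw w ` K \<inter> fw v ` K = {}")
      case True
      with separate_compact_closed[of "fw w ` K" "fw v ` K"] compact_cell[OF set_words[OF w(1)]]
        compact_cell[OF set_words[OF w(2)]]
      show ?thesis by (auto simp: compact_imp_closed q)
    qed (auto simp: q intro: exI[of _ 1])
  qed
  from bchoice[OF this] obtain d where d': "\<forall>q\<in>W n \<times> W n. 0 < d q \<and>
      (fw (fst q) ` K \<inter> fw (snd q) ` K = {} \<longrightarrow> (\<forall>x\<in>fw (fst q) ` K. \<forall>y\<in>fw (snd q) ` K. d q \<le> dist x y))"
    by blast
  have d: "0 < d (w, v) \<and> (fw w ` K \<inter> fw v ` K = {} \<longrightarrow>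
      (\<forall>x\<in>fw w ` K. \<forall>y\<in>fw v ` K. d (w, v) \<le> dist x y))" if "w \<in> W n" "v \<in> W n" for w v
    using d'[rule_format, of "(w, v)"] that by simp
  define \<delta> where "\<delta> = Min (insert 1 (d ` (W n \<times> W n)))"
  have "0 < \<delta>" unfolding \<delta>_def using d by (subst Min_gr_iff) auto
  moreover have "dist (u x') (u x) < e" if x: "x \<in> VS" "x' \<in> VS" "dist x' x < \<delta>" for x x'
  proof -
    obtain w y where w: "w \<in> W n" "y \<in> VS" "x = fw w y" using VS_obtain[OF x(1)] .
    obtain v z where v: "v \<in> W n" "z \<in> VS" "x' = fw v z" using VS_obtain[OF x(2)] .
    have K: "y \<in> K" "z \<in> K" using w v VS_subset_K by auto
    have "\<delta> \<le> d (v, w)" unfolding \<delta>_def using w v by (intro Min_le) auto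
    then have "dist (fw v z) (fw w y) < d (v, w)" using x(3) w v by simp
    moreover have "d (v, w) \<le> dist (fw v z) (fw w y)" if "fw v ` K \<inter> fw w ` K = {}"
      using d[OF v(1) w(1), THEN conjunct2, rule_format, OF that imageI[OF K(2)] imageI[OF K(1)]] .
    ultimately have "fw v ` K \<inter> fw w ` K \<noteq> {}" by linarith
    then obtain a where "a \<in> fw v ` K" "a \<in> fw w ` K" by blast
    then obtain y' z' where y': "y' \<in> K" "z' \<in> K" "fw w y' = fw v z'" by (elim imageE) simp
    show ?thesis
    proof (cases "w = v")
      case True
      then show ?thesis using n[OF w(1) w(2) v(2)] w v e by (simp add: dist_real_def abs_minus_commute)
    next
      case False
      then have "y' \<in> VS" "z' \<in> VS"
        using cells_meet[OF w(1) v(1) _ y'(1,2)] cells_meet[OF v(1) w(1) _ y'(2,1)] y'(3) V_subset_VS by auto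
      then have "\<bar>u x - u (fw w y')\<bar> \<le> e / 3" "\<bar>u x' - u (fw w y')\<bar> \<le> e / 3"
        using n[OF w(1) w(2), of y'] n[OF v(1) v(2), of z'] w(3) v(3) y'(3) by simp_all
      then show ?thesis using e unfolding dist_real_def by linarith
    qed
  qed
  ultimately show "\<exists>d>0. \<forall>x\<in>VS. \<forall>x'\<in>VS. dist x' x < d \<longrightarrow> dist (u x') (u x) < e" by blast
qed

text \<open>Connectedness of V_1 as the graph whose cliques are the sets F_i V_0. It will show that
  vanishing energy at level 1 forces a function to be constant.\<close>

lemma cell_constant_V1:
  assumes cell: "\<And>i x y. i \<in> {1..N} \<Longrightarrow> x \<in> V 0 \<Longrightarrow> y \<in> V 0 \<Longrightarrow> F i x \<in> S \<Longrightarrow> F i y \<in> S"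
    and x: "x \<in> V 1" "x \<in> S" and y: "y \<in> V 1"
  shows "y \<in> S"
proof -
  have "{i\<in>{1..N}. \<exists>q\<in>V 0. F i q \<in> S} = {1..N}" (is "?T = _")
  proof (rule locally_constant_cells)
    have V1: "V 1 = (\<Union>i\<in>{1..N}. F i ` V 0)" by simp
    then obtain i q where "i \<in> {1..N}" "q \<in> V 0" "x = F i q" using x(1) by blast
    then show "?T \<noteq> {}" using x(2) by blast
    fix i j assume i: "i \<in> ?T" and j: "j \<in> {1..N} - ?T"
    show "F i ` K \<inter> F j ` K = {}"
    proof (rule ccontr)
      assume "F i ` K \<inter> F j ` K \<noteq> {}"
      then obtain a b where ab: "a \<in> K" "b \<in> K" "F i a = F j b" by blast
      have "i \<noteq> j" using i j by blast
      then have "a \<in> V 0" "b \<in> V 0"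
        using i j ab cells_meet[of "[i]" 1 "[j]" a b] cells_meet[of "[j]" 1 "[i]" b a] by auto
      moreover obtain q where "i \<in> {1..N}" "q \<in> V 0" "F i q \<in> S" using i by blast
      ultimately have "F i a \<in> S" using cell by blast
      then have "F j b \<in> S" using ab(3) by simp
      then show False using j \<open>b \<in> V 0\<close> by blast
    qed
  qed blast
  moreover have "V 1 = (\<Union>i\<in>{1..N}. F i ` V 0)" by simp
  then obtain j b where "j \<in> {1..N}" "b \<in> V 0" "y = F j b" using y by blast
  ultimately show ?thesis using cell by blast
qed

end

section \<open>Discrete p-energies\<close>

text \<open>Convexity at the points x / t and y / (1 - t) with weights t and 1 - t. The free
  parameter matters: t near 1 keeps the factor of x near 1 and puts the loss on y.\<close>

lemma powr_sum_le:
  fixes x y t p :: real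
  assumes p: "1 < p" and t: "0 < t" "t < 1" and xy: "0 \<le> x" "0 \<le> y"
  shows "(x + y) powr p \<le> t powr (1 - p) * x powr p + (1 - t) powr (1 - p) * y powr p"
proof -
  have small: "s powr p \<le> s" if "0 \<le> s" "s \<le> 1" for s :: real
    using powr_mono'[of 1 p s] that p by auto
  have scale: "s * (x / s) powr p = s powr (1 - p) * x powr p" if "0 < s" "0 \<le> x" for s x :: real
    using that by (simp add: powr_divide powr_diff)
  have conv: "(t * a + (1 - t) * b) powr p \<le> t * a powr p + (1 - t) * b powr p" if "0 \<le> a" "0 \<le> b" for a b
  proof (cases "a = 0 \<or> b = 0")
    case True
    then show ?thesis using that t p small[of t] small[of "1 - t"]
      by (auto simp: powr_mult intro!: mult_right_mono)
  next
    case False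
    then have "a > 0" "b > 0" using that by auto
    then show ?thesis
      using convex_onD[OF powr_convex, of p "1 - t" a b] p t by simp
  qed
  have "(x + y) powr p = (t * (x / t) + (1 - t) * (y / (1 - t))) powr p" using t by simp
  also have "\<dots> \<le> t * (x / t) powr p + (1 - t) * (y / (1 - t)) powr p" using t xy by (intro conv) auto
  finally show ?thesis using scale[of t x] scale[of "1 - t" y] t xy by simp
qed

lemma powr_sum_le_half:
  fixes x y p :: real
  assumes "1 < p" "0 \<le> x" "0 \<le> y"
  shows "(x + y) powr p \<le> 2 powr (p - 1) * (x powr p + y powr p)"
proof -
  have "(1 / 2 :: real) powr (1 - p) = 2 powr (p - 1)" by (simp add: powr_divide powr_diff)
  then show ?thesis using powr_sum_le[of p "1/2" x y] assms by (simp add: distrib_left)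
qed

lemma unit_cut_bounds: "0 \<le> unit_cut f x" "unit_cut f x \<le> 1"
  by (simp_all add: unit_cut_def)

lemma unit_cut_diff_le: "\<bar>unit_cut f x - unit_cut f y\<bar> \<le> \<bar>f x - f y\<bar>"
  by (auto simp: unit_cut_def min_def max_def)

text \<open>Among the \<open>card A + 1\<close> intervals of equal length in \<open>[0,1]\<close> one contains no value of \<open>f\<close>;
  stretching this interval to \<open>[0,1]\<close> and truncating turns \<open>f\<close> into an indicator function. This
  replaces compactness arguments for energies on finite sets.\<close>

lemma gap_indicator:
  assumes A: "finite A" and xy: "x \<in> A" "y \<in> A" "f x = 0" "f y = (1::real)"
  obtains b where "\<And>z. z \<in> A \<Longrightarrow> unit_cut (\<lambda>z. (real (card A) + 1) * f z + b) z \<in> {0, 1}"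
    "unit_cut (\<lambda>z. (real (card A) + 1) * f z + b) x = 0"
    "unit_cut (\<lambda>z. (real (card A) + 1) * f z + b) y = 1"
proof -
  let ?k = "card A + 1"
  have "\<not> int ` {0..<?k} \<subseteq> (\<lambda>z. \<lfloor>real ?k * f z\<rfloor>) ` A"
  proof
    assume "int ` {0..<?k} \<subseteq> (\<lambda>z. \<lfloor>real ?k * f z\<rfloor>) ` A"
    then have "card (int ` {0..<?k}) \<le> card ((\<lambda>z. \<lfloor>real ?k * f z\<rfloor>) ` A)"
      by (intro card_mono finite_imageI A)
    also have "\<dots> \<le> card A" by (rule card_image_le[OF A])
    finally show False by (simp add: card_image)
  qed
  then obtain i where "i \<in> int ` {0..<?k}" "i \<notin> (\<lambda>z. \<lfloor>real ?k * f z\<rfloor>) ` A" by blast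
  then have "\<And>z. z \<in> A \<Longrightarrow> \<lfloor>real ?k * f z\<rfloor> \<noteq> i" by blast
  moreover obtain j where "i = int j" "j < ?k" using \<open>i \<in> int ` {0..<?k}\<close> by auto
  ultimately have j: "j < ?k" "\<And>z. z \<in> A \<Longrightarrow> \<lfloor>real ?k * f z\<rfloor> \<noteq> int j" by auto
  have *: "real ?k * f z < real j \<or> real j + 1 \<le> real ?k * f z" if "z \<in> A" for z
  proof (rule ccontr)
    assume "\<not> ?thesis"
    then have "\<lfloor>real ?k * f z\<rfloor> = int j" by (intro floor_unique) auto
    with j(2)[OF that] show False by blast
  qed
  show thesis
  proof (rule that[of "- real j"])
    fix z assume "z \<in> A"
    from *[OF this] show "unit_cut (\<lambda>z. (real (card A) + 1) * f z + - real j) z \<in> {0, 1}"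
      by (auto simp: unit_cut_def add.commute)
  next
    show "unit_cut (\<lambda>z. (real (card A) + 1) * f z + - real j) x = 0" using xy by (simp add: unit_cut_def)
    have "real j + 1 \<le> real ?k" using j(1) by simp
    then show "unit_cut (\<lambda>z. (real (card A) + 1) * f z + - real j) y = 1" using xy by (simp add: unit_cut_def)
  qed
qed

text \<open>A Poincare inequality. Normalize f to be 0 at x and 1 at y, stretch a gap between its
  values, and compare with the cheapest indicator function; the stretching contributes the factor
  (card A + 1) powr p.\<close>

lemma gap_bound:
  fixes G :: "('a \<Rightarrow> real) \<Rightarrow> real"
  assumes A: "finite A" and p: "1 < p"
    and G: "functional_on A G" "\<And>f. 0 \<le> G f" "\<And>f a b. G (\<lambda>x. a * f x + b) = \<bar>a\<bar> powr p * G f"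
      "\<And>f. G (unit_cut f) \<le> G f"
    and c: "0 < c" "\<And>S. S \<subseteq> A \<Longrightarrow> S \<noteq> {} \<Longrightarrow> S \<noteq> A \<Longrightarrow> c \<le> G (indicator S)"
    and xy: "x \<in> A" "y \<in> A"
  shows "\<bar>f x - f y\<bar> powr p \<le> ((real (card A) + 1) powr p / c) * G f"
proof (cases "f x = f y")
  case True
  then show ?thesis using c(1) G(2)[of f] p by simp
next
  case False
  let ?k = "real (card A) + 1"
  define g where "g = (\<lambda>z. (1 / (f y - f x)) * f z + (- f x / (f y - f x)))"
  have g: "g x = 0" "g y = 1" using False by (auto simp: g_def simp flip: diff_divide_distrib)
  obtain b where b: "\<And>z. z \<in> A \<Longrightarrow> unit_cut (\<lambda>z. ?k * g z + b) z \<in> {0, 1}"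
      "unit_cut (\<lambda>z. ?k * g z + b) x = 0" "unit_cut (\<lambda>z. ?k * g z + b) y = 1"
    using gap_indicator[OF A xy g] by metis
  define S where "S = {z \<in> A. unit_cut (\<lambda>z. ?k * g z + b) z = 1}"
  have "x \<notin> S" "y \<in> S" using b(2,3) xy by (auto simp: S_def)
  then have "S \<subseteq> A" "S \<noteq> {}" "S \<noteq> A" using xy by (auto simp: S_def)
  then have "c \<le> G (indicator S)" by (rule c(2))
  also have "G (indicator S) = G (unit_cut (\<lambda>z. ?k * g z + b))"
  proof -
    have "\<forall>z\<in>A. indicator S z = unit_cut (\<lambda>z. ?k * g z + b) z"
    proof
      fix z assume "z \<in> A"
      with b(1)[OF this] show "indicator S z = unit_cut (\<lambda>z. ?k * g z + b) z"
        by (cases "z \<in> S") (auto simp: S_def)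
    qed
    with G(1) show ?thesis unfolding functional_on_def by blast
  qed
  also have "\<dots> \<le> G (\<lambda>z. ?k * g z + b)" by (rule G(4))
  also have "\<dots> = ?k powr p * G g" by (simp add: G(3))
  also have "G g = \<bar>1 / (f y - f x)\<bar> powr p * G f" unfolding g_def by (rule G(3))
  also have "\<bar>1 / (f y - f x)\<bar> powr p = 1 / \<bar>f x - f y\<bar> powr p"
    by (simp add: powr_divide abs_minus_commute)
  finally have "c \<le> ?k powr p * (1 / \<bar>f x - f y\<bar> powr p * G f)" .
  moreover obtain D where D: "D = \<bar>f x - f y\<bar> powr p" by blast
  moreover have "0 < D" using D False by simp
  ultimately show ?thesis unfolding D[symmetric] using c(1) by (simp add: field_simps)
qed

section \<open>Energies in M_p(A) on a finite set\<close>

context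
  fixes p :: real and A :: "'a set" and E :: "('a \<Rightarrow> real) \<Rightarrow> real"
  assumes p: "1 < p" and E: "E \<in> energies_M p A"
begin

lemma energies_M_cong: "(\<And>x. x \<in> A \<Longrightarrow> f x = g x) \<Longrightarrow> E f = E g"
  using E by (auto simp: energies_M_def functional_on_def)

lemma energies_M_nonneg: "0 \<le> E f"
  using E by (auto simp: energies_M_def)

lemma energies_M_affine: "E (\<lambda>x. a * f x + b) = \<bar>a\<bar> powr p * E f"
proof -
  have "\<forall>f t. E (\<lambda>x. f x + t) = E f" "\<forall>f t. E (\<lambda>x. t * f x) = \<bar>t\<bar> powr p * E f"
    using E by (auto simp: energies_M_def)
  from this(1)[rule_format, of "\<lambda>x. a * f x" b] this(2)[rule_format, of a f]
  show ?thesis by simp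
qed

lemma energies_M_scale: "E (\<lambda>x. a * f x) = \<bar>a\<bar> powr p * E f"
  using energies_M_affine[of a f 0] by simp

lemma energies_M_shift: "E (\<lambda>x. f x + b) = E f"
  using energies_M_affine[of 1 f b] by simp

lemma energies_M_unit_cut: "E (unit_cut f) \<le> E f"
  using E unfolding energies_M_def by blast

lemma energies_M_eq_0: "E f = 0 \<longleftrightarrow> constant_on_set A f"
  using E unfolding energies_M_def by blast

lemma energies_M_const: "(\<And>x. x \<in> A \<Longrightarrow> f x = c) \<Longrightarrow> E f = 0"
  using energies_M_eq_0[of f] by (auto simp: constant_on_set_def)

lemma energies_M_add: "E (\<lambda>x. f x + g x) \<le> 2 powr (p - 1) * (E f + E g)"
proof -
  have "\<forall>f g t. 0 < t \<and> t < 1 \<longrightarrow> E (\<lambda>x. t * f x + (1 - t) * g x) \<le> t * E f + (1 - t) * E g"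
    using E by (simp add: energies_M_def)
  from this[rule_format, of "1/2" f g]
  have half: "E (\<lambda>x. (f x + g x) / 2) \<le> (E f + E g) / 2" by (simp add: add_divide_distrib)
  have "(\<lambda>x. f x + g x) = (\<lambda>x. 2 * ((f x + g x) / 2))" by (simp add: add_divide_distrib)
  then have "E (\<lambda>x. f x + g x) = E (\<lambda>x. 2 * ((f x + g x) / 2))" by (rule arg_cong)
  also have "\<dots> = 2 powr p * E (\<lambda>x. (f x + g x) / 2)" by (subst energies_M_scale) simp
  also have "\<dots> \<le> 2 powr p * ((E f + E g) / 2)" using half by (intro mult_left_mono) auto
  also have "\<dots> = 2 powr (p - 1) * (E f + E g)" by (simp add: powr_diff)
  finally show ?thesis .
qed

lemma energies_M_clip:
  assumes "a \<le> b"
  shows "E (\<lambda>x. min (max (f x) a) b) \<le> E f"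
proof (cases "a = b")
  case True
  then have "E (\<lambda>x. min (max (f x) a) b) = 0" by (intro energies_M_const[where c = a]) auto
  then show ?thesis using energies_M_nonneg by simp
next
  case False
  then have ab: "0 < b - a" using assms by simp
  define g where "g = (\<lambda>x. (1 / (b - a)) * f x + (- a / (b - a)))"
  have g: "g x = (f x - a) / (b - a)" for x by (simp add: g_def diff_divide_distrib)
  have "(\<lambda>x. min (max (f x) a) b) = (\<lambda>x. (b - a) * unit_cut g x + a)"
    using ab by (auto simp: fun_eq_iff unit_cut_def g min_def max_def field_simps)
  then have "E (\<lambda>x. min (max (f x) a) b) = (b - a) powr p * E (unit_cut g)"
    using ab by (simp add: energies_M_affine)
  also have "\<dots> \<le> (b - a) powr p * E g" by (intro mult_left_mono energies_M_unit_cut) auto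
  also have "E g = \<bar>1 / (b - a)\<bar> powr p * E f" unfolding g_def by (rule energies_M_affine)
  also have "(b - a) powr p * (\<bar>1 / (b - a)\<bar> powr p * E f) = E f"
    using ab by (simp add: powr_divide)
  finally show ?thesis .
qed

lemma energies_M_lower:
  assumes A: "finite A"
  obtains C where "0 < C" "\<And>f x y. x \<in> A \<Longrightarrow> y \<in> A \<Longrightarrow> \<bar>f x - f y\<bar> powr p \<le> C * E f"
proof -
  define Ss where "Ss = {S. S \<subseteq> A \<and> S \<noteq> {} \<and> S \<noteq> A}"
  have fin: "finite Ss" using A by (auto simp: Ss_def)
  \<comment> \<open>The entry 1 keeps the minimum defined when A has no proper nonempty
    subset.\<close>
  define c where "c = Min (insert 1 ((\<lambda>S. E (indicator S)) ` Ss))"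
  have "0 < E (indicator S)" if "S \<in> Ss" for S
  proof -
    have "\<not> constant_on_set A (indicator S :: 'a \<Rightarrow> real)"
      using that by (auto simp: Ss_def constant_on_set_def indicator_def)
    then show ?thesis using energies_M_eq_0 energies_M_nonneg by (metis order_le_less)
  qed
  then have c: "0 < c" unfolding c_def using fin by (subst Min_gr_iff) auto
  have le: "c \<le> E (indicator S)" if "S \<subseteq> A" "S \<noteq> {}" "S \<noteq> A" for S
    unfolding c_def using fin that by (intro Min_le) (auto simp: Ss_def)
  show thesis
  proof (rule that[of "(real (card A) + 1) powr p / c"])
    show "0 < (real (card A) + 1) powr p / c" using c by (simp add: add_nonneg_pos)
    have "functional_on A E" using E by (simp add: energies_M_def)
    then show "\<bar>f x - f y\<bar> powr p \<le> ((real (card A) + 1) powr p / c) * E f"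
      if "x \<in> A" "y \<in> A" for f x y
      using that le by (intro gap_bound[OF A p _ energies_M_nonneg energies_M_affine energies_M_unit_cut c])
  qed
qed

text \<open>Minus one of its values, f is a combination of indicators of points with coefficients
  bounded by D. They are added one at a time by \<open>energies_M_add\<close>, with a constant
  depending only on A, p and E.\<close>

lemma energies_M_upper:
  assumes A: "finite A"
  obtains C where "0 < C" "\<And>f D. 0 \<le> D \<Longrightarrow> (\<And>x y. x \<in> A \<Longrightarrow> y \<in> A \<Longrightarrow> \<bar>f x - f y\<bar> \<le> D) \<Longrightarrow> E f \<le> C * D powr p"
proof -
  have "\<exists>C>0. \<forall>c D. 0 \<le> D \<longrightarrow> (\<forall>x\<in>B. \<bar>c x\<bar> \<le> D) \<longrightarrow>
      E (\<lambda>z. \<Sum>x\<in>B. c x * indicator {x} z) \<le> C * D powr p" if "finite B" for B :: "'a set"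
    using that
  proof (induction B)
    case empty
    then show ?case by (auto simp: energies_M_const[where c = 0] intro!: exI[of _ 1])
  next
    case (insert b B)
    then obtain C where C: "0 < C" "\<And>c D. 0 \<le> D \<Longrightarrow> (\<forall>x\<in>B. \<bar>c x\<bar> \<le> D) \<Longrightarrow>
      E (\<lambda>z. \<Sum>x\<in>B. c x * indicator {x} z) \<le> C * D powr p" by blast
    let ?e = "E (indicator {b})"
    show ?case
    proof (intro exI conjI allI impI)
      show "0 < 2 powr (p - 1) * (?e + C)" using C(1) energies_M_nonneg by (simp add: add_nonneg_pos)
      fix c :: "'a \<Rightarrow> real" and D :: real assume D: "0 \<le> D" "\<forall>x\<in>insert b B. \<bar>c x\<bar> \<le> D"
      have "E (\<lambda>z. \<Sum>x\<in>insert b B. c x * indicator {x} z)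
          = E (\<lambda>z. c b * indicator {b} z + (\<Sum>x\<in>B. c x * indicator {x} z))"
        by (simp only: sum.insert[OF insert.hyps(1,2)])
      also have "\<dots> \<le> 2 powr (p - 1) * (\<bar>c b\<bar> powr p * ?e + C * D powr p)"
        using C(2)[of D c] D
        by (intro order_trans[OF energies_M_add] mult_left_mono add_mono) (auto simp: energies_M_scale)
      also have "\<dots> \<le> 2 powr (p - 1) * (D powr p * ?e + C * D powr p)"
        using D p energies_M_nonneg by (intro mult_left_mono add_mono mult_right_mono powr_mono2) auto
      finally show "E (\<lambda>z. \<Sum>x\<in>insert b B. c x * indicator {x} z) \<le> 2 powr (p - 1) * (?e + C) * D powr p"
        by (simp add: algebra_simps)
    qed
  qed
  from this[OF A] obtain C where C: "0 < C" "\<And>c D. 0 \<le> D \<Longrightarrow> (\<forall>x\<in>A. \<bar>c x\<bar> \<le> D) \<Longrightarrow>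
      E (\<lambda>z. \<Sum>x\<in>A. c x * indicator {x} z) \<le> C * D powr p" by blast
  show thesis
  proof (rule that[OF C(1)])
    fix f :: "'a \<Rightarrow> real" and D :: real
    assume D: "0 \<le> D" "\<And>x y. x \<in> A \<Longrightarrow> y \<in> A \<Longrightarrow> \<bar>f x - f y\<bar> \<le> D"
    show "E f \<le> C * D powr p"
    proof (cases "A = {}")
      case True
      then show ?thesis using C(1) energies_M_const[of f 0] by simp
    next
      case False
      then obtain a where a: "a \<in> A" by blast
      have "E f = E (\<lambda>x. f x + - f a)" by (rule energies_M_shift[symmetric])
      also have "\<dots> = E (\<lambda>z. \<Sum>x\<in>A. (f x - f a) * indicator {x} z)"
        by (rule energies_M_cong) (use A in \<open>simp add: indicator_def if_distrib cong: if_cong\<close>)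
      also have "\<dots> \<le> C * D powr p" by (rule C(2)) (use D a in auto)
      finally show ?thesis .
    qed
  qed
qed

end

lemma initial_energy_nonneg: "0 \<le> initial_energy p A f"
  unfolding initial_energy_def by (intro mult_nonneg_nonneg sum_nonneg) auto

lemma initial_energy_diff_le:
  assumes "finite A" "x \<in> A" "y \<in> A" "1 < p"
  shows "\<bar>f x - f y\<bar> powr p \<le> 2 * initial_energy p A f"
proof (cases "x = y")
  case True
  then show ?thesis using initial_energy_nonneg[of p A f] assms by simp
next
  case False
  have "\<bar>f x - f y\<bar> powr p \<le> (\<Sum>y\<in>A - {x}. \<bar>f x - f y\<bar> powr p)"
    using assms False by (intro member_le_sum) auto
  also have "\<dots> \<le> (\<Sum>x\<in>A. \<Sum>y\<in>A - {x}. \<bar>f x - f y\<bar> powr p)"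
    using assms by (intro member_le_sum[of x A "\<lambda>x. \<Sum>y\<in>A - {x}. \<bar>f x - f y\<bar> powr p"] sum_nonneg) auto
  finally show ?thesis by (simp add: initial_energy_def)
qed

lemma initial_energy_le:
  assumes "finite A" "\<And>x y. x \<in> A \<Longrightarrow> y \<in> A \<Longrightarrow> \<bar>f x - f y\<bar> powr p \<le> D" "0 \<le> D"
  shows "initial_energy p A f \<le> (real (card A))\<^sup>2 * D"
proof -
  have inner: "(\<Sum>y\<in>A - {x}. \<bar>f x - f y\<bar> powr p) \<le> real (card A) * D" if "x \<in> A" for x
  proof -
    have "(\<Sum>y\<in>A - {x}. \<bar>f x - f y\<bar> powr p) \<le> real (card (A - {x})) * D"
      using assms that by (intro sum_bounded_above) auto
    also have "\<dots> \<le> real (card A) * D" using assms by (intro mult_right_mono) (auto intro: card_mono)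
    finally show ?thesis .
  qed
  have "(\<Sum>x\<in>A. \<Sum>y\<in>A - {x}. \<bar>f x - f y\<bar> powr p) \<le> real (card A) * (real (card A) * D)"
    by (intro sum_bounded_above inner)
  moreover have "0 \<le> (\<Sum>x\<in>A. \<Sum>y\<in>A - {x}. \<bar>f x - f y\<bar> powr p)" by (intro sum_nonneg) auto
  ultimately show ?thesis by (simp add: initial_energy_def power2_eq_square)
qed

text \<open>Unlike its counterpart for \<open>p\<close>-th roots, this form of the Leibniz rule is linear in the
  energies, so that it passes to sums, traces and limits.\<close>

definition leibniz_rule :: "real \<Rightarrow> 'a set \<Rightarrow> (('a \<Rightarrow> real) \<Rightarrow> real) \<Rightarrow> bool" where
  "leibniz_rule p A E \<longleftrightarrow> (\<forall>\<eta> a c t. 0 < t \<and> t < 1 \<and> 0 \<le> c \<and>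
     (\<forall>x\<in>A. 0 \<le> \<eta> x \<and> \<eta> x \<le> 1) \<and> (\<forall>x\<in>A. \<bar>a x\<bar> \<le> c) \<longrightarrow>
     E (\<lambda>x. \<eta> x * a x) \<le> t powr (1 - p) * E a + (1 - t) powr (1 - p) * c powr p * E \<eta>)"

lemma leibniz_ruleD:
  assumes "leibniz_rule p A E" "0 < t" "t < 1" "0 \<le> c"
    "\<And>x. x \<in> A \<Longrightarrow> 0 \<le> \<eta> x" "\<And>x. x \<in> A \<Longrightarrow> \<eta> x \<le> 1" "\<And>x. x \<in> A \<Longrightarrow> \<bar>a x\<bar> \<le> c"
  shows "E (\<lambda>x. \<eta> x * a x) \<le> t powr (1 - p) * E a + (1 - t) powr (1 - p) * c powr p * E \<eta>"
  using assms unfolding leibniz_rule_def by blast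

lemma leibniz_rule_energies_S:
  assumes p: "1 < p" and E: "E \<in> energies_S p A"
  shows "leibniz_rule p A E"
  unfolding leibniz_rule_def
proof (intro allI impI, elim conjE)
  fix \<eta> a :: "'a \<Rightarrow> real" and c t :: real
  assume t: "0 < t" "t < 1" and c: "0 \<le> c" and \<eta>: "\<forall>x\<in>A. 0 \<le> \<eta> x \<and> \<eta> x \<le> 1" and a: "\<forall>x\<in>A. \<bar>a x\<bar> \<le> c"
  let ?s = "t powr (1 - p)" and ?u = "(1 - t) powr (1 - p) * c powr p"
  obtain k where k: "\<And>x y. x \<in> A \<Longrightarrow> y \<in> A \<Longrightarrow> 0 \<le> k x y"
      "\<And>f. E f = (\<Sum>x\<in>A. \<Sum>y\<in>A. k x y * \<bar>f x - f y\<bar> powr p)"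
    using E unfolding energies_S_def by blast
  have "\<bar>\<eta> x * a x - \<eta> y * a y\<bar> powr p \<le> ?s * \<bar>a x - a y\<bar> powr p + ?u * \<bar>\<eta> x - \<eta> y\<bar> powr p"
    if "x \<in> A" "y \<in> A" for x y
  proof -
    have "\<eta> x * a x - \<eta> y * a y = \<eta> x * (a x - a y) + a y * (\<eta> x - \<eta> y)" by (simp add: algebra_simps)
    then have "\<bar>\<eta> x * a x - \<eta> y * a y\<bar> \<le> \<bar>\<eta> x\<bar> * \<bar>a x - a y\<bar> + \<bar>a y\<bar> * \<bar>\<eta> x - \<eta> y\<bar>"
      by (metis abs_mult abs_triangle_ineq)
    also have "\<dots> \<le> 1 * \<bar>a x - a y\<bar> + c * \<bar>\<eta> x - \<eta> y\<bar>"
      using \<eta> a that by (intro add_mono mult_right_mono) auto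
    finally have "\<bar>\<eta> x * a x - \<eta> y * a y\<bar> powr p \<le> (\<bar>a x - a y\<bar> + c * \<bar>\<eta> x - \<eta> y\<bar>) powr p"
      using p by (intro powr_mono2) auto
    also have "\<dots> \<le> ?s * \<bar>a x - a y\<bar> powr p + (1 - t) powr (1 - p) * (c * \<bar>\<eta> x - \<eta> y\<bar>) powr p"
      using p t c by (intro powr_sum_le) auto
    finally show ?thesis using c by (simp add: powr_mult mult.assoc)
  qed
  then have "E (\<lambda>x. \<eta> x * a x) \<le> (\<Sum>x\<in>A. \<Sum>y\<in>A. k x y * (?s * \<bar>a x - a y\<bar> powr p + ?u * \<bar>\<eta> x - \<eta> y\<bar> powr p))"
    unfolding k(2)[of "\<lambda>x. \<eta> x * a x"] using k(1) by (intro sum_mono mult_left_mono) auto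
  also have "\<dots> = ?s * E a + ?u * E \<eta>"
    by (simp add: k(2) sum_distrib_left sum.distrib distrib_left mult.left_commute)
  finally show "E (\<lambda>x. \<eta> x * a x) \<le> ?s * E a + (1 - t) powr (1 - p) * c powr p * E \<eta>" .
qed

lemma trace_energy_le:
  assumes "\<And>f. 0 \<le> E f" "\<And>x. x \<in> B \<Longrightarrow> g x = f x"
  shows "trace_energy B E f \<le> E g"
  unfolding trace_energy_def by (rule cInf_lower) (use assms in \<open>auto intro!: bdd_belowI[of _ 0]\<close>)

lemma trace_energy_approx:
  assumes "0 < \<epsilon>"
  obtains g where "\<And>x. x \<in> B \<Longrightarrow> g x = f x" "E g < trace_energy B E f + \<epsilon>"
proof -
  have "{E f' |f'. \<forall>x\<in>B. f' x = f x} \<noteq> {}" by blast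
  from cInf_lessD[OF this, of "trace_energy B E f + \<epsilon>"] assms that show thesis
    by (auto simp: trace_energy_def)
qed

lemma le_by_approx:
  fixes x y C :: real
  assumes "0 \<le> C" "\<And>\<epsilon>. 0 < \<epsilon> \<Longrightarrow> x \<le> y + C * \<epsilon>"
  shows "x \<le> y"
proof (rule field_le_epsilon)
  fix e :: real assume "0 < e"
  have "x \<le> y + C * (e / (C + 1))" using assms \<open>0 < e\<close> by (intro assms(2)) auto
  also have "C * (e / (C + 1)) \<le> e" using assms(1) \<open>0 < e\<close> by (simp add: field_simps)
  finally show "x \<le> y + e" by simp
qed

text \<open>The product of near-optimal extensions of \<eta> and a is an admissible extension of the
  product. Clipping these extensions restores the bounds that the rule on B asks for and does not
  raise their energies.\<close>

lemma leibniz_rule_energies_Q':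
  assumes p: "1 < p" and E: "E \<in> energies_Q' p A"
  shows "leibniz_rule p A E"
  unfolding leibniz_rule_def
proof (intro allI impI, elim conjE)
  fix \<eta> a :: "'a \<Rightarrow> real" and c t :: real
  assume t: "0 < t" "t < 1" and c: "0 \<le> c" and \<eta>: "\<forall>x\<in>A. 0 \<le> \<eta> x \<and> \<eta> x \<le> 1" and a: "\<forall>x\<in>A. \<bar>a x\<bar> \<le> c"
  let ?s = "t powr (1 - p)" and ?u = "(1 - t) powr (1 - p) * c powr p"
  obtain B G where B: "A \<subseteq> B" "G \<in> energies_S p B" "E = trace_energy A G"
    using E unfolding energies_Q'_def by blast
  have M: "G \<in> energies_M p B" using B by (simp add: energies_S_def)
  note nonneg = energies_M_nonneg[OF p M]
  show "E (\<lambda>x. \<eta> x * a x) \<le> ?s * E a + ?u * E \<eta>"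
  proof (rule le_by_approx)
    show "0 \<le> ?s + ?u" by simp
    fix \<epsilon> :: real assume \<epsilon>: "0 < \<epsilon>"
    obtain a' where a': "\<And>x. x \<in> A \<Longrightarrow> a' x = a x" "G a' < E a + \<epsilon>"
      using trace_energy_approx[OF \<epsilon>, of A a G] B(3) by auto
    obtain \<eta>' where \<eta>': "\<And>x. x \<in> A \<Longrightarrow> \<eta>' x = \<eta> x" "G \<eta>' < E \<eta> + \<epsilon>"
      using trace_energy_approx[OF \<epsilon>, of A \<eta> G] B(3) by auto
    let ?a = "\<lambda>x. min (max (a' x) (- c)) c" and ?\<eta> = "unit_cut \<eta>'"
    have "?\<eta> x = \<eta> x" "?a x = a x" if "x \<in> A" for x
      using a'(1)[OF that] \<eta>'(1)[OF that] a[rule_format, OF that] \<eta>[rule_format, OF that]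
      by (auto simp: unit_cut_def)
    then have "E (\<lambda>x. \<eta> x * a x) \<le> G (\<lambda>x. ?\<eta> x * ?a x)" unfolding B(3)
      by (intro trace_energy_le[OF nonneg]) auto
    also have "\<dots> \<le> ?s * G ?a + ?u * G ?\<eta>"
      using c by (intro leibniz_ruleD[OF leibniz_rule_energies_S[OF p B(2)] t c] unit_cut_bounds) auto
    also have "\<dots> \<le> ?s * (E a + \<epsilon>) + ?u * (E \<eta> + \<epsilon>)"
      using energies_M_clip[OF p M, of "- c" c a'] energies_M_unit_cut[OF p M, of \<eta>'] c a'(2) \<eta>'(2)
      by (intro add_mono mult_left_mono) auto
    finally show "E (\<lambda>x. \<eta> x * a x) \<le> ?s * E a + ?u * E \<eta> + (?s + ?u) * \<epsilon>"
      by (simp add: algebra_simps)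
  qed
qed

lemma energies_Q_approx:
  assumes p: "1 < p" and A: "finite A" and E: "E \<in> energies_Q p A" and \<epsilon>: "0 < \<epsilon>"
  obtains E' where "E' \<in> energies_Q' p A"
    "\<And>f D. 0 \<le> D \<Longrightarrow> (\<And>x y. x \<in> A \<Longrightarrow> y \<in> A \<Longrightarrow> \<bar>f x - f y\<bar> \<le> D) \<Longrightarrow> \<bar>E f - E' f\<bar> \<le> \<epsilon> * D powr p"
proof -
  obtain E' where E': "E' \<in> energies_Q' p A" "functional_norm p A (\<lambda>f. E f - E' f) < ereal \<epsilon>"
    using E \<epsilon> unfolding energies_Q_def by blast
  have M: "E \<in> energies_M p A" "E' \<in> energies_M p A"
    using E E' by (auto simp: energies_Q_def energies_Q'_def)
  show thesis
  proof (rule that[OF E'(1)])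
    fix f :: "'a \<Rightarrow> real" and D :: real
    assume D: "0 \<le> D" "\<And>x y. x \<in> A \<Longrightarrow> y \<in> A \<Longrightarrow> \<bar>f x - f y\<bar> \<le> D"
    show "\<bar>E f - E' f\<bar> \<le> \<epsilon> * D powr p"
    \<comment> \<open>The norm tests non-constant functions only; on constant ones both energies
      vanish.\<close>
    proof (cases "constant_on_set A f")
      case True
      then have "E f = 0" "E' f = 0" using energies_M_eq_0[OF p M(1)] energies_M_eq_0[OF p M(2)] by auto
      then show ?thesis using \<epsilon> by simp
    next
      case False
      let ?S = "{\<bar>f x - f y\<bar> powr p | x y. x \<in> A \<and> y \<in> A}"
      have fin: "finite ?S" using A by (auto intro: finite_image_set2)
      obtain x y where xy: "x \<in> A" "y \<in> A" "f x \<noteq> f y" using False by (auto simp: constant_on_set_def)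
      have "0 < \<bar>f x - f y\<bar> powr p" using xy by simp
      also have "\<dots> \<le> Max ?S" by (rule Max_ge[OF fin]) (use xy in blast)
      finally have pos: "0 < Max ?S" .
      have "ereal (\<bar>E f - E' f\<bar> / Max ?S) \<le> functional_norm p A (\<lambda>f. E f - E' f)"
        unfolding functional_norm_def using False by (intro SUP_upper) auto
      with E'(2) have "ereal (\<bar>E f - E' f\<bar> / Max ?S) < ereal \<epsilon>" by (rule order_le_less_trans[rotated])
      then have "\<bar>E f - E' f\<bar> \<le> \<epsilon> * Max ?S" using pos by (simp add: field_simps)
      also have "Max ?S \<le> D powr p"
        using fin xy D p by (subst Max_le_iff) (auto intro!: powr_mono2)
      finally show ?thesis using \<epsilon> by simp
    qed
  qed
qed

lemma leibniz_rule_energies_Q: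
  assumes p: "1 < p" and A: "finite A" and E: "E \<in> energies_Q p A"
  shows "leibniz_rule p A E"
  unfolding leibniz_rule_def
proof (intro allI impI, elim conjE)
  fix \<eta> a :: "'a \<Rightarrow> real" and c t :: real
  assume t: "0 < t" "t < 1" and c: "0 \<le> c" and \<eta>: "\<forall>x\<in>A. 0 \<le> \<eta> x \<and> \<eta> x \<le> 1" and a: "\<forall>x\<in>A. \<bar>a x\<bar> \<le> c"
  \<comment> \<open>\<open>?D\<close> bounds the oscillation of all three functions at once: 2 c for
    a and for the product, 1 for \<eta>.\<close>
  let ?s = "t powr (1 - p)" and ?u = "(1 - t) powr (1 - p) * c powr p" and ?D = "2 * c + 1"
  show "E (\<lambda>x. \<eta> x * a x) \<le> ?s * E a + ?u * E \<eta>"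
  proof (rule le_by_approx)
    show "0 \<le> (1 + ?s + ?u) * ?D powr p" using c by simp
    fix \<epsilon> :: real assume "0 < \<epsilon>"
    then obtain E' where E': "E' \<in> energies_Q' p A"
      "\<And>f D. 0 \<le> D \<Longrightarrow> (\<And>x y. x \<in> A \<Longrightarrow> y \<in> A \<Longrightarrow> \<bar>f x - f y\<bar> \<le> D) \<Longrightarrow> \<bar>E f - E' f\<bar> \<le> \<epsilon> * D powr p"
      using energies_Q_approx[OF p A E] by metis
    have prod: "\<bar>\<eta> x * a x\<bar> \<le> c" if "x \<in> A" for x
      using that \<eta> a c mult_mono[of "\<bar>\<eta> x\<bar>" 1 "\<bar>a x\<bar>" c] by (auto simp: abs_mult)
    have "\<bar>E (\<lambda>x. \<eta> x * a x) - E' (\<lambda>x. \<eta> x * a x)\<bar> \<le> \<epsilon> * ?D powr p"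
    proof (rule E'(2))
      fix x y assume "x \<in> A" "y \<in> A"
      with prod[of x] prod[of y] show "\<bar>\<eta> x * a x - \<eta> y * a y\<bar> \<le> ?D" by linarith
    qed (use c in simp)
    moreover have "\<bar>E a - E' a\<bar> \<le> \<epsilon> * ?D powr p"
    proof (rule E'(2))
      fix x y assume "x \<in> A" "y \<in> A"
      then have "\<bar>a x\<bar> \<le> c" "\<bar>a y\<bar> \<le> c" using a by auto
      then show "\<bar>a x - a y\<bar> \<le> ?D" by linarith
    qed (use c in simp)
    moreover have "\<bar>E \<eta> - E' \<eta>\<bar> \<le> \<epsilon> * ?D powr p"
    proof (rule E'(2))
      fix x y assume "x \<in> A" "y \<in> A"
      then have "0 \<le> \<eta> x" "\<eta> x \<le> 1" "0 \<le> \<eta> y" "\<eta> y \<le> 1" using \<eta> by auto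
      then show "\<bar>\<eta> x - \<eta> y\<bar> \<le> ?D" using c by linarith
    qed (use c in simp)
    moreover have "E' (\<lambda>x. \<eta> x * a x) \<le> ?s * E' a + ?u * E' \<eta>"
      using \<eta> a by (intro leibniz_ruleD[OF leibniz_rule_energies_Q'[OF p E'(1)] t c]) auto
    moreover have "?s * E' a \<le> ?s * (E a + \<epsilon> * ?D powr p)" "?u * E' \<eta> \<le> ?u * (E \<eta> + \<epsilon> * ?D powr p)"
      using calculation by (auto intro!: mult_left_mono)
    ultimately show "E (\<lambda>x. \<eta> x * a x) \<le> ?s * E a + ?u * E \<eta> + (1 + ?s + ?u) * ?D powr p * \<epsilon>"
      by (simp add: algebra_simps)
  qed
qed

section \<open>Energies on the vertices\<close>

definition osc_le :: "'a set \<Rightarrow> ('a \<Rightarrow> real) \<Rightarrow> real \<Rightarrow> bool" where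
  "osc_le A f d \<longleftrightarrow> (\<forall>x\<in>A. \<forall>y\<in>A. \<bar>f x - f y\<bar> \<le> d)"

lemma osc_le_obtain_range:
  assumes "finite A" "A \<noteq> {}" "osc_le A f d"
  obtains a b where "b - a \<le> d" "\<And>x. x \<in> A \<Longrightarrow> a \<le> f x \<and> f x \<le> b"
proof (rule that[of "Max (f ` A)" "Min (f ` A)"])
  have "Max (f ` A) \<in> f ` A" "Min (f ` A) \<in> f ` A" using assms by (auto intro: Max_in Min_in)
  then show "Max (f ` A) - Min (f ` A) \<le> d" using assms(3) unfolding osc_le_def by (force simp: abs_le_iff)
  show "x \<in> A \<Longrightarrow> Min (f ` A) \<le> f x \<and> f x \<le> Max (f ` A)" for x using assms(1) by simp
qed

lemma osc_le_range: "(\<And>x. x \<in> A \<Longrightarrow> a \<le> f x \<and> f x \<le> b) \<Longrightarrow> b - a \<le> d \<Longrightarrow> osc_le A f d"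
  unfolding osc_le_def by (smt (verit))

locale pcf_weights = pcf_set F K N
  for F :: "nat \<Rightarrow> 'a::euclidean_space \<Rightarrow> 'a" and K :: "'a set" and N :: nat +
  fixes r :: "nat \<Rightarrow> real" and p :: real
  assumes r_pos: "\<forall>i\<in>{1..N}. 0 < r i" and p: "1 < p"
begin

abbreviation "rw \<equiv> word_weight r"

lemma rw_pos: "w \<in> W n \<Longrightarrow> 0 < rw w"
  using word_weight_pos[OF r_pos] set_words by blast

end

locale pcf_fixed_form = pcf_weights F K N r p
  for F :: "nat \<Rightarrow> 'a::euclidean_space \<Rightarrow> 'a" and K :: "'a set" and N :: nat
    and r :: "nat \<Rightarrow> real" and p :: real +
  fixes E :: "('a \<Rightarrow> real) \<Rightarrow> real"
  assumes E_Q: "E \<in> energies_Q p (vertices N F K 0)"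
    and E_fixed: "renorm N F K r E = E"
begin

lemma E_M: "E \<in> energies_M p (V 0)"
  using E_Q by (simp add: energies_Q_def)

lemmas E_cong = energies_M_cong[OF p E_M]
  and E_nonneg = energies_M_nonneg[OF p E_M]
  and E_affine = energies_M_affine[OF p E_M]
  and E_unit_cut = energies_M_unit_cut[OF p E_M]
  and E_add = energies_M_add[OF p E_M]
  and E_clip = energies_M_clip[OF p E_M]
  and E_const = energies_M_const[OF p E_M]

text \<open>This is \<Lambda>^n E for the fixed form E, with the iteration already resolved into
  words as in \<open>energy_lift_power\<close>.\<close>

definition Lam :: "nat \<Rightarrow> ('a \<Rightarrow> real) \<Rightarrow> real" where
  "Lam n f = (\<Sum>w\<in>W n. inverse (rw w) * E (f \<circ> fw w))"

lemma Lam_0 [simp]: "Lam 0 f = E f"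
  by (simp add: Lam_def)

lemma Lam_add: "Lam (m + n) f = (\<Sum>w\<in>W m. inverse (rw w) * Lam n (f \<circ> fw w))"
  unfolding Lam_def sum_words_append
  by (simp add: word_map_append word_weight_append sum_distrib_left mult.assoc o_assoc)

lemma Lam_mono_terms:
  assumes "\<And>w. w \<in> W m \<Longrightarrow> Lam n (f \<circ> fw w) \<le> c w"
  shows "Lam (m + n) f \<le> (\<Sum>w\<in>W m. inverse (rw w) * c w)"
  unfolding Lam_add using assms rw_pos by (intro sum_mono mult_left_mono) (auto intro: less_imp_le)

lemma Lam_nonneg: "0 \<le> Lam n f"
  unfolding Lam_def using rw_pos E_nonneg by (intro sum_nonneg mult_nonneg_nonneg) (auto intro: less_imp_le)

lemma Lam_cong:
  assumes "\<And>x. x \<in> V n \<Longrightarrow> f x = g x"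
  shows "Lam n f = Lam n g"
  unfolding Lam_def
proof (intro sum.cong refl arg_cong2[where f = "(*)"] E_cong)
  fix w q assume "w \<in> W n" "q \<in> V 0"
  then have "fw w q \<in> V n" using fw_in_V[of w n q 0] by simp
  then show "(f \<circ> fw w) q = (g \<circ> fw w) q" using assms by simp
qed

lemma Lam_affine: "Lam n (\<lambda>x. a * f x + b) = \<bar>a\<bar> powr p * Lam n f"
  unfolding Lam_def using E_affine[of a _ b] by (simp add: o_def sum_distrib_left mult.left_commute)

lemma Lam_const: "(\<And>x. x \<in> V n \<Longrightarrow> f x = c) \<Longrightarrow> Lam n f = 0"
  using Lam_cong[of n f "\<lambda>x. c"] Lam_affine[of n 0 f c] p by simp

lemma Lam_clip: "a \<le> b \<Longrightarrow> Lam n (\<lambda>x. min (max (f x) a) b) \<le> Lam n f"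
  unfolding Lam_def using rw_pos E_clip[of a b]
  by (intro sum_mono mult_left_mono) (auto simp: o_def intro: less_imp_le)

lemma Lam_add_le: "Lam n (\<lambda>x. f x + g x) \<le> 2 powr (p - 1) * (Lam n f + Lam n g)"
proof -
  have "Lam n (\<lambda>x. f x + g x) \<le>
      (\<Sum>w\<in>W n. inverse (rw w) * (2 powr (p - 1) * (E (f \<circ> fw w) + E (g \<circ> fw w))))"
    unfolding Lam_def using rw_pos E_add
    by (intro sum_mono mult_left_mono) (auto simp: o_def intro: less_imp_le)
  also have "\<dots> = 2 powr (p - 1) * (Lam n f + Lam n g)"
    unfolding Lam_def by (simp add: distrib_left sum.distrib sum_distrib_left mult.left_commute)
  finally show ?thesis .
qed

lemma Lam_leibniz:
  assumes t: "0 < t" "t < 1" and c: "0 \<le> c"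
    and \<eta>: "\<And>x. x \<in> V n \<Longrightarrow> 0 \<le> \<eta> x" "\<And>x. x \<in> V n \<Longrightarrow> \<eta> x \<le> 1" and f: "\<And>x. x \<in> V n \<Longrightarrow> \<bar>f x\<bar> \<le> c"
  shows "Lam n (\<lambda>x. \<eta> x * f x) \<le> t powr (1 - p) * Lam n f + (1 - t) powr (1 - p) * c powr p * Lam n \<eta>"
proof -
  have V: "fw w q \<in> V n" if "w \<in> W n" "q \<in> V 0" for w q
    using fw_in_V[OF that] by simp
  have "Lam n (\<lambda>x. \<eta> x * f x) \<le> (\<Sum>w\<in>W n. inverse (rw w) * (t powr (1 - p) * E (f \<circ> fw w) +
      (1 - t) powr (1 - p) * c powr p * E (\<eta> \<circ> fw w)))"
    unfolding Lam_def
  proof (intro sum_mono mult_left_mono)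
    fix w assume w: "w \<in> W n"
    show "0 \<le> inverse (rw w)" using rw_pos[OF w] by simp
    show "E ((\<lambda>x. \<eta> x * f x) \<circ> fw w) \<le> t powr (1 - p) * E (f \<circ> fw w) + (1 - t) powr (1 - p) * c powr p * E (\<eta> \<circ> fw w)"
      using leibniz_ruleD[OF leibniz_rule_energies_Q[OF p finite_V E_Q] t c, of "\<eta> \<circ> fw w" "f \<circ> fw w"]
        V[OF w] \<eta> f by (simp add: o_def)
  qed
  also have "\<dots> = t powr (1 - p) * Lam n f + (1 - t) powr (1 - p) * c powr p * Lam n \<eta>"
    unfolding Lam_def by (simp add: distrib_left sum.distrib sum_distrib_left mult.left_commute)
  finally show ?thesis .
qed

lemma Lam_Suc_0: "Lam (Suc 0) f = energy_lift N F r E f"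
  unfolding Lam_def sum_words_1 by (simp add: energy_lift_def)

lemma E_le_Lam_1: "E f \<le> Lam (Suc 0) f"
proof -
  have nonneg: "0 \<le> energy_lift N F r E f" for f
    using Lam_nonneg[of "Suc 0" f] by (simp add: Lam_Suc_0)
  have "E f = trace_energy (V 0) (energy_lift N F r E) f"
    using E_fixed by (simp add: renorm_def fun_eq_iff)
  also have "\<dots> \<le> energy_lift N F r E f" by (rule trace_energy_le[OF nonneg]) simp
  finally show ?thesis by (simp add: Lam_Suc_0)
qed

text \<open>Being its own renormalized trace, E is at most \<Lambda> E on every function. Applied in
  each cell of level n, this lets the energy grow with the level.\<close>

lemma Lam_mono: "m \<le> n \<Longrightarrow> Lam m f \<le> Lam n f"
proof (rule lift_Suc_mono_le[of "\<lambda>n. Lam n f"])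
  fix n
  have "Lam n f = Lam (n + 0) f" by simp
  also have "\<dots> \<le> (\<Sum>w\<in>W n. inverse (rw w) * Lam (Suc 0) (f \<circ> fw w))"
    by (rule Lam_mono_terms) (simp add: E_le_Lam_1)
  also have "\<dots> = Lam (n + Suc 0) f" by (rule Lam_add[symmetric])
  finally show "Lam n f \<le> Lam (Suc n) f" by simp
qed

text \<open>A bound for the supremum of all \<Lambda>^n E(f), written without the supremum, which
  may be infinite.\<close>

definition energy_le :: "('a \<Rightarrow> real) \<Rightarrow> real \<Rightarrow> bool" where
  "energy_le f c \<longleftrightarrow> (\<forall>n. Lam n f \<le> c)"

lemma energy_leD: "energy_le f c \<Longrightarrow> Lam n f \<le> c"
  by (simp add: energy_le_def)

lemma energy_le_cong: "(\<And>x. x \<in> VS \<Longrightarrow> f x = g x) \<Longrightarrow> energy_le f c \<longleftrightarrow> energy_le g c"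
  unfolding energy_le_def using Lam_cong[of _ f g] V_subset_VS by (metis subsetD)

lemma energy_le_mono: "energy_le f c \<Longrightarrow> c \<le> d \<Longrightarrow> energy_le f d"
  unfolding energy_le_def by (meson order_trans)

lemma energy_le_nonneg: "energy_le f c \<Longrightarrow> 0 \<le> c"
  unfolding energy_le_def using Lam_nonneg by (meson order_trans)

lemma energy_le_affine: "energy_le f c \<Longrightarrow> energy_le (\<lambda>x. a * f x + b) (\<bar>a\<bar> powr p * c)"
  unfolding energy_le_def Lam_affine by (simp add: mult_left_mono)

lemma energy_le_const: "0 \<le> c \<Longrightarrow> energy_le (\<lambda>x. a) c"
  unfolding energy_le_def by (simp add: Lam_const)

text \<open>By monotonicity the levels below m need no bound of their own.\<close>

lemma energy_le_cells:
  assumes "\<And>w. w \<in> W m \<Longrightarrow> energy_le (f \<circ> fw w) (c w)"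
  shows "energy_le f (\<Sum>w\<in>W m. inverse (rw w) * c w)"
  unfolding energy_le_def
proof
  fix n
  have "Lam n f \<le> Lam (m + n) f" by (rule Lam_mono) simp
  also have "\<dots> \<le> (\<Sum>w\<in>W m. inverse (rw w) * c w)"
    using assms by (intro Lam_mono_terms energy_leD)
  finally show "Lam n f \<le> (\<Sum>w\<in>W m. inverse (rw w) * c w)" .
qed

lemma energy_le_glue:
  assumes b: "\<And>w q. w \<in> W m \<Longrightarrow> q \<in> V 0 \<Longrightarrow> g w q = b (fw w q)"
    and g: "\<And>w. w \<in> W m \<Longrightarrow> energy_le (g w) (c w)"
  shows "energy_le (glue m g) (\<Sum>w\<in>W m. inverse (rw w) * c w)"
proof (rule energy_le_cells)
  fix w assume w: "w \<in> W m"
  have "energy_le (glue m g \<circ> fw w) (c w) \<longleftrightarrow> energy_le (g w) (c w)"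
    using glue_cell[where b = b, OF b w] VS_subset_K by (intro energy_le_cong) auto
  then show "energy_le (glue m g \<circ> fw w) (c w)" using g[OF w] by blast
qed

lemma energy_le_cell:
  assumes "energy_le f c" "w \<in> W m"
  shows "energy_le (f \<circ> fw w) (rw w * c)"
  unfolding energy_le_def
proof
  fix n
  have "inverse (rw w) * Lam n (f \<circ> fw w) \<le> Lam (m + n) f"
    unfolding Lam_add using assms(2) rw_pos Lam_nonneg
    by (intro member_le_sum mult_nonneg_nonneg) (auto intro: less_imp_le)
  also have "\<dots> \<le> c" using assms(1) by (rule energy_leD)
  finally show "Lam n (f \<circ> fw w) \<le> rw w * c" using rw_pos[OF assms(2)] by (simp add: field_simps)
qed

text \<open>One step of extending from V_0, with oscillations in the cells of level m reduced by the
  factor \<rho>. Two features make it iterable: m depends on \<epsilon> but not on h, so the step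
  can be made in all cells of a level at once, and the energy error is multiplicative.\<close>

definition extension_step :: "real \<Rightarrow> bool" where
  "extension_step \<rho> \<longleftrightarrow> (\<forall>\<epsilon>>0. \<exists>m\<ge>1. \<forall>h. \<exists>f. (\<forall>q\<in>V 0. f q = h q) \<and>
     (\<forall>a b. (\<forall>q\<in>V 0. a \<le> h q \<and> h q \<le> b) \<longrightarrow> (\<forall>x\<in>V m. a \<le> f x \<and> f x \<le> b)) \<and>
     (\<forall>w\<in>W m. \<forall>d. osc_le (V 0) h d \<longrightarrow> osc_le (V 0) (f \<circ> fw w) (\<rho> * d)) \<and>
     Lam m f \<le> (1 + \<epsilon>) * E h)"

text \<open>The errors of the successive steps are chosen such that \<open>1 + \<epsilon> (1 - 2\<^sup>-\<^sup>k)\<close> bounds the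
  energy after \<open>k\<close> steps.\<close>

lemma extension_iterate:
  assumes step: "extension_step \<rho>" and \<epsilon>: "0 < \<epsilon>"
  obtains f where "\<And>q. q \<in> V 0 \<Longrightarrow> f q = h q"
    "\<And>a b x. (\<And>q. q \<in> V 0 \<Longrightarrow> a \<le> h q \<and> h q \<le> b) \<Longrightarrow> x \<in> VS \<Longrightarrow> a \<le> f x \<and> f x \<le> b"
    "energy_le f ((1 + \<epsilon>) * E h)"
    "\<And>k d. osc_le (V 0) h d \<Longrightarrow> \<exists>n. \<forall>w\<in>W n. osc_le VS (f \<circ> fw w) (\<rho> ^ k * d)"
proof -
  define c where "c k = 1 + \<epsilon> * (1 - (1/2) ^ k)" for k
  have c_pos: "0 < c k" and c_less: "c k < c (Suc k)" and c_le: "c k \<le> 1 + \<epsilon>" for k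
  proof -
    have "(1/2::real) ^ k \<le> 1" "0 < (1/2::real) ^ k" by (auto intro: power_le_one)
    then show "0 < c k" "c k < c (Suc k)" "c k \<le> 1 + \<epsilon>"
      using \<epsilon> by (auto simp: c_def intro: add_pos_nonneg)
  qed
  define good where "good k m X \<longleftrightarrow> 1 \<le> m \<and> (\<forall>h. (\<forall>q\<in>V 0. X h q = h q) \<and>
     (\<forall>a b. (\<forall>q\<in>V 0. a \<le> h q \<and> h q \<le> b) \<longrightarrow> (\<forall>x\<in>V m. a \<le> X h x \<and> X h x \<le> b)) \<and>
     (\<forall>w\<in>W m. \<forall>d. osc_le (V 0) h d \<longrightarrow> osc_le (V 0) (X h \<circ> fw w) (\<rho> * d)) \<and>
     Lam m (X h) \<le> (1 + (c (Suc k) / c k - 1)) * E h)" for k m X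
  have "\<forall>k. \<exists>m X. good k m X"
  proof
    fix k
    have "0 < c (Suc k) / c k - 1" using c_pos[of k] c_less[of k] by simp
    from step[unfolded extension_step_def, rule_format, OF this]
    obtain m where m: "1 \<le> m" "\<forall>h. \<exists>f. (\<forall>q\<in>V 0. f q = h q) \<and>
     (\<forall>a b. (\<forall>q\<in>V 0. a \<le> h q \<and> h q \<le> b) \<longrightarrow> (\<forall>x\<in>V m. a \<le> f x \<and> f x \<le> b)) \<and>
     (\<forall>w\<in>W m. \<forall>d. osc_le (V 0) h d \<longrightarrow> osc_le (V 0) (f \<circ> fw w) (\<rho> * d)) \<and>
     Lam m f \<le> (1 + (c (Suc k) / c k - 1)) * E h" by blast
    from m(1) choice[OF m(2)] show "\<exists>m X. good k m X" unfolding good_def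
      by - (rule exI[of _ m], simp only: ex_simps simp_thms)
  qed
  then obtain m X where "\<And>k. good k (m k) (X k)" by metis
  note good = this[unfolded good_def]
  have m: "\<And>k. 1 \<le> m k"
    and X0: "\<And>k h q. q \<in> V 0 \<Longrightarrow> X k h q = h q"
    and Xr: "\<And>k h a b x. (\<And>q. q \<in> V 0 \<Longrightarrow> a \<le> h q \<and> h q \<le> b) \<Longrightarrow> x \<in> V (m k) \<Longrightarrow> a \<le> X k h x \<and> X k h x \<le> b"
    and Xo: "\<And>k h w d. w \<in> W (m k) \<Longrightarrow> osc_le (V 0) h d \<Longrightarrow> osc_le (V 0) (X k h \<circ> fw w) (\<rho> * d)"
    using good by (blast, blast, blast, blast)
  have XE: "Lam (m k) (X k h) \<le> (c (Suc k) / c k) * E h" for k h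
  proof -
    have "Lam (m k) (X k h) \<le> (1 + (c (Suc k) / c k - 1)) * E h" using good by blast
    then show ?thesis by simp
  qed
  define M where "M k = (\<Sum>i<k. m i)" for k
  have M0: "M 0 = 0" and MS: "M (Suc k) = M k + m k" for k by (simp_all add: M_def)
  have M_add: "M k + l \<le> M (k + l)" for k l
  proof (induction l)
    case (Suc l)
    then show ?case using m[of "k + l"] MS[of "k + l"] by simp
  qed simp
  have M_mono: "j \<le> k \<Longrightarrow> M j \<le> M k" for j k using M_add[of j "k - j"] by simp
  \<comment> \<open>Stage k is meaningful up to level M k. The next stage extends the corner values
    of every cell of that level by m k further levels and glues the results.\<close>
  define g where "g = rec_nat h (\<lambda>k f. glue (M k) (\<lambda>w. X k (f \<circ> fw w)))"
  have g0: "g 0 = h" and gS: "g (Suc k) = glue (M k) (\<lambda>w. X k (g k \<circ> fw w))" for k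
    by (simp_all add: g_def)
  have g_cell: "g (Suc k) (fw w y) = X k (g k \<circ> fw w) y" if "w \<in> W (M k)" "y \<in> K" for k w y
    unfolding gS by (rule glue_cell[where b = "g k"]) (use that X0 in auto)
  have g_vertex: "g (Suc k) x = g k x" if "x \<in> V (M k)" for k x
    unfolding gS by (rule glue_vertex[where b = "g k"]) (use that X0 in auto)
  have g_stable: "g j x = g k x" if "x \<in> V (M k)" "k \<le> j" for j k x
    using that(2)
  proof (induction j rule: dec_induct)
    case (step j)
    then have "x \<in> V (M j)" using V_mono[OF M_mono] that(1) by blast
    then show ?case using g_vertex step.IH by simp
  qed simp
  \<comment> \<open>Values at the vertices of level M k are frozen from stage k on, so every stage
    that has reached x gives the same value.\<close>
  define f where "f x = g (LEAST k. x \<in> V (M k)) x" for x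
  have f: "f x = g k x" if "x \<in> V (M k)" for k x
  proof -
    have "x \<in> V (M (LEAST k. x \<in> V (M k)))" by (rule LeastI[of "\<lambda>k. x \<in> V (M k)"], rule that)
    then show ?thesis unfolding f_def
      using g_stable that Least_le[of "\<lambda>k. x \<in> V (M k)", OF that] by metis
  qed
  have Lam_g: "Lam (M k) (g k) \<le> c k * E h" for k
  proof (induction k)
    case 0
    then show ?case by (simp add: M0 g0 c_def)
  next
    case (Suc k)
    have "Lam (M k + m k) (g (Suc k)) \<le> (\<Sum>w\<in>W (M k). inverse (rw w) * ((c (Suc k) / c k) * E (g k \<circ> fw w)))"
    proof (rule Lam_mono_terms)
      fix w assume w: "w \<in> W (M k)"
      have "Lam (m k) (g (Suc k) \<circ> fw w) = Lam (m k) (X k (g k \<circ> fw w))"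
        using g_cell[OF w] V_subset_K by (intro Lam_cong) auto
      then show "Lam (m k) (g (Suc k) \<circ> fw w) \<le> (c (Suc k) / c k) * E (g k \<circ> fw w)" using XE by simp
    qed
    also have "\<dots> = (c (Suc k) / c k) * Lam (M k) (g k)"
      by (simp add: Lam_def sum_distrib_left mult.left_commute)
    also have "\<dots> \<le> (c (Suc k) / c k) * (c k * E h)"
      using Suc c_pos[of k] c_pos[of "Suc k"] by (intro mult_left_mono) auto
    finally show ?case using c_pos[of k] by (simp add: MS)
  qed
  \<comment> \<open>A maximum principle inside a cell: bounds at its corners persist at all later
    stages. It carries oscillation bounds from the corners to all vertices of the cell.\<close>
  have range: "a \<le> g j (fw w x) \<and> g j (fw w x) \<le> b"
    if w: "w \<in> W (M k)" and ab: "\<And>q. q \<in> V 0 \<Longrightarrow> a \<le> g k (fw w q) \<and> g k (fw w q) \<le> b"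
      and "k \<le> j" "x \<in> V (M j - M k)" for j k w x a b
    using that(3,4)
  proof (induction j arbitrary: x rule: dec_induct)
    case base
    then show ?case using ab by simp
  next
    case (step j)
    have "M (Suc j) - M k = (M j - M k) + m j" using MS M_mono[OF step.hyps(1)] by simp
    then have "x \<in> V ((M j - M k) + m j)" using step.prems by simp
    then obtain u y where u: "u \<in> W (M j - M k)" "y \<in> V (m j)" "x = fw u y"
      unfolding V_add by blast
    have wu: "w @ u \<in> W (M j)" using append_in_words[OF w u(1)] M_mono[OF step.hyps(1)] by simp
    have "a \<le> X j (g j \<circ> fw (w @ u)) y \<and> X j (g j \<circ> fw (w @ u)) y \<le> b"
    proof (rule Xr[OF _ u(2)])
      fix q assume "q \<in> V 0"
      then have "fw u q \<in> V (M j - M k)" using fw_in_V[OF u(1), of q 0] by simp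
      from step.IH[OF this] show "a \<le> (g j \<circ> fw (w @ u)) q \<and> (g j \<circ> fw (w @ u)) q \<le> b"
        by (simp add: word_map_append)
    qed
    moreover have "y \<in> K" using u(2) V_subset_K by blast
    ultimately show ?case using g_cell[OF wu, of y] u(3) by (simp add: word_map_append)
  qed
  have f_range: "a \<le> f (fw w x) \<and> f (fw w x) \<le> b"
    if w: "w \<in> W (M k)" and ab: "\<And>q. q \<in> V 0 \<Longrightarrow> a \<le> g k (fw w q) \<and> g k (fw w q) \<le> b"
      and x: "x \<in> VS" for k w x a b
  proof -
    obtain l where l: "x \<in> V l" using x unfolding all_vertices_def by blast
    have "l \<le> M (k + l) - M k" using M_add[of k l] by simp
    then have "x \<in> V (M (k + l) - M k)" using V_mono l by blast
    moreover have "fw w x \<in> V (M (k + l))"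
      using fw_in_V[OF w calculation] M_mono[of k "k + l"] by simp
    ultimately show ?thesis using range[OF w ab, of "k + l" x] f by simp
  qed
  have osc: "osc_le (V 0) (g k \<circ> fw w) (\<rho> ^ k * d)" if d: "osc_le (V 0) h d" and w: "w \<in> W (M k)" for k w d
    using w
  proof (induction k arbitrary: w)
    case 0
    then show ?case using d by (simp add: g0 M0 o_def)
  next
    case (Suc k)
    from Suc.prems obtain u v where u: "u \<in> W (M k)" "v \<in> W (m k)" "w = u @ v"
      unfolding MS by (rule words_append_obtain)
    have "(g (Suc k) \<circ> fw w) q = (X k (g k \<circ> fw u) \<circ> fw v) q" if "q \<in> V 0" for q
      using g_cell[OF u(1), of "fw v q"] u(2,3) that V0_subset_K fw_in_K[OF set_words[OF u(2)]]
      by (auto simp: word_map_append)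
    moreover have "osc_le (V 0) (X k (g k \<circ> fw u) \<circ> fw v) (\<rho> * (\<rho> ^ k * d))"
      by (rule Xo[OF u(2) Suc.IH[OF u(1)]])
    ultimately show ?case by (simp add: osc_le_def mult.assoc)
  qed
  show thesis
  proof (rule that[of f])
    fix q assume "q \<in> V 0"
    then show "f q = h q" using f[of q 0] by (simp add: M0 g0)
  next
    fix a b x assume "\<And>q. q \<in> V 0 \<Longrightarrow> a \<le> h q \<and> h q \<le> b" "x \<in> VS"
    then show "a \<le> f x \<and> f x \<le> b" using f_range[of "[]" 0 a b x] by (simp add: M0 g0)
  next
    show "energy_le f ((1 + \<epsilon>) * E h)" unfolding energy_le_def
    proof
      fix n
      have "Lam n f \<le> Lam (M n) f" using M_add[of 0 n] by (intro Lam_mono) (simp add: M0)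
      also have "\<dots> = Lam (M n) (g n)" using f by (rule Lam_cong)
      also have "\<dots> \<le> c n * E h" by (rule Lam_g)
      also have "\<dots> \<le> (1 + \<epsilon>) * E h" using c_le E_nonneg by (intro mult_right_mono)
      finally show "Lam n f \<le> (1 + \<epsilon>) * E h" .
    qed
  next
    fix k d assume d: "osc_le (V 0) h d"
    have "osc_le VS (f \<circ> fw w) (\<rho> ^ k * d)" if w: "w \<in> W (M k)" for w
    proof -
      obtain a b where ab: "b - a \<le> \<rho> ^ k * d" "\<And>q. q \<in> V 0 \<Longrightarrow> a \<le> (g k \<circ> fw w) q \<and> (g k \<circ> fw w) q \<le> b"
        using osc_le_obtain_range[OF finite_V V0_nonempty osc[OF d w]] by metis
      then show ?thesis using f_range[OF w] by (intro osc_le_range[OF _ ab(1)]) auto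
    qed
    then show "\<exists>n. \<forall>w\<in>W n. osc_le VS (f \<circ> fw w) (\<rho> ^ k * d)" by blast
  qed
qed

text \<open>The trace equation yields a near-minimizer at level 1. Clipping it to the range of h on
  V_0 preserves the corner values, does not raise the energy, and bounds every oscillation by that
  of h.\<close>

lemma extension_step_1: "extension_step 1"
  unfolding extension_step_def
proof (intro allI impI)
  fix \<epsilon> :: real assume \<epsilon>: "0 < \<epsilon>"
  show "\<exists>m\<ge>1. \<forall>h. \<exists>f. (\<forall>q\<in>V 0. f q = h q) \<and>
     (\<forall>a b. (\<forall>q\<in>V 0. a \<le> h q \<and> h q \<le> b) \<longrightarrow> (\<forall>x\<in>V m. a \<le> f x \<and> f x \<le> b)) \<and>
     (\<forall>w\<in>W m. \<forall>d. osc_le (V 0) h d \<longrightarrow> osc_le (V 0) (f \<circ> fw w) (1 * d)) \<and>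
     Lam m f \<le> (1 + \<epsilon>) * E h"
  proof (intro exI[of _ "Suc 0"] conjI allI)
    fix h :: "'a \<Rightarrow> real"
    define lo hi where "lo = Min (h ` V 0)" and "hi = Max (h ` V 0)"
    have lohi: "lo \<in> h ` V 0" "hi \<in> h ` V 0" "\<And>q. q \<in> V 0 \<Longrightarrow> lo \<le> h q \<and> h q \<le> hi"
      unfolding lo_def hi_def using finite_V V0_nonempty by (auto intro!: Min_in Max_in)
    have "\<exists>g. (\<forall>q\<in>V 0. g q = h q) \<and> Lam (Suc 0) g \<le> (1 + \<epsilon>) * E h"
    \<comment> \<open>A multiplicative error leaves no slack when E h = 0; then h is constant on V_0
      and a constant extends it.\<close>
    proof (cases "E h = 0")
      case True
      then have "constant_on_set (V 0) h" using energies_M_eq_0[OF p E_M] by blast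
      moreover obtain q0 where "q0 \<in> V 0" "lo = h q0" using lohi(1) by blast
      ultimately have "\<forall>q\<in>V 0. lo = h q" unfolding constant_on_set_def by metis
      then show ?thesis using True by (intro exI[of _ "\<lambda>_. lo"]) (auto simp: Lam_const)
    next
      case False
      then have "0 < \<epsilon> * E h" using \<epsilon> E_nonneg[of h] by simp
      then obtain g where g: "\<And>x. x \<in> V 0 \<Longrightarrow> g x = h x"
        "energy_lift N F r E g < trace_energy (V 0) (energy_lift N F r E) h + \<epsilon> * E h"
        using trace_energy_approx by metis
      moreover have "trace_energy (V 0) (energy_lift N F r E) h = E h"
        using fun_cong[OF E_fixed, of h] by (simp add: renorm_def)
      ultimately have "Lam (Suc 0) g \<le> (1 + \<epsilon>) * E h" by (simp add: Lam_Suc_0 distrib_right)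
      then show ?thesis using g(1) by (intro exI[of _ g]) simp
    qed
    then obtain g where g: "\<forall>q\<in>V 0. g q = h q" "Lam (Suc 0) g \<le> (1 + \<epsilon>) * E h" by blast
    define f where "f = (\<lambda>x. min (max (g x) lo) hi)"
    obtain q where "q \<in> V 0" using V0_nonempty by blast
    then have le: "lo \<le> hi" using lohi(3)[of q] by linarith
    have 1: "\<forall>q\<in>V 0. f q = h q" using g(1) lohi(3) by (simp add: f_def)
    have 2: "lo \<le> f x \<and> f x \<le> hi" for x using le by (auto simp: f_def)
    have 3: "hi - lo \<le> d" if "osc_le (V 0) h d" for d
      using lohi(1,2) that unfolding osc_le_def by (force simp: abs_le_iff)
    have 4: "Lam (Suc 0) f \<le> (1 + \<epsilon>) * E h" using Lam_clip[OF le] g(2) unfolding f_def by (rule order_trans)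
    have 5: "a \<le> f x \<and> f x \<le> b" if "\<forall>q\<in>V 0. a \<le> h q \<and> h q \<le> b" for a b x
      using that lohi(1,2) 2[of x] by (auto intro: order_trans)
    have 6: "osc_le (V 0) (f \<circ> fw w) (1 * d)" if "osc_le (V 0) h d" for w d
      using 3[OF that] 2 by (intro osc_le_range[of _ lo _ hi]) auto
    show "\<exists>f. (\<forall>q\<in>V 0. f q = h q) \<and>
     (\<forall>a b. (\<forall>q\<in>V 0. a \<le> h q \<and> h q \<le> b) \<longrightarrow> (\<forall>x\<in>V (Suc 0). a \<le> f x \<and> f x \<le> b)) \<and>
     (\<forall>w\<in>W (Suc 0). \<forall>d. osc_le (V 0) h d \<longrightarrow> osc_le (V 0) (f \<circ> fw w) (1 * d)) \<and>
     Lam (Suc 0) f \<le> (1 + \<epsilon>) * E h"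
      using 1 4 5 6 by (intro exI[of _ f]) blast
  qed simp
qed

end

section \<open>Continuous functions of finite energy\<close>

context pcf_fixed_form
begin

text \<open>Stands in for the energy-minimizing extension of h. It is a choice function of h so that
  it can be used in all cells simultaneously.\<close>

definition near_harmonic :: "real \<Rightarrow> ('a \<Rightarrow> real) \<Rightarrow> 'a \<Rightarrow> real" where
  "near_harmonic \<epsilon> h = (SOME f. (\<forall>q\<in>V 0. f q = h q) \<and>
     (\<forall>a b. (\<forall>q\<in>V 0. a \<le> h q \<and> h q \<le> b) \<longrightarrow> (\<forall>x\<in>VS. a \<le> f x \<and> f x \<le> b)) \<and>
     energy_le f ((1 + \<epsilon>) * E h))"

lemma near_harmonic:
  assumes "0 < \<epsilon>"
  shows near_harmonic_vertex: "q \<in> V 0 \<Longrightarrow> near_harmonic \<epsilon> h q = h q"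
    and near_harmonic_range: "(\<And>q. q \<in> V 0 \<Longrightarrow> a \<le> h q \<and> h q \<le> b) \<Longrightarrow> x \<in> VS \<Longrightarrow>
      a \<le> near_harmonic \<epsilon> h x \<and> near_harmonic \<epsilon> h x \<le> b"
    and near_harmonic_energy: "energy_le (near_harmonic \<epsilon> h) ((1 + \<epsilon>) * E h)"
proof -
  have "\<exists>f. (\<forall>q\<in>V 0. f q = h q) \<and>
     (\<forall>a b. (\<forall>q\<in>V 0. a \<le> h q \<and> h q \<le> b) \<longrightarrow> (\<forall>x\<in>VS. a \<le> f x \<and> f x \<le> b)) \<and>
     energy_le f ((1 + \<epsilon>) * E h)"
  proof (rule extension_iterate[OF extension_step_1 assms, of h])
    fix f
    assume "\<And>q. q \<in> V 0 \<Longrightarrow> f q = h q"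
      "\<And>a b x. (\<And>q. q \<in> V 0 \<Longrightarrow> a \<le> h q \<and> h q \<le> b) \<Longrightarrow> x \<in> VS \<Longrightarrow> a \<le> f x \<and> f x \<le> b"
      "energy_le f ((1 + \<epsilon>) * E h)"
    then show ?thesis by (intro exI[of _ f] conjI ballI allI impI) blast+
  qed
  from someI_ex[OF this] have *: "(\<forall>q\<in>V 0. near_harmonic \<epsilon> h q = h q) \<and>
     (\<forall>a b. (\<forall>q\<in>V 0. a \<le> h q \<and> h q \<le> b) \<longrightarrow>
       (\<forall>x\<in>VS. a \<le> near_harmonic \<epsilon> h x \<and> near_harmonic \<epsilon> h x \<le> b)) \<and>
     energy_le (near_harmonic \<epsilon> h) ((1 + \<epsilon>) * E h)" unfolding near_harmonic_def .
  show "q \<in> V 0 \<Longrightarrow> near_harmonic \<epsilon> h q = h q" using * by blast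
  show "(\<And>q. q \<in> V 0 \<Longrightarrow> a \<le> h q \<and> h q \<le> b) \<Longrightarrow> x \<in> VS \<Longrightarrow>
      a \<le> near_harmonic \<epsilon> h x \<and> near_harmonic \<epsilon> h x \<le> b" using * by blast
  show "energy_le (near_harmonic \<epsilon> h) ((1 + \<epsilon>) * E h)" using * by blast
qed

text \<open>If \<open>r\<^sub>w \<ge> 1\<close>, the \<open>M\<close> nested cells \<open>F\<^sub>w\<^sup>k K\<close> around the fixed point \<open>x\<close> give room for a
  function which decreases from \<open>M\<close> to \<open>0\<close> in \<open>M\<close> unit steps, each of bounded energy. Since
  \<open>p > 1\<close>, the capacity of \<open>{x}\<close> in \<open>V\<^sub>0\<close> would vanish.\<close>

lemma weight_at_fixed_vertex_less_1:
  assumes w: "w \<in> W n" "1 \<le> n" and x: "x \<in> V 0" "fw w x = x"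
  shows "rw w < 1"
proof (rule ccontr)
  assume "\<not> rw w < 1"
  then have r1: "1 \<le> rw w" by simp
  have xK: "x \<in> K" using x V0_subset_K by blast
  have "\<forall>q\<in>V 0. \<exists>d>0. q \<noteq> x \<longrightarrow> d \<le> dist q x"
  proof
    fix q show "\<exists>d>0. q \<noteq> x \<longrightarrow> d \<le> dist q x"
      by (cases "q = x") (auto intro: exI[of _ 1] exI[of _ "dist q x"])
  qed
  from bchoice[OF this] obtain d where d: "\<And>q. q \<in> V 0 \<Longrightarrow> 0 < d q \<and> (q \<noteq> x \<longrightarrow> d q \<le> dist q x)" by blast
  define \<delta> where "\<delta> = Min (d ` V 0)"
  have \<delta>: "0 < \<delta>" unfolding \<delta>_def using d finite_V V0_nonempty by (subst Min_gr_iff) auto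
  have \<delta>_le: "\<delta> \<le> dist q x" if "q \<in> V 0" "q \<noteq> x" for q
  proof -
    have "\<delta> \<le> d q" unfolding \<delta>_def using that finite_V by (intro Min_le) auto
    then show ?thesis using d[OF that(1)] that(2) by linarith
  qed
  obtain n0 where n0: "\<And>m v y z. n0 \<le> m \<Longrightarrow> v \<in> W m \<Longrightarrow> y \<in> K \<Longrightarrow> z \<in> K \<Longrightarrow> dist (fw v y) (fw v z) < \<delta>"
    using cells_small[OF \<delta>] by metis
  have power: "\<exists>u\<in>W (j * n). 1 \<le> rw u \<and> fw u x = x" for j
  proof (induction j)
    case (Suc j)
    then obtain u where u: "u \<in> W (j * n)" "1 \<le> rw u" "fw u x = x" by blast
    have "1 * 1 \<le> rw w * rw u" using r1 u(2) by (intro mult_mono) auto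
    then show ?case using append_in_words[OF w(1) u(1)] u(3) x(2)
      by (intro bexI[of _ "w @ u"]) (auto simp: word_map_append word_weight_append)
  qed auto
  \<comment> \<open>A multiple of n, so that a power of w has this length, and at least n0, so that
    its cell is too small to contain a second point of V_0.\<close>
  define m where "m = Suc n0 * n"
  have m: "n0 \<le> m" "1 \<le> m"
  proof -
    have "Suc n0 * 1 \<le> Suc n0 * n" using w(2) by (rule mult_le_mono2)
    then show "n0 \<le> m" "1 \<le> m" by (simp_all add: m_def)
  qed
  obtain u where u: "u \<in> W m" "1 \<le> rw u" "fw u x = x" using power[of "Suc n0"] unfolding m_def by blast
  have u_touch: "fw u q = x" if "q \<in> V 0" "fw u q \<in> V 0" for q
  proof (rule ccontr)
    assume "fw u q \<noteq> x"
    then have "\<delta> \<le> dist (fw u q) (fw u x)" using \<delta>_le[OF that(2)] u(3) by simp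
    moreover have "dist (fw u q) (fw u x) < \<delta>" using n0[OF m(1) u(1)] that(1) V0_subset_K xK by blast
    ultimately show False by simp
  qed
  have u_unique: "v = u" if "v \<in> W m" "q \<in> V 0" "fw v q = x" for v q
    using fixed_vertex_unique_cell[OF u(1) m(2) xK u(3) that(1)] that V0_subset_K by blast
  define \<psi> :: "'a \<Rightarrow> real" where "\<psi> = indicator (fw u ` V 0)"
  define g where "g v = near_harmonic 1 (\<psi> \<circ> fw v)" for v
  have g: "g v q = \<psi> (fw v q)" if "q \<in> V 0" for v q
    unfolding g_def using near_harmonic_vertex[OF zero_less_one that] by simp
  have gE: "energy_le (g v) (2 * E (\<psi> \<circ> fw v))" for v
    unfolding g_def using near_harmonic_energy[of 1 "\<psi> \<circ> fw v"] by simp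
  define c where "c = (\<Sum>v\<in>W m - {u}. inverse (rw v) * (2 * E (\<psi> \<circ> fw v)))"
  have c: "0 \<le> c" unfolding c_def using rw_pos E_nonneg
    by (intro sum_nonneg mult_nonneg_nonneg) (auto intro: less_imp_le)
  \<comment> \<open>One rung: inside the cell of u the previous function is repeated and raised by
    1, outside a fixed function descends from 1 at the corners of that cell to 0 at all other
    vertices of level m. As the weight of u is at least 1, the copy costs no more than its original,
    and c pays for the outside.\<close>
  have ladder: "\<exists>a. a x = real M \<and> (\<forall>q\<in>V 0 - {x}. a q = 0) \<and> energy_le a (real M * c)" for M
  proof (induction M)
    case 0
    show ?case by (intro exI[of _ "\<lambda>_. 0"]) (simp add: energy_le_const)
  next
    case (Suc M)
    then obtain a where a: "a x = real M" "\<And>q. q \<in> V 0 \<Longrightarrow> q \<noteq> x \<Longrightarrow> a q = 0" "energy_le a (real M * c)" by blast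
    define a' where "a' = (\<lambda>v. if v = u then (\<lambda>y. 1 * a y + 1) else g v)"
    define b where "b = (\<lambda>z. if z = x then real (Suc M) else \<psi> z)"
    have b: "a' v q = b (fw v q)" if "v \<in> W m" "q \<in> V 0" for v q
    proof (cases "v = u")
      case True
      show ?thesis
      proof (cases "q = x")
        case True
        then show ?thesis using \<open>v = u\<close> u a by (simp add: a'_def b_def)
      next
        case False
        then have "fw u q \<noteq> x" using u inj_fw[OF set_words[OF u(1)]] by (metis injD)
        then show ?thesis using \<open>v = u\<close> a(2)[OF that(2) False] that(2) by (simp add: a'_def b_def \<psi>_def)
      qed
    next
      case False
      then have "fw v q \<noteq> x" using u_unique that by blast
      then show ?thesis using False that g by (simp add: a'_def b_def)
    qed
    have "energy_le (glue m a') (\<Sum>v\<in>W m. inverse (rw v) * (if v = u then real M * c else 2 * E (\<psi> \<circ> fw v)))"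
      using energy_le_affine[OF a(3), of 1 1] gE
      by (intro energy_le_glue[where b = b] b) (auto simp: a'_def)
    moreover have "(\<Sum>v\<in>W m. inverse (rw v) * (if v = u then real M * c else 2 * E (\<psi> \<circ> fw v)))
        = inverse (rw u) * (real M * c) + c"
      unfolding c_def using u(1) by (subst sum.remove[of _ u]) auto
    moreover have "inverse (rw u) * (real M * c) \<le> 1 * (real M * c)"
      using u(2) c by (intro mult_right_mono) (auto simp: inverse_le_1_iff)
    ultimately have "energy_le (glue m a') (real (Suc M) * c)"
      by (elim energy_le_mono) (simp add: distrib_right)
    moreover have "glue m a' x = real (Suc M)"
      using glue_cell[where b = b and g = a', OF b u(1) xK] u(3) a(1) by (simp add: a'_def)
    moreover have "glue m a' q = 0" if "q \<in> V 0" "q \<noteq> x" for q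
    proof -
      have "q \<in> V m" using that(1) V_mono[of 0 m] by blast
      then have "glue m a' q = b q" by (intro glue_vertex[where b = b] b)
      moreover have "q \<notin> fw u ` V 0" using u_touch that by blast
      ultimately show ?thesis using that by (simp add: b_def \<psi>_def)
    qed
    ultimately show ?case by blast
  qed
  define e where "e = E (indicator {x})"
  obtain y where "y \<in> V 0" "y \<noteq> x" using V0_other[OF x(1)] by blast
  then have "\<not> constant_on_set (V 0) (indicator {x} :: 'a \<Rightarrow> real)"
    using x(1) unfolding constant_on_set_def by (metis indicator_simps(1,2) singletonD singletonI zero_neq_one)
  then have e: "0 < e" unfolding e_def using energies_M_eq_0[OF p E_M] E_nonneg by (metis order_le_less)
  have bound: "real M powr p * e \<le> real M * c" if "0 < M" for M
  proof -
    obtain a where a: "a x = real M" "\<And>q. q \<in> V 0 \<Longrightarrow> q \<noteq> x \<Longrightarrow> a q = 0" "energy_le a (real M * c)"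
      using ladder[of M] by blast
    have "E a = E (\<lambda>z. real M * indicator {x} z + 0)"
      by (rule E_cong) (use a in \<open>auto simp: indicator_def\<close>)
    also have "\<dots> = real M powr p * e" by (subst E_affine) (simp add: e_def)
    finally show ?thesis using energy_leD[OF a(3), of 0] by simp
  qed
  \<comment> \<open>Height M is reached with energy at most M c, but any function of that height
    needs M powr p times e; this M makes the second number larger.\<close>
  obtain M :: nat where M: "max 1 ((c / e) powr (1 / (p - 1))) < real M" using reals_Archimedean2 by blast
  then have "((c / e) powr (1 / (p - 1))) powr (p - 1) < real M powr (p - 1)"
    using p by (intro powr_less_mono2) auto
  then have "c / e < real M powr (p - 1)" using p c e by (cases "c = 0") (simp_all add: powr_powr)
  then have "c < real M powr (p - 1) * e" using e by (simp add: field_simps)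
  then have "real M * c < real M * (real M powr (p - 1) * e)" using M by simp
  also have "\<dots> = real M powr p * e" using M by (simp add: powr_diff)
  finally show False using bound[of M] M by simp
qed

text \<open>The points \<open>fw (drop k v) q\<close> all lie in V_0. Among the first card(V_0) + 1
  of them two coincide, which gives a loop word fixing a vertex, and by
  \<open>fixed_vertex_unique_cell\<close> the remainder of v must run through this loop over and
  over. Each round contributes a factor below 1, uniformly over the finitely many loops.\<close>

lemma weights_at_vertices_small:
  assumes "0 < \<eta>"
  obtains n where "1 \<le> n" "\<And>v q. v \<in> W n \<Longrightarrow> q \<in> V 0 \<Longrightarrow> fw v q \<in> V 0 \<Longrightarrow> rw v \<le> \<eta>"
proof -
  define s where "s = card (V 0)"
  have s: "0 < s" unfolding s_def using finite_V V0_nonempty by (simp add: card_gt_0_iff)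
  define Ws where "Ws = (\<Union>k\<in>{..s}. W k)"
  have fin: "finite Ws" by (simp add: Ws_def)
  define B where "B = Max (insert 1 (rw ` Ws))"
  have B1: "1 \<le> B" unfolding B_def using fin by (intro Max_ge) auto
  have B: "rw v \<le> B" if "v \<in> W k" "k \<le> s" for v k
    unfolding B_def using fin that by (intro Max_ge) (auto simp: Ws_def)
  define T where "T = {w \<in> Ws. w \<noteq> [] \<and> (\<exists>x\<in>V 0. fw w x = x)}"
  \<comment> \<open>The entry 1/2 keeps the maximum defined and positive even if T is empty.\<close>
  define \<theta> where "\<theta> = Max (insert (1/2) (rw ` T))"
  have finT: "finite T" using fin by (simp add: T_def)
  have "rw w < 1" if wT: "w \<in> T" for w
  proof -
    obtain k x where "w \<in> W k" "w \<noteq> []" "x \<in> V 0" "fw w x = x"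
      using wT unfolding T_def Ws_def by blast
    then show ?thesis using weight_at_fixed_vertex_less_1[of w k x] by (cases k) auto
  qed
  then have \<theta>1: "\<theta> < 1" unfolding \<theta>_def using finT by (subst Max_less_iff) auto
  have \<theta>0: "0 < \<theta>"
  proof -
    have "1 / 2 \<le> \<theta>" unfolding \<theta>_def using finT by (intro Max_ge) auto
    then show ?thesis by simp
  qed
  \<comment> \<open>As long as m letters remain, a word whose cell contains the fixed point x must
    begin with the loop w; the rest after all complete rounds weighs at most B.\<close>
  have cycle: "rw t \<le> B * \<theta> ^ (l div m)"
    if w: "w \<in> W m" "1 \<le> m" "m \<le> s" "x \<in> V 0" "fw w x = x" and "t \<in> W l" "y \<in> K" "fw t y = x" for w m x t l y
    using that(6,8)
  proof (induction l arbitrary: t rule: less_induct)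
    case (less l)
    show ?case
    proof (cases "l < m")
      case True
      then show ?thesis using B[OF less.prems(1)] w(3) by simp
    next
      case False
      then obtain t1 t2 where t: "t1 \<in> W m" "t2 \<in> W (l - m)" "t = t1 @ t2"
        using words_append_obtain[of t N m "l - m"] less.prems(1) by auto
      have eq: "fw t1 (fw t2 y) = x" using less.prems(2) t(3) by (simp add: word_map_append)
      have "fw t2 y \<in> K" using fw_in_K[OF set_words[OF t(2)] \<open>y \<in> K\<close>] .
      then have t1: "t1 = w"
        using fixed_vertex_unique_cell[OF w(1,2) _ w(5) t(1) _ eq] w(4) V0_subset_K by blast
      then have "fw t2 y = x" using eq w(5) inj_fw[OF set_words[OF w(1)]] by (metis injD)
      then have IH: "rw t2 \<le> B * \<theta> ^ ((l - m) div m)" using less.IH[OF _ t(2)] w(2) False by simp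
      have "w \<in> T" using w by (auto simp: T_def Ws_def)
      then have "rw w \<le> \<theta>" unfolding \<theta>_def using finT by (intro Max_ge) auto
      then have "rw w * rw t2 \<le> \<theta> * (B * \<theta> ^ ((l - m) div m))"
        using IH \<theta>0 rw_pos[OF t(2)] by (intro mult_mono) auto
      moreover have "l div m = Suc ((l - m) div m)" using False w(2) by (simp add: le_div_geq)
      ultimately show ?thesis using t(3) t1 by (simp add: word_weight_append algebra_simps)
    qed
  qed
  have key: "rw v \<le> B * (B * \<theta> ^ M)" if v: "v \<in> W (s + s * M)" and q: "q \<in> V 0" "fw v q \<in> V 0" for v q M
  proof -
    define x where "x k = fw (drop k v) q" for k
    have split: "take k v \<in> W k \<and> drop k v \<in> W (length v - k)" if "k \<le> length v" for k
      using that v set_take_subset[of k v] set_drop_subset[of k v] by (auto simp: words_def)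
    have lv: "length v = s + s * M" using v by (simp add: words_def)
    have xV: "x k \<in> V 0" if "k \<le> length v" for k
    proof (rule V0_preimage)
      show "take k v \<in> W k" using split that by blast
      show "x k \<in> K" unfolding x_def using split that q V0_subset_K by (blast intro: fw_in_K[OF set_words])
      show "fw (take k v) (x k) \<in> V 0" using q(2) unfolding x_def
        by (metis append_take_drop_id comp_apply word_map_append)
    qed
    have "\<not> inj_on x {..s}"
    proof
      assume "inj_on x {..s}"
      then have "card (x ` {..s}) = Suc s" by (simp add: card_image)
      moreover have "card (x ` {..s}) \<le> card (V 0)" using xV lv by (intro card_mono finite_V) auto
      ultimately show False by (simp add: s_def)
    qed
    then obtain i j where ij: "i < j" "j \<le> s" "x i = x j"
      unfolding inj_on_def by (metis atMost_iff linorder_neqE_nat)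
    define t where "t = drop i v"
    define w where "w = take (j - i) t"
    have t: "t \<in> W (length v - i)" unfolding t_def using split[of i] ij lv by simp
    have lt: "j - i \<le> length t" unfolding t_def using ij lv by simp
    have w: "w \<in> W (j - i)" using t lt set_take_subset[of "j - i" t] by (auto simp: w_def words_def)
    have "t = w @ drop j v" unfolding w_def t_def using ij
      by (metis append_take_drop_id drop_drop le_add_diff_inverse2 less_imp_le)
    then have "x i = fw w (x j)" unfolding x_def t_def by (simp add: word_map_append)
    then have fix_i: "fw w (x i) = x i" using ij(3) by simp
    have "rw t \<le> B * \<theta> ^ ((length v - i) div (j - i))"
      using cycle[OF w _ _ _ fix_i t] ij xV[of i] lv q V0_subset_K by (auto simp: x_def t_def)
    also have "\<theta> ^ ((length v - i) div (j - i)) \<le> \<theta> ^ M"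
    proof (rule power_decreasing)
      have "j - i \<le> s" using ij by simp
      then have "M * (j - i) \<le> s * M" by (metis mult.commute mult_le_mono1)
      also have "\<dots> \<le> length v - i" using ij lv by simp
      finally show "M \<le> (length v - i) div (j - i)" using ij by (simp add: less_eq_div_iff_mult_less_eq)
    qed (use \<theta>0 \<theta>1 in auto)
    finally have rt: "rw t \<le> B * \<theta> ^ M" using B1 by simp
    have "rw v = rw (take i v) * rw t" unfolding t_def by (metis append_take_drop_id word_weight_append)
    also have "\<dots> \<le> B * (B * \<theta> ^ M)"
    proof (rule mult_mono[OF B rt])
      show "take i v \<in> W i" using split[of i] ij lv by simp
    qed (use ij B1 rw_pos[OF t] in auto)
    finally show ?thesis .
  qed
  have "(\<lambda>M. B * (B * \<theta> ^ M)) \<longlonglongrightarrow> B * (B * 0)"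
    using \<theta>0 \<theta>1 by (intro tendsto_intros LIMSEQ_power_zero) auto
  then have "eventually (\<lambda>M. B * (B * \<theta> ^ M) < \<eta>) sequentially"
    using assms by (intro order_tendstoD(2)) auto
  then obtain M where "B * (B * \<theta> ^ M) < \<eta>" by (auto simp: eventually_sequentially)
  show thesis
  proof (rule that)
    show "1 \<le> s + s * M" using s by simp
    show "rw v \<le> \<eta>" if "v \<in> W (s + s * M)" "q \<in> V 0" "fw v q \<in> V 0" for v q
      using key[OF that] \<open>B * (B * \<theta> ^ M) < \<eta>\<close> by simp
  qed
qed

end

section \<open>Contraction of oscillations and continuous extensions\<close>

context pcf_fixed_form
begin

lemma osc_le_near_harmonic:
  assumes "0 < \<epsilon>" "osc_le (V 0) h d"
  shows "osc_le VS (near_harmonic \<epsilon> h) d"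
proof -
  obtain a b where ab: "b - a \<le> d" "\<And>x. x \<in> V 0 \<Longrightarrow> a \<le> h x \<and> h x \<le> b"
    using osc_le_obtain_range[OF finite_V V0_nonempty assms(2)] by metis
  show ?thesis using near_harmonic_range[OF assms(1) ab(2)] by (intro osc_le_range[OF _ ab(1)])
qed

text \<open>Capacity of the set where \<open>f\<close> oscillates: on a cell where \<open>f\<close> varies by more than \<open>1/2\<close>,
  the indicator function of the interior costs at most a multiple of the energy of \<open>f\<close>, and
  cells touching the boundary are harmless because their weights are small. Nesting \<open>M\<close> such
  layers gives \<open>\<eta>\<close>, whose energy grows only linearly in \<open>M\<close>.\<close>

lemma oscillation_cutoff:
  obtains n C where "1 \<le> n" "0 < C"
    "\<And>M \<epsilon> h. 0 < \<epsilon> \<Longrightarrow> (\<forall>q\<in>V 0. 0 \<le> h q \<and> h q \<le> 1) \<Longrightarrow>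
      \<exists>f \<eta>. (\<forall>q\<in>V 0. f q = h q \<and> \<eta> q = 0) \<and>
        (\<forall>x\<in>VS. 0 \<le> f x \<and> f x \<le> 1 \<and> 0 \<le> \<eta> x \<and> \<eta> x \<le> real M) \<and>
        energy_le f ((1 + \<epsilon>) * E h) \<and> energy_le \<eta> (C * real M * (1 + \<epsilon>) * E h) \<and>
        (\<forall>w\<in>W (M * n). osc_le VS (f \<circ> fw w) (1/2) \<and> osc_le VS (\<eta> \<circ> fw w) 1 \<or>
           (\<forall>x\<in>VS. \<eta> (fw w x) = real M))"
proof -
  obtain Cl where Cl: "0 < Cl" "\<And>f x y. x \<in> V 0 \<Longrightarrow> y \<in> V 0 \<Longrightarrow> \<bar>f x - f y\<bar> powr p \<le> Cl * E f"
    using energies_M_lower[OF p E_M finite_V] by metis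
  obtain Cu where Cu: "0 < Cu"
      "\<And>f D. 0 \<le> D \<Longrightarrow> (\<And>x y. x \<in> V 0 \<Longrightarrow> y \<in> V 0 \<Longrightarrow> \<bar>f x - f y\<bar> \<le> D) \<Longrightarrow> E f \<le> Cu * D powr p"
    using energies_M_upper[OF p E_M finite_V] by metis
  define half :: real where "half = (1/2) powr p"
  have half: "0 < half" by (simp add: half_def)
  \<comment> \<open>Meant for the cells touching V_0. Boundary values in [0,1] have energy at most
    Cu, a near-minimal extension at most doubles it, and this weight leaves at most half / Cl of it
    in such a cell, hence an oscillation of at most 1/2.\<close>
  have "0 < half / (2 * Cl * Cu)" using half Cl(1) Cu(1) by simp
  then obtain n where n: "1 \<le> n"
      "\<And>v q. v \<in> W n \<Longrightarrow> q \<in> V 0 \<Longrightarrow> fw v q \<in> V 0 \<Longrightarrow> rw v \<le> half / (2 * Cl * Cu)"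
    using weights_at_vertices_small by metis
  define \<phi> :: "'a \<Rightarrow> real" where "\<phi> x = (if x \<in> V 0 then 0 else 1)" for x
  \<comment> \<open>Pays for one layer. Its transition from 0 to 1 costs at most 2 * Lam n \<phi>,
    and it is built only where h oscillates by more than 1/2, that is, where (Cl / half) * E h is at
    least 1.\<close>
  define C where "C = (2 * Lam n \<phi> + 1) * (Cl / half)"
  have C: "0 < C" unfolding C_def using Lam_nonneg[of n \<phi>] Cl(1) half by simp
  have main: "\<exists>f \<eta>. (\<forall>q\<in>V 0. f q = h q \<and> \<eta> q = 0) \<and>
        (\<forall>x\<in>VS. 0 \<le> f x \<and> f x \<le> 1 \<and> 0 \<le> \<eta> x \<and> \<eta> x \<le> real M) \<and>
        energy_le f ((1 + \<epsilon>) * E h) \<and> energy_le \<eta> (C * real M * (1 + \<epsilon>) * E h) \<and>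
        (\<forall>w\<in>W (M * n). osc_le VS (f \<circ> fw w) (1/2) \<and> osc_le VS (\<eta> \<circ> fw w) 1 \<or>
           (\<forall>x\<in>VS. \<eta> (fw w x) = real M))"
    if "0 < \<epsilon>" "\<forall>q\<in>V 0. 0 \<le> h q \<and> h q \<le> 1" for M \<epsilon> h
    using that
  proof (induction M arbitrary: \<epsilon> h)
    case 0
    show ?case
      using near_harmonic_vertex[OF 0(1), of _ h] near_harmonic_range[OF 0(1), of 0 h 1]
        near_harmonic_energy[OF 0(1), of h] 0(2)
      by - (rule exI[of _ "near_harmonic \<epsilon> h"], rule exI[of _ "\<lambda>_. 0"], auto simp: energy_le_const)
  next
    case (Suc M)
    have h01: "\<And>q. q \<in> V 0 \<Longrightarrow> 0 \<le> h q \<and> h q \<le> 1" using Suc.prems(2) by blast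
    show ?case
    proof (cases "osc_le (V 0) h (1/2)")
      case True
      have "osc_le VS (near_harmonic \<epsilon> h \<circ> fw w) (1/2) \<and> osc_le VS ((\<lambda>_. 0) \<circ> fw w) 1"
        if "w \<in> W (Suc M * n)" for w
        using osc_le_near_harmonic[OF Suc.prems(1) True] fw_in_VS[OF that] by (simp add: osc_le_def)
      then show ?thesis
        using near_harmonic_vertex[OF Suc.prems(1), of _ h] near_harmonic_range[OF Suc.prems(1), of 0 h 1]
          near_harmonic_energy[OF Suc.prems(1), of h] h01 C E_nonneg[of h] Suc.prems(1)
        by - (rule exI[of _ "near_harmonic \<epsilon> h"], rule exI[of _ "\<lambda>_. 0"], auto simp: o_def intro!: energy_le_const)
    next
      case False
      then obtain x y where xy: "x \<in> V 0" "y \<in> V 0" "1/2 < \<bar>h x - h y\<bar>"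
        unfolding osc_le_def by (auto simp: not_le)
      have "half \<le> \<bar>h x - h y\<bar> powr p" unfolding half_def using xy p by (intro powr_mono2) auto
      also have "\<dots> \<le> Cl * E h" by (rule Cl(2)[OF xy(1,2)])
      finally have E_large: "1 \<le> (Cl / half) * E h" using half by (simp add: field_simps)
      \<comment> \<open>Each layer extends twice, from V_0 to V_n and then inside the cells; the
        product of both error factors has to stay below 1 + \<epsilon>.\<close>
      define \<delta> where "\<delta> = min 1 (\<epsilon> / 3)"
      have \<delta>: "0 < \<delta>" "\<delta> \<le> 1" "(1 + \<delta>) * (1 + \<delta>) \<le> 1 + \<epsilon>"
      proof -
        show d: "0 < \<delta>" "\<delta> \<le> 1" using Suc.prems(1) by (auto simp: \<delta>_def)
        have "\<delta> * \<delta> \<le> \<delta> * 1" using d by (intro mult_left_mono) auto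
        moreover have "3 * \<delta> \<le> \<epsilon>" by (simp add: \<delta>_def)
        ultimately show "(1 + \<delta>) * (1 + \<delta>) \<le> 1 + \<epsilon>" by (simp add: algebra_simps)
      qed
      define G where "G = near_harmonic \<delta> h"
      have G0: "G q = h q" if "q \<in> V 0" for q unfolding G_def by (rule near_harmonic_vertex[OF \<delta>(1) that])
      have G01: "0 \<le> G x \<and> G x \<le> 1" if "x \<in> VS" for x
        unfolding G_def by (rule near_harmonic_range[OF \<delta>(1) h01 that])
      have GE: "energy_le G ((1 + \<delta>) * E h)" unfolding G_def by (rule near_harmonic_energy[OF \<delta>(1)])
      \<comment> \<open>In cells touching V_0 the cutoff returns to 0, so it stays between 0 and 1
        there and no recursion takes place. In all other cells the induction hypothesis supplies a
        cutoff of height M, which is raised by 1.\<close>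
      define T where "T = {v \<in> W n. \<exists>q\<in>V 0. fw v q \<in> V 0}"
      have GV: "0 \<le> (G \<circ> fw v) q \<and> (G \<circ> fw v) q \<le> 1" if "v \<in> W n" "q \<in> V 0" for v q
        using G01[of "fw v q"] fw_in_VS[OF that(1), of q] V_subset_VS that(2) by auto
      have touch: "osc_le (V 0) (G \<circ> fw v) (1/2)" if "v \<in> T" for v
        unfolding osc_le_def
      proof (intro ballI)
        fix x y assume xy: "x \<in> V 0" "y \<in> V 0"
        have v: "v \<in> W n" "rw v \<le> half / (2 * Cl * Cu)" using that n(2) by (auto simp: T_def)
        have "E h \<le> Cu * 1 powr p"
        proof (rule Cu(2))
          fix x y assume "x \<in> V 0" "y \<in> V 0"
          then show "\<bar>h x - h y\<bar> \<le> 1" using h01[of x] h01[of y] by linarith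
        qed simp
        then have Eh: "E h \<le> Cu" by simp
        have "\<bar>(G \<circ> fw v) x - (G \<circ> fw v) y\<bar> powr p \<le> Cl * E (G \<circ> fw v)" by (rule Cl(2)[OF xy])
        also have "\<dots> \<le> Cl * (rw v * ((1 + \<delta>) * E h))"
          using energy_leD[OF energy_le_cell[OF GE v(1)], of 0] Cl(1) by simp
        also have "\<dots> \<le> Cl * (half / (2 * Cl * Cu) * (2 * Cu))"
          using Cl(1) Cu(1) v rw_pos[OF v(1)] \<delta> Eh E_nonneg[of h] half
          by (intro mult_left_mono mult_mono) auto
        also have "\<dots> = half" using Cl(1) Cu(1) by simp
        finally have "\<bar>(G \<circ> fw v) x - (G \<circ> fw v) y\<bar> powr p \<le> (1/2) powr p" by (simp add: half_def)
        then show "\<bar>(G \<circ> fw v) x - (G \<circ> fw v) y\<bar> \<le> 1/2"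
          using p powr_less_mono2[of p "1/2" "\<bar>(G \<circ> fw v) x - (G \<circ> fw v) y\<bar>"] by force
      qed
      have "\<forall>v\<in>W n - T. \<exists>a. (\<forall>q\<in>V 0. fst a q = (G \<circ> fw v) q \<and> snd a q = 0) \<and>
        (\<forall>x\<in>VS. 0 \<le> fst a x \<and> fst a x \<le> 1 \<and> 0 \<le> snd a x \<and> snd a x \<le> real M) \<and>
        energy_le (fst a) ((1 + \<delta>) * E (G \<circ> fw v)) \<and>
        energy_le (snd a) (C * real M * (1 + \<delta>) * E (G \<circ> fw v)) \<and>
        (\<forall>w\<in>W (M * n). osc_le VS (fst a \<circ> fw w) (1/2) \<and> osc_le VS (snd a \<circ> fw w) 1 \<or>
           (\<forall>x\<in>VS. snd a (fw w x) = real M))"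
        using Suc.IH[OF \<delta>(1)] GV by (auto simp del: o_apply) 
      from bchoice[OF this] obtain a where a: "\<And>v. v \<in> W n - T \<Longrightarrow>
        (\<forall>q\<in>V 0. fst (a v) q = (G \<circ> fw v) q \<and> snd (a v) q = 0) \<and>
        (\<forall>x\<in>VS. 0 \<le> fst (a v) x \<and> fst (a v) x \<le> 1 \<and> 0 \<le> snd (a v) x \<and> snd (a v) x \<le> real M) \<and>
        energy_le (fst (a v)) ((1 + \<delta>) * E (G \<circ> fw v)) \<and>
        energy_le (snd (a v)) (C * real M * (1 + \<delta>) * E (G \<circ> fw v)) \<and>
        (\<forall>w\<in>W (M * n). osc_le VS (fst (a v) \<circ> fw w) (1/2) \<and> osc_le VS (snd (a v) \<circ> fw w) 1 \<or>
           (\<forall>x\<in>VS. snd (a v) (fw w x) = real M))"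
        by blast
      define fv where "fv v = (if v \<in> T then near_harmonic \<delta> (G \<circ> fw v) else fst (a v))" for v
      define \<eta>v where "\<eta>v v = (if v \<in> T then near_harmonic 1 (\<phi> \<circ> fw v) else (\<lambda>x. 1 * snd (a v) x + 1))" for v
      have fv0: "fv v q = G (fw v q)" if "v \<in> W n" "q \<in> V 0" for v q
        using that a[of v] near_harmonic_vertex[OF \<delta>(1) that(2), of "G \<circ> fw v"] by (simp add: fv_def)
      have \<eta>v0: "\<eta>v v q = \<phi> (fw v q)" if "v \<in> W n" "q \<in> V 0" for v q
      proof (cases "v \<in> T")
        case True
        then show ?thesis using near_harmonic_vertex[OF zero_less_one that(2), of "\<phi> \<circ> fw v"] by (simp add: \<eta>v_def)
      next
        case False
        then have "fw v q \<notin> V 0" using that by (auto simp: T_def)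
        then show ?thesis using a[of v] False that by (simp add: \<eta>v_def \<phi>_def)
      qed
      have fv1: "0 \<le> fv v x \<and> fv v x \<le> 1" if "v \<in> W n" "x \<in> VS" for v x
        using that a[of v] near_harmonic_range[OF \<delta>(1), of 0 "G \<circ> fw v" 1 x] GV[OF that(1)]
        by (auto simp: fv_def simp del: o_apply)
      have \<eta>vT: "0 \<le> \<eta>v v x \<and> \<eta>v v x \<le> 1" if "v \<in> T" "x \<in> VS" for v x
        using that near_harmonic_range[OF zero_less_one, of 0 "\<phi> \<circ> fw v" 1 x]
        by (auto simp: \<eta>v_def \<phi>_def)
      have \<eta>v1: "0 \<le> \<eta>v v x \<and> \<eta>v v x \<le> real (Suc M)" if "v \<in> W n" "x \<in> VS" for v x
      proof (cases "v \<in> T")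
        case True
        then show ?thesis using \<eta>vT[OF True that(2)] by linarith
      next
        case False
        then show ?thesis using a[of v] that by (auto simp: \<eta>v_def)
      qed
      have fvE: "energy_le (fv v) ((1 + \<delta>) * E (G \<circ> fw v))" if "v \<in> W n" for v
        using that a[of v] near_harmonic_energy[OF \<delta>(1), of "G \<circ> fw v"] by (simp add: fv_def)
      have \<eta>vE: "energy_le (\<eta>v v) (2 * E (\<phi> \<circ> fw v) + C * real M * (1 + \<delta>) * E (G \<circ> fw v))" if "v \<in> W n" for v
      proof (cases "v \<in> T")
        case True
        have "energy_le (\<eta>v v) (2 * E (\<phi> \<circ> fw v))"
          using near_harmonic_energy[OF zero_less_one, of "\<phi> \<circ> fw v"] True by (simp add: \<eta>v_def)
        then show ?thesis using C \<delta> E_nonneg by (elim energy_le_mono) simp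
      next
        case False
        then have "energy_le (snd (a v)) (C * real M * (1 + \<delta>) * E (G \<circ> fw v))" using a[of v] that by blast
        from energy_le_affine[OF this, of 1 1] show ?thesis
          using False E_nonneg[of "\<phi> \<circ> fw v"] by (auto simp: \<eta>v_def elim!: energy_le_mono)
      qed
      define f where "f = glue n fv"
      define \<eta> where "\<eta> = glue n \<eta>v"
      have f_cell: "f (fw v y) = fv v y" if "v \<in> W n" "y \<in> VS" for v y
        unfolding f_def using that VS_subset_K by (intro glue_cell[where b = G] fv0) auto
      have \<eta>_cell: "\<eta> (fw v y) = \<eta>v v y" if "v \<in> W n" "y \<in> VS" for v y
        unfolding \<eta>_def using that VS_subset_K by (intro glue_cell[where b = \<phi>] \<eta>v0) auto
      have vertex: "f q = h q \<and> \<eta> q = 0" if "q \<in> V 0" for q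
      proof -
        have q: "q \<in> V n" using that V_mono[of 0 n] by blast
        have "f q = G q" unfolding f_def using q by (intro glue_vertex[where b = G] fv0)
        moreover have "\<eta> q = \<phi> q" unfolding \<eta>_def using q by (intro glue_vertex[where b = \<phi>] \<eta>v0)
        ultimately show ?thesis using G0 that by (simp add: \<phi>_def)
      qed
      have range: "0 \<le> f x \<and> f x \<le> 1 \<and> 0 \<le> \<eta> x \<and> \<eta> x \<le> real (Suc M)" if x: "x \<in> VS" for x
      proof -
        obtain v y where "v \<in> W n" "y \<in> VS" "x = fw v y" using VS_obtain[OF x] .
        then show ?thesis using f_cell \<eta>_cell fv1 \<eta>v1 by simp
      qed
      have LG: "Lam n G \<le> (1 + \<delta>) * E h" by (rule energy_leD[OF GE])
      have fE: "energy_le f ((1 + \<epsilon>) * E h)"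
      proof (rule energy_le_mono)
        show "energy_le f (\<Sum>v\<in>W n. inverse (rw v) * ((1 + \<delta>) * E (G \<circ> fw v)))"
          unfolding f_def by (intro energy_le_glue[where b = G] fv0 fvE)
        have "(\<Sum>v\<in>W n. inverse (rw v) * ((1 + \<delta>) * E (G \<circ> fw v))) = (1 + \<delta>) * Lam n G"
          by (simp add: Lam_def sum_distrib_left mult.left_commute)
        also have "\<dots> \<le> (1 + \<delta>) * ((1 + \<delta>) * E h)" using LG \<delta>(1) by (intro mult_left_mono) auto
        also have "\<dots> = ((1 + \<delta>) * (1 + \<delta>)) * E h" by simp
        also have "\<dots> \<le> (1 + \<epsilon>) * E h" using \<delta>(3) E_nonneg by (rule mult_right_mono)
        finally show "(\<Sum>v\<in>W n. inverse (rw v) * ((1 + \<delta>) * E (G \<circ> fw v))) \<le> (1 + \<epsilon>) * E h" .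
      qed
      have \<eta>E: "energy_le \<eta> (C * real (Suc M) * (1 + \<epsilon>) * E h)"
      proof (rule energy_le_mono)
        show "energy_le \<eta> (\<Sum>v\<in>W n. inverse (rw v) * (2 * E (\<phi> \<circ> fw v) + C * real M * (1 + \<delta>) * E (G \<circ> fw v)))"
          unfolding \<eta>_def by (intro energy_le_glue[where b = \<phi>] \<eta>v0 \<eta>vE)
        have "(\<Sum>v\<in>W n. inverse (rw v) * (2 * E (\<phi> \<circ> fw v) + C * real M * (1 + \<delta>) * E (G \<circ> fw v)))
            = 2 * Lam n \<phi> + C * real M * (1 + \<delta>) * Lam n G"
          by (simp add: Lam_def sum_distrib_left mult.left_commute distrib_left sum.distrib)
        also have "2 * Lam n \<phi> \<le> C * E h"
        proof -
          have "2 * Lam n \<phi> \<le> (2 * Lam n \<phi> + 1) * 1" by simp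
          also have "\<dots> \<le> (2 * Lam n \<phi> + 1) * ((Cl / half) * E h)"
            using E_large Lam_nonneg[of n \<phi>] by (intro mult_left_mono) auto
          finally show ?thesis by (simp add: C_def)
        qed
        also have "C * real M * (1 + \<delta>) * Lam n G \<le> C * real M * (1 + \<delta>) * ((1 + \<delta>) * E h)"
          using LG C \<delta>(1) by (intro mult_left_mono) auto
        also have "\<dots> = C * real M * E h * ((1 + \<delta>) * (1 + \<delta>))" by simp
        also have "\<dots> \<le> C * real M * E h * (1 + \<epsilon>)" using \<delta>(3) C E_nonneg by (intro mult_left_mono) auto
        also have "C * E h + C * real M * E h * (1 + \<epsilon>) \<le> C * real (Suc M) * (1 + \<epsilon>) * E h"
          using C E_nonneg[of h] Suc.prems(1) by (simp add: algebra_simps)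
        finally show "(\<Sum>v\<in>W n. inverse (rw v) * (2 * E (\<phi> \<circ> fw v) + C * real M * (1 + \<delta>) * E (G \<circ> fw v)))
          \<le> C * real (Suc M) * (1 + \<epsilon>) * E h" by (simp add: o_def)
      qed
      have cells: "osc_le VS (f \<circ> fw w) (1/2) \<and> osc_le VS (\<eta> \<circ> fw w) 1 \<or>
           (\<forall>x\<in>VS. \<eta> (fw w x) = real (Suc M))" if w: "w \<in> W (Suc M * n)" for w
      proof -
        obtain v u where vu: "v \<in> W n" "u \<in> W (M * n)" "w = v @ u"
          using words_append_obtain[of w N n "M * n"] w by auto
        have fwu: "f (fw w x) = fv v (fw u x)" "\<eta> (fw w x) = \<eta>v v (fw u x)" if "x \<in> VS" for x
          using f_cell[OF vu(1)] \<eta>_cell[OF vu(1)] fw_in_VS[OF vu(2) that] vu(3) by (simp_all add: word_map_append)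
        have VSu: "fw u x \<in> VS" if "x \<in> VS" for x using fw_in_VS[OF vu(2) that] .
        show ?thesis
        proof (cases "v \<in> T")
          case True
          have "osc_le VS (fv v) (1/2)"
            using osc_le_near_harmonic[OF \<delta>(1) touch[OF True]] True by (simp add: fv_def)
          moreover have "osc_le VS (\<eta>v v) 1" using \<eta>vT[OF True] by (intro osc_le_range[of _ 0 _ 1]) auto
          ultimately show ?thesis using fwu VSu by (simp add: osc_le_def)
        next
          case False
          then have "osc_le VS (fst (a v) \<circ> fw u) (1/2) \<and> osc_le VS (snd (a v) \<circ> fw u) 1 \<or>
           (\<forall>x\<in>VS. snd (a v) (fw u x) = real M)" using a[of v] vu by blast
          then show ?thesis using fwu False by (simp add: osc_le_def fv_def \<eta>v_def)
        qed
      qed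
      show ?thesis using vertex range fE \<eta>E cells by - (rule exI[of _ f], rule exI[of _ \<eta>], blast)
    qed
  qed
  show thesis using n(1) C main by (rule that)
qed

text \<open>After scaling the boundary values to [0,1], each cell either has \<eta> = M, where the
  damped function is constant on the vertices, or f oscillates by at most 1/2 and \<zeta> = 1 -
  \<eta>/M by at most 1/M, which is below 1/2. For \<zeta> (f - 1/2) this gives 1/2 + 1/2 * 1/2 =
  3/4.\<close>

lemma extension_step_contracting: "extension_step (3/4)"
  unfolding extension_step_def
proof (intro allI impI)
  fix \<epsilon> :: real assume \<epsilon>: "0 < \<epsilon>"
  obtain n C where n: "1 \<le> n" and C: "0 < C" and cutoff:
    "\<And>M \<epsilon> h. 0 < \<epsilon> \<Longrightarrow> (\<forall>q\<in>V 0. 0 \<le> h q \<and> h q \<le> 1) \<Longrightarrow>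
      \<exists>f \<eta>. (\<forall>q\<in>V 0. f q = h q \<and> \<eta> q = 0) \<and>
        (\<forall>x\<in>VS. 0 \<le> f x \<and> f x \<le> 1 \<and> 0 \<le> \<eta> x \<and> \<eta> x \<le> real M) \<and>
        energy_le f ((1 + \<epsilon>) * E h) \<and> energy_le \<eta> (C * real M * (1 + \<epsilon>) * E h) \<and>
        (\<forall>w\<in>W (M * n). osc_le VS (f \<circ> fw w) (1/2) \<and> osc_le VS (\<eta> \<circ> fw w) 1 \<or>
           (\<forall>x\<in>VS. \<eta> (fw w x) = real M))"
    by (rule oscillation_cutoff) blast
  define \<delta> where "\<delta> = min 1 (\<epsilon> / 6)"
  have \<delta>: "0 < \<delta>" "\<delta> \<le> 1" "(1 + \<delta>) * (1 + \<delta>) \<le> 1 + \<epsilon> / 2"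
  proof -
    show d: "0 < \<delta>" "\<delta> \<le> 1" using \<epsilon> by (auto simp: \<delta>_def)
    have "\<delta> * \<delta> \<le> \<delta> * 1" using d by (intro mult_left_mono) auto
    moreover have "6 * \<delta> \<le> \<epsilon>" by (simp add: \<delta>_def)
    ultimately show "(1 + \<delta>) * (1 + \<delta>) \<le> 1 + \<epsilon> / 2" by (simp add: algebra_simps)
  qed
  \<comment> \<open>Solves t powr (1 - p) = 1 + \<delta>: the Leibniz rule then hardly increases the
    energy of f, and its large second constant is left to M.\<close>
  define t where "t = (1 + \<delta>) powr (1 / (1 - p))"
  have t: "0 < t" "t < 1" "t powr (1 - p) = 1 + \<delta>"
    unfolding t_def using \<delta> p by (auto simp: powr_powr powr_less_one)
  define B where "B = (1 - t) powr (1 - p) * C * (1 + \<delta>)"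
  have B: "0 < B" unfolding B_def using t C \<delta> by simp
  \<comment> \<open>The energy of \<eta> is at most linear in M and that of \<eta>/M smaller by the
    factor M powr (- p); the product M powr (1 - p) becomes small since p > 1. The bound 2 serves
    the oscillation estimate.\<close>
  obtain M :: nat where M: "max 2 ((2 * B / \<epsilon>) powr (1 / (p - 1))) < real M" using reals_Archimedean2 by blast
  then have "((2 * B / \<epsilon>) powr (1 / (p - 1))) powr (p - 1) < real M powr (p - 1)"
    using p by (intro powr_less_mono2) auto
  then have "2 * B / \<epsilon> < real M powr (p - 1)" using p B \<epsilon> by (simp add: powr_powr)
  then have "2 * B < \<epsilon> * real M powr (p - 1)" using \<epsilon> by (simp add: field_simps)
  then have "2 * B * real M powr (1 - p) \<le> \<epsilon> * real M powr (p - 1) * real M powr (1 - p)"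
    by (intro mult_right_mono) auto
  also have "\<dots> = \<epsilon>" using M by (simp add: mult.assoc flip: powr_add)
  finally have BM: "B * real M powr (1 - p) \<le> \<epsilon> / 2" by simp
  have M2: "2 < real M" using M by simp
  show "\<exists>m\<ge>1. \<forall>h. \<exists>f. (\<forall>q\<in>V 0. f q = h q) \<and>
     (\<forall>a b. (\<forall>q\<in>V 0. a \<le> h q \<and> h q \<le> b) \<longrightarrow> (\<forall>x\<in>V m. a \<le> f x \<and> f x \<le> b)) \<and>
     (\<forall>w\<in>W m. \<forall>d. osc_le (V 0) h d \<longrightarrow> osc_le (V 0) (f \<circ> fw w) (3/4 * d)) \<and>
     Lam m f \<le> (1 + \<epsilon>) * E h"
  proof (intro exI[of _ "M * n"] conjI allI)
    have "1 * 1 \<le> M * n" using M2 n by (intro mult_le_mono) auto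
    then show "1 \<le> M * n" by simp
    fix h :: "'a \<Rightarrow> real"
    define lo hi where "lo = Min (h ` V 0)" and "hi = Max (h ` V 0)"
    have lohi: "lo \<in> h ` V 0" "hi \<in> h ` V 0" "\<And>q. q \<in> V 0 \<Longrightarrow> lo \<le> h q \<and> h q \<le> hi"
      unfolding lo_def hi_def using finite_V V0_nonempty by (auto intro!: Min_in Max_in)
    have ab: "a \<le> lo \<and> hi \<le> b" if "\<forall>q\<in>V 0. a \<le> h q \<and> h q \<le> b" for a b using that lohi(1,2) by auto
    have D_le: "hi - lo \<le> d" if "osc_le (V 0) h d" for d
      using lohi(1,2) that unfolding osc_le_def by (force simp: abs_le_iff)
    show "\<exists>f. (\<forall>q\<in>V 0. f q = h q) \<and>
     (\<forall>a b. (\<forall>q\<in>V 0. a \<le> h q \<and> h q \<le> b) \<longrightarrow> (\<forall>x\<in>V (M * n). a \<le> f x \<and> f x \<le> b)) \<and>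
     (\<forall>w\<in>W (M * n). \<forall>d. osc_le (V 0) h d \<longrightarrow> osc_le (V 0) (f \<circ> fw w) (3/4 * d)) \<and>
     Lam (M * n) f \<le> (1 + \<epsilon>) * E h"
    proof (cases "lo = hi")
      case True
      then have "h q = lo" if "q \<in> V 0" for q using lohi(3)[OF that] by simp
      moreover have "0 \<le> d" if "osc_le (V 0) h d" for d using D_le[OF that] True by simp
      ultimately show ?thesis using lohi(1) E_nonneg[of h] \<epsilon>
        by (intro exI[of _ "\<lambda>_. lo"]) (auto simp: Lam_const osc_le_def)
    next
      case False
      define D where "D = hi - lo"
      obtain q where "q \<in> V 0" using V0_nonempty by blast
      then have D: "0 < D" using False lohi(3)[of q] by (simp add: D_def)
      define h' where "h' = (\<lambda>x. (1 / D) * h x + (- lo / D))"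
      have h': "h' x = (h x - lo) / D" for x by (simp add: h'_def diff_divide_distrib)
      have h'01: "\<forall>q\<in>V 0. 0 \<le> h' q \<and> h' q \<le> 1"
        using lohi(3) D unfolding h' by (auto simp: D_def field_simps)
      have Eh': "D powr p * E h' = E h"
        unfolding h'_def E_affine using D by (simp add: powr_divide)
      obtain f \<eta> where f: "\<And>q. q \<in> V 0 \<Longrightarrow> f q = h' q \<and> \<eta> q = 0"
        "\<And>x. x \<in> VS \<Longrightarrow> 0 \<le> f x \<and> f x \<le> 1 \<and> 0 \<le> \<eta> x \<and> \<eta> x \<le> real M"
        "energy_le f ((1 + \<delta>) * E h')" "energy_le \<eta> (C * real M * (1 + \<delta>) * E h')"
        "\<And>w. w \<in> W (M * n) \<Longrightarrow> osc_le VS (f \<circ> fw w) (1/2) \<and> osc_le VS (\<eta> \<circ> fw w) 1 \<or>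
           (\<forall>x\<in>VS. \<eta> (fw w x) = real M)"
        using cutoff[OF \<delta>(1) h'01, of M] by blast
      define \<zeta> where "\<zeta> = (\<lambda>x. (- 1 / real M) * \<eta> x + 1)"
      define g where "g = (\<lambda>x. \<zeta> x * (1 * f x + (- 1/2)))"
      have \<zeta>: "0 \<le> \<zeta> x \<and> \<zeta> x \<le> 1" if "x \<in> VS" for x
        using f(2)[OF that] M2 by (auto simp: \<zeta>_def field_simps)
      have g_abs: "\<bar>g x\<bar> \<le> 1/2" if "x \<in> VS" for x
      proof -
        have "\<bar>1 * f x + (- 1/2)\<bar> \<le> 1/2" using f(2)[OF that] by linarith
        then have "\<bar>\<zeta> x\<bar> * \<bar>1 * f x + (- 1/2)\<bar> \<le> 1 * (1/2)"
          using \<zeta>[OF that] by (intro mult_mono) auto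
        then show ?thesis by (simp add: g_def abs_mult)
      qed
      \<comment> \<open>Undoes the normalization; D / 2 + lo is the midpoint of the range of h,
        towards which the function has been damped.\<close>
      define F where "F = (\<lambda>x. D * g x + (D / 2 + lo))"
      have F0: "F q = h q" if "q \<in> V 0" for q
      proof -
        have "D * f q = h q - lo" using f(1)[OF that] D by (simp add: h')
        moreover have "F q = D * f q + lo" using f(1)[OF that] by (simp add: F_def g_def \<zeta>_def algebra_simps)
        ultimately show ?thesis by simp
      qed
      have F_range: "lo \<le> F x \<and> F x \<le> hi" if "x \<in> VS" for x
      proof -
        have "D * \<bar>g x\<bar> \<le> D * (1/2)" using D g_abs[OF that] by (intro mult_left_mono) auto
        then have "\<bar>D * g x\<bar> \<le> D / 2" using D by (simp add: abs_mult)
        moreover have "hi = D + lo" by (simp add: D_def)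
        ultimately show ?thesis unfolding F_def by linarith
      qed
      have g_osc: "\<bar>g (fw w x) - g (fw w y)\<bar> \<le> 3/4"
        if w: "w \<in> W (M * n)" and xy: "x \<in> V 0" "y \<in> V 0" for w x y
      proof -
        have VS: "x \<in> VS" "y \<in> VS" "fw w x \<in> VS" "fw w y \<in> VS" using xy V_subset_VS fw_in_VS[OF w] by auto
        show ?thesis
        proof (cases "\<forall>x\<in>VS. \<eta> (fw w x) = real M")
          case True
          then have "\<zeta> (fw w x) = 0" "\<zeta> (fw w y) = 0" using VS M2 by (simp_all add: \<zeta>_def)
          then show ?thesis by (simp add: g_def)
        next
          case False
          then have o: "\<bar>f (fw w x) - f (fw w y)\<bar> \<le> 1/2" "\<bar>\<eta> (fw w x) - \<eta> (fw w y)\<bar> \<le> 1"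
            using f(5)[OF w] VS unfolding osc_le_def by auto
          have "\<zeta> (fw w x) - \<zeta> (fw w y) = - ((\<eta> (fw w x) - \<eta> (fw w y)) / real M)"
            by (simp add: \<zeta>_def diff_divide_distrib)
          then have "\<bar>\<zeta> (fw w x) - \<zeta> (fw w y)\<bar> = \<bar>\<eta> (fw w x) - \<eta> (fw w y)\<bar> / real M"
            by (simp only: abs_minus_cancel abs_divide abs_of_nat)
          also have "\<dots> \<le> 1 / 2" using o(2) M2 by (simp add: field_simps)
          finally have o': "\<bar>\<zeta> (fw w x) - \<zeta> (fw w y)\<bar> \<le> 1/2" .
          have eq: "g (fw w x) - g (fw w y) = \<zeta> (fw w x) * (f (fw w x) - f (fw w y))
              + (f (fw w y) - 1/2) * (\<zeta> (fw w x) - \<zeta> (fw w y))"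
            by (simp add: g_def algebra_simps)
          have "\<bar>\<zeta> (fw w x)\<bar> * \<bar>f (fw w x) - f (fw w y)\<bar> \<le> 1 * (1/2)"
            using \<zeta>[OF VS(3)] o by (intro mult_mono) auto
          moreover have "\<bar>f (fw w y) - 1/2\<bar> \<le> 1/2" using f(2)[OF VS(4)] by linarith
          then have "\<bar>f (fw w y) - 1/2\<bar> * \<bar>\<zeta> (fw w x) - \<zeta> (fw w y)\<bar> \<le> (1/2) * (1/2)"
            using o' by (intro mult_mono) auto
          ultimately show ?thesis unfolding eq
            using abs_triangle_ineq[of "\<zeta> (fw w x) * (f (fw w x) - f (fw w y))"
              "(f (fw w y) - 1/2) * (\<zeta> (fw w x) - \<zeta> (fw w y))"] by (simp add: abs_mult)
        qed
      qed
      have F_osc: "osc_le (V 0) (F \<circ> fw w) (3/4 * d)" if d: "osc_le (V 0) h d" and w: "w \<in> W (M * n)" for w d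
        unfolding osc_le_def
      proof (intro ballI)
        fix x y assume xy: "x \<in> V 0" "y \<in> V 0"
        have "\<bar>(F \<circ> fw w) x - (F \<circ> fw w) y\<bar> = D * \<bar>g (fw w x) - g (fw w y)\<bar>"
          using D by (simp add: F_def abs_mult flip: right_diff_distrib)
        also have "\<dots> \<le> d * (3/4)"
          using g_osc[OF w xy] D D_le[OF d] by (intro mult_mono) (auto simp: D_def)
        finally show "\<bar>(F \<circ> fw w) x - (F \<circ> fw w) y\<bar> \<le> 3/4 * d" by simp
      qed
      have "Lam (M * n) g \<le> t powr (1 - p) * Lam (M * n) (\<lambda>x. 1 * f x + (- 1/2)) +
          (1 - t) powr (1 - p) * (1/2) powr p * Lam (M * n) \<zeta>"
        unfolding g_def
      proof (rule Lam_leibniz[OF t(1,2)])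
        fix x assume "x \<in> V (M * n)"
        then have x: "x \<in> VS" using V_subset_VS by blast
        show "0 \<le> \<zeta> x" "\<zeta> x \<le> 1" using \<zeta>[OF x] by auto
        show "\<bar>1 * f x + - 1 / 2\<bar> \<le> 1 / 2" using f(2)[OF x] by linarith
      qed simp
      also have "Lam (M * n) (\<lambda>x. 1 * f x + (- 1/2)) = Lam (M * n) f" by (subst Lam_affine) simp
      also have "Lam (M * n) \<zeta> = real M powr (- p) * Lam (M * n) \<eta>"
        unfolding \<zeta>_def by (subst Lam_affine) (use M2 in \<open>simp add: powr_divide powr_minus field_simps\<close>)
      also have "t powr (1 - p) * Lam (M * n) f + (1 - t) powr (1 - p) * (1/2) powr p * (real M powr (- p) * Lam (M * n) \<eta>)
        \<le> (1 + \<delta>) * ((1 + \<delta>) * E h') + (1 - t) powr (1 - p) * 1 * (real M powr (- p) * (C * real M * (1 + \<delta>) * E h'))"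
        using energy_leD[OF f(3)] energy_leD[OF f(4)] t \<delta> p Lam_nonneg
        by (intro add_mono mult_mono) (auto simp: powr_le_one_le powr_le1 intro!: mult_nonneg_nonneg)
      also have "\<dots> = ((1 + \<delta>) * (1 + \<delta>) + B * real M powr (1 - p)) * E h'"
      proof -
        have "real M powr (1 - p) = real M powr (- p) * real M"
          using M2 by (simp add: powr_diff powr_minus field_simps)
        then show ?thesis unfolding B_def by (simp only:) (simp add: algebra_simps)
      qed
      also have "\<dots> \<le> (1 + \<epsilon>) * E h'" using \<delta>(3) BM E_nonneg[of h'] by (intro mult_right_mono) auto
      finally have "Lam (M * n) g \<le> (1 + \<epsilon>) * E h'" .
      then have "D powr p * Lam (M * n) g \<le> D powr p * ((1 + \<epsilon>) * E h')" by (intro mult_left_mono) auto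
      also have "\<dots> = (1 + \<epsilon>) * (D powr p * E h')" by simp
      also have "\<dots> = (1 + \<epsilon>) * E h" unfolding Eh' ..
      finally have F_E: "Lam (M * n) F \<le> (1 + \<epsilon>) * E h" unfolding F_def Lam_affine using D by simp
      show ?thesis
      proof (intro exI[of _ F] conjI allI ballI impI F_E)
        fix a b x assume "\<forall>q\<in>V 0. a \<le> h q \<and> h q \<le> b" and "x \<in> V (M * n)"
        then have "a \<le> lo" "hi \<le> b" "x \<in> VS" using ab V_subset_VS by blast+
        then show "a \<le> F x" "F x \<le> b" using F_range[of x] by auto
      qed (use F0 F_osc in auto)
    qed
  qed
qed

text \<open>The factor 2 is 1 + \<epsilon> for \<epsilon> = 1; below, energies of these extensions
  are compared only up to constants.\<close>

definition continuous_extension :: "('a \<Rightarrow> real) \<Rightarrow> 'a \<Rightarrow> real" where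
  "continuous_extension h = (SOME f. (\<forall>q\<in>V 0. f q = h q) \<and>
     (\<forall>a b. (\<forall>q\<in>V 0. a \<le> h q \<and> h q \<le> b) \<longrightarrow> (\<forall>x\<in>VS. a \<le> f x \<and> f x \<le> b)) \<and>
     energy_le f (2 * E h) \<and> uniformly_continuous_on VS f)"

lemma continuous_extension_exists:
  "\<exists>f. (\<forall>q\<in>V 0. f q = h q) \<and>
     (\<forall>a b. (\<forall>q\<in>V 0. a \<le> h q \<and> h q \<le> b) \<longrightarrow> (\<forall>x\<in>VS. a \<le> f x \<and> f x \<le> b)) \<and>
     energy_le f (2 * E h) \<and> uniformly_continuous_on VS f"
proof (rule extension_iterate[OF extension_step_contracting zero_less_one, of h])
  fix f
  assume f: "\<And>q. q \<in> V 0 \<Longrightarrow> f q = h q"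
    "\<And>a b x. (\<And>q. q \<in> V 0 \<Longrightarrow> a \<le> h q \<and> h q \<le> b) \<Longrightarrow> x \<in> VS \<Longrightarrow> a \<le> f x \<and> f x \<le> b"
    "energy_le f ((1 + 1) * E h)"
    "\<And>k d. osc_le (V 0) h d \<Longrightarrow> \<exists>n. \<forall>w\<in>W n. osc_le VS (f \<circ> fw w) ((3/4) ^ k * d)"
  define d where "d = Max (h ` V 0) - Min (h ` V 0)"
  have d: "osc_le (V 0) h d"
    by (rule osc_le_range[of _ "Min (h ` V 0)" _ "Max (h ` V 0)"]) (use finite_V in \<open>auto simp: d_def\<close>)
  have "uniformly_continuous_on VS f"
  proof (rule uniformly_continuous_cells)
    fix e :: real assume "0 < e"
    have "(\<lambda>k. (3/4) ^ k * d) \<longlonglongrightarrow> 0 * d" by (intro tendsto_intros LIMSEQ_power_zero) auto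
    then have "eventually (\<lambda>k. (3/4) ^ k * d < e) sequentially"
      using \<open>0 < e\<close> by (intro order_tendstoD(2)) auto
    then obtain k where k: "(3/4) ^ k * d < e" by (auto simp: eventually_sequentially)
    obtain n where "\<forall>w\<in>W n. osc_le VS (f \<circ> fw w) ((3/4) ^ k * d)" using f(4)[OF d] by blast
    then show "\<exists>n. \<forall>w\<in>W n. \<forall>x\<in>VS. \<forall>y\<in>VS. \<bar>f (fw w x) - f (fw w y)\<bar> \<le> e"
      using k unfolding osc_le_def by (intro exI[of _ n]) fastforce
  qed
  moreover have "energy_le f (2 * E h)" using f(3) by simp
  ultimately show ?thesis using f(1,2) by (intro exI[of _ f] conjI ballI allI impI) blast+
qed

lemmas continuous_extension = someI_ex[OF continuous_extension_exists, folded continuous_extension_def]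

lemma continuous_extension_vertex: "q \<in> V 0 \<Longrightarrow> continuous_extension h q = h q"
  and continuous_extension_range: "(\<And>q. q \<in> V 0 \<Longrightarrow> a \<le> h q \<and> h q \<le> b) \<Longrightarrow> x \<in> VS \<Longrightarrow>
    a \<le> continuous_extension h x \<and> continuous_extension h x \<le> b"
  and continuous_extension_energy: "energy_le (continuous_extension h) (2 * E h)"
  and uniformly_continuous_extension: "uniformly_continuous_on VS (continuous_extension h)"
  using continuous_extension[of h] by blast+

end

section \<open>Uniform convexity\<close>

text \<open>Writing two nonnegative numbers as m (1 + x) and m (1 - x) reduces strict convexity to
  (1 + x)^p + (1 - x)^p > 2, whose left side has positive derivative. The case a = -b is separate,
  as passing to absolute values would lose strictness there.\<close>

lemma powr_midpoint_less:
  fixes a b p :: real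
  assumes p: "1 < p" and ne: "a \<noteq> b"
  shows "\<bar>(a + b) / 2\<bar> powr p < (\<bar>a\<bar> powr p + \<bar>b\<bar> powr p) / 2"
proof -
  have strict: "2 < (1 + x) powr p + (1 - x) powr p" if x: "0 < x" "x \<le> 1" for x :: real
  proof -
    have "(1 + 0) powr p + (1 - 0) powr p < (1 + x) powr p + (1 - x) powr p"
    proof (rule DERIV_pos_imp_increasing_open[OF x(1)])
      fix y assume y: "0 < y" "y < x"
      have "((\<lambda>x. (1 + x) powr p + (1 - x) powr p) has_real_derivative
          p * ((1 + y) powr (p - 1) - (1 - y) powr (p - 1))) (at y)"
        using y x by (auto intro!: derivative_eq_intros simp: algebra_simps)
      moreover have "(1 - y) powr (p - 1) < (1 + y) powr (p - 1)"
        using y x p by (intro powr_less_mono2) auto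
      ultimately show "\<exists>d. ((\<lambda>x. (1 + x) powr p + (1 - x) powr p) has_real_derivative d) (at y) \<and> 0 < d"
        using p by (intro exI conjI) auto
    next
      show "continuous_on {0..x} (\<lambda>x. (1 + x) powr p + (1 - x) powr p)"
        using p x by (intro continuous_on_add continuous_on_powr') (auto intro!: continuous_intros)
    qed
    then show ?thesis by simp
  qed
  have pos: "((u + v) / 2) powr p < (u powr p + v powr p) / 2" if uv: "0 \<le> v" "v < u" for u v :: real
  proof -
    define m x where "m = (u + v) / 2" and "x = (u - v) / (u + v)"
    have m: "0 < m" and x: "0 < x" "x \<le> 1" using uv by (auto simp: m_def x_def field_simps)
    have "m * (1 + x) = u" "m * (1 - x) = v" using uv by (auto simp: m_def x_def field_simps)
    then have "u powr p + v powr p = m powr p * ((1 + x) powr p + (1 - x) powr p)"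
      using m x by (simp add: distrib_left flip: powr_mult)
    also have "\<dots> > m powr p * 2" using strict[OF x] m by (intro mult_strict_left_mono) auto
    finally show ?thesis by (simp add: m_def)
  qed
  show ?thesis
  proof (cases "\<bar>a\<bar> = \<bar>b\<bar>")
    case True
    then have "a + b = 0" "a \<noteq> 0" using ne by (auto simp: abs_eq_iff)
    then show ?thesis using True by simp
  next
    case False
    have "\<bar>(a + b) / 2\<bar> powr p \<le> ((\<bar>a\<bar> + \<bar>b\<bar>) / 2) powr p" using p by (intro powr_mono2) auto
    also have "\<dots> < (\<bar>a\<bar> powr p + \<bar>b\<bar> powr p) / 2"
      using pos[of "\<bar>b\<bar>" "\<bar>a\<bar>"] pos[of "\<bar>a\<bar>" "\<bar>b\<bar>"] False
      by (cases "\<bar>a\<bar>" "\<bar>b\<bar>" rule: linorder_cases) (auto simp: add.commute)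
    finally show ?thesis .
  qed
qed

text \<open>A substitute for the Clarkson inequalities which holds for all \<open>p > 1\<close> and is linear in
  the \<open>p\<close>-th powers.\<close>

lemma uniform_convexity_inequality:
  fixes p \<kappa> :: real
  assumes p: "1 < p" and \<kappa>: "0 < \<kappa>"
  obtains C where "0 < C" "\<And>a b. \<bar>a - b\<bar> powr p \<le>
    \<kappa> * (\<bar>a\<bar> powr p + \<bar>b\<bar> powr p) + C * ((\<bar>a\<bar> powr p + \<bar>b\<bar> powr p) / 2 - \<bar>(a + b) / 2\<bar> powr p)"
proof -
  define n where "n z = \<bar>fst z\<bar> powr p + \<bar>snd z\<bar> powr p" for z :: "real \<times> real"
  define G where "G z = n z / 2 - \<bar>(fst z + snd z) / 2\<bar> powr p" for z :: "real \<times> real"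
  \<comment> \<open>By homogeneity the sphere n z = 1 suffices. On the compact set S the convexity
    gap G has a positive lower bound g and pays for |a - b|^p, which is at most 2^p there; off S the
    term with \<kappa> pays.\<close>
  define S where "S = {z. n z = 1 \<and> \<kappa> \<le> \<bar>fst z - snd z\<bar> powr p}"
  have cont_n: "continuous_on UNIV n" unfolding n_def
    using p by (intro continuous_intros continuous_on_powr') auto
  have cont_G: "continuous_on UNIV G" unfolding G_def
    using p by (intro continuous_intros continuous_on_powr' cont_n) auto
  have cont_d: "continuous_on UNIV (\<lambda>z::real \<times> real. \<bar>fst z - snd z\<bar> powr p)"
    using p by (intro continuous_intros continuous_on_powr') auto
  have le1: "\<bar>fst z\<bar> \<le> 1 \<and> \<bar>snd z\<bar> \<le> 1" if "n z = 1" for z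
  proof -
    have "\<bar>x\<bar> \<le> 1" if "\<bar>x\<bar> powr p \<le> 1" for x :: real
    proof (rule ccontr)
      assume "\<not> \<bar>x\<bar> \<le> 1"
      then have "1 powr p < \<bar>x\<bar> powr p" using p by (intro powr_less_mono2) auto
      with that show False by simp
    qed
    moreover have "\<bar>fst z\<bar> powr p \<le> 1" "\<bar>snd z\<bar> powr p \<le> 1"
      using that unfolding n_def by (smt (verit) powr_ge_zero)+
    ultimately show ?thesis by blast
  qed
  have "S \<subseteq> cball 0 2"
  proof
    fix z assume "z \<in> S"
    then have "\<bar>fst z\<bar> \<le> 1 \<and> \<bar>snd z\<bar> \<le> 1" using le1 by (simp add: S_def)
    then have "norm z \<le> 1 + 1"
      using norm_Pair_le[of "fst z" "snd z"] by simp
    then show "z \<in> cball 0 2" by simp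
  qed
  moreover have "closed S" unfolding S_def
    by (intro closed_Collect_conj closed_Collect_eq closed_Collect_le cont_n cont_d continuous_intros)
  ultimately have S: "compact S" by (meson bounded_cball bounded_subset compact_eq_bounded_closed)
  have pos: "0 < G z" if "z \<in> S" for z
  proof -
    have "fst z \<noteq> snd z" using that \<kappa> by (auto simp: S_def)
    then show ?thesis using powr_midpoint_less[OF p] by (simp add: G_def n_def)
  qed
  obtain g where g: "0 < g" "\<And>z. z \<in> S \<Longrightarrow> g \<le> G z"
  proof (cases "S = {}")
    case False
    then obtain z where "z \<in> S" "\<And>y. y \<in> S \<Longrightarrow> G z \<le> G y"
      using continuous_attains_inf[OF S] continuous_on_subset[OF cont_G] by blast
    then show thesis using that[of "G z"] pos by blast
  qed (use that[of 1] in auto)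
  have norm1: "\<bar>fst z - snd z\<bar> powr p \<le> \<kappa> + (2 powr p / g) * G z" if z: "n z = 1" for z
  proof (cases "z \<in> S")
    case True
    have "\<bar>fst z - snd z\<bar> \<le> 2" using le1[OF z] by linarith
    then have "\<bar>fst z - snd z\<bar> powr p \<le> 2 powr p" using p by (intro powr_mono2) auto
    also have "\<dots> = (2 powr p / g) * g" using g by simp
    also have "\<dots> \<le> (2 powr p / g) * G z" using g(1) g(2)[OF True] by (intro mult_left_mono) auto
    finally show ?thesis using \<kappa> by simp
  next
    case False
    have "0 \<le> G z"
    proof (cases "fst z = snd z")
      case True
      then show ?thesis by (simp add: G_def n_def)
    qed (use powr_midpoint_less[OF p] in \<open>force simp: G_def n_def\<close>)
    then have "0 \<le> (2 powr p / g) * G z" using g by simp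
    then show ?thesis using False z by (simp add: S_def)
  qed
  show thesis
  proof (rule that[of "2 powr p / g"])
    show "0 < 2 powr p / g" using g by simp
    fix a b :: real
    let ?s = "\<bar>a\<bar> powr p + \<bar>b\<bar> powr p"
    show "\<bar>a - b\<bar> powr p \<le> \<kappa> * ?s + (2 powr p / g) * (?s / 2 - \<bar>(a + b) / 2\<bar> powr p)"
    proof (cases "a = 0 \<and> b = 0")
      case False
      then have s: "0 < ?s" by (auto intro: add_pos_nonneg add_nonneg_pos)
      define l where "l = ?s powr (1 / p)"
      have l: "0 < l" "l powr p = ?s" using s p by (auto simp: l_def powr_powr)
      define z where "z = (a / l, b / l)"
      have "n z = 1" using l s by (simp add: z_def n_def powr_divide flip: add_divide_distrib)
      from norm1[OF this] have "\<bar>a / l - b / l\<bar> powr p \<le> \<kappa> + (2 powr p / g) * (1 / 2 - \<bar>(a / l + b / l) / 2\<bar> powr p)"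
        using \<open>n z = 1\<close> by (simp add: G_def z_def)
      moreover have "\<bar>a / l - b / l\<bar> powr p = \<bar>a - b\<bar> powr p / ?s"
        using l by (simp add: powr_divide flip: diff_divide_distrib)
      moreover have "\<bar>(a / l + b / l) / 2\<bar> powr p = \<bar>(a + b) / 2\<bar> powr p / ?s"
      proof -
        have "\<bar>(a / l + b / l) / 2\<bar> = \<bar>(a + b) / 2\<bar> / l" using l by (simp add: field_simps flip: add_divide_distrib)
        then show ?thesis by (simp only: powr_divide l(2))
      qed
      ultimately have "\<bar>a - b\<bar> powr p / ?s \<le> \<kappa> + (2 powr p / g) * (1 / 2 - \<bar>(a + b) / 2\<bar> powr p / ?s)" by simp
      then have "\<bar>a - b\<bar> powr p / ?s * ?s \<le> (\<kappa> + (2 powr p / g) * (1 / 2 - \<bar>(a + b) / 2\<bar> powr p / ?s)) * ?s"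
        using s by (intro mult_right_mono) auto
      also have "\<dots> = \<kappa> * ?s + (2 powr p / g) * ((1 / 2 - \<bar>(a + b) / 2\<bar> powr p / ?s) * ?s)"
        by (simp only: distrib_right mult.assoc)
      also have "(1 / 2 - \<bar>(a + b) / 2\<bar> powr p / ?s) * ?s = ?s / 2 - \<bar>(a + b) / 2\<bar> powr p"
        using s by (simp add: left_diff_distrib)
      finally show ?thesis using s by simp
    qed auto
  qed
qed

section \<open>The limit form\<close>

context pcf_fixed_form
begin

abbreviation "Lv \<equiv> level_energy p N F K r"
abbreviation "\<F> \<equiv> limit_domain p N F K r"

lemma Lv_def: "Lv n f = (\<Sum>w\<in>W n. inverse (rw w) * initial_energy p (V 0) (f \<circ> fw w))"
  by (simp add: level_energy_def energy_lift_power)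

lemma Lv_nonneg: "0 \<le> Lv n f"
  unfolding Lv_def using rw_pos initial_energy_nonneg
  by (intro sum_nonneg mult_nonneg_nonneg) (auto intro: less_imp_le)

lemma Lv_expand: "Lv n f = (\<Sum>w\<in>W n. \<Sum>x\<in>V 0. \<Sum>y\<in>V 0 - {x}.
    inverse (rw w) / 2 * \<bar>f (fw w x) - f (fw w y)\<bar> powr p)"
  by (simp add: Lv_def initial_energy_def sum_distrib_left mult.assoc)

text \<open>E and E_0 are comparable on the finite set V_0. Summing this over cells gives the same
  constant at every level.\<close>

lemma energy_comparison:
  obtains C where "0 < C" "\<And>n f. Lv n f \<le> C * Lam n f" "\<And>n f. Lam n f \<le> C * Lv n f"
proof -
  obtain Cl where Cl: "0 < Cl" "\<And>f x y. x \<in> V 0 \<Longrightarrow> y \<in> V 0 \<Longrightarrow> \<bar>f x - f y\<bar> powr p \<le> Cl * E f"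
    using energies_M_lower[OF p E_M finite_V] by metis
  obtain Cu where Cu: "0 < Cu"
      "\<And>f D. 0 \<le> D \<Longrightarrow> (\<And>x y. x \<in> V 0 \<Longrightarrow> y \<in> V 0 \<Longrightarrow> \<bar>f x - f y\<bar> \<le> D) \<Longrightarrow> E f \<le> Cu * D powr p"
    using energies_M_upper[OF p E_M finite_V] by metis
  define C where "C = (real (card (V 0)))\<^sup>2 * Cl + 2 * Cu"
  have C: "0 < C" unfolding C_def using Cl Cu by (intro add_nonneg_pos) auto
  have 1: "initial_energy p (V 0) f \<le> C * E f" for f
  proof -
    have "initial_energy p (V 0) f \<le> (real (card (V 0)))\<^sup>2 * (Cl * E f)"
      using Cl E_nonneg[of f] by (intro initial_energy_le finite_V) auto
    also have "\<dots> \<le> C * E f" using Cu E_nonneg[of f] by (simp add: C_def distrib_right)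
    finally show ?thesis .
  qed
  have 2: "E f \<le> C * initial_energy p (V 0) f" for f
  proof -
    let ?I = "initial_energy p (V 0) f"
    have I: "0 \<le> ?I" by (rule initial_energy_nonneg)
    have "E f \<le> Cu * ((2 * ?I) powr (1 / p)) powr p"
    proof (rule Cu(2))
      fix x y assume "x \<in> V 0" "y \<in> V 0"
      then have "\<bar>f x - f y\<bar> powr p \<le> 2 * ?I" by (intro initial_energy_diff_le finite_V p)
      then have "(\<bar>f x - f y\<bar> powr p) powr (1 / p) \<le> (2 * ?I) powr (1 / p)" using p by (intro powr_mono2) auto
      then show "\<bar>f x - f y\<bar> \<le> (2 * ?I) powr (1 / p)" using p by (simp add: powr_powr)
    qed simp
    also have "\<dots> = Cu * (2 * ?I)" using p I by (simp add: powr_powr)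
    also have "\<dots> \<le> C * ?I" using Cl I by (simp add: C_def distrib_right)
    finally show ?thesis .
  qed
  show thesis
  proof (rule that[OF C])
    fix n f
    have "Lv n f \<le> (\<Sum>w\<in>W n. inverse (rw w) * (C * E (f \<circ> fw w)))"
      unfolding Lv_def using rw_pos 1 by (intro sum_mono mult_left_mono) (auto intro: less_imp_le)
    then show "Lv n f \<le> C * Lam n f" by (simp add: Lam_def sum_distrib_left mult.left_commute)
    have "Lam n f \<le> (\<Sum>w\<in>W n. inverse (rw w) * (C * initial_energy p (V 0) (f \<circ> fw w)))"
      unfolding Lam_def using rw_pos 2 by (intro sum_mono mult_left_mono) (auto intro: less_imp_le)
    then show "Lam n f \<le> C * Lv n f" by (simp add: Lv_def sum_distrib_left mult.left_commute)
  qed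
qed

lemma limit_domain_iff: "f \<in> \<F> \<longleftrightarrow> (\<exists>c. energy_le f c)"
proof -
  obtain C where C: "0 < C" "\<And>n f. Lv n f \<le> C * Lam n f" "\<And>n f. Lam n f \<le> C * Lv n f"
    using energy_comparison by metis
  show ?thesis
  proof
    assume "f \<in> \<F>"
    then obtain B where B: "\<And>n. 1 \<le> n \<Longrightarrow> Lv n f \<le> B"
      by (auto simp: limit_domain_def bdd_above_def)
    have "Lam n f \<le> C * B" for n
    proof -
      have "Lam n f \<le> Lam (Suc n) f" by (rule Lam_mono) simp
      also have "\<dots> \<le> C * Lv (Suc n) f" by (rule C(3))
      also have "\<dots> \<le> C * B" using B C(1) by (intro mult_left_mono) auto
      finally show ?thesis .
    qed
    then show "\<exists>c. energy_le f c" unfolding energy_le_def by blast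
  next
    assume "\<exists>c. energy_le f c"
    then obtain c where c: "\<And>n. Lam n f \<le> c" by (auto simp: energy_le_def)
    have "Lv n f \<le> C * c" for n
      using C(2)[of n f] c[of n] C(1) by (meson mult_left_mono less_imp_le order_trans)
    then show "f \<in> \<F>" unfolding limit_domain_def by (auto intro!: bdd_aboveI[of _ "C * c"])
  qed
qed

lemma limit_domainI: "energy_le f c \<Longrightarrow> f \<in> \<F>"
  using limit_domain_iff by blast

lemma limit_domain_cong: "(\<And>x. x \<in> VS \<Longrightarrow> f x = g x) \<Longrightarrow> f \<in> \<F> \<longleftrightarrow> g \<in> \<F>"
  unfolding limit_domain_iff using energy_le_cong[of f g] by blast

lemma limit_domain_lin: "f \<in> \<F> \<Longrightarrow> g \<in> \<F> \<Longrightarrow> (\<lambda>x. a * f x + b * g x) \<in> \<F>"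
proof -
  assume "f \<in> \<F>" "g \<in> \<F>"
  then obtain c d where "energy_le f c" "energy_le g d" unfolding limit_domain_iff by blast
  then have c: "\<And>n. Lam n (\<lambda>x. a * f x) \<le> \<bar>a\<bar> powr p * c" "\<And>n. Lam n (\<lambda>x. b * g x) \<le> \<bar>b\<bar> powr p * d"
    using energy_le_affine[of f c a 0] energy_le_affine[of g d b 0] by (auto simp: energy_le_def)
  have "Lam n (\<lambda>x. a * f x + b * g x) \<le> 2 powr (p - 1) * (\<bar>a\<bar> powr p * c + \<bar>b\<bar> powr p * d)" for n
    using Lam_add_le[of n "\<lambda>x. a * f x" "\<lambda>x. b * g x"] c[of n]
    by (meson add_mono mult_left_mono order_trans powr_ge_zero)
  then show ?thesis by (intro limit_domainI[of _ "2 powr (p - 1) * (\<bar>a\<bar> powr p * c + \<bar>b\<bar> powr p * d)"])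
    (simp add: energy_le_def)
qed

lemma limit_domain_diff: "f \<in> \<F> \<Longrightarrow> g \<in> \<F> \<Longrightarrow> (\<lambda>x. f x - g x) \<in> \<F>"
  using limit_domain_lin[of f g 1 "-1"] by simp

lemma limit_domain_add: "f \<in> \<F> \<Longrightarrow> g \<in> \<F> \<Longrightarrow> (\<lambda>x. f x + g x) \<in> \<F>"
  using limit_domain_lin[of f g 1 1] by simp

lemma limit_domain_const: "(\<lambda>_. c) \<in> \<F>"
  using energy_le_const[of 0 c] by (auto intro: limit_domainI)

lemma limit_domain_midpoint: "f \<in> \<F> \<Longrightarrow> g \<in> \<F> \<Longrightarrow> (\<lambda>x. (f x + g x) / 2) \<in> \<F>"
  using limit_domain_lin[of f g "1/2" "1/2"] by (simp add: add_divide_distrib)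

lemma limit_domain_unit_cut: "f \<in> \<F> \<Longrightarrow> unit_cut f \<in> \<F>"
  unfolding limit_domain_iff energy_le_def
  using Lam_clip[of 0 1 _ f] by (auto simp: unit_cut_def[abs_def] intro: order_trans)

lemma limit_domain_cell: "f \<in> \<F> \<Longrightarrow> w \<in> W n \<Longrightarrow> f \<circ> fw w \<in> \<F>"
  unfolding limit_domain_iff using energy_le_cell by blast

lemma Lv_cong: "(\<And>x. x \<in> V n \<Longrightarrow> f x = g x) \<Longrightarrow> Lv n f = Lv n g"
proof -
  assume *: "\<And>x. x \<in> V n \<Longrightarrow> f x = g x"
  have "f (fw w q) = g (fw w q)" if "w \<in> W n" "q \<in> V 0" for w q
    using * fw_in_V[OF that] by simp
  then show ?thesis unfolding Lv_expand by (auto intro!: sum.cong)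
qed

lemma Lv_continuous:
  assumes "\<And>x. x \<in> V n \<Longrightarrow> (\<lambda>k. h k x) \<longlonglongrightarrow> f x"
  shows "(\<lambda>k. Lv n (h k)) \<longlonglongrightarrow> Lv n f"
proof -
  have "fw w q \<in> V n" if "w \<in> W n" "q \<in> V 0" for w q
    using fw_in_V[OF that] by simp
  then show ?thesis unfolding Lv_expand using p assms
    by (intro tendsto_sum tendsto_mult tendsto_const tendsto_powr' tendsto_rabs tendsto_diff) auto
qed

text \<open>E_0 need not be fixed by \<open>renorm\<close>; monotonicity is borrowed from E and
  survives up to a constant.\<close>

lemma Lv_quasi_mono:
  obtains C where "0 < C" "\<And>m n f. m \<le> n \<Longrightarrow> Lv m f \<le> C * Lv n f"
proof -
  obtain C where C: "0 < C" "\<And>n f. Lv n f \<le> C * Lam n f" "\<And>n f. Lam n f \<le> C * Lv n f"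
    using energy_comparison by metis
  show thesis
  proof (rule that[of "C * C"])
    show "0 < C * C" using C by simp
    fix m n f assume "m \<le> (n::nat)"
    have "Lv m f \<le> C * Lam m f" by (rule C(2))
    also have "\<dots> \<le> C * Lam n f" using Lam_mono[OF \<open>m \<le> n\<close>] C(1) by (intro mult_left_mono) auto
    also have "\<dots> \<le> C * (C * Lv n f)" using C by (intro mult_left_mono) auto
    finally show "Lv m f \<le> C * C * Lv n f" by simp
  qed
qed

text \<open>Makes \<open>energies_M_lower\<close> available on V_1, which is how values at vertices
  of consecutive levels are compared. Definiteness rests on \<open>cell_constant_V1\<close>; the
  other properties hold termwise.\<close>

lemma Lam_1_energies_M: "Lam (Suc 0) \<in> energies_M p (V 1)"
proof -
  have conv: "E (\<lambda>x. t * f x + (1 - t) * g x) \<le> t * E f + (1 - t) * E g" if "0 < t" "t < 1" for f g t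
    using E_M that unfolding energies_M_def by blast
  have "Lam (Suc 0) (\<lambda>x. t * f x + (1 - t) * g x) \<le> t * Lam (Suc 0) f + (1 - t) * Lam (Suc 0) g"
    if "0 < t" "t < 1" for f g t
  proof -
    have "Lam (Suc 0) (\<lambda>x. t * f x + (1 - t) * g x) \<le>
        (\<Sum>w\<in>W (Suc 0). inverse (rw w) * (t * E (f \<circ> fw w) + (1 - t) * E (g \<circ> fw w)))"
      unfolding Lam_def using rw_pos conv[OF that]
      by (intro sum_mono mult_left_mono) (auto simp: o_def intro: less_imp_le)
    then show ?thesis
      by (simp add: Lam_def sum_distrib_left sum.distrib distrib_left mult.left_commute)
  qed
  moreover have "Lam (Suc 0) f = 0 \<longleftrightarrow> constant_on_set (V 1) f" for f
  proof
    assume "Lam (Suc 0) f = 0"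
    then have "\<forall>w\<in>W (Suc 0). inverse (rw w) * E (f \<circ> fw w) = 0"
      unfolding Lam_def using rw_pos E_nonneg
      by (subst (asm) sum_nonneg_eq_0_iff) (auto intro!: mult_nonneg_nonneg intro: less_imp_le)
    then have E0: "E (f \<circ> fw [i]) = 0" if "i \<in> {1..N}" for i
      using that rw_pos[of "[i]" "Suc 0"] by (force simp: words_1)
    have cell: "f (F i x) = f (F i y)" if "i \<in> {1..N}" "x \<in> V 0" "y \<in> V 0" for i x y
    proof -
      have "constant_on_set (V 0) (f \<circ> fw [i])"
        using E0[OF that(1)] energies_M_eq_0[OF p E_M] by blast
      then have "(f \<circ> fw [i]) x = (f \<circ> fw [i]) y" using that(2,3) unfolding constant_on_set_def by blast
      then show ?thesis by simp
    qed
    show "constant_on_set (V 1) f" unfolding constant_on_set_def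
    proof (intro ballI)
      fix x y assume xy: "x \<in> V 1" "y \<in> V 1"
      have "y \<in> {z. f z = f x}" 
      proof (rule cell_constant_V1[OF _ xy(1) _ xy(2)])
        fix i a b assume "i \<in> {1..N}" "a \<in> V 0" "b \<in> V 0" "F i a \<in> {z. f z = f x}"
        then show "F i b \<in> {z. f z = f x}" using cell[of i a b] unfolding mem_Collect_eq by metis
      qed simp
      then show "f x = f y" by simp
    qed
  next
    assume c: "constant_on_set (V 1) f"
    show "Lam (Suc 0) f = 0"
    proof (cases "V 1 = {}")
      case False
      then obtain x where "x \<in> V 1" by blast
      then have "\<forall>y\<in>V 1. f y = f x" using c unfolding constant_on_set_def by blast
      then show ?thesis by (intro Lam_const[of _ _ "f x"]) (metis One_nat_def)
    qed (use Lam_const[of "Suc 0" f 0] in \<open>metis One_nat_def empty_iff\<close>)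
  qed
  moreover have "functional_on (V 1) (Lam (Suc 0))"
    unfolding functional_on_def One_nat_def using Lam_cong[of "Suc 0"] by blast
  moreover have "Lam (Suc 0) (\<lambda>x. t * f x) = \<bar>t\<bar> powr p * Lam (Suc 0) f" for t f
    using Lam_affine[of "Suc 0" t f 0] by simp
  moreover have "Lam (Suc 0) (\<lambda>x. f x + t) = Lam (Suc 0) f" for t f
    using Lam_affine[of "Suc 0" 1 f t] by simp
  moreover have "Lam (Suc 0) (unit_cut f) \<le> Lam (Suc 0) f" for f
    using Lam_clip[of 0 1 "Suc 0" f] by (simp add: unit_cut_def[abs_def])
  ultimately show ?thesis using Lam_nonneg by (simp add: energies_M_def)
qed

lemma diff_V1_le:
  obtains C where "0 < C"
    "\<And>f c x y. energy_le f c \<Longrightarrow> x \<in> V 1 \<Longrightarrow> y \<in> V 1 \<Longrightarrow> \<bar>f x - f y\<bar> powr p \<le> C * c"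
proof -
  obtain C where C: "0 < C" "\<And>f x y. x \<in> V 1 \<Longrightarrow> y \<in> V 1 \<Longrightarrow> \<bar>f x - f y\<bar> powr p \<le> C * Lam (Suc 0) f"
    using energies_M_lower[OF p Lam_1_energies_M finite_V] by metis
  show thesis
  proof (rule that[OF C(1)])
    fix f c x y assume "energy_le f c" "x \<in> V 1" "y \<in> V 1"
    then show "\<bar>f x - f y\<bar> powr p \<le> C * c"
      using C(2)[of x y f] energy_leD[of f c "Suc 0"] C(1) by (meson mult_left_mono less_imp_le order_trans)
  qed
qed

lemma powr_abs_add_le: "\<bar>x + y\<bar> powr p \<le> 2 powr (p - 1) * (\<bar>x\<bar> powr p + \<bar>y\<bar> powr p)"
proof -
  have "\<bar>x + y\<bar> powr p \<le> (\<bar>x\<bar> + \<bar>y\<bar>) powr p" using p by (intro powr_mono2) auto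
  also have "\<dots> \<le> 2 powr (p - 1) * (\<bar>x\<bar> powr p + \<bar>y\<bar> powr p)" using p by (intro powr_sum_le_half) auto
  finally show ?thesis .
qed

text \<open>Differences of point evaluations are bounded by the energy. A vertex F_i z is joined to
  q in two moves: to F_i q by the bound for z applied to the restriction of f to the cell, then from
  F_i q to q inside V_1.\<close>

lemma diff_VS_le:
  assumes "x \<in> VS" "y \<in> VS"
  obtains C where "0 < C" "\<And>f c. energy_le f c \<Longrightarrow> \<bar>f x - f y\<bar> powr p \<le> C * c"
proof -
  obtain C1 where C1: "0 < C1"
    "\<And>f c x y. energy_le f c \<Longrightarrow> x \<in> V 1 \<Longrightarrow> y \<in> V 1 \<Longrightarrow> \<bar>f x - f y\<bar> powr p \<le> C1 * c"
    using diff_V1_le by metis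
  obtain q where q: "q \<in> V 0" using V0_nonempty by blast
  then have q1: "q \<in> V 1" using V_mono_Suc[of 0] by (metis One_nat_def subsetD)
  let ?P = "2 powr (p - 1)"
  have to_q: "\<exists>C>0. \<forall>f c. energy_le f c \<longrightarrow> \<bar>f x - f q\<bar> powr p \<le> C * c" if "x \<in> V n" for x n
    using that
  proof (induction n arbitrary: x)
    case 0
    then have "x \<in> V 1" using V_mono_Suc[of 0] by (metis One_nat_def subsetD)
    then show ?case using C1 q1 by blast
  next
    case (Suc n)
    then obtain i z where i: "i \<in> {1..N}" "z \<in> V n" "x = F i z" by auto
    obtain C where C: "0 < C" "\<And>f c. energy_le f c \<Longrightarrow> \<bar>f z - f q\<bar> powr p \<le> C * c"
      using Suc.IH[OF i(2)] by blast
    have w: "[i] \<in> W (Suc 0)" using i by simp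
    have iq: "F i q \<in> V 1" using i(1) q by auto
    show ?case
    proof (intro exI conjI allI impI)
      show "0 < ?P * (C * rw [i] + C1)"
        using C(1) C1(1) rw_pos[OF w] by (intro mult_pos_pos add_pos_pos) auto
      fix f c assume f: "energy_le f c"
      have "\<bar>f x - f (F i q)\<bar> powr p \<le> C * (rw [i] * c)"
        using C(2)[OF energy_le_cell[OF f w]] i(3) by simp
      moreover have "\<bar>f (F i q) - f q\<bar> powr p \<le> C1 * c" by (rule C1(2)[OF f iq q1])
      moreover have "\<bar>f x - f q\<bar> powr p \<le> ?P * (\<bar>f x - f (F i q)\<bar> powr p + \<bar>f (F i q) - f q\<bar> powr p)"
        using powr_abs_add_le[of "f x - f (F i q)" "f (F i q) - f q"] by simp
      ultimately have "\<bar>f x - f q\<bar> powr p \<le> ?P * (C * (rw [i] * c) + C1 * c)"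
        by (meson add_mono mult_left_mono order_trans powr_ge_zero)
      then show "\<bar>f x - f q\<bar> powr p \<le> ?P * (C * rw [i] + C1) * c" by (simp add: algebra_simps)
    qed
  qed
  obtain n m where "x \<in> V n" "y \<in> V m" using assms unfolding all_vertices_def by blast
  then obtain Cx Cy where Cx: "0 < Cx" "\<And>f c. energy_le f c \<Longrightarrow> \<bar>f x - f q\<bar> powr p \<le> Cx * c"
    and Cy: "0 < Cy" "\<And>f c. energy_le f c \<Longrightarrow> \<bar>f y - f q\<bar> powr p \<le> Cy * c"
    using to_q by meson
  show thesis
  proof (rule that[of "?P * (Cx + Cy)"])
    show "0 < ?P * (Cx + Cy)" using Cx Cy by simp
    fix f c assume f: "energy_le f c"
    have "\<bar>f x - f y\<bar> powr p \<le> ?P * (\<bar>f x - f q\<bar> powr p + \<bar>f q - f y\<bar> powr p)"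
      using powr_abs_add_le[of "f x - f q" "f q - f y"] by simp
    also have "\<dots> \<le> ?P * (Cx * c + Cy * c)"
      using Cx(2)[OF f] Cy(2)[OF f] by (intro mult_left_mono add_mono) (auto simp: abs_minus_commute)
    finally show "\<bar>f x - f y\<bar> powr p \<le> ?P * (Cx + Cy) * c" by (simp add: algebra_simps)
  qed
qed

end

section \<open>Interpolation from the vertices of a level\<close>

context pcf_fixed_form
begin

text \<open>Entry point for inequalities proved on single differences. The four terms match the
  shape of \<open>limit_form_transfer\<close>, with coefficient 0 where fewer occur.\<close>

lemma Lv_pointwise:
  assumes "\<And>w x y. w \<in> W n \<Longrightarrow> x \<in> V 0 \<Longrightarrow> y \<in> V 0 \<Longrightarrow>
    a * \<bar>f (fw w x) - f (fw w y)\<bar> powr p + b * \<bar>g (fw w x) - g (fw w y)\<bar> powr p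
      \<le> c * \<bar>h (fw w x) - h (fw w y)\<bar> powr p + d * \<bar>k (fw w x) - k (fw w y)\<bar> powr p"
  shows "a * Lv n f + b * Lv n g \<le> c * Lv n h + d * Lv n k"
proof -
  have eq: "a * Lv n f + b * Lv n g = (\<Sum>w\<in>W n. \<Sum>x\<in>V 0. \<Sum>y\<in>V 0 - {x}. inverse (rw w) / 2 *
      (a * \<bar>f (fw w x) - f (fw w y)\<bar> powr p + b * \<bar>g (fw w x) - g (fw w y)\<bar> powr p))" for a b f g
    unfolding Lv_expand by (simp add: sum_distrib_left distrib_left sum.distrib mult.left_commute)
  show ?thesis unfolding eq
    using assms rw_pos by (intro sum_mono mult_left_mono) (auto intro: less_imp_le)
qed

lemma energy_le_add:
  assumes "energy_le f c" "energy_le g d"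
  shows "energy_le (\<lambda>x. f x + g x) (2 powr (p - 1) * (c + d))"
  unfolding energy_le_def
proof
  fix n
  have "Lam n (\<lambda>x. f x + g x) \<le> 2 powr (p - 1) * (Lam n f + Lam n g)" by (rule Lam_add_le)
  also have "\<dots> \<le> 2 powr (p - 1) * (c + d)"
    using energy_leD[OF assms(1)] energy_leD[OF assms(2)] by (intro mult_left_mono add_mono) auto
  finally show "Lam n (\<lambda>x. f x + g x) \<le> 2 powr (p - 1) * (c + d)" .
qed

lemma energy_le_sum:
  assumes "finite B" "\<And>b. b \<in> B \<Longrightarrow> u b \<in> \<F>"
  obtains A where "0 < A" "\<And>a D. 0 \<le> D \<Longrightarrow> (\<And>b. b \<in> B \<Longrightarrow> \<bar>a b\<bar> \<le> D) \<Longrightarrow>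
    energy_le (\<lambda>x. \<Sum>b\<in>B. a b * u b x) (A * D powr p)"
proof -
  have "\<exists>A>0. \<forall>a D. 0 \<le> D \<longrightarrow> (\<forall>b\<in>B. \<bar>a b\<bar> \<le> D) \<longrightarrow>
      energy_le (\<lambda>x. \<Sum>b\<in>B. a b * u b x) (A * D powr p)"
    using assms
  proof (induction B)
    case empty
    then show ?case by (auto simp: energy_le_const intro!: exI[of _ 1])
  next
    case (insert b B)
    then obtain A where A: "0 < A" "\<And>a D. 0 \<le> D \<Longrightarrow> (\<forall>b\<in>B. \<bar>a b\<bar> \<le> D) \<Longrightarrow>
      energy_le (\<lambda>x. \<Sum>b\<in>B. a b * u b x) (A * D powr p)" by auto
    obtain c where c: "energy_le (u b) c" using insert.prems[of b] limit_domain_iff by auto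
    have c0: "0 \<le> c" by (rule energy_le_nonneg[OF c])
    show ?case
    proof (intro exI conjI allI impI)
      show "0 < 2 powr (p - 1) * (c + A)" using c0 A(1) by simp
      fix a :: "'b \<Rightarrow> real" and D :: real assume D: "0 \<le> D" "\<forall>b\<in>insert b B. \<bar>a b\<bar> \<le> D"
      have "\<bar>a b\<bar> powr p * c \<le> D powr p * c" using D c0 p by (intro mult_right_mono powr_mono2) auto
      then have "energy_le (\<lambda>x. a b * u b x) (D powr p * c)"
        using energy_le_affine[OF c, of "a b" 0] by (auto elim: energy_le_mono)
      from energy_le_add[OF this A(2)[OF D(1), of a]] D(2)
      have "energy_le (\<lambda>x. a b * u b x + (\<Sum>b\<in>B. a b * u b x)) (2 powr (p - 1) * (D powr p * c + A * D powr p))"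
        by simp
      then show "energy_le (\<lambda>x. \<Sum>b\<in>insert b B. a b * u b x) (2 powr (p - 1) * (c + A) * D powr p)"
        by (simp add: sum.insert[OF insert.hyps(1,2)] algebra_simps)
    qed
  qed
  then show thesis using that by meson
qed

lemma uniformly_continuous_osc:
  assumes u: "uniformly_continuous_on VS u" and \<epsilon>: "0 < \<epsilon>"
  obtains n0 where "\<And>n w. n0 \<le> n \<Longrightarrow> w \<in> W n \<Longrightarrow> osc_le VS (u \<circ> fw w) \<epsilon>"
proof -
  obtain d where d: "0 < d" "\<And>x y. x \<in> VS \<Longrightarrow> y \<in> VS \<Longrightarrow> dist y x < d \<Longrightarrow> dist (u y) (u x) < \<epsilon>"
    using u \<epsilon> unfolding uniformly_continuous_on_def by metis
  obtain n0 where n0: "\<And>n w x y. n0 \<le> n \<Longrightarrow> w \<in> W n \<Longrightarrow> x \<in> K \<Longrightarrow> y \<in> K \<Longrightarrow> dist (fw w x) (fw w y) < d"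
    using cells_small[OF d(1)] by metis
  show thesis
  proof (rule that)
    fix n w assume n: "n0 \<le> n" and w: "w \<in> W n"
    show "osc_le VS (u \<circ> fw w) \<epsilon>" unfolding osc_le_def
    proof (intro ballI)
      fix x y assume "x \<in> VS" "y \<in> VS"
      then have "dist (u (fw w x)) (u (fw w y)) < \<epsilon>"
        using d(2)[of "fw w y" "fw w x"] n0[OF n w] fw_in_VS[OF w] VS_subset_K by blast
      then show "\<bar>(u \<circ> fw w) x - (u \<circ> fw w) y\<bar> \<le> \<epsilon>" by (simp add: dist_real_def)
    qed
  qed
qed

lemma uniformly_continuous_glue:
  assumes b: "\<And>w q. w \<in> W m \<Longrightarrow> q \<in> V 0 \<Longrightarrow> g w q = b (fw w q)"
    and u: "\<And>w. w \<in> W m \<Longrightarrow> uniformly_continuous_on VS (g w)"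
  shows "uniformly_continuous_on VS (glue m g)"
proof (rule uniformly_continuous_cells)
  fix \<epsilon> :: real assume \<epsilon>: "0 < \<epsilon>"
  have "\<forall>w\<in>W m. \<exists>n0. \<forall>n\<ge>n0. \<forall>v\<in>W n. osc_le VS (g w \<circ> fw v) \<epsilon>"
  proof
    fix w assume "w \<in> W m"
    from u[OF this] \<epsilon> obtain n0 where "\<And>n v. n0 \<le> n \<Longrightarrow> v \<in> W n \<Longrightarrow> osc_le VS (g w \<circ> fw v) \<epsilon>"
      by (rule uniformly_continuous_osc) blast
    then show "\<exists>n0. \<forall>n\<ge>n0. \<forall>v\<in>W n. osc_le VS (g w \<circ> fw v) \<epsilon>" by blast
  qed
  from bchoice[OF this] obtain n0 where
    n0: "\<And>w n v. w \<in> W m \<Longrightarrow> n0 w \<le> n \<Longrightarrow> v \<in> W n \<Longrightarrow> osc_le VS (g w \<circ> fw v) \<epsilon>" by blast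
  define n where "n = Max (insert 0 (n0 ` W m))"
  have n: "n0 w \<le> n" if "w \<in> W m" for w unfolding n_def using that by (intro Max_ge) auto
  have "\<bar>glue m g (fw t x) - glue m g (fw t y)\<bar> \<le> \<epsilon>" if t: "t \<in> W (m + n)" and xy: "x \<in> VS" "y \<in> VS" for t x y
  proof -
    obtain w v where wv: "w \<in> W m" "v \<in> W n" "t = w @ v" using words_append_obtain[OF t] .
    have "glue m g (fw t z) = g w (fw v z)" if "z \<in> VS" for z
      using glue_cell[where b = b and g = g, OF b wv(1)] fw_in_VS[OF wv(2) that] VS_subset_K wv(3)
      by (auto simp: word_map_append)
    then show ?thesis using n0[OF wv(1) n[OF wv(1)] wv(2)] xy unfolding osc_le_def by simp
  qed
  then show "\<exists>n. \<forall>w\<in>W n. \<forall>x\<in>VS. \<forall>y\<in>VS. \<bar>glue m g (fw w x) - glue m g (fw w y)\<bar> \<le> \<epsilon>" by blast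
qed

definition base_vertex :: 'a where
  "base_vertex = (SOME q. q \<in> V 0)"

lemma base_vertex: "base_vertex \<in> V 0" "base_vertex \<in> V n" "base_vertex \<in> VS"
proof -
  show 0: "base_vertex \<in> V 0" unfolding base_vertex_def using V0_nonempty by (simp add: some_in_eq)
  then show "base_vertex \<in> V n" "base_vertex \<in> VS" using V_mono[of 0 n] V_subset_VS by blast+
qed

text \<open>\<open>continuous_extension\<close> is a choice and need not be linear in h. Combining
  its values at indicators of points is linear, and splitting off the value at one vertex reproduces
  constants, so that the energy is controlled by E h.\<close>

definition linear_extension :: "('a \<Rightarrow> real) \<Rightarrow> 'a \<Rightarrow> real" where
  "linear_extension h x = h base_vertex +
    (\<Sum>q\<in>V 0 - {base_vertex}. (h q - h base_vertex) * continuous_extension (indicator {q}) x)"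

lemma linear_extension_linear:
  "linear_extension (\<lambda>x. a * f x + b * g x) x = a * linear_extension f x + b * linear_extension g x"
  by (simp add: linear_extension_def algebra_simps sum.distrib sum_distrib_left sum_subtractf)

lemma linear_extension_vertex:
  assumes q: "q \<in> V 0"
  shows "linear_extension h q = h q"
proof -
  have "(\<Sum>a\<in>V 0 - {base_vertex}. (h a - h base_vertex) * continuous_extension (indicator {a}) q)
      = (\<Sum>a\<in>V 0 - {base_vertex}. if q = a then h q - h base_vertex else 0)"
    by (intro sum.cong refl) (simp add: continuous_extension_vertex[OF q] indicator_def)
  then show ?thesis using q finite_V[of 0] by (auto simp: linear_extension_def)
qed

lemma linear_extension_energy:
  obtains A where "0 < A" "\<And>h. energy_le (linear_extension h) (A * E h)"
proof -
  obtain Cl where Cl: "0 < Cl" "\<And>f x y. x \<in> V 0 \<Longrightarrow> y \<in> V 0 \<Longrightarrow> \<bar>f x - f y\<bar> powr p \<le> Cl * E f"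
    using energies_M_lower[OF p E_M finite_V] by metis
  obtain A where A: "0 < A" "\<And>a D. 0 \<le> D \<Longrightarrow> (\<And>q. q \<in> V 0 - {base_vertex} \<Longrightarrow> \<bar>a q\<bar> \<le> D) \<Longrightarrow>
    energy_le (\<lambda>x. \<Sum>q\<in>V 0 - {base_vertex}. a q * continuous_extension (indicator {q}) x) (A * D powr p)"
    by (rule energy_le_sum[where B = "V 0 - {base_vertex}" and u = "\<lambda>q. continuous_extension (indicator {q})",
        OF finite_Diff[OF finite_V] limit_domainI[OF continuous_extension_energy]]) blast
  show thesis
  proof (rule that[of "A * Cl"])
    show "0 < A * Cl" using A Cl by simp
    fix h
    let ?D = "(Cl * E h) powr (1 / p)"
    have "energy_le (\<lambda>x. \<Sum>q\<in>V 0 - {base_vertex}. (h q - h base_vertex) *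
        continuous_extension (indicator {q}) x) (A * ?D powr p)"
    proof (rule A(2))
      fix q assume "q \<in> V 0 - {base_vertex}"
      then have "\<bar>h q - h base_vertex\<bar> powr p \<le> Cl * E h" using Cl(2) base_vertex(1) by blast
      then have "(\<bar>h q - h base_vertex\<bar> powr p) powr (1 / p) \<le> ?D" using p by (intro powr_mono2) auto
      then show "\<bar>h q - h base_vertex\<bar> \<le> ?D" using p by (simp add: powr_powr)
    qed simp
    moreover have "?D powr p = Cl * E h" using p Cl(1) E_nonneg[of h] by (simp add: powr_powr)
    ultimately have "energy_le (\<lambda>x. 1 * (\<Sum>q\<in>V 0 - {base_vertex}. (h q - h base_vertex) *
        continuous_extension (indicator {q}) x) + h base_vertex) (\<bar>1\<bar> powr p * (A * (Cl * E h)))"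
      by (intro energy_le_affine) simp
    then show "energy_le (linear_extension h) (A * Cl * E h)"
      by (simp add: linear_extension_def[abs_def] mult.assoc add.commute)
  qed
qed

lemma uniformly_continuous_linear_extension: "uniformly_continuous_on VS (linear_extension h)"
proof -
  have "uniformly_continuous_on VS (\<lambda>x. \<Sum>q\<in>B. a q * continuous_extension (indicator {q}) x)"
    if "finite B" for B :: "'a set" and a
    using that
    by induction (auto intro!: uniformly_continuous_on_add uniformly_continuous_on_cmul_left
        uniformly_continuous_extension uniformly_continuous_on_const)
  from this[of "V 0 - {base_vertex}"] show ?thesis
    unfolding linear_extension_def[abs_def] using finite_V
    by (intro uniformly_continuous_on_add uniformly_continuous_on_const) auto
qed

definition interpolation :: "nat \<Rightarrow> ('a \<Rightarrow> real) \<Rightarrow> 'a \<Rightarrow> real" where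
  "interpolation m f = glue m (\<lambda>w. linear_extension (f \<circ> fw w))"

text \<open>\<open>glue\<close> selects the cell of a point independently of the functions being
  glued.\<close>

lemma interpolation_linear:
  "interpolation m (\<lambda>x. a * f x + b * g x) x = a * interpolation m f x + b * interpolation m g x"
  using linear_extension_linear by (simp add: interpolation_def glue_def Let_def o_def)

lemma interpolation_vertex: "x \<in> V m \<Longrightarrow> interpolation m f x = f x"
  unfolding interpolation_def by (rule glue_vertex[where b = f]) (simp_all add: linear_extension_vertex)

lemma interpolation_energy:
  obtains A where "0 < A" "\<And>m f. energy_le (interpolation m f) (A * Lam m f)"
proof -
  obtain A where A: "0 < A" "\<And>h. energy_le (linear_extension h) (A * E h)"
    using linear_extension_energy by metis
  show thesis
  proof (rule that[OF A(1)])
    fix m f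
    have "energy_le (interpolation m f) (\<Sum>w\<in>W m. inverse (rw w) * (A * E (f \<circ> fw w)))"
      unfolding interpolation_def
      by (rule energy_le_glue[where b = f]) (simp_all add: linear_extension_vertex A(2))
    then show "energy_le (interpolation m f) (A * Lam m f)"
      by (simp add: Lam_def sum_distrib_left mult.left_commute)
  qed
qed

lemma uniformly_continuous_interpolation: "uniformly_continuous_on VS (interpolation m f)"
  unfolding interpolation_def
  by (rule uniformly_continuous_glue[where b = f])
    (simp_all add: linear_extension_vertex uniformly_continuous_linear_extension)

lemma interpolation_limit_domain: "interpolation m f \<in> \<F>"
  using interpolation_energy limit_domainI by metis

text \<open>Like \<open>interpolation\<close>, but preserving the range in each cell instead of
  being linear; this suits uniform approximation.\<close>

definition cell_extension :: "nat \<Rightarrow> ('a \<Rightarrow> real) \<Rightarrow> 'a \<Rightarrow> real" where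
  "cell_extension m f = glue m (\<lambda>w. continuous_extension (f \<circ> fw w))"

lemma cell_extension:
  shows cell_extension_limit_domain: "cell_extension m f \<in> \<F>"
    and uniformly_continuous_cell_extension: "uniformly_continuous_on VS (cell_extension m f)"
    and cell_extension_range: "w \<in> W m \<Longrightarrow> y \<in> VS \<Longrightarrow> (\<And>q. q \<in> V 0 \<Longrightarrow> a \<le> f (fw w q) \<and> f (fw w q) \<le> b) \<Longrightarrow>
      a \<le> cell_extension m f (fw w y) \<and> cell_extension m f (fw w y) \<le> b"
proof -
  have b: "continuous_extension (f \<circ> fw w) q = f (fw w q)" if "w \<in> W m" "q \<in> V 0" for w q
    by (simp add: continuous_extension_vertex[OF that(2)])
  show "cell_extension m f \<in> \<F>" unfolding cell_extension_def
    by (rule limit_domainI, rule energy_le_glue[where b = f], rule b, assumption+, rule continuous_extension_energy)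
  show "uniformly_continuous_on VS (cell_extension m f)" unfolding cell_extension_def
    by (rule uniformly_continuous_glue[where b = f], rule b, assumption+, rule uniformly_continuous_extension)
  show "a \<le> cell_extension m f (fw w y) \<and> cell_extension m f (fw w y) \<le> b"
    if w: "w \<in> W m" "y \<in> VS" "\<And>q. q \<in> V 0 \<Longrightarrow> a \<le> f (fw w q) \<and> f (fw w q) \<le> b"
  proof -
    have "y \<in> K" using w(2) VS_subset_K by blast
    then have "cell_extension m f (fw w y) = continuous_extension (f \<circ> fw w) y"
      unfolding cell_extension_def by (intro glue_cell[where b = f] b w(1))
    then show ?thesis using continuous_extension_range[of a "f \<circ> fw w" b y] w(2,3) by simp
  qed
qed

end

section \<open>Cesaro limits of the level energies\<close>

locale pcf_limit_form = pcf_fixed_form F K N r p E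
  for F :: "nat \<Rightarrow> 'a::euclidean_space \<Rightarrow> 'a" and K :: "'a set" and N :: nat
    and r :: "nat \<Rightarrow> real" and p :: real and E :: "('a \<Rightarrow> real) \<Rightarrow> real" +
  fixes s :: "nat \<Rightarrow> nat"
  assumes s_mono: "strict_mono s"
    and s_convergent: "\<forall>f\<in>limit_domain p N F K r. convergent (\<lambda>l. cesaro_energy p N F K r (s l) f)"
begin

abbreviation "\<E> \<equiv> limit_form p N F K r s"

lemma cesaro_tendsto: "f \<in> \<F> \<Longrightarrow> (\<lambda>l. cesaro_energy p N F K r (s l) f) \<longlonglongrightarrow> \<E> f"
  using s_convergent unfolding limit_form_def by (auto simp: convergent_LIMSEQ_iff)

text \<open>The passage from level energies to the limit form: an inequality valid from some level
  on survives averaging, since the finitely many exceptional terms are divided by the length of the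
  average. Two functions on each side and a constant e form the common pattern of the
  applications.\<close>

lemma limit_form_transfer:
  assumes D: "f \<in> \<F>" "g \<in> \<F>" "h \<in> \<F>" "k \<in> \<F>"
    and le: "\<And>n. n0 \<le> n \<Longrightarrow> a * Lv n f + b * Lv n g + e \<le> c * Lv n h + d * Lv n k"
  shows "a * \<E> f + b * \<E> g + e \<le> c * \<E> h + d * \<E> k"
proof -
  define u where "u n = c * Lv n h + d * Lv n k - a * Lv n f - b * Lv n g - e" for n
  \<comment> \<open>Bounds the total deficit of the levels below n0.\<close>
  define B where "B = (\<Sum>m<n0. \<bar>u m\<bar>)"
  let ?A = "\<lambda>n. cesaro_energy p N F K r n"
  have avg: "c * ?A n h + d * ?A n k - a * ?A n f - b * ?A n g - e = (1 / (real n + 1)) * (\<Sum>m=0..n. u m)" for n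
  proof -
    have "(1 / (real n + 1)) * (\<Sum>m=0..n. e) = e" by (simp add: add.commute)
    then show ?thesis unfolding u_def cesaro_energy_def
      by (simp only: sum_subtractf sum.distrib right_diff_distrib distrib_left sum_distrib_left[symmetric])
        (simp add: algebra_simps)
  qed
  have u_nonneg: "0 \<le> u m" if "n0 \<le> m" for m
    using le[OF that] by (simp add: u_def)
  have sum_ge: "- B \<le> (\<Sum>m=0..n. u m)" for n
  proof -
    have "(\<Sum>m\<in>{0..n}. - u m) \<le> (\<Sum>m\<in>{0..n}. if m < n0 then \<bar>u m\<bar> else 0)"
      using u_nonneg by (intro sum_mono) (auto simp: not_less)
    also have "\<dots> = (\<Sum>m\<in>{0..n} \<inter> {..<n0}. \<bar>u m\<bar>)" by (simp add: sum.If_cases lessThan_def)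
    also have "\<dots> \<le> B" unfolding B_def by (intro sum_mono2) auto
    finally show ?thesis by (simp add: sum_negf)
  qed
  have "(\<lambda>l. c * ?A (s l) h + d * ?A (s l) k - a * ?A (s l) f - b * ?A (s l) g - e)
      \<longlonglongrightarrow> c * \<E> h + d * \<E> k - a * \<E> f - b * \<E> g - e"
    by (intro tendsto_intros cesaro_tendsto D)
  moreover have "(\<lambda>l. - B * inverse (real (Suc (s l)))) \<longlonglongrightarrow> - B * 0"
    using LIMSEQ_subseq_LIMSEQ[OF LIMSEQ_inverse_real_of_nat s_mono]
    by (intro tendsto_intros) (simp add: o_def)
  moreover have "- B * inverse (real (Suc (s l))) \<le> c * ?A (s l) h + d * ?A (s l) k - a * ?A (s l) f - b * ?A (s l) g - e" for l
    unfolding avg using mult_right_mono[OF sum_ge[of "s l"], of "inverse (real (Suc (s l)))"]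
    by (simp add: field_simps)
  ultimately have "- B * 0 \<le> c * \<E> h + d * \<E> k - a * \<E> f - b * \<E> g - e"
    by (intro LIMSEQ_le) auto
  then show ?thesis by simp
qed

lemma limit_form_nonneg: "f \<in> \<F> \<Longrightarrow> 0 \<le> \<E> f"
  using limit_form_transfer[of f f f f 0 0 0 0 1 0] Lv_nonneg by simp

lemma limit_form_le: "f \<in> \<F> \<Longrightarrow> (\<And>n. Lv n f \<le> c) \<Longrightarrow> \<E> f \<le> c"
  using limit_form_transfer[of f f f f 0 1 0 "- c" 0 0] by simp

lemma limit_form_comparison:
  obtains C where "0 < C" "\<And>f n. f \<in> \<F> \<Longrightarrow> Lv n f \<le> C * \<E> f"
    "\<And>f. f \<in> \<F> \<Longrightarrow> energy_le f (C * \<E> f)" "\<And>f c. energy_le f c \<Longrightarrow> \<E> f \<le> C * c"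
proof -
  obtain A where A: "0 < A" "\<And>n f. Lv n f \<le> A * Lam n f" "\<And>n f. Lam n f \<le> A * Lv n f"
    using energy_comparison by metis
  obtain B where B: "0 < B" "\<And>m n f. m \<le> n \<Longrightarrow> Lv m f \<le> B * Lv n f" using Lv_quasi_mono by metis
  \<comment> \<open>The number \<open>Lv m f\<close> for fixed m takes the part of the constant e;
    from level m on it is at most B * Lv n f.\<close>
  have Lv_le: "Lv m f \<le> B * \<E> f" if f: "f \<in> \<F>" for f m
    using limit_form_transfer[OF f f f f, of m 0 0 "Lv m f" B 0] B(2) by simp
  have 1: "Lv m f \<le> (A * B + A + B) * \<E> f" if f: "f \<in> \<F>" for f m
  proof -
    have "B * \<E> f \<le> (A * B + A + B) * \<E> f"
      using A B limit_form_nonneg[OF f] by (intro mult_right_mono) auto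
    with Lv_le[OF f, of m] show ?thesis by linarith
  qed
  have 2: "energy_le f ((A * B + A + B) * \<E> f)" if f: "f \<in> \<F>" for f
    unfolding energy_le_def
  proof
    fix n
    have "Lam n f \<le> A * (B * \<E> f)"
      using A(3)[of n f] mult_left_mono[OF Lv_le[OF f, of n], of A] A(1) by linarith
    also have "\<dots> \<le> (A * B + A + B) * \<E> f"
      using A(1) B(1) limit_form_nonneg[OF f] by (simp add: distrib_right)
    finally show "Lam n f \<le> (A * B + A + B) * \<E> f" .
  qed
  have 3: "\<E> f \<le> (A * B + A + B) * c" if f: "energy_le f c" for f c
  proof (rule limit_form_le[OF limit_domainI[OF f]])
    fix n
    have "Lv n f \<le> A * c"
      using A(2)[of n f] mult_left_mono[OF energy_leD[OF f, of n], of A] A(1) by linarith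
    also have "\<dots> \<le> (A * B + A + B) * c" using A B energy_le_nonneg[OF f] by (simp add: distrib_right)
    finally show "Lv n f \<le> (A * B + A + B) * c" .
  qed
  have "0 < A * B + A + B" using A(1) B(1) by (simp add: add_pos_pos)
  then show thesis using 1 2 3 by (rule that)
qed

lemma limit_form_cong: "(\<And>x. x \<in> VS \<Longrightarrow> f x = g x) \<Longrightarrow> \<E> f = \<E> g"
proof -
  assume "\<And>x. x \<in> VS \<Longrightarrow> f x = g x"
  then have "Lv n f = Lv n g" for n using V_subset_VS by (intro Lv_cong) blast
  then show ?thesis by (simp add: limit_form_def cesaro_energy_def)
qed

lemma limit_form_affine:
  assumes "f \<in> \<F>"
  shows "\<E> (\<lambda>x. a * f x + b) = \<bar>a\<bar> powr p * \<E> f"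
proof -
  have D: "(\<lambda>x. a * f x + b) \<in> \<F>"
    using limit_domain_lin[OF assms limit_domain_const[of 1], of a b] by simp
  have "\<bar>(a * x + b) - (a * y + b)\<bar> powr p = \<bar>a\<bar> powr p * \<bar>x - y\<bar> powr p" for x y
    by (simp add: powr_mult abs_mult flip: right_diff_distrib)
  then have "Lv n (\<lambda>x. a * f x + b) = \<bar>a\<bar> powr p * Lv n f" for n
    unfolding Lv_expand by (simp add: sum_distrib_left mult.left_commute)
  then show ?thesis
    using limit_form_transfer[OF D D assms assms, of 0 1 0 0 "\<bar>a\<bar> powr p" 0]
      limit_form_transfer[OF assms assms D D, of 0 "\<bar>a\<bar> powr p" 0 0 1 0] by simp
qed

lemma limit_form_add_le:
  assumes "f \<in> \<F>" "g \<in> \<F>"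
  shows "\<E> (\<lambda>x. f x + g x) \<le> 2 powr (p - 1) * (\<E> f + \<E> g)"
proof -
  have "1 * Lv n (\<lambda>x. f x + g x) + 0 * Lv n f \<le> 2 powr (p - 1) * Lv n f + 2 powr (p - 1) * Lv n g" for n
  proof (rule Lv_pointwise)
    fix w x y
    show "1 * \<bar>f (fw w x) + g (fw w x) - (f (fw w y) + g (fw w y))\<bar> powr p + 0 * \<bar>f (fw w x) - f (fw w y)\<bar> powr p
        \<le> 2 powr (p - 1) * \<bar>f (fw w x) - f (fw w y)\<bar> powr p + 2 powr (p - 1) * \<bar>g (fw w x) - g (fw w y)\<bar> powr p"
      using powr_abs_add_le[of "f (fw w x) - f (fw w y)" "g (fw w x) - g (fw w y)"]
      by (simp add: distrib_left add_diff_add)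
  qed
  then show ?thesis
    using limit_form_transfer[OF limit_domain_add[OF assms] assms(1) assms, of 0 1 0 0 "2 powr (p - 1)" "2 powr (p - 1)"]
    by (simp add: distrib_left)
qed

lemma limit_form_unit_cut:
  assumes "f \<in> \<F>"
  shows "\<E> (unit_cut f) \<le> \<E> f"
proof -
  have "1 * Lv n (unit_cut f) + 0 * Lv n f \<le> 1 * Lv n f + 0 * Lv n f" for n
    using p unit_cut_diff_le by (intro Lv_pointwise) (auto intro!: powr_mono2)
  then show ?thesis
    using limit_form_transfer[OF limit_domain_unit_cut[OF assms] assms assms assms, of 0 1 0 0 1 0] by simp
qed

text \<open>Uniform convexity in additive form. It needs no normalization and so applies to
  near-minimizers whose energies agree only approximately.\<close>

lemma limit_form_convexity:
  assumes \<kappa>: "0 < \<kappa>"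
  obtains C where "0 < C" "\<And>f g. f \<in> \<F> \<Longrightarrow> g \<in> \<F> \<Longrightarrow> \<E> (\<lambda>x. f x - g x) \<le>
    \<kappa> * (\<E> f + \<E> g) + C * ((\<E> f + \<E> g) / 2 - \<E> (\<lambda>x. (f x + g x) / 2))"
proof -
  obtain C where C: "0 < C" "\<And>a b. \<bar>a - b\<bar> powr p \<le>
    \<kappa> * (\<bar>a\<bar> powr p + \<bar>b\<bar> powr p) + C * ((\<bar>a\<bar> powr p + \<bar>b\<bar> powr p) / 2 - \<bar>(a + b) / 2\<bar> powr p)"
    using uniform_convexity_inequality[OF p \<kappa>] by metis
  show thesis
  proof (rule that[OF C(1)])
    fix f g assume fg: "f \<in> \<F>" "g \<in> \<F>"
    have "1 * Lv n (\<lambda>x. f x - g x) + C * Lv n (\<lambda>x. (f x + g x) / 2) \<le> (\<kappa> + C / 2) * Lv n f + (\<kappa> + C / 2) * Lv n g" for n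
    proof (rule Lv_pointwise)
      fix w x y
      have eq: "f (fw w x) - g (fw w x) - (f (fw w y) - g (fw w y)) = (f (fw w x) - f (fw w y)) - (g (fw w x) - g (fw w y))"
        "(f (fw w x) + g (fw w x)) / 2 - (f (fw w y) + g (fw w y)) / 2 = ((f (fw w x) - f (fw w y)) + (g (fw w x) - g (fw w y))) / 2"
        by (simp_all add: field_simps)
      show "1 * \<bar>f (fw w x) - g (fw w x) - (f (fw w y) - g (fw w y))\<bar> powr p
          + C * \<bar>(f (fw w x) + g (fw w x)) / 2 - (f (fw w y) + g (fw w y)) / 2\<bar> powr p
        \<le> (\<kappa> + C / 2) * \<bar>f (fw w x) - f (fw w y)\<bar> powr p + (\<kappa> + C / 2) * \<bar>g (fw w x) - g (fw w y)\<bar> powr p"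
        unfolding eq using C(2)[of "f (fw w x) - f (fw w y)" "g (fw w x) - g (fw w y)"]
        by (simp add: algebra_simps add_divide_distrib)
    qed
    then have "1 * \<E> (\<lambda>x. f x - g x) + C * \<E> (\<lambda>x. (f x + g x) / 2) + 0 \<le> (\<kappa> + C / 2) * \<E> f + (\<kappa> + C / 2) * \<E> g"
      by (intro limit_form_transfer limit_domain_diff limit_domain_midpoint fg) simp
    then show "\<E> (\<lambda>x. f x - g x) \<le> \<kappa> * (\<E> f + \<E> g) + C * ((\<E> f + \<E> g) / 2 - \<E> (\<lambda>x. (f x + g x) / 2))"
      by (simp add: algebra_simps add_divide_distrib)
  qed
qed

lemma uniformly_convex: "uniformly_convex_form \<F> \<E>"
  unfolding uniformly_convex_form_def
proof (intro allI impI)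
  fix \<delta> :: real assume \<delta>: "0 < \<delta>"
  \<comment> \<open>With \<E> f = \<E> g = 1 the first term of the convexity inequality is \<delta>
    / 2. The other half of \<delta> must come from C times the gap, which is where \<delta> / (2 *
    C) originates.\<close>
  then have \<delta>4: "0 < \<delta> / 4" by simp
  obtain C where C: "0 < C" "\<And>f g. f \<in> \<F> \<Longrightarrow> g \<in> \<F> \<Longrightarrow> \<E> (\<lambda>x. f x - g x) \<le>
    \<delta> / 4 * (\<E> f + \<E> g) + C * ((\<E> f + \<E> g) / 2 - \<E> (\<lambda>x. (f x + g x) / 2))"
    by (rule limit_form_convexity[OF \<delta>4]) blast
  show "\<exists>\<epsilon>>0. \<forall>f\<in>\<F>. \<forall>g\<in>\<F>. \<E> f = 1 \<and> \<E> g = 1 \<and> \<delta> \<le> \<E> (\<lambda>x. f x - g x) \<longrightarrow>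
      \<E> (\<lambda>x. (f x + g x) / 2) \<le> 1 - \<epsilon>"
  proof (intro exI[of _ "\<delta> / (2 * C)"] conjI ballI impI)
    show "0 < \<delta> / (2 * C)" using \<delta> C(1) by simp
    fix f g assume "f \<in> \<F>" "g \<in> \<F>" "\<E> f = 1 \<and> \<E> g = 1 \<and> \<delta> \<le> \<E> (\<lambda>x. f x - g x)"
    then have "\<delta> / 2 \<le> C * (1 - \<E> (\<lambda>x. (f x + g x) / 2))" using C(2)[of f g] by simp
    then show "\<E> (\<lambda>x. (f x + g x) / 2) \<le> 1 - \<delta> / (2 * C)" using C(1) by (simp add: field_simps)
  qed
qed

text \<open>If g is nonzero at a corner of a cell of diameter below the distance from the support of
  g to K - U, all corners of the cell lie in U, where f is constant. So from some level on each p-th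
  power splits exactly, and transferring both inequalities gives equality.\<close>

lemma strongly_local: "strongly_local K \<F> \<E>"
  unfolding strongly_local_def
proof (intro ballI impI, elim exE conjE)
  fix f g U
  assume "f \<in> continuous_core K \<F>" "g \<in> continuous_core K \<F>"
  then have fg: "f \<in> \<F>" "g \<in> \<F>" by (auto simp: continuous_core_def)
  assume U: "openin (top_of_set K) U" "support_in K g \<subseteq> U" "constant_on_set U f"
  obtain T where T: "open T" "U = K \<inter> T" using U(1) by (auto simp: openin_open)
  have "compact (support_in K g)" unfolding support_in_def using compact by (simp add: compact_Int_closed)
  moreover have "closed (K - T)" using compact T(1) by (auto intro: compact_imp_closed)
  moreover have "support_in K g \<inter> (K - T) = {}" using U(2) T(2) by blast
  ultimately obtain d where d: "0 < d" "\<And>x y. x \<in> support_in K g \<Longrightarrow> y \<in> K - T \<Longrightarrow> d \<le> dist x y"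
    using separate_compact_closed by meson
  obtain n0 where n0: "\<And>n w x y. n0 \<le> n \<Longrightarrow> w \<in> W n \<Longrightarrow> x \<in> K \<Longrightarrow> y \<in> K \<Longrightarrow> dist (fw w x) (fw w y) < d"
    using cells_small[OF d(1)] by metis
  have in_U: "fw w y \<in> U" if "n0 \<le> n" "w \<in> W n" "x \<in> V 0" "y \<in> V 0" "g (fw w x) \<noteq> 0" for n w x y
  proof -
    have xy: "x \<in> K" "y \<in> K" using that(3,4) V0_subset_K by blast+
    then have fK: "fw w x \<in> K" "fw w y \<in> K" using fw_in_K[OF set_words[OF that(2)]] by blast+
    have "fw w x \<in> {x \<in> K. g x \<noteq> 0}" using fK that(5) by blast
    from subsetD[OF closure_subset this] have supp: "fw w x \<in> support_in K g" unfolding support_in_def using fK by simp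
    have "fw w y \<notin> K - T"
    proof
      assume "fw w y \<in> K - T"
      with d(2)[OF supp this] n0[OF that(1,2) xy(1,2)] show False by linarith
    qed
    then show ?thesis using fK T(2) by blast
  qed
  have additive: "\<bar>(f (fw w x) + g (fw w x)) - (f (fw w y) + g (fw w y))\<bar> powr p
      = \<bar>f (fw w x) - f (fw w y)\<bar> powr p + \<bar>g (fw w x) - g (fw w y)\<bar> powr p"
    if "n0 \<le> n" "w \<in> W n" "x \<in> V 0" "y \<in> V 0" for n w x y
  proof (cases "g (fw w x) = 0 \<and> g (fw w y) = 0")
    case False
    then have "fw w x \<in> U" "fw w y \<in> U"
      using in_U[OF that(1,2)] that(3,4) by blast+
    then have "f (fw w x) = f (fw w y)" using U(3) unfolding constant_on_set_def by blast
    then show ?thesis by simp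
  qed simp
  have Lv: "1 * Lv n (\<lambda>x. f x + g x) + 0 * Lv n f \<le> 1 * Lv n f + 1 * Lv n g"
    "1 * Lv n f + 1 * Lv n g \<le> 1 * Lv n (\<lambda>x. f x + g x) + 0 * Lv n f" if "n0 \<le> n" for n
    using additive[OF that] by (intro Lv_pointwise; simp)+
  have D: "(\<lambda>x. f x + g x) \<in> \<F>" by (rule limit_domain_add[OF fg])
  show "\<E> (\<lambda>x. f x + g x) = \<E> f + \<E> g"
    using limit_form_transfer[OF D fg(1) fg, of n0 1 0 0 1 1] limit_form_transfer[OF fg D fg(1), of n0 1 1 0 1 0] Lv
    by simp
qed

text \<open>Near-minimizers of \<open>\<E> (f - v)\<close> among the \<open>v \<in> L\<close> which agree with \<open>f\<close> on \<open>V\<^sub>m\<close> form a Cauchy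
  sequence by uniform convexity, and the pointwise limit on the vertices is \<open>f\<close>.\<close>

lemma limit_form_approximation:
  assumes f: "f \<in> \<F>" and L: "L \<subseteq> \<F>" "\<And>u v. u \<in> L \<Longrightarrow> v \<in> L \<Longrightarrow> (\<lambda>x. (u x + v x) / 2) \<in> L"
    and bounded: "\<And>m. \<exists>v\<in>L. (\<forall>x\<in>V m. v x = f x) \<and> \<E> v \<le> B"
    and \<epsilon>: "0 < \<epsilon>"
  obtains v where "v \<in> L" "\<And>x. x \<in> V m \<Longrightarrow> v x = f x" "\<E> (\<lambda>x. f x - v x) < \<epsilon>"
proof -
  obtain C where C: "0 < C" "\<And>f n. f \<in> \<F> \<Longrightarrow> Lv n f \<le> C * \<E> f"
    using limit_form_comparison by metis
  define A where "A m = {v \<in> L. \<forall>x\<in>V m. v x = f x}" for m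
  define d where "d m = Inf ((\<lambda>v. \<E> (\<lambda>x. f x - v x)) ` A m)" for m
  define B' where "B' = 2 powr (p - 1) * (\<E> f + B)"
  have AF: "v \<in> \<F>" if "v \<in> A m" for v m using that L(1) by (auto simp: A_def)
  have A_ne: "A m \<noteq> {}" for m using bounded[of m] by (auto simp: A_def)
  have bdd: "bdd_below ((\<lambda>v. \<E> (\<lambda>x. f x - v x)) ` A m)" for m
    using limit_form_nonneg limit_domain_diff f AF by (intro bdd_belowI[of _ 0]) auto
  have d_le: "d m \<le> \<E> (\<lambda>x. f x - v x)" if "v \<in> A m" for v m
    unfolding d_def using bdd that by (intro cInf_lower) auto
  have A_mono: "A n \<subseteq> A m" if "m \<le> n" for m n using V_mono[OF that] by (auto simp: A_def)
  have d_mono: "d m \<le> d n" if "m \<le> n" for m n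
    unfolding d_def using A_ne bdd A_mono[OF that] by (intro cInf_superset_mono) auto
  have d_B: "d m \<le> B'" for m
  proof -
    obtain v where v: "v \<in> L" "\<forall>x\<in>V m. v x = f x" "\<E> v \<le> B" using bounded by blast
    then have vA: "v \<in> A m" "v \<in> \<F>" using L(1) by (auto simp: A_def)
    have "\<E> (\<lambda>x. f x + (-1 * v x + 0)) \<le> 2 powr (p - 1) * (\<E> f + \<E> (\<lambda>x. -1 * v x + 0))"
      using limit_domain_lin[OF vA(2) vA(2), of "-1" 0] by (intro limit_form_add_le f) simp
    moreover have "\<E> (\<lambda>x. -1 * v x + 0) = \<E> v" by (subst limit_form_affine[OF vA(2)]) simp
    ultimately have "\<E> (\<lambda>x. f x - v x) \<le> 2 powr (p - 1) * (\<E> f + \<E> v)" by simp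
    also have "\<dots> \<le> B'" unfolding B'_def using v(3) by (intro mult_left_mono) auto
    finally show ?thesis using d_le[OF vA(1)] by linarith
  qed
  \<comment> \<open>Higher levels leave fewer competitors, so the infima increase; the energy bound
    B on competitors keeps them bounded.\<close>
  have "incseq d" using d_mono by (simp add: incseq_def)
  moreover have "bdd_above (range d)" using d_B by (auto intro: bdd_aboveI[of _ B'])
  ultimately have d_lim: "d \<longlonglongrightarrow> (SUP n. d n)" by (intro LIMSEQ_incseq_SUP)
  define D where "D = (SUP n. d n)"
  have d_D: "d n \<le> D" for n unfolding D_def using \<open>bdd_above (range d)\<close> by (intro cSUP_upper) auto
  have D0: "0 \<le> D"
  proof -
    have "0 \<le> d 0" unfolding d_def using A_ne limit_form_nonneg limit_domain_diff f AF
      by (intro cInf_greatest) auto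
    then show ?thesis using d_D[of 0] by linarith
  qed
  define \<epsilon>' where "\<epsilon>' = \<epsilon> / (2 * C)"
  have \<epsilon>': "0 < \<epsilon>'" using \<epsilon> C by (simp add: \<epsilon>'_def)
  \<comment> \<open>The bound \<epsilon>' is split in halves: \<kappa> meets two energies of at most
    D + 1, and the constant U meets a gap of at most 2 * \<delta>.\<close>
  define \<kappa> where "\<kappa> = \<epsilon>' / (4 * (D + 1))"
  have \<kappa>: "0 < \<kappa>" using \<epsilon>' D0 by (simp add: \<kappa>_def)
  obtain U where U: "0 < U" "\<And>f g. f \<in> \<F> \<Longrightarrow> g \<in> \<F> \<Longrightarrow> \<E> (\<lambda>x. f x - g x) \<le>
    \<kappa> * (\<E> f + \<E> g) + U * ((\<E> f + \<E> g) / 2 - \<E> (\<lambda>x. (f x + g x) / 2))"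
    by (rule limit_form_convexity[OF \<kappa>]) blast
  define \<delta> where "\<delta> = min 1 (\<epsilon>' / (4 * U))"
  have \<delta>: "0 < \<delta>" "\<delta> \<le> 1" "U * (2 * \<delta>) \<le> \<epsilon>' / 2"
  proof -
    show "0 < \<delta>" "\<delta> \<le> 1" using \<epsilon>' U(1) by (auto simp: \<delta>_def)
    have "U * (2 * \<delta>) \<le> U * (2 * (\<epsilon>' / (4 * U)))" using U(1) by (intro mult_left_mono) (auto simp: \<delta>_def)
    also have "\<dots> = \<epsilon>' / 2" using U(1) by simp
    finally show "U * (2 * \<delta>) \<le> \<epsilon>' / 2" .
  qed
  have "eventually (\<lambda>n. D - \<delta> < d n) sequentially"
    using order_tendstoD(1)[OF d_lim, of "D - \<delta>"] \<delta>(1) by (simp add: D_def)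
  then obtain m0 where m0: "\<And>n. m0 \<le> n \<Longrightarrow> D - \<delta> < d n" by (auto simp: eventually_sequentially)
  define k where "k = max m m0"
  have "\<exists>v. v \<in> A n \<and> \<E> (\<lambda>x. f x - v x) < D + \<delta>" for n
  proof -
    have "Inf ((\<lambda>v. \<E> (\<lambda>x. f x - v x)) ` A n) < D + \<delta>" using d_D[of n] \<delta>(1) by (simp add: d_def)
    from cInf_lessD[OF _ this] A_ne show ?thesis by auto
  qed
  then obtain v where v: "\<And>n. v n \<in> A n" "\<And>n. \<E> (\<lambda>x. f x - v n x) < D + \<delta>" by metis
  have Cauchy: "\<E> (\<lambda>x. v l x - v k x) \<le> \<epsilon>'" if "k \<le> l" for l
  proof -
    have vk: "v k \<in> A k" "v l \<in> A k" using v(1) A_mono[OF that] by auto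
    \<comment> \<open>The midpoint is again a competitor at level k, so its distance to f is at
      least d k > D - \<delta>. Both endpoints being below D + \<delta>, the convexity gap is at
      most 2 * \<delta>.\<close>
    then have mid: "(\<lambda>x. (v k x + v l x) / 2) \<in> A k" using L(2) by (auto simp: A_def)
    let ?f = "\<lambda>x. f x - v k x" and ?g = "\<lambda>x. f x - v l x"
    have F: "?f \<in> \<F>" "?g \<in> \<F>" using vk AF f by (auto intro: limit_domain_diff)
    have "(\<lambda>x. (?f x + ?g x) / 2) = (\<lambda>x. f x - (v k x + v l x) / 2)" by (simp add: fun_eq_iff field_simps)
    then have "D - \<delta> \<le> \<E> (\<lambda>x. (?f x + ?g x) / 2)" using d_le[OF mid] m0[of k] by (simp add: k_def)
    moreover have E: "\<E> ?f \<le> D + \<delta>" "\<E> ?g \<le> D + \<delta>" using v(2)[of k] v(2)[of l] by auto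
    moreover have "(a + b) / 2 - c \<le> 2 * \<delta>" if "D - \<delta> \<le> c" "a \<le> D + \<delta>" "b \<le> D + \<delta>" for a b c
      using that by (simp add: field_simps)
    ultimately have gap: "(\<E> ?f + \<E> ?g) / 2 - \<E> (\<lambda>x. (?f x + ?g x) / 2) \<le> 2 * \<delta>" by blast
    have "\<E> (\<lambda>x. ?f x - ?g x) \<le> \<kappa> * (\<E> ?f + \<E> ?g) + U * ((\<E> ?f + \<E> ?g) / 2 - \<E> (\<lambda>x. (?f x + ?g x) / 2))"
      by (rule U(2)[OF F])
    also have "\<dots> \<le> \<kappa> * (2 * (D + 1)) + U * (2 * \<delta>)"
      using gap E \<delta>(2) \<kappa> U(1) by (intro add_mono mult_left_mono) auto
    also have "\<kappa> * (2 * (D + 1)) = \<epsilon>' / 2" using D0 by (simp add: \<kappa>_def field_simps)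
    finally show ?thesis using \<delta>(3) by simp
  qed
  have vk: "v k \<in> \<F>" "v k \<in> L" using AF[OF v(1)[of k]] v(1)[of k] by (simp_all add: A_def)
  have "Lv n (\<lambda>x. f x - v k x) \<le> C * \<epsilon>'" for n
  proof -
    \<comment> \<open>A later competitor coincides with f on V_n, so the Cauchy estimate bounds the
      level energy of f - v k without forming a limit.\<close>
    define l where "l = max n k"
    have "Lv n (\<lambda>x. f x - v k x) = Lv n (\<lambda>x. v l x - v k x)"
      using v(1)[of l] V_mono[of n l] by (intro Lv_cong) (auto simp: A_def l_def)
    also have "\<dots> \<le> C * \<E> (\<lambda>x. v l x - v k x)"
      using v(1) AF vk by (intro C(2) limit_domain_diff) auto
    also have "\<dots> \<le> C * \<epsilon>'" using Cauchy[of l] C(1) by (intro mult_left_mono) (auto simp: l_def)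
    finally show ?thesis .
  qed
  then have "\<E> (\<lambda>x. f x - v k x) \<le> C * \<epsilon>'" by (intro limit_form_le limit_domain_diff f vk)
  also have "\<dots> < \<epsilon>" using C \<epsilon> by (simp add: \<epsilon>'_def)
  finally show thesis using v(1)[of k] V_mono[of m k] by (intro that[OF vk(2)]) (auto simp: A_def k_def)
qed

end

section \<open>The embedding into \<open>L\<^sup>p\<close>\<close>

text \<open>Induction from the two-term case \<open>powr_sum_le\<close>, where t is the share of the
  earlier weights in the total weight.\<close>

lemma weighted_power_mean:
  fixes b d :: "nat \<Rightarrow> real"
  assumes p: "1 < p" and b: "\<And>k. 0 < b k" and n: "0 < n"
  shows "(\<Sum>k<n. \<bar>d k\<bar>) powr p \<le> (\<Sum>k<n. b k) powr (p - 1) * (\<Sum>k<n. b k powr (1 - p) * \<bar>d k\<bar> powr p)"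
proof -
  have "(\<Sum>k<Suc n. b k) powr (1 - p) * (\<Sum>k<Suc n. \<bar>d k\<bar>) powr p \<le> (\<Sum>k<Suc n. b k powr (1 - p) * \<bar>d k\<bar> powr p)" for n
  proof (induction n)
    case (Suc n)
    define B X where "B = (\<Sum>k<Suc n. b k)" and "X = (\<Sum>k<Suc n. \<bar>d k\<bar>)"
    have B: "0 < B" unfolding B_def using b by (intro sum_pos) auto
    have X: "0 \<le> X" unfolding X_def by (intro sum_nonneg) auto
    have bn: "0 < b (Suc n)" by (rule b)
    define t where "t = B / (B + b (Suc n))"
    have t: "0 < t" "t < 1" "1 - t = b (Suc n) / (B + b (Suc n))" using B bn by (auto simp: t_def field_simps)
    have "(B + b (Suc n)) powr (1 - p) * (X + \<bar>d (Suc n)\<bar>) powr p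
      \<le> (B + b (Suc n)) powr (1 - p) * (t powr (1 - p) * X powr p + (1 - t) powr (1 - p) * \<bar>d (Suc n)\<bar> powr p)"
      using powr_sum_le[OF p t(1,2) X, of "\<bar>d (Suc n)\<bar>"] by (intro mult_left_mono) auto
    also have "\<dots> = B powr (1 - p) * X powr p + b (Suc n) powr (1 - p) * \<bar>d (Suc n)\<bar> powr p"
    proof -
      have "(B + b (Suc n)) powr (1 - p) * t powr (1 - p) = B powr (1 - p)"
        "(B + b (Suc n)) powr (1 - p) * (1 - t) powr (1 - p) = b (Suc n) powr (1 - p)"
        using B bn t by (simp_all add: t_def flip: powr_mult)
      then show ?thesis by (simp add: distrib_left flip: mult.assoc)
    qed
    finally show ?case using Suc.IH by (simp add: B_def X_def)
  qed (use b in simp)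
  from this[of "n - 1"] n
  have le: "(\<Sum>k<n. b k) powr (1 - p) * (\<Sum>k<n. \<bar>d k\<bar>) powr p \<le> (\<Sum>k<n. b k powr (1 - p) * \<bar>d k\<bar> powr p)" by simp
  have B: "0 < (\<Sum>k<n. b k)" using b n by (intro sum_pos) auto
  have "(\<Sum>k<n. \<bar>d k\<bar>) powr p = (\<Sum>k<n. b k) powr (p - 1) * ((\<Sum>k<n. b k) powr (1 - p) * (\<Sum>k<n. \<bar>d k\<bar>) powr p)"
    using B by (simp flip: mult.assoc powr_add)
  also have "\<dots> \<le> (\<Sum>k<n. b k) powr (p - 1) * (\<Sum>k<n. b k powr (1 - p) * \<bar>d k\<bar> powr p)"
    using le by (intro mult_left_mono) auto
  finally show ?thesis .
qed

locale pcf_measure = pcf_limit_form F K N r p E s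
  for F :: "nat \<Rightarrow> 'a::euclidean_space \<Rightarrow> 'a" and K :: "'a set" and N :: nat
    and r :: "nat \<Rightarrow> real" and p :: real and E :: "('a \<Rightarrow> real) \<Rightarrow> real" and s :: "nat \<Rightarrow> nat" +
  fixes \<mu> :: "'a measure"
  assumes radon: "radon_probability_on K \<mu>"
    and kappa_summable: "summable (\<lambda>m. kappa N F K r \<mu> m powr (1 / p))"
begin

sublocale prob_space \<mu>
  using radon by (simp add: radon_probability_on_def)

lemma sets_\<mu>: "sets \<mu> = sets (restrict_space borel K)"
  using radon by (simp add: radon_probability_on_def)

lemma space_\<mu>: "space \<mu> = K"
  using sets_eq_imp_space_eq[OF sets_\<mu>] by (simp add: space_restrict_space)

lemma borel_subset_sets: "A \<in> sets borel \<Longrightarrow> A \<subseteq> K \<Longrightarrow> A \<in> sets \<mu>"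
  unfolding sets_\<mu> sets_restrict_space by (auto intro!: image_eqI[of _ _ A])

lemma countable_sets: "countable A \<Longrightarrow> A \<subseteq> K \<Longrightarrow> A \<in> sets \<mu>"
  by (rule borel_subset_sets[OF sets.countable]) auto

lemma countable_VS: "countable VS"
  unfolding all_vertices_def using finite_V by (intro countable_UN) (auto intro: countable_finite)

lemma cell_sets: "w \<in> W n \<Longrightarrow> fw w ` K \<in> sets \<mu>"
  using compact_cell[OF set_words] fw_in_K[OF set_words]
  by (intro borel_subset_sets borel_closed compact_imp_closed) auto

abbreviation "\<kappa> \<equiv> kappa N F K r \<mu>"

lemma words_nonempty: "W n \<noteq> {}"
proof -
  have "replicate n 1 \<in> W n" using N_ge_2 by (auto simp: words_def)
  then show ?thesis by blast
qed

lemma kappa_ge: "w \<in> W m \<Longrightarrow> rw w * measure \<mu> (fw w ` K) \<le> \<kappa> m"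
  unfolding kappa_def by (intro Max_ge) auto

lemma kappa_nonneg: "0 \<le> \<kappa> m"
proof -
  obtain w where w: "w \<in> W m" using words_nonempty by blast
  have "0 \<le> rw w * measure \<mu> (fw w ` K)" using rw_pos[OF w] by simp
  then show ?thesis using kappa_ge[OF w] by linarith
qed

text \<open>Points of \<open>K\<close> outside the vertices lie in a unique cell of each level; for the countably
  many vertices an address is chosen arbitrarily.\<close>

definition address :: "'a \<Rightarrow> nat \<Rightarrow> nat" where
  "address x = (SOME \<omega>. \<omega> \<in> \<Sigma> \<and> code \<omega> = x)"

definition cell :: "nat \<Rightarrow> 'a \<Rightarrow> nat list" where
  "cell m x = address_prefix (address x) m"

lemma address:
  assumes "x \<in> K"
  shows "address x \<in> \<Sigma> \<and> code (address x) = x"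
proof -
  obtain \<omega> where "\<omega> \<in> \<Sigma>" "code \<omega> = x" using code_surj[OF assms] .
  then show ?thesis unfolding address_def by (intro someI[of "\<lambda>\<omega>. \<omega> \<in> \<Sigma> \<and> code \<omega> = x" \<omega>]) simp
qed

lemma cell_words: "x \<in> K \<Longrightarrow> cell m x \<in> W m"
  unfolding cell_def using address by (intro address_prefix_in_words) blast

lemma cell_Suc: "cell (Suc m) x = cell m x @ [address x m]"
  by (simp add: cell_def)

lemma in_cell: "x \<in> K \<Longrightarrow> x \<in> fw (cell m x) ` K"
  using code_in_cell[of "address x" m] address[of x] by (simp add: cell_def)

lemma cell_unique:
  assumes "x \<in> K" "x \<notin> VS" "w \<in> W m" "x \<in> fw w ` K"
  shows "w = cell m x"
proof (rule ccontr)
  assume ne: "w \<noteq> cell m x"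
  obtain y where y: "y \<in> K" "x = fw w y" using assms(4) by blast
  obtain z where z: "z \<in> K" "x = fw (cell m x) z" using in_cell[OF assms(1)] by blast
  have "fw w y = fw (cell m x) z" using y(2) z(2) by simp
  from cells_meet[OF assms(3) cell_words[OF assms(1)] ne y(1) z(1) this] have "y \<in> VS"
    using V_subset_VS by blast
  then show False using fw_in_VS[OF assms(3)] y(2) assms(2) by blast
qed

definition cell_value :: "('a \<Rightarrow> real) \<Rightarrow> nat \<Rightarrow> 'a \<Rightarrow> real" where
  "cell_value f m x = f (fw (cell m x) base_vertex)"

text \<open>On the countable set of vertices the value is prescribed, so that \<Psi> f extends f
  literally; elsewhere it is the limit along the chosen cells, which exists almost everywhere for f
  in the domain. The two prescriptions have to agree at vertices that carry mass, see
  \<open>cell_value_tendsto_atom\<close>.\<close>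

definition \<Psi> :: "('a \<Rightarrow> real) \<Rightarrow> 'a \<Rightarrow> real" where
  "\<Psi> f x = (if x \<in> VS then f x else if x \<in> K then lim (\<lambda>m. cell_value f m x) else 0)"

lemma \<Psi>_vertex [simp]: "x \<in> VS \<Longrightarrow> \<Psi> f x = f x"
  by (simp add: \<Psi>_def)

lemma cell_base_VS: "x \<in> K \<Longrightarrow> fw (cell m x) base_vertex \<in> VS"
  using cell_words fw_in_VS base_vertex by blast

lemma \<Psi>_cong:
  assumes "\<And>x. x \<in> VS \<Longrightarrow> f x = g x"
  shows "\<Psi> f = \<Psi> g"
proof
  fix x
  have "x \<in> K \<Longrightarrow> cell_value f m x = cell_value g m x" for m
    using assms cell_base_VS by (simp add: cell_value_def)
  then show "\<Psi> f x = \<Psi> g x" using assms by (simp add: \<Psi>_def)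
qed

text \<open>The arbitrary choice of addresses affects only the countable set of vertices; away from
  it the level set of w is the cell F_w K.\<close>

lemma measurable_cell: "cell m \<in> measurable \<mu> (count_space (W m))"
proof (subst measurable_count_space_eq2[OF finite_words], intro conjI ballI)
  show "cell m \<in> space \<mu> \<rightarrow> W m" using cell_words by (auto simp: space_\<mu>)
  fix w assume w: "w \<in> W m"
  have "cell m -` {w} \<inter> space \<mu> = (fw w ` K - VS) \<union> (cell m -` {w} \<inter> VS)"
  proof (intro set_eqI iffI)
    fix x assume "x \<in> cell m -` {w} \<inter> space \<mu>"
    then show "x \<in> (fw w ` K - VS) \<union> (cell m -` {w} \<inter> VS)" using in_cell[of x m] by (auto simp: space_\<mu>)
  next
    fix x assume x: "x \<in> (fw w ` K - VS) \<union> (cell m -` {w} \<inter> VS)"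
    then have "x \<in> K" using fw_in_K[OF set_words[OF w]] VS_subset_K by blast
    then show "x \<in> cell m -` {w} \<inter> space \<mu>" using x cell_unique[OF _ _ w] by (auto simp: space_\<mu>)
  qed
  moreover have "VS \<in> sets \<mu>" "cell m -` {w} \<inter> VS \<in> sets \<mu>"
    using countable_VS VS_subset_K by (auto intro!: countable_sets intro: countable_Int2)
  ultimately show "cell m -` {w} \<inter> space \<mu> \<in> sets \<mu>" using cell_sets[OF w] by auto
qed

lemma measurable_cell_value [measurable]: "cell_value f m \<in> borel_measurable \<mu>"
proof -
  have "(\<lambda>w. f (fw w base_vertex)) \<in> measurable (count_space (W m)) borel" by simp
  from measurable_compose[OF measurable_cell this] show ?thesis
    by (simp add: cell_value_def[abs_def])
qed

lemma measurable_\<Psi> [measurable]: "\<Psi> f \<in> borel_measurable \<mu>"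
proof (rule measurable_discrete_difference[where X = VS])
  show "(\<lambda>x. lim (\<lambda>m. cell_value f m x)) \<in> borel_measurable \<mu>" by measurable
  show "{x} \<in> sets \<mu>" if "x \<in> VS" for x using that VS_subset_K by (intro countable_sets) auto
  show "lim (\<lambda>m. cell_value f m x) = \<Psi> f x" if "x \<in> space \<mu>" "x \<notin> VS" for x
    using that by (simp add: \<Psi>_def space_\<mu>)
qed (auto intro: countable_VS)

text \<open>Holds at every point of K, not only almost everywhere: off the vertices cells are
  unique, so those of F_w x are the cells of x with w put in front, and finitely many initial terms
  do not change a limit.\<close>

lemma \<Psi>_cell:
  assumes w: "w \<in> W n" and x: "x \<in> K"
  shows "\<Psi> (f \<circ> fw w) x = \<Psi> f (fw w x)"
proof (cases "x \<in> VS")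
  case True
  then show ?thesis using fw_in_VS[OF w True] by simp
next
  case False
  have wx: "fw w x \<in> K" "fw w x \<notin> VS"
    using fw_in_K[OF set_words[OF w] x] VS_preimage[OF w x] False by auto
  have "cell_value f (m + n) (fw w x) = cell_value (f \<circ> fw w) m x" for m
  proof -
    obtain y where y: "y \<in> K" "x = fw (cell m x) y" using in_cell[OF x] by blast
    have "w @ cell m x \<in> W (m + n)" using append_in_words[OF w cell_words[OF x, of m]] by (simp add: add.commute)
    moreover have "fw w x = fw (w @ cell m x) y" using y(2) by (simp add: word_map_append)
    then have "fw w x \<in> fw (w @ cell m x) ` K" using y(1) by (metis imageI)
    ultimately have "w @ cell m x = cell (m + n) (fw w x)" by (rule cell_unique[OF wx])
    then have "cell (m + n) (fw w x) = w @ cell m x" ..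
    then show ?thesis by (simp add: cell_value_def word_map_append)
  qed
  then have "(\<lambda>m. cell_value (f \<circ> fw w) m x) = (\<lambda>m. cell_value f (m + n) (fw w x))" by simp
  then have "lim (\<lambda>m. cell_value (f \<circ> fw w) m x) = lim (\<lambda>m. cell_value f m (fw w x))"
  proof -
    have "(\<lambda>m. cell_value f (m + n) (fw w x)) \<longlonglongrightarrow> L \<longleftrightarrow> (\<lambda>m. cell_value f m (fw w x)) \<longlonglongrightarrow> L" for L
      using LIMSEQ_ignore_initial_segment[of "\<lambda>m. cell_value f m (fw w x)" L n]
        LIMSEQ_offset[of "\<lambda>m. cell_value f m (fw w x)" n L] by blast
    then show ?thesis using \<open>(\<lambda>m. cell_value (f \<circ> fw w) m x) = _\<close> by (simp add: lim_def)
  qed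
  then show ?thesis using False x wx by (simp add: \<Psi>_def)
qed

lemma cell_base_tendsto:
  assumes x: "x \<in> K"
  shows "(\<lambda>m. fw (cell m x) base_vertex) \<longlonglongrightarrow> x"
proof (rule metric_LIMSEQ_I)
  fix e :: real assume "0 < e"
  then obtain n0 where n0: "\<And>n w x y. n0 \<le> n \<Longrightarrow> w \<in> W n \<Longrightarrow> x \<in> K \<Longrightarrow> y \<in> K \<Longrightarrow> dist (fw w x) (fw w y) < e"
    using cells_small by metis
  have "dist (fw (cell m x) base_vertex) x < e" if m: "n0 \<le> m" for m
  proof -
    obtain y where y: "y \<in> K" "x = fw (cell m x) y" using in_cell[OF x] by blast
    have "base_vertex \<in> K" using base_vertex VS_subset_K by blast
    from n0[OF m cell_words[OF x, of m] this y(1)] show ?thesis using y(2) by simp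
  qed
  then show "\<exists>n0. \<forall>m\<ge>n0. dist (fw (cell m x) base_vertex) x < e" by blast
qed

lemma closure_VS: "closure VS = K"
  using K_subset_closure_VS closure_minimal[OF VS_subset_K compact_imp_closed[OF compact]] by blast

lemma continuous_\<Psi>:
  assumes "uniformly_continuous_on VS f"
  shows "continuous_on K (\<Psi> f)"
proof -
  obtain g where g: "uniformly_continuous_on (closure VS) g" "\<And>x. x \<in> VS \<Longrightarrow> f x = g x"
    using uniformly_continuous_on_extension_on_closure[OF assms] by metis
  then have cont: "continuous_on K g" unfolding closure_VS by (intro uniformly_continuous_imp_continuous)
  have "\<Psi> f x = g x" if x: "x \<in> K" for x
  proof (cases "x \<in> VS")
    case False
    have "(\<lambda>m. g (fw (cell m x) base_vertex)) \<longlonglongrightarrow> g x"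
      using cell_base_VS[OF x] VS_subset_K
      by (intro continuous_on_tendsto_compose[OF cont cell_base_tendsto[OF x] x]) (auto intro!: always_eventually)
    then have "(\<lambda>m. cell_value f m x) \<longlonglongrightarrow> g x" using g(2)[OF cell_base_VS[OF x]] by (simp add: cell_value_def)
    then show ?thesis using False x by (simp add: \<Psi>_def limI)
  qed (use g in simp)
  with cont show ?thesis by (simp cong: continuous_on_cong)
qed

lemma kappa_tendsto: "\<kappa> \<longlonglongrightarrow> 0"
proof -
  have "(\<lambda>m. (\<kappa> m powr (1 / p)) powr p) \<longlonglongrightarrow> 0 powr p"
    using p by (intro tendsto_powr' summable_LIMSEQ_zero[OF kappa_summable] tendsto_const) auto
  then show ?thesis using p kappa_nonneg by (simp add: powr_powr)
qed

text \<open>Dividing \<kappa>_m by the mass of y bounds the weights of the chosen cells around y, so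
  these tend to 0 and with them the energy of f in the cells. From the level of y on, y and the
  image of the base vertex are both corners of the cell.\<close>

lemma cell_value_tendsto_atom:
  assumes f: "f \<in> \<F>" and y: "y \<in> VS" "0 < measure \<mu> {y}"
  shows "(\<lambda>m. cell_value f m y) \<longlonglongrightarrow> f y"
proof -
  obtain Cl where Cl: "0 < Cl" "\<And>f x y. x \<in> V 0 \<Longrightarrow> y \<in> V 0 \<Longrightarrow> \<bar>f x - f y\<bar> powr p \<le> Cl * E f"
    using energies_M_lower[OF p E_M finite_V] by metis
  obtain c where c: "energy_le f c" using f limit_domain_iff by blast
  have yK: "y \<in> K" using y VS_subset_K by blast
  obtain n where n: "y \<in> V n" using y(1) unfolding all_vertices_def by blast
  have bound: "\<bar>f y - cell_value f m y\<bar> powr p \<le> Cl * (\<kappa> m / measure \<mu> {y} * c)" if m: "n \<le> m" for m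
  proof -
    let ?w = "cell m y"
    have w: "?w \<in> W m" by (rule cell_words[OF yK])
    obtain z where z: "z \<in> K" "y = fw ?w z" using in_cell[OF yK] by blast
    have "y \<in> V m" using n V_mono[OF m] by blast
    then obtain v q where v: "v \<in> W m" "q \<in> V 0" "y = fw v q" using vertices_eq[of N F K m] by blast
    have z0: "z \<in> V 0"
    proof (cases "?w = v")
      case True
      then have "z = q" using z(2) v(3) inj_fw[OF set_words[OF w]] by (metis injD)
      then show ?thesis using v(2) by simp
    next
      case False
      have "fw ?w z = fw v q" using z(2) v(3) by simp
      from cells_meet[OF w v(1) False z(1) _ this] show ?thesis using v(2) V0_subset_K by blast
    qed
    have "measure \<mu> {y} \<le> measure \<mu> (fw ?w ` K)" using in_cell[OF yK] cell_sets[OF w] by (intro finite_measure_mono) auto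
    then have "rw ?w * measure \<mu> {y} \<le> \<kappa> m"
      using kappa_ge[OF w] mult_left_mono[of "measure \<mu> {y}" "measure \<mu> (fw ?w ` K)" "rw ?w"] rw_pos[OF w] by linarith
    then have rw: "rw ?w \<le> \<kappa> m / measure \<mu> {y}" using y(2) by (simp add: field_simps)
    have "\<bar>f y - cell_value f m y\<bar> = \<bar>(f \<circ> fw ?w) z - (f \<circ> fw ?w) base_vertex\<bar>"
      using z(2) by (simp add: cell_value_def)
    also have "\<dots> powr p \<le> Cl * E (f \<circ> fw ?w)" by (rule Cl(2)[OF z0 base_vertex(1)])
    also have "\<dots> \<le> Cl * (rw ?w * c)" using energy_leD[OF energy_le_cell[OF c w], of 0] Cl(1) by simp
    also have "\<dots> \<le> Cl * (\<kappa> m / measure \<mu> {y} * c)"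
      using rw Cl(1) energy_le_nonneg[OF c] by (intro mult_left_mono mult_right_mono) auto
    finally show ?thesis .
  qed
  have "(\<lambda>m. Cl * (\<kappa> m / measure \<mu> {y} * c)) \<longlonglongrightarrow> Cl * (0 / measure \<mu> {y} * c)"
    using y(2) by (intro tendsto_intros kappa_tendsto) auto
  then have lim: "(\<lambda>m. Cl * (\<kappa> m / measure \<mu> {y} * c)) \<longlonglongrightarrow> 0" by simp
  have "(\<lambda>m. \<bar>f y - cell_value f m y\<bar> powr p) \<longlonglongrightarrow> 0"
  proof (rule Lim_null_comparison[OF _ lim])
    show "eventually (\<lambda>m. norm (\<bar>f y - cell_value f m y\<bar> powr p) \<le> Cl * (\<kappa> m / measure \<mu> {y} * c)) sequentially"
      using eventually_ge_at_top[of n] by eventually_elim (drule bound, simp)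
  qed
  then have "(\<lambda>m. (\<bar>f y - cell_value f m y\<bar> powr p) powr (1 / p)) \<longlonglongrightarrow> 0 powr (1 / p)"
    using p by (intro tendsto_powr' tendsto_const) auto
  then have "(\<lambda>m. \<bar>f y - cell_value f m y\<bar>) \<longlonglongrightarrow> 0" using p by (simp add: powr_powr)
  then have "(\<lambda>m. f y - cell_value f m y) \<longlonglongrightarrow> 0" by (simp add: tendsto_rabs_zero_iff)
  from tendsto_diff[OF tendsto_const[of "f y"] this] show ?thesis by simp
qed

text \<open>Hoelder's inequality with the summable weights \<open>b\<^sub>k = \<kappa>\<^sub>k\<^sup>1\<^sup>/\<^sup>p + 2\<^sup>-\<^sup>k\<close>; the second summand only
  ensures that they do not vanish.\<close>

lemma cell_value_convergence:
  obtains A where "0 < A" "\<And>f c. energy_le f c \<Longrightarrow> \<exists>H. H \<in> borel_measurable \<mu> \<and>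
    (\<integral>\<^sup>+x. ennreal (H x) \<partial>\<mu>) \<le> ennreal (A * c) \<and>
    (AE x in \<mu>. (\<lambda>m. cell_value f m x) \<longlonglongrightarrow> \<Psi> f x \<and> \<bar>\<Psi> f x - f base_vertex\<bar> powr p \<le> H x)"
proof -
  obtain C where C: "0 < C" "\<And>f x y. x \<in> V 1 \<Longrightarrow> y \<in> V 1 \<Longrightarrow> \<bar>f x - f y\<bar> powr p \<le> C * Lam (Suc 0) f"
    using energies_M_lower[OF p Lam_1_energies_M finite_V] by metis
  define b where "b k = \<kappa> k powr (1 / p) + (1/2) ^ k" for k
  have b_pos: "0 < b k" for k unfolding b_def by (intro add_nonneg_pos) auto
  have b_summable: "summable b" unfolding b_def by (intro summable_add kappa_summable) (simp add: summable_geometric)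
  define S where "S = suminf b"
  have S: "(\<Sum>k<n. b k) \<le> S" for n unfolding S_def using b_pos by (intro sum_le_suminf b_summable) (auto intro: less_imp_le)
  have S_pos: "0 < S" unfolding S_def using b_pos by (intro suminf_pos b_summable)
  have kb: "\<kappa> k \<le> b k powr p" for k
  proof -
    have "\<kappa> k = (\<kappa> k powr (1 / p)) powr p" using p kappa_nonneg[of k] by (simp add: powr_powr)
    also have "\<dots> \<le> b k powr p" unfolding b_def using p by (intro powr_mono2) auto
    finally show ?thesis .
  qed
  show thesis
  proof (rule that[of "S powr (p - 1) * (C * S)"])
    show "0 < S powr (p - 1) * (C * S)" using S_pos C by simp
    fix f c assume c: "energy_le f c"
    have c0: "0 \<le> c" by (rule energy_le_nonneg[OF c])
    have f: "f \<in> \<F>" using c by (rule limit_domainI)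
    \<comment> \<open>A majorant of the p-th power of the k-th increment: consecutive base points
      both lie in F_w V_1 for the current cell w. Summing over all cells containing x makes it
      independent of the chosen address.\<close>
    define G where "G k x = (\<Sum>w\<in>W k. C * Lam (Suc 0) (f \<circ> fw w) * indicator (fw w ` K) x)" for k x
    have Lam0: "0 \<le> C * Lam (Suc 0) g" for g using C(1) Lam_nonneg by simp
    have G0: "0 \<le> G k x" for k x unfolding G_def by (intro sum_nonneg mult_nonneg_nonneg[OF Lam0]) simp
    have G_meas [measurable]: "G k \<in> borel_measurable \<mu>" for k
      unfolding G_def[abs_def] using cell_sets
      by (intro borel_measurable_sum borel_measurable_times borel_measurable_indicator) auto
    have d_le: "\<bar>cell_value f (Suc k) x - cell_value f k x\<bar> powr p \<le> G k x" if x: "x \<in> K" for k x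
    proof -
      let ?w = "cell k x"
      have w: "?w \<in> W k" by (rule cell_words[OF x])
      have "address x k \<in> {1..N}" using address[OF x] by (auto simp: shift_space_def)
      then have q: "F (address x k) base_vertex \<in> V 1" using base_vertex(1) by auto
      have eq: "\<bar>cell_value f (Suc k) x - cell_value f k x\<bar>
          = \<bar>(f \<circ> fw ?w) (F (address x k) base_vertex) - (f \<circ> fw ?w) base_vertex\<bar>"
        by (simp add: cell_value_def cell_Suc word_map_append)
      have "\<bar>cell_value f (Suc k) x - cell_value f k x\<bar> powr p \<le> C * Lam (Suc 0) (f \<circ> fw ?w)"
        unfolding eq by (rule C(2)[OF q base_vertex(2)])
      also have "\<dots> = C * Lam (Suc 0) (f \<circ> fw ?w) * indicator (fw ?w ` K) x" using in_cell[OF x] by simp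
      also have "\<dots> \<le> G k x" unfolding G_def using Lam0 w
        by (intro member_le_sum[where f = "\<lambda>w. C * Lam (Suc 0) (f \<circ> fw w) * indicator (fw w ` K) x"]) auto
      finally show ?thesis .
    qed
    \<comment> \<open>\<kappa>_k trades the measure of a cell for its inverse weight; the sum over
      cells then becomes \<kappa>_k times \<Lambda>^(k+1) E(f).\<close>
    have G_int: "(\<integral>\<^sup>+x. ennreal (G k x) \<partial>\<mu>) \<le> ennreal (C * c * b k powr p)" for k
    proof -
      have "(\<integral>\<^sup>+x. ennreal (G k x) \<partial>\<mu>) =
          (\<integral>\<^sup>+x. (\<Sum>w\<in>W k. ennreal (C * Lam (Suc 0) (f \<circ> fw w)) * indicator (fw w ` K) x) \<partial>\<mu>)"
      proof (rule nn_integral_cong)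
        fix x
        have "ennreal (G k x) = (\<Sum>w\<in>W k. ennreal (C * Lam (Suc 0) (f \<circ> fw w) * indicator (fw w ` K) x))"
          unfolding G_def by (rule sum_ennreal[symmetric]) (intro mult_nonneg_nonneg[OF Lam0], simp)
        then show "ennreal (G k x) = (\<Sum>w\<in>W k. ennreal (C * Lam (Suc 0) (f \<circ> fw w)) * indicator (fw w ` K) x)"
          by (simp only: ennreal_mult[OF Lam0 indicator_pos_le] ennreal_indicator)
      qed
      also have "\<dots> = (\<Sum>w\<in>W k. \<integral>\<^sup>+x. ennreal (C * Lam (Suc 0) (f \<circ> fw w)) * indicator (fw w ` K) x \<partial>\<mu>)"
        using cell_sets by (intro nn_integral_sum) auto
      also have "\<dots> = (\<Sum>w\<in>W k. ennreal (C * Lam (Suc 0) (f \<circ> fw w)) * emeasure \<mu> (fw w ` K))"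
        using cell_sets by (intro sum.cong refl nn_integral_cmult_indicator) auto
      also have "\<dots> = ennreal (\<Sum>w\<in>W k. C * Lam (Suc 0) (f \<circ> fw w) * measure \<mu> (fw w ` K))"
      proof -
        have "(\<Sum>w\<in>W k. ennreal (C * Lam (Suc 0) (f \<circ> fw w) * measure \<mu> (fw w ` K)))
            = ennreal (\<Sum>w\<in>W k. C * Lam (Suc 0) (f \<circ> fw w) * measure \<mu> (fw w ` K))"
          by (rule sum_ennreal) (intro mult_nonneg_nonneg[OF Lam0] measure_nonneg)
        then show ?thesis by (simp only: ennreal_mult[OF Lam0 measure_nonneg] emeasure_eq_measure)
      qed
      also have "\<dots> \<le> ennreal (C * c * b k powr p)"
      proof (rule ennreal_leI)
        have "(\<Sum>w\<in>W k. C * Lam (Suc 0) (f \<circ> fw w) * measure \<mu> (fw w ` K)) \<le>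
            (\<Sum>w\<in>W k. C * (inverse (rw w) * Lam (Suc 0) (f \<circ> fw w)) * \<kappa> k)"
        proof (rule sum_mono)
          fix w assume w: "w \<in> W k"
          have "C * Lam (Suc 0) (f \<circ> fw w) * measure \<mu> (fw w ` K)
              = C * (inverse (rw w) * Lam (Suc 0) (f \<circ> fw w)) * (rw w * measure \<mu> (fw w ` K))"
            using rw_pos[OF w] by simp
          also have "\<dots> \<le> C * (inverse (rw w) * Lam (Suc 0) (f \<circ> fw w)) * \<kappa> k"
            using kappa_ge[OF w] C(1) rw_pos[OF w] Lam_nonneg
            by (intro mult_left_mono mult_nonneg_nonneg) (auto intro: less_imp_le)
          finally show "C * Lam (Suc 0) (f \<circ> fw w) * measure \<mu> (fw w ` K)
              \<le> C * (inverse (rw w) * Lam (Suc 0) (f \<circ> fw w)) * \<kappa> k" .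
        qed
        also have "\<dots> = C * Lam (k + Suc 0) f * \<kappa> k"
          unfolding Lam_add by (simp add: sum_distrib_left sum_distrib_right)
        also have "\<dots> \<le> C * c * b k powr p"
          using energy_leD[OF c, of "k + Suc 0"] kb[of k] kappa_nonneg[of k] C(1) c0 Lam_nonneg
          by (intro mult_mono mult_nonneg_nonneg) auto
        finally show "(\<Sum>w\<in>W k. C * Lam (Suc 0) (f \<circ> fw w) * measure \<mu> (fw w ` K)) \<le> C * c * b k powr p" .
      qed
      finally show ?thesis .
    qed
    define u where "u k x = b k powr (1 - p) * G k x" for k x
    have u0: "0 \<le> u k x" for k x unfolding u_def using G0 by simp
    have u_meas [measurable]: "u k \<in> borel_measurable \<mu>" for k unfolding u_def[abs_def] by measurable
    have u_int: "(\<integral>\<^sup>+x. (\<Sum>k. ennreal (u k x)) \<partial>\<mu>) \<le> ennreal (C * c * S)"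
    proof -
      have "(\<integral>\<^sup>+x. (\<Sum>k. ennreal (u k x)) \<partial>\<mu>) = (\<Sum>k. \<integral>\<^sup>+x. ennreal (u k x) \<partial>\<mu>)"
        by (rule nn_integral_suminf) measurable
      also have "\<dots> \<le> (\<Sum>k. ennreal (C * c * b k))"
      proof (rule suminf_le)
        fix k
        have "(\<integral>\<^sup>+x. ennreal (u k x) \<partial>\<mu>) = ennreal (b k powr (1 - p)) * (\<integral>\<^sup>+x. ennreal (G k x) \<partial>\<mu>)"
          unfolding u_def using G0 by (subst nn_integral_cmult[symmetric]) (auto simp: ennreal_mult)
        also have "\<dots> \<le> ennreal (b k powr (1 - p)) * ennreal (C * c * b k powr p)"
          by (intro mult_left_mono G_int) auto
        also have "\<dots> = ennreal (b k powr (1 - p) * (C * c * b k powr p))"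
          using C c0 by (subst ennreal_mult) auto
        also have "b k powr (1 - p) * (C * c * b k powr p) = C * c * (b k powr (1 - p) * b k powr p)" by simp
        also have "b k powr (1 - p) * b k powr p = b k" using b_pos[of k] by (simp flip: powr_add)
        finally show "(\<integral>\<^sup>+x. ennreal (u k x) \<partial>\<mu>) \<le> ennreal (C * c * b k)" .
      qed auto
      also have "\<dots> = ennreal (\<Sum>k. C * c * b k)"
      proof (rule suminf_ennreal2)
        show "0 \<le> C * c * b k" for k using C(1) c0 b_pos[of k] by simp
      qed (intro summable_mult b_summable)
      also have "(\<Sum>k. C * c * b k) = C * c * S" unfolding S_def by (rule suminf_mult[OF b_summable])
      finally show ?thesis .
    qed
    \<comment> \<open>Where the series diverges \<open>enn2real\<close> gives 0; by the integral
      bound this is a null set.\<close>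
    define H where "H x = S powr (p - 1) * enn2real (\<Sum>k. ennreal (u k x))" for x
    have H_meas: "H \<in> borel_measurable \<mu>" unfolding H_def[abs_def] by measurable
    have H_int: "(\<integral>\<^sup>+x. ennreal (H x) \<partial>\<mu>) \<le> ennreal (S powr (p - 1) * (C * S) * c)"
    proof -
      have "(\<integral>\<^sup>+x. ennreal (H x) \<partial>\<mu>) \<le> (\<integral>\<^sup>+x. ennreal (S powr (p - 1)) * (\<Sum>k. ennreal (u k x)) \<partial>\<mu>)"
        unfolding H_def
        by (intro nn_integral_mono) (auto simp: ennreal_mult ennreal_enn2real_if intro!: mult_left_mono)
      also have "\<dots> = ennreal (S powr (p - 1)) * (\<integral>\<^sup>+x. (\<Sum>k. ennreal (u k x)) \<partial>\<mu>)"
        by (intro nn_integral_cmult) measurable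
      also have "\<dots> \<le> ennreal (S powr (p - 1)) * ennreal (C * c * S)" by (intro mult_left_mono u_int) auto
      also have "\<dots> = ennreal (S powr (p - 1) * (C * S) * c)"
        using C(1) c0 S_pos by (subst ennreal_mult[symmetric]) (auto simp: mult_ac)
      finally show ?thesis .
    qed
    have "AE x in \<mu>. (\<Sum>k. ennreal (u k x)) \<noteq> \<infinity>"
      by (rule nn_integral_PInf_AE) (use u_int in \<open>auto simp: top_unique\<close>)
    then have AE1: "AE x in \<mu>. \<exists>l. (\<lambda>m. cell_value f m x) \<longlonglongrightarrow> l \<and> \<bar>l - f base_vertex\<bar> powr p \<le> H x"
    proof (rule AE_mp, intro AE_I2 impI)
      fix x assume x: "x \<in> space \<mu>" and fin: "(\<Sum>k. ennreal (u k x)) \<noteq> \<infinity>"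
      have xK: "x \<in> K" using x by (simp add: space_\<mu>)
      have sum_u: "summable (\<lambda>k. u k x)" using fin u0 by (intro summable_suminf_not_top) auto
      have "(\<Sum>k. ennreal (u k x)) = ennreal (\<Sum>k. u k x)" by (rule suminf_ennreal2[OF u0 sum_u])
      then have H_eq: "H x = S powr (p - 1) * (\<Sum>k. u k x)"
        unfolding H_def using suminf_nonneg[OF sum_u u0] by (simp only: enn2real_ennreal)
      define d where "d k = cell_value f (Suc k) x - cell_value f k x" for k
      have partial: "(\<Sum>k<n. \<bar>d k\<bar>) powr p \<le> H x" for n
      proof (cases "n = 0")
        case False
        then have "(\<Sum>k<n. \<bar>d k\<bar>) powr p \<le> (\<Sum>k<n. b k) powr (p - 1) * (\<Sum>k<n. b k powr (1 - p) * \<bar>d k\<bar> powr p)"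
          by (intro weighted_power_mean p b_pos) simp
        also have "\<dots> \<le> S powr (p - 1) * (\<Sum>k. u k x)"
        proof (rule mult_mono)
          show "(\<Sum>k<n. b k) powr (p - 1) \<le> S powr (p - 1)"
            using S p b_pos by (intro powr_mono2 sum_nonneg) (auto intro: less_imp_le)
          have "(\<Sum>k<n. b k powr (1 - p) * \<bar>d k\<bar> powr p) \<le> (\<Sum>k<n. u k x)"
            unfolding u_def d_def by (intro sum_mono mult_left_mono d_le[OF xK]) auto
          also have "\<dots> \<le> (\<Sum>k. u k x)" using u0 by (intro sum_le_suminf sum_u) auto
          finally show "(\<Sum>k<n. b k powr (1 - p) * \<bar>d k\<bar> powr p) \<le> (\<Sum>k. u k x)" .
        qed (auto intro!: sum_nonneg)
        finally show ?thesis by (simp add: H_eq)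
      qed (use p u0 suminf_nonneg[OF sum_u] in \<open>simp add: H_eq\<close>)
      have partial': "(\<Sum>k<n. \<bar>d k\<bar>) \<le> H x powr (1 / p)" for n
      proof -
        have "((\<Sum>k<n. \<bar>d k\<bar>) powr p) powr (1 / p) \<le> H x powr (1 / p)" using p partial by (intro powr_mono2) auto
        moreover have "0 \<le> (\<Sum>k<n. \<bar>d k\<bar>)" by (intro sum_nonneg) auto
        ultimately show ?thesis using p by (simp add: powr_powr)
      qed
      have "summable (\<lambda>k. \<bar>d k\<bar>)" by (rule summableI_nonneg_bounded[OF _ partial']) simp
      then have "summable d" by (rule summable_rabs_cancel)
      then have lim_d: "(\<lambda>n. \<Sum>k<n. d k) \<longlonglongrightarrow> suminf d" by (rule summable_LIMSEQ)
      \<comment> \<open>The telescope starts at \<open>base_vertex\<close> itself, because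
        \<open>cell 0 x\<close> is the empty word.\<close>
      have tele: "(\<Sum>k<n. d k) = cell_value f n x - f base_vertex" for n
        unfolding d_def by (subst sum_lessThan_telescope) (simp add: cell_value_def cell_def)
      have "(\<lambda>n. cell_value f n x) \<longlonglongrightarrow> suminf d + f base_vertex"
        using tendsto_add[OF lim_d tendsto_const[of "f base_vertex"]] by (simp add: tele)
      moreover have "\<bar>suminf d\<bar> powr p \<le> H x"
      proof (rule LIMSEQ_le_const2)
        show "(\<lambda>n. \<bar>\<Sum>k<n. d k\<bar> powr p) \<longlonglongrightarrow> \<bar>suminf d\<bar> powr p"
          using p by (intro tendsto_powr' tendsto_rabs lim_d tendsto_const) auto
        have "\<bar>\<Sum>k<n. d k\<bar> powr p \<le> H x" for n
          using powr_mono2[of p "\<bar>\<Sum>k<n. d k\<bar>" "\<Sum>k<n. \<bar>d k\<bar>"] p sum_abs[of d "{..<n}"] partial[of n] by simp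
        then show "\<exists>N. \<forall>n\<ge>N. \<bar>\<Sum>k<n. d k\<bar> powr p \<le> H x" by blast
      qed
      ultimately show "\<exists>l. (\<lambda>m. cell_value f m x) \<longlonglongrightarrow> l \<and> \<bar>l - f base_vertex\<bar> powr p \<le> H x"
        by (intro exI[of _ "suminf d + f base_vertex"]) simp
    qed
    \<comment> \<open>A vertex without mass is a null set, and an atom is covered by
      \<open>cell_value_tendsto_atom\<close>; countability then combines all vertices.\<close>
    have "\<forall>y\<in>VS. AE x in \<mu>. x = y \<longrightarrow> (\<lambda>m. cell_value f m y) \<longlonglongrightarrow> f y"
    proof
      fix y assume y: "y \<in> VS"
      show "AE x in \<mu>. x = y \<longrightarrow> (\<lambda>m. cell_value f m y) \<longlonglongrightarrow> f y"
      proof (cases "0 < measure \<mu> {y}")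
        case True
        then show ?thesis using cell_value_tendsto_atom[OF f y] by simp
      next
        case False
        then have "measure \<mu> {y} = 0" using measure_nonneg[of \<mu> "{y}"] by linarith
        moreover have "{y} \<in> sets \<mu>" using y VS_subset_K by (intro countable_sets) auto
        ultimately have "{y} \<in> null_sets \<mu>" by (simp add: null_sets_def emeasure_eq_measure)
        from AE_not_in[OF this] show ?thesis by (rule AE_mp) (auto intro!: AE_I2)
      qed
    qed
    then have AE2: "AE x in \<mu>. \<forall>y\<in>VS. x = y \<longrightarrow> (\<lambda>m. cell_value f m y) \<longlonglongrightarrow> f y"
      by (subst AE_ball_countable[OF countable_VS])
    have "AE x in \<mu>. (\<lambda>m. cell_value f m x) \<longlonglongrightarrow> \<Psi> f x \<and> \<bar>\<Psi> f x - f base_vertex\<bar> powr p \<le> H x"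
      using AE1 AE2 AE_space
    proof eventually_elim
      case (elim x)
      then obtain l where l: "(\<lambda>m. cell_value f m x) \<longlonglongrightarrow> l" "\<bar>l - f base_vertex\<bar> powr p \<le> H x" by blast
      have "\<Psi> f x = l"
      proof (cases "x \<in> VS")
        case True
        then show ?thesis using elim(2) l(1) LIMSEQ_unique by fastforce
      next
        case False
        then show ?thesis using elim(3) l(1) by (simp add: \<Psi>_def space_\<mu> limI)
      qed
      with l show ?case by simp
    qed
    with H_meas H_int show "\<exists>H. H \<in> borel_measurable \<mu> \<and>
      (\<integral>\<^sup>+x. ennreal (H x) \<partial>\<mu>) \<le> ennreal (S powr (p - 1) * (C * S) * c) \<and>
      (AE x in \<mu>. (\<lambda>m. cell_value f m x) \<longlonglongrightarrow> \<Psi> f x \<and> \<bar>\<Psi> f x - f base_vertex\<bar> powr p \<le> H x)"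
      by blast
  qed
qed

section \<open>Almost-everywhere identities and norm bounds for the embedding\<close>

lemma AE_cell_value_tendsto:
  assumes "f \<in> \<F>"
  shows "AE x in \<mu>. (\<lambda>m. cell_value f m x) \<longlonglongrightarrow> \<Psi> f x"
proof -
  obtain c where c: "energy_le f c" using assms limit_domain_iff by blast
  show ?thesis
  proof (rule cell_value_convergence)
    fix A
    assume "\<And>f c. energy_le f c \<Longrightarrow> \<exists>H. H \<in> borel_measurable \<mu> \<and>
      (\<integral>\<^sup>+x. ennreal (H x) \<partial>\<mu>) \<le> ennreal (A * c) \<and>
      (AE x in \<mu>. (\<lambda>m. cell_value f m x) \<longlonglongrightarrow> \<Psi> f x \<and> \<bar>\<Psi> f x - f base_vertex\<bar> powr p \<le> H x)"
    from this[OF c] obtain H where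
      "AE x in \<mu>. (\<lambda>m. cell_value f m x) \<longlonglongrightarrow> \<Psi> f x \<and> \<bar>\<Psi> f x - f base_vertex\<bar> powr p \<le> H x"
      by blast
    then show ?thesis by eventually_elim blast
  qed
qed

lemma AE_\<Psi>_linear:
  assumes "f \<in> \<F>" "g \<in> \<F>"
  shows "AE x in \<mu>. \<Psi> (\<lambda>x. a * f x + b * g x) x = a * \<Psi> f x + b * \<Psi> g x"
  using AE_cell_value_tendsto[OF assms(1)] AE_cell_value_tendsto[OF assms(2)]
    AE_cell_value_tendsto[OF limit_domain_lin[OF assms, of a b]]
proof eventually_elim
  case (elim x)
  have "(\<lambda>m. cell_value (\<lambda>x. a * f x + b * g x) m x) \<longlonglongrightarrow> a * \<Psi> f x + b * \<Psi> g x"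
    using tendsto_add[OF tendsto_mult[OF tendsto_const[of a] elim(1)] tendsto_mult[OF tendsto_const[of b] elim(2)]]
    by (simp add: cell_value_def)
  with elim(3) show ?case by (rule LIMSEQ_unique)
qed

lemma AE_\<Psi>_unit_cut:
  assumes "f \<in> \<F>"
  shows "AE x in \<mu>. \<Psi> (unit_cut f) x = unit_cut (\<Psi> f) x"
  using AE_cell_value_tendsto[OF assms] AE_cell_value_tendsto[OF limit_domain_unit_cut[OF assms]]
proof eventually_elim
  case (elim x)
  have "(\<lambda>m. cell_value (unit_cut f) m x) \<longlonglongrightarrow> unit_cut (\<Psi> f) x"
    using tendsto_min[OF tendsto_max[OF elim(1) tendsto_const[of 0]] tendsto_const[of 1]]
    by (simp add: cell_value_def unit_cut_def)
  with elim(2) show ?case by (rule LIMSEQ_unique)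
qed

text \<open>Makes the norm of the form equivalent to |f(q)|^p + \<E>(f) at the base vertex q, an
  expression without integrals. Both bounds integrate the quasi-triangle inequality between \<Psi> f
  and the constant f(q), \<mu> having mass 1.\<close>

lemma \<Psi>_comparison:
  obtains A where "0 < A" "\<And>f. f \<in> \<F> \<Longrightarrow> integrable \<mu> (\<lambda>x. \<bar>\<Psi> f x\<bar> powr p)"
    "\<And>f. f \<in> \<F> \<Longrightarrow> (\<integral>x. \<bar>\<Psi> f x\<bar> powr p \<partial>\<mu>) \<le> A * (\<bar>f base_vertex\<bar> powr p + \<E> f)"
    "\<And>f. f \<in> \<F> \<Longrightarrow> \<bar>f base_vertex\<bar> powr p \<le> A * ((\<integral>x. \<bar>\<Psi> f x\<bar> powr p \<partial>\<mu>) + \<E> f)"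
proof -
  obtain B where B: "0 < B" "\<And>f c. energy_le f c \<Longrightarrow> \<exists>H. H \<in> borel_measurable \<mu> \<and>
    (\<integral>\<^sup>+x. ennreal (H x) \<partial>\<mu>) \<le> ennreal (B * c) \<and>
    (AE x in \<mu>. (\<lambda>m. cell_value f m x) \<longlonglongrightarrow> \<Psi> f x \<and> \<bar>\<Psi> f x - f base_vertex\<bar> powr p \<le> H x)"
    using cell_value_convergence by blast
  obtain C where C: "0 < C" "\<And>f. f \<in> \<F> \<Longrightarrow> energy_le f (C * \<E> f)"
    using limit_form_comparison by metis
  let ?P = "2 powr (p - 1)"
  have P: "0 < ?P" by simp
  have diff: "integrable \<mu> (\<lambda>x. \<bar>\<Psi> f x - f base_vertex\<bar> powr p) \<and>
      (\<integral>x. \<bar>\<Psi> f x - f base_vertex\<bar> powr p \<partial>\<mu>) \<le> B * C * \<E> f" if f: "f \<in> \<F>" for f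
  proof -
    obtain H where H: "(\<integral>\<^sup>+x. ennreal (H x) \<partial>\<mu>) \<le> ennreal (B * (C * \<E> f))"
      "AE x in \<mu>. (\<lambda>m. cell_value f m x) \<longlonglongrightarrow> \<Psi> f x \<and> \<bar>\<Psi> f x - f base_vertex\<bar> powr p \<le> H x"
      using B(2)[OF C(2)[OF f]] by blast
    have "(\<integral>\<^sup>+x. ennreal (\<bar>\<Psi> f x - f base_vertex\<bar> powr p) \<partial>\<mu>) \<le> (\<integral>\<^sup>+x. ennreal (H x) \<partial>\<mu>)"
    proof (rule nn_integral_mono_AE)
      show "AE x in \<mu>. ennreal (\<bar>\<Psi> f x - f base_vertex\<bar> powr p) \<le> ennreal (H x)"
        using H(2) by eventually_elim (simp add: ennreal_leI)
    qed
    with H(1) have int: "(\<integral>\<^sup>+x. ennreal (\<bar>\<Psi> f x - f base_vertex\<bar> powr p) \<partial>\<mu>) \<le> ennreal (B * C * \<E> f)"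
      by (simp add: mult.assoc)
    have "integrable \<mu> (\<lambda>x. \<bar>\<Psi> f x - f base_vertex\<bar> powr p)"
      by (rule integrableI_nonneg) (use int in \<open>auto simp: less_top[symmetric] top_unique\<close>)
    moreover have "(\<integral>x. \<bar>\<Psi> f x - f base_vertex\<bar> powr p \<partial>\<mu>) \<le> B * C * \<E> f"
      using B(1) C(1) limit_form_nonneg[OF f] by (intro integral_real_bounded int) auto
    ultimately show ?thesis by blast
  qed
  have le1: "\<bar>\<Psi> f x\<bar> powr p \<le> ?P * (\<bar>\<Psi> f x - f base_vertex\<bar> powr p + \<bar>f base_vertex\<bar> powr p)" for f x
    using powr_abs_add_le[of "\<Psi> f x - f base_vertex" "f base_vertex"] by simp
  have le2: "\<bar>f base_vertex\<bar> powr p \<le> ?P * (\<bar>\<Psi> f x\<bar> powr p + \<bar>\<Psi> f x - f base_vertex\<bar> powr p)" for f x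
    using powr_abs_add_le[of "\<Psi> f x" "f base_vertex - \<Psi> f x"] by (simp add: abs_minus_commute)
  have int: "integrable \<mu> (\<lambda>x. \<bar>\<Psi> f x\<bar> powr p)" if f: "f \<in> \<F>" for f
  proof (rule Bochner_Integration.integrable_bound)
    show "integrable \<mu> (\<lambda>x. ?P * (\<bar>\<Psi> f x - f base_vertex\<bar> powr p + \<bar>f base_vertex\<bar> powr p))"
      using diff[OF f] by auto
    show "AE x in \<mu>. norm (\<bar>\<Psi> f x\<bar> powr p) \<le> norm (?P * (\<bar>\<Psi> f x - f base_vertex\<bar> powr p + \<bar>f base_vertex\<bar> powr p))"
      using le1 by (intro AE_I2) (simp add: abs_mult)
  qed measurable
  have up: "(\<integral>x. \<bar>\<Psi> f x\<bar> powr p \<partial>\<mu>) \<le> ?P * (B * C * \<E> f + \<bar>f base_vertex\<bar> powr p)" if f: "f \<in> \<F>" for f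
  proof -
    have "(\<integral>x. \<bar>\<Psi> f x\<bar> powr p \<partial>\<mu>) \<le> (\<integral>x. ?P * (\<bar>\<Psi> f x - f base_vertex\<bar> powr p + \<bar>f base_vertex\<bar> powr p) \<partial>\<mu>)"
      using diff[OF f] int[OF f] le1 by (intro integral_mono) auto
    also have "\<dots> = ?P * ((\<integral>x. \<bar>\<Psi> f x - f base_vertex\<bar> powr p \<partial>\<mu>) + \<bar>f base_vertex\<bar> powr p)"
      using diff[OF f] by (simp add: prob_space)
    also have "\<dots> \<le> ?P * (B * C * \<E> f + \<bar>f base_vertex\<bar> powr p)" using diff[OF f] by (intro mult_left_mono) auto
    finally show ?thesis .
  qed
  have low: "\<bar>f base_vertex\<bar> powr p \<le> ?P * ((\<integral>x. \<bar>\<Psi> f x\<bar> powr p \<partial>\<mu>) + B * C * \<E> f)" if f: "f \<in> \<F>" for f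
  proof -
    have "\<bar>f base_vertex\<bar> powr p = (\<integral>x. \<bar>f base_vertex\<bar> powr p \<partial>\<mu>)" by (simp add: prob_space)
    also have "\<dots> \<le> (\<integral>x. ?P * (\<bar>\<Psi> f x\<bar> powr p + \<bar>\<Psi> f x - f base_vertex\<bar> powr p) \<partial>\<mu>)"
      using diff[OF f] int[OF f] le2 by (intro integral_mono) auto
    also have "\<dots> = ?P * ((\<integral>x. \<bar>\<Psi> f x\<bar> powr p \<partial>\<mu>) + (\<integral>x. \<bar>\<Psi> f x - f base_vertex\<bar> powr p \<partial>\<mu>))"
      using diff[OF f] int[OF f] by simp
    also have "\<dots> \<le> ?P * ((\<integral>x. \<bar>\<Psi> f x\<bar> powr p \<partial>\<mu>) + B * C * \<E> f)" using diff[OF f] by (intro mult_left_mono) auto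
    finally show ?thesis .
  qed
  have BC: "0 < B * C" using B(1) C(1) by simp
  show thesis
  proof (rule that[of "?P * (B * C + 1)"])
    have "0 < B * C + 1" using BC by linarith
    then show "0 < ?P * (B * C + 1)" using P by (rule mult_pos_pos[rotated])
    fix f assume f: "f \<in> \<F>"
    have E0: "0 \<le> \<E> f" by (rule limit_form_nonneg[OF f])
    have I0: "0 \<le> (\<integral>x. \<bar>\<Psi> f x\<bar> powr p \<partial>\<mu>)" by (intro integral_nonneg_AE) auto
    show "integrable \<mu> (\<lambda>x. \<bar>\<Psi> f x\<bar> powr p)" by (rule int[OF f])
    have mono: "?P * (B * C * \<E> f + a) \<le> ?P * (B * C + 1) * (a + \<E> f)" if "0 \<le> a" for a
    proof -
      have "(B * C + 1) * (a + \<E> f) = B * C * a + B * C * \<E> f + a + \<E> f" by (simp add: algebra_simps)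
      moreover have "0 \<le> B * C * a" using BC that by simp
      ultimately have "B * C * \<E> f + a \<le> (B * C + 1) * (a + \<E> f)" using E0 by linarith
      then have "?P * (B * C * \<E> f + a) \<le> ?P * ((B * C + 1) * (a + \<E> f))" by (intro mult_left_mono) auto
      then show ?thesis by (simp add: mult.assoc)
    qed
    show "(\<integral>x. \<bar>\<Psi> f x\<bar> powr p \<partial>\<mu>) \<le> ?P * (B * C + 1) * (\<bar>f base_vertex\<bar> powr p + \<E> f)"
      by (rule order_trans[OF up[OF f] mono[OF powr_ge_zero]])
    show "\<bar>f base_vertex\<bar> powr p \<le> ?P * (B * C + 1) * ((\<integral>x. \<bar>\<Psi> f x\<bar> powr p \<partial>\<mu>) + \<E> f)"
      by (rule order_trans[OF low[OF f, unfolded add.commute[of _ "B * C * \<E> f"]] mono[OF I0]])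
  qed
qed

end

section \<open>The closed p-energy form\<close>

context pcf_measure
begin

lemma \<Psi>_Lp: "f \<in> \<F> \<Longrightarrow> \<Psi> f \<in> Lp_functions p \<mu>"
proof -
  assume f: "f \<in> \<F>"
  obtain A where "\<And>f. f \<in> \<F> \<Longrightarrow> integrable \<mu> (\<lambda>x. \<bar>\<Psi> f x\<bar> powr p)"
    by (rule \<Psi>_comparison) blast
  then show ?thesis using f by (simp add: Lp_functions_def)
qed

lemma energy1_eq: "energy1 p \<mu> \<E> \<Psi> f = \<E> f + (\<integral>x. \<bar>\<Psi> f x\<bar> powr p \<partial>\<mu>)"
proof -
  have "0 \<le> (\<integral>x. \<bar>\<Psi> f x\<bar> powr p \<partial>\<mu>)" by (intro integral_nonneg_AE) auto
  then show ?thesis using p by (simp add: energy1_def Lp_norm_def powr_powr)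
qed

lemma energy1_cong: "(\<And>x. x \<in> VS \<Longrightarrow> f x = g x) \<Longrightarrow> energy1 p \<mu> \<E> \<Psi> f = energy1 p \<mu> \<E> \<Psi> g"
  using limit_form_cong[of f g] \<Psi>_cong[of f g] by (simp add: energy1_def)

lemma energy1_nonneg: "f \<in> \<F> \<Longrightarrow> 0 \<le> energy1 p \<mu> \<E> \<Psi> f"
  unfolding energy1_def using limit_form_nonneg[of f] by simp

lemma limit_form_le_energy1: "\<E> f \<le> energy1 p \<mu> \<E> \<Psi> f"
  by (simp add: energy1_def)

lemma energy1_comparison:
  obtains A where "0 < A"
    "\<And>f. f \<in> \<F> \<Longrightarrow> energy1 p \<mu> \<E> \<Psi> f \<le> A * (\<bar>f base_vertex\<bar> powr p + \<E> f)"
    "\<And>f. f \<in> \<F> \<Longrightarrow> \<bar>f base_vertex\<bar> powr p \<le> A * energy1 p \<mu> \<E> \<Psi> f"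
proof -
  obtain A where A: "0 < A"
    "\<And>f. f \<in> \<F> \<Longrightarrow> integrable \<mu> (\<lambda>x. \<bar>\<Psi> f x\<bar> powr p)"
    "\<And>f. f \<in> \<F> \<Longrightarrow> (\<integral>x. \<bar>\<Psi> f x\<bar> powr p \<partial>\<mu>) \<le> A * (\<bar>f base_vertex\<bar> powr p + \<E> f)"
    "\<And>f. f \<in> \<F> \<Longrightarrow> \<bar>f base_vertex\<bar> powr p \<le> A * ((\<integral>x. \<bar>\<Psi> f x\<bar> powr p \<partial>\<mu>) + \<E> f)"
    by (rule \<Psi>_comparison) blast
  show thesis
  proof (rule that[of "A + 1"])
    fix f assume f: "f \<in> \<F>"
    have "e + i \<le> (A + 1) * (b + e)" if "i \<le> A * (b + e)" "0 \<le> b" for e i b :: real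
      using that by (simp add: algebra_simps)
    from this[OF A(3)[OF f] powr_ge_zero] show "energy1 p \<mu> \<E> \<Psi> f \<le> (A + 1) * (\<bar>f base_vertex\<bar> powr p + \<E> f)"
      unfolding energy1_eq .
    have "\<bar>f base_vertex\<bar> powr p \<le> A * energy1 p \<mu> \<E> \<Psi> f" using A(4)[OF f] by (simp add: energy1_eq add.commute)
    then show "\<bar>f base_vertex\<bar> powr p \<le> (A + 1) * energy1 p \<mu> \<E> \<Psi> f"
      using energy1_nonneg[OF f] by (simp add: distrib_right)
  qed (use A(1) in simp)
qed

lemma Lp_extension: "Lp_extension p K VS \<mu> \<F> \<E> \<Psi>"
  unfolding Lp_extension_def
proof (intro conjI allI impI ballI)
  fix f g :: "'a \<Rightarrow> real" assume "\<forall>x\<in>VS. f x = g x"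
  then show "\<Psi> f = \<Psi> g" by (intro \<Psi>_cong) blast
next
  fix f assume "f \<in> \<F>"
  then show "\<Psi> f \<in> Lp_functions p \<mu>" by (rule \<Psi>_Lp)
next
  fix f g a b assume "f \<in> \<F>" "g \<in> \<F>"
  then show "(\<lambda>x. a * f x + b * g x) \<in> \<F>" "AE x in \<mu>. \<Psi> (\<lambda>x. a * f x + b * g x) x = a * \<Psi> f x + b * \<Psi> g x"
    by (rule limit_domain_lin AE_\<Psi>_linear)+
next
  fix f assume "f \<in> uc_domain VS \<F>"
  then show "continuous_on K (\<Psi> f)" by (intro continuous_\<Psi>) (simp add: uc_domain_def)
next
  fix f x assume "x \<in> VS"
  then show "\<Psi> f x = f x" by simp
next
  fix h f
  assume *: "(\<forall>n. h n \<in> uc_domain VS \<F>) \<and> f \<in> \<F> \<and> (\<forall>x\<in>VS. (\<lambda>n. h n x) \<longlonglongrightarrow> f x) \<and>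
    (\<lambda>n::nat. \<E> (\<lambda>x. h n x - f x)) \<longlonglongrightarrow> 0"
  then have h: "\<And>n. h n \<in> \<F>" and f: "f \<in> \<F>" by (auto simp: uc_domain_def)
  obtain A where A: "0 < A"
    "\<And>f. f \<in> \<F> \<Longrightarrow> integrable \<mu> (\<lambda>x. \<bar>\<Psi> f x\<bar> powr p)"
    "\<And>f. f \<in> \<F> \<Longrightarrow> (\<integral>x. \<bar>\<Psi> f x\<bar> powr p \<partial>\<mu>) \<le> A * (\<bar>f base_vertex\<bar> powr p + \<E> f)"
    "\<And>f. f \<in> \<F> \<Longrightarrow> \<bar>f base_vertex\<bar> powr p \<le> A * ((\<integral>x. \<bar>\<Psi> f x\<bar> powr p \<partial>\<mu>) + \<E> f)"
    by (rule \<Psi>_comparison) blast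
  \<comment> \<open>The comparison, applied to h_n - f, bounds the integral of the p-th power by the
    value at the base vertex and the energy.\<close>
  have "(\<lambda>n. \<bar>h n base_vertex - f base_vertex\<bar> powr p) \<longlonglongrightarrow> \<bar>f base_vertex - f base_vertex\<bar> powr p"
    using * base_vertex(3) p by (intro tendsto_powr' tendsto_intros) auto
  then have "(\<lambda>n. A * (\<bar>h n base_vertex - f base_vertex\<bar> powr p + \<E> (\<lambda>x. h n x - f x))) \<longlonglongrightarrow> A * (0 + 0)"
    using * by (intro tendsto_mult tendsto_add tendsto_const) auto
  then have bound: "(\<lambda>n. A * (\<bar>h n base_vertex - f base_vertex\<bar> powr p + \<E> (\<lambda>x. h n x - f x))) \<longlonglongrightarrow> 0" by simp
  have eq: "(\<integral>x. \<bar>\<Psi> (h n) x - \<Psi> f x\<bar> powr p \<partial>\<mu>) = (\<integral>x. \<bar>\<Psi> (\<lambda>x. h n x - f x) x\<bar> powr p \<partial>\<mu>)" for n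
  proof (rule integral_cong_AE)
    show "AE x in \<mu>. \<bar>\<Psi> (h n) x - \<Psi> f x\<bar> powr p = \<bar>\<Psi> (\<lambda>x. h n x - f x) x\<bar> powr p"
      using AE_\<Psi>_linear[OF h[of n] f, of 1 "-1"] by eventually_elim simp
  qed measurable
  have "(\<lambda>n. \<integral>x. \<bar>\<Psi> (h n) x - \<Psi> f x\<bar> powr p \<partial>\<mu>) \<longlonglongrightarrow> 0"
  proof (rule Lim_null_comparison[OF _ bound])
    have "norm (\<integral>x. \<bar>\<Psi> (h n) x - \<Psi> f x\<bar> powr p \<partial>\<mu>) \<le> A * (\<bar>h n base_vertex - f base_vertex\<bar> powr p + \<E> (\<lambda>x. h n x - f x))" for n
      using A(3)[OF limit_domain_diff[OF h f], of n] unfolding eq by simp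
    then show "eventually (\<lambda>n. norm (\<integral>x. \<bar>\<Psi> (h n) x - \<Psi> f x\<bar> powr p \<partial>\<mu>)
      \<le> A * (\<bar>h n base_vertex - f base_vertex\<bar> powr p + \<E> (\<lambda>x. h n x - f x))) sequentially" by simp
  qed
  then have "(\<lambda>n. (\<integral>x. \<bar>\<Psi> (h n) x - \<Psi> f x\<bar> powr p \<partial>\<mu>) powr (1 / p)) \<longlonglongrightarrow> 0 powr (1 / p)"
    using p by (intro tendsto_powr' tendsto_const) auto
  then show "(\<lambda>n. Lp_norm p \<mu> (\<lambda>x. \<Psi> (h n) x - \<Psi> f x)) \<longlonglongrightarrow> 0"
    using p by (simp add: Lp_norm_def)
qed

lemma self_similar_embedding: "self_similar_embedding N F \<mu> \<F> \<Psi>"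
  unfolding self_similar_embedding_def
proof (intro allI ballI conjI AE_I2)
  fix n w f assume w: "w \<in> W n" and f: "f \<in> \<F>"
  show "f \<circ> fw w \<in> \<F>" by (rule limit_domain_cell[OF f w])
  fix x assume "x \<in> space \<mu>"
  then show "\<Psi> (f \<circ> fw w) x = (\<Psi> f \<circ> fw w) x" using \<Psi>_cell[OF w] by (simp add: space_\<mu>)
qed

lemma markov_property: "markov_property \<mu> \<F> \<E> \<Psi>"
  unfolding markov_property_def
  using limit_domain_unit_cut limit_form_unit_cut AE_\<Psi>_unit_cut by blast

lemma energy1_dist_less:
  assumes "0 < \<epsilon>" "(\<lambda>x. f x - g x) \<in> \<F>" "energy1 p \<mu> \<E> \<Psi> (\<lambda>x. f x - g x) < \<epsilon> powr p"
  shows "energy1_dist p \<mu> \<E> \<Psi> f g < \<epsilon>"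
proof -
  have "energy1_dist p \<mu> \<E> \<Psi> f g < (\<epsilon> powr p) powr (1 / p)"
    unfolding energy1_dist_def using assms p energy1_nonneg[OF assms(2)] by (intro powr_less_mono2) auto
  then show ?thesis using assms p by (simp add: powr_powr)
qed

text \<open>Point evaluations are continuous for the norm, so a Cauchy sequence converges at each
  vertex. Every level energy involves finitely many vertices and passes to this limit; that bounds
  h_m - f at all levels at once and puts f into the domain.\<close>

lemma complete: "complete_for (energy1_dist p \<mu> \<E> \<Psi>) \<F>"
  unfolding complete_for_def
proof (intro allI impI, elim conjE)
  fix h :: "nat \<Rightarrow> 'a \<Rightarrow> real"
  assume h': "\<forall>n. h n \<in> \<F>" and Cauchy: "\<forall>\<epsilon>>0. \<exists>M. \<forall>m\<ge>M. \<forall>n\<ge>M. energy1_dist p \<mu> \<E> \<Psi> (h m) (h n) < \<epsilon>"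
  have h: "h n \<in> \<F>" for n using h' by blast
  let ?e = "\<lambda>f. energy1 p \<mu> \<E> \<Psi> f"
  obtain A where A: "0 < A"
    "\<And>f. f \<in> \<F> \<Longrightarrow> ?e f \<le> A * (\<bar>f base_vertex\<bar> powr p + \<E> f)"
    "\<And>f. f \<in> \<F> \<Longrightarrow> \<bar>f base_vertex\<bar> powr p \<le> A * ?e f"
    by (rule energy1_comparison) blast
  obtain C where C: "0 < C" "\<And>f n. f \<in> \<F> \<Longrightarrow> Lv n f \<le> C * \<E> f" "\<And>f. f \<in> \<F> \<Longrightarrow> energy_le f (C * \<E> f)"
    by (rule limit_form_comparison) blast
  have diff: "(\<lambda>x. h m x - h n x) \<in> \<F>" for m n using h by (intro limit_domain_diff)
  have Cauchy': "\<exists>M. \<forall>m\<ge>M. \<forall>n\<ge>M. ?e (\<lambda>x. h m x - h n x) < \<epsilon>" if \<epsilon>: "0 < \<epsilon>" for \<epsilon>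
  proof -
    have "0 < \<epsilon> powr (1 / p)" using \<epsilon> by simp
    then obtain M where M: "\<And>m n. M \<le> m \<Longrightarrow> M \<le> n \<Longrightarrow> energy1_dist p \<mu> \<E> \<Psi> (h m) (h n) < \<epsilon> powr (1 / p)"
      using Cauchy by metis
    have "?e (\<lambda>x. h m x - h n x) < \<epsilon>" if "M \<le> m" "M \<le> n" for m n
    proof -
      have "(?e (\<lambda>x. h m x - h n x) powr (1 / p)) powr p < (\<epsilon> powr (1 / p)) powr p"
        using M[OF that] p unfolding energy1_dist_def by (subst powr_less_mono2) auto
      then show ?thesis using p \<epsilon> energy1_nonneg[OF diff] by (simp add: powr_powr)
    qed
    then show ?thesis by blast
  qed
  have "convergent (\<lambda>n. h n x)" if x: "x \<in> VS" for x
  proof -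
    obtain B where B: "0 < B" "\<And>f c. energy_le f c \<Longrightarrow> \<bar>f x - f base_vertex\<bar> powr p \<le> B * c"
      by (rule diff_VS_le[OF x base_vertex(3)]) blast
    define Q where "Q = 2 powr (p - 1) * (B * C + A)"
    have Q: "0 < Q" unfolding Q_def using A(1) B(1) C(1) by (simp add: add_pos_pos)
    have point: "\<bar>f x\<bar> powr p \<le> Q * ?e f" if f: "f \<in> \<F>" for f
    proof -
      have "\<bar>f x\<bar> powr p \<le> 2 powr (p - 1) * (\<bar>f x - f base_vertex\<bar> powr p + \<bar>f base_vertex\<bar> powr p)"
        using powr_abs_add_le[of "f x - f base_vertex" "f base_vertex"] by simp
      also have "\<dots> \<le> 2 powr (p - 1) * (B * (C * ?e f) + A * ?e f)"
      proof (intro mult_left_mono add_mono A(3)[OF f])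
        have "\<bar>f x - f base_vertex\<bar> powr p \<le> B * (C * \<E> f)" by (rule B(2)[OF C(3)[OF f]])
        also have "\<dots> \<le> B * (C * ?e f)" using B(1) C(1) limit_form_le_energy1 by (intro mult_left_mono) auto
        finally show "\<bar>f x - f base_vertex\<bar> powr p \<le> B * (C * ?e f)" .
      qed simp
      also have "\<dots> = Q * ?e f" by (simp add: Q_def algebra_simps)
      finally show ?thesis .
    qed
    have "Cauchy (\<lambda>n. h n x)"
    proof (rule metric_CauchyI)
      fix \<epsilon> :: real assume \<epsilon>: "0 < \<epsilon>"
      then have "0 < \<epsilon> powr p / Q" using Q by simp
      from Cauchy'[OF this] obtain M where M: "\<And>m n. M \<le> m \<Longrightarrow> M \<le> n \<Longrightarrow> ?e (\<lambda>x. h m x - h n x) < \<epsilon> powr p / Q" by blast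
      have "dist (h m x) (h n x) < \<epsilon>" if "M \<le> m" "M \<le> n" for m n
      proof (rule ccontr)
        assume "\<not> dist (h m x) (h n x) < \<epsilon>"
        then have "\<epsilon> powr p \<le> \<bar>h m x - h n x\<bar> powr p" using \<epsilon> p by (intro powr_mono2) (auto simp: dist_real_def)
        also have "\<dots> \<le> Q * ?e (\<lambda>x. h m x - h n x)" by (rule point[OF diff])
        also have "\<dots> < Q * (\<epsilon> powr p / Q)" using M[OF that] Q by (intro mult_strict_left_mono) auto
        finally show False using Q by simp
      qed
      then show "\<exists>M. \<forall>m\<ge>M. \<forall>n\<ge>M. dist (h m x) (h n x) < \<epsilon>" by blast
    qed
    then show ?thesis by (simp add: Cauchy_convergent_iff)
  qed
  define f where "f x = lim (\<lambda>n. h n x)" for x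
  have f_lim: "(\<lambda>n. h n x) \<longlonglongrightarrow> f x" if "x \<in> VS" for x
    using \<open>x \<in> VS \<Longrightarrow> convergent (\<lambda>n. h n x)\<close> that unfolding f_def by (simp add: convergent_LIMSEQ_iff)
  have close: "\<exists>M. \<forall>m\<ge>M. (\<lambda>x. h m x - f x) \<in> \<F> \<and> ?e (\<lambda>x. h m x - f x) \<le> A * (A + C) * \<epsilon>" if \<epsilon>: "0 < \<epsilon>" for \<epsilon>
  proof -
    obtain M where M: "\<And>m n. M \<le> m \<Longrightarrow> M \<le> n \<Longrightarrow> ?e (\<lambda>x. h m x - h n x) < \<epsilon>" using Cauchy'[OF \<epsilon>] by blast
    have "(\<lambda>x. h m x - f x) \<in> \<F> \<and> ?e (\<lambda>x. h m x - f x) \<le> A * (A + C) * \<epsilon>" if m: "M \<le> m" for m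
    proof -
      have Lv: "Lv k (\<lambda>x. h m x - f x) \<le> C * \<epsilon>" for k
      proof (rule LIMSEQ_le_const2)
        show "(\<lambda>n. Lv k (\<lambda>x. h m x - h n x)) \<longlonglongrightarrow> Lv k (\<lambda>x. h m x - f x)"
          using V_subset_VS by (intro Lv_continuous tendsto_diff tendsto_const f_lim) blast
        have "Lv k (\<lambda>x. h m x - h n x) \<le> C * \<epsilon>" if "M \<le> n" for n
        proof -
          have "Lv k (\<lambda>x. h m x - h n x) \<le> C * \<E> (\<lambda>x. h m x - h n x)" by (rule C(2)[OF diff])
          also have "\<dots> \<le> C * \<epsilon>"
            using M[OF m that] limit_form_le_energy1[of "\<lambda>x. h m x - h n x"] C(1) by (intro mult_left_mono) auto
          finally show ?thesis .
        qed
        then show "\<exists>N. \<forall>n\<ge>N. Lv k (\<lambda>x. h m x - h n x) \<le> C * \<epsilon>" by blast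
      qed
      then have D: "(\<lambda>x. h m x - f x) \<in> \<F>" unfolding limit_domain_def by (auto intro!: bdd_aboveI[of _ "C * \<epsilon>"])
      have E: "\<E> (\<lambda>x. h m x - f x) \<le> C * \<epsilon>" by (rule limit_form_le[OF D Lv])
      have "\<bar>h m base_vertex - f base_vertex\<bar> powr p \<le> A * \<epsilon>"
      proof (rule LIMSEQ_le_const2)
        show "(\<lambda>n. \<bar>h m base_vertex - h n base_vertex\<bar> powr p) \<longlonglongrightarrow> \<bar>h m base_vertex - f base_vertex\<bar> powr p"
          using p by (intro tendsto_powr' tendsto_rabs tendsto_diff tendsto_const f_lim base_vertex) auto
        have "\<bar>h m base_vertex - h n base_vertex\<bar> powr p \<le> A * \<epsilon>" if "M \<le> n" for n
        proof -
          have "\<bar>h m base_vertex - h n base_vertex\<bar> powr p \<le> A * ?e (\<lambda>x. h m x - h n x)" by (rule A(3)[OF diff])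
          also have "\<dots> \<le> A * \<epsilon>" using M[OF m that] A(1) by (intro mult_left_mono) auto
          finally show ?thesis .
        qed
        then show "\<exists>N. \<forall>n\<ge>N. \<bar>h m base_vertex - h n base_vertex\<bar> powr p \<le> A * \<epsilon>" by blast
      qed
      then have "A * (\<bar>h m base_vertex - f base_vertex\<bar> powr p + \<E> (\<lambda>x. h m x - f x)) \<le> A * (A * \<epsilon> + C * \<epsilon>)"
        using E A(1) by (intro mult_left_mono add_mono) auto
      then have "?e (\<lambda>x. h m x - f x) \<le> A * (A + C) * \<epsilon>" using A(2)[OF D] by (simp add: algebra_simps)
      with D show ?thesis by blast
    qed
    then show ?thesis by blast
  qed
  obtain M where "(\<lambda>x. h M x - f x) \<in> \<F>" using close[of 1] by auto
  from limit_domain_diff[OF h[of M] this] have f: "f \<in> \<F>" by simp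
  have "(\<lambda>n. ?e (\<lambda>x. h n x - f x)) \<longlonglongrightarrow> 0"
  proof (rule LIMSEQ_I)
    fix \<epsilon> :: real assume \<epsilon>: "0 < \<epsilon>"
    have AC: "0 < A * (A + C)" using A(1) C(1) by (simp add: add_pos_pos)
    then have "0 < \<epsilon> / (2 * (A * (A + C)))" using \<epsilon> by simp
    from close[OF this] obtain M where M: "\<And>m. M \<le> m \<Longrightarrow> (\<lambda>x. h m x - f x) \<in> \<F> \<and>
      ?e (\<lambda>x. h m x - f x) \<le> A * (A + C) * (\<epsilon> / (2 * (A * (A + C))))" by blast
    have "norm (?e (\<lambda>x. h m x - f x) - 0) < \<epsilon>" if m: "M \<le> m" for m
    proof -
      have "c * (\<epsilon> / (2 * c)) = \<epsilon> / 2" if "0 < c" for c using that by simp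
      from this[OF AC] show ?thesis using M[OF m] energy1_nonneg[of "\<lambda>x. h m x - f x"] \<epsilon> by simp
    qed
    then show "\<exists>M. \<forall>m\<ge>M. norm (?e (\<lambda>x. h m x - f x) - 0) < \<epsilon>" by blast
  qed
  then have "(\<lambda>n. ?e (\<lambda>x. h n x - f x) powr (1 / p)) \<longlonglongrightarrow> 0 powr (1 / p)"
    using p energy1_nonneg[OF limit_domain_diff[OF h f]] by (intro tendsto_powr' tendsto_const) auto
  then have "(\<lambda>n. energy1_dist p \<mu> \<E> \<Psi> (h n) f) \<longlonglongrightarrow> 0" using p by (simp add: energy1_dist_def)
  with f show "\<exists>f\<in>\<F>. (\<lambda>n. energy1_dist p \<mu> \<E> \<Psi> (h n) f) \<longlonglongrightarrow> 0" by blast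
qed

text \<open>Several levels are summed because an interpolation at one level need not be one at a
  higher level, while \<open>limit_form_approximation\<close> asks for a family closed under
  midpoints. A spline still depends on finitely many real numbers, which gives separability.\<close>

definition spline :: "nat \<Rightarrow> (nat \<Rightarrow> 'a \<Rightarrow> real) \<Rightarrow> 'a \<Rightarrow> real" where
  "spline n g x = (\<Sum>k<n. interpolation k (g k) x)"

lemma interpolation_zero: "interpolation k (\<lambda>_. 0) x = 0"
  using interpolation_linear[of k 0 "\<lambda>_. 0" 0 "\<lambda>_. 0" x] by simp

lemma spline_limit_domain: "spline n g \<in> \<F>"
proof (induction n)
  case 0
  then show ?case using limit_domain_const[of 0] by (simp add: spline_def[abs_def])
next
  case (Suc n)
  from limit_domain_add[OF this interpolation_limit_domain[of n "g n"]] show ?case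
    by (simp add: spline_def[abs_def])
qed

lemma uniformly_continuous_spline: "uniformly_continuous_on VS (spline n g)"
proof (induction n)
  case 0
  then show ?case by (simp add: spline_def[abs_def] uniformly_continuous_on_const)
next
  case (Suc n)
  from uniformly_continuous_on_add[OF this uniformly_continuous_interpolation[of n "g n"]] show ?case
    by (simp add: spline_def[abs_def])
qed

lemma spline_diff: "spline n g x - spline n g' x = spline n (\<lambda>k y. g k y - g' k y) x"
proof -
  have "interpolation k (g k) x - interpolation k (g' k) x = interpolation k (\<lambda>y. g k y - g' k y) x" for k
    using interpolation_linear[of k 1 "g k" "-1" "g' k" x] by simp
  then show ?thesis by (simp add: spline_def sum_subtractf[symmetric])
qed

lemma spline_midpoint: "\<exists>m g''. (\<lambda>x. (spline n g x + spline n' g' x) / 2) = spline m g''"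
proof -
  \<comment> \<open>Pads the shorter spline with zero data so that both use the same levels.\<close>
  define cut where "cut n g k = (if k < n then g k else (\<lambda>_. 0))" for n and g :: "nat \<Rightarrow> 'a \<Rightarrow> real" and k
  have pad: "spline n g x = spline m (cut n g) x" if "n \<le> m" for n m g x
  proof -
    have "(\<Sum>k<m. interpolation k (cut n g k) x) = (\<Sum>k\<in>{..<m} \<inter> {..<n}. interpolation k (g k) x)"
      by (subst sum.inter_restrict) (auto simp: cut_def interpolation_zero intro!: sum.cong)
    also have "{..<m} \<inter> {..<n} = {..<n}" using that by auto
    finally show ?thesis by (simp add: spline_def)
  qed
  define m where "m = max n n'"
  have "(spline n g x + spline n' g' x) / 2 = spline m (\<lambda>k y. 1/2 * cut n g k y + 1/2 * cut n' g' k y) x" for x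
    unfolding pad[of n m g, OF max.cobounded1[of n n', folded m_def]] pad[of n' m g', OF max.cobounded2[of n' n, folded m_def]]
    by (simp only: spline_def interpolation_linear sum.distrib sum_distrib_left[symmetric]) simp
  then show ?thesis by blast
qed

text \<open>Interpolating f at level m, with zero data elsewhere, is a spline of controlled energy.
  The approximant is made to agree with f on V_0, so that the base-vertex term of
  \<open>energy1_comparison\<close> vanishes.\<close>

lemma spline_approximation:
  assumes f: "f \<in> \<F>" and \<epsilon>: "0 < \<epsilon>"
  obtains n g where "energy1 p \<mu> \<E> \<Psi> (\<lambda>x. f x - spline n g x) < \<epsilon>"
proof -
  obtain A where A: "0 < A" "\<And>f. f \<in> \<F> \<Longrightarrow> energy1 p \<mu> \<E> \<Psi> f \<le> A * (\<bar>f base_vertex\<bar> powr p + \<E> f)"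
    by (rule energy1_comparison) blast
  obtain C where C: "0 < C" "\<And>f. f \<in> \<F> \<Longrightarrow> energy_le f (C * \<E> f)" "\<And>f c. energy_le f c \<Longrightarrow> \<E> f \<le> C * c"
    by (rule limit_form_comparison) blast
  obtain B where B: "0 < B" "\<And>m f. energy_le (interpolation m f) (B * Lam m f)"
    using interpolation_energy by metis
  let ?L = "{spline n g | n g. True}"
  have "\<exists>v\<in>?L. (\<forall>x\<in>V m. v x = f x) \<and> \<E> v \<le> C * (B * (C * \<E> f))" for m
  proof -
    define g where "g k = (if k = m then f else (\<lambda>_. 0))" for k
    have "spline (Suc m) g x = interpolation m f x" for x
      by (simp add: spline_def g_def interpolation_zero)
    then have eq: "spline (Suc m) g = interpolation m f" by blast
    have "\<E> (interpolation m f) \<le> C * (B * Lam m f)" by (rule C(3)[OF B(2)])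
    also have "\<dots> \<le> C * (B * (C * \<E> f))"
      using B(1) C(1) energy_leD[OF C(2)[OF f]] by (intro mult_left_mono) auto
    finally have "\<E> (spline (Suc m) g) \<le> C * (B * (C * \<E> f))" unfolding eq .
    moreover have "\<forall>x\<in>V m. spline (Suc m) g x = f x" unfolding eq using interpolation_vertex by blast
    ultimately show ?thesis by blast
  qed
  moreover have "?L \<subseteq> \<F>" using spline_limit_domain by blast
  moreover have "(\<lambda>x. (u x + v x) / 2) \<in> ?L" if "u \<in> ?L" "v \<in> ?L" for u v
    using that spline_midpoint by blast
  moreover have "0 < \<epsilon> / A" using A(1) \<epsilon> by simp
  ultimately obtain v where v: "v \<in> ?L" "\<And>x. x \<in> V 0 \<Longrightarrow> v x = f x" "\<E> (\<lambda>x. f x - v x) < \<epsilon> / A"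
    using limit_form_approximation[OF f, of ?L "C * (B * (C * \<E> f))" "\<epsilon> / A" 0] by blast
  then obtain n g where ng: "v = spline n g" by blast
  have D: "(\<lambda>x. f x - v x) \<in> \<F>" using f spline_limit_domain unfolding ng by (intro limit_domain_diff)
  have "energy1 p \<mu> \<E> \<Psi> (\<lambda>x. f x - v x) \<le> A * (\<bar>f base_vertex - v base_vertex\<bar> powr p + \<E> (\<lambda>x. f x - v x))"
    by (rule A(2)[OF D])
  also have "\<dots> = A * \<E> (\<lambda>x. f x - v x)" using v(2)[OF base_vertex(1)] by simp
  also have "\<dots> < A * (\<epsilon> / A)" using v(3) A(1) by (intro mult_strict_left_mono) auto
  finally show thesis using A(1) ng that by simp
qed

text \<open>For fixed n the data control the norm, so rounding them to rationals changes a spline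
  only slightly.\<close>

lemma spline_energy1:
  obtains Q where "0 < Q" "\<And>g D. 0 \<le> D \<Longrightarrow> (\<And>k x. k < n \<Longrightarrow> x \<in> V k \<Longrightarrow> \<bar>g k x\<bar> \<le> D) \<Longrightarrow>
    energy1 p \<mu> \<E> \<Psi> (spline n g) \<le> Q * D powr p"
proof -
  obtain A where A: "0 < A" "\<And>f. f \<in> \<F> \<Longrightarrow> energy1 p \<mu> \<E> \<Psi> f \<le> A * (\<bar>f base_vertex\<bar> powr p + \<E> f)"
    by (rule energy1_comparison) blast
  obtain C where C: "0 < C" "\<And>f c. energy_le f c \<Longrightarrow> \<E> f \<le> C * c"
    by (rule limit_form_comparison) blast
  obtain B where B: "0 < B" "\<And>m f. energy_le (interpolation m f) (B * Lam m f)"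
    using interpolation_energy by metis
  obtain Cu where Cu: "0 < Cu"
      "\<And>f D. 0 \<le> D \<Longrightarrow> (\<And>x y. x \<in> V 0 \<Longrightarrow> y \<in> V 0 \<Longrightarrow> \<bar>f x - f y\<bar> \<le> D) \<Longrightarrow> E f \<le> Cu * D powr p"
    using energies_M_upper[OF p E_M finite_V] by metis
  have Lam: "\<exists>c>0. \<forall>g D. 0 \<le> D \<longrightarrow> (\<forall>x\<in>V k. \<bar>g x\<bar> \<le> D) \<longrightarrow> Lam k g \<le> c * D powr p" for k
  proof (intro exI conjI allI impI)
    show "0 < (\<Sum>w\<in>W k. inverse (rw w) * (Cu * 2 powr p))"
      using Cu(1) rw_pos words_nonempty by (intro sum_pos mult_pos_pos) auto
    fix g :: "'a \<Rightarrow> real" and D :: real assume D: "0 \<le> D" "\<forall>x\<in>V k. \<bar>g x\<bar> \<le> D"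
    have "Lam k g \<le> (\<Sum>w\<in>W k. inverse (rw w) * (Cu * (2 * D) powr p))"
      unfolding Lam_def
    proof (intro sum_mono mult_left_mono Cu(2))
      fix w x y assume w: "w \<in> W k" "x \<in> V 0" "y \<in> V 0"
      then have "\<bar>g (fw w x)\<bar> \<le> D" "\<bar>g (fw w y)\<bar> \<le> D" using D(2) fw_in_V[OF w(1), of _ 0] by auto
      then show "\<bar>(g \<circ> fw w) x - (g \<circ> fw w) y\<bar> \<le> 2 * D" by (simp add: abs_le_iff)
    qed (use D rw_pos in \<open>auto intro: less_imp_le\<close>)
    then show "Lam k g \<le> (\<Sum>w\<in>W k. inverse (rw w) * (Cu * 2 powr p)) * D powr p"
      using D(1) by (simp add: powr_mult sum_distrib_right mult.assoc)
  qed
  have "\<exists>c>0. \<forall>g D. 0 \<le> D \<longrightarrow> (\<forall>k<n. \<forall>x\<in>V k. \<bar>g k x\<bar> \<le> D) \<longrightarrow> energy_le (spline n g) (c * D powr p)" for n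
  proof (induction n)
    case 0
    show ?case by (auto simp: spline_def[abs_def] energy_le_const intro!: exI[of _ 1])
  next
    case (Suc n)
    then obtain c where c: "0 < c" "\<And>g D. 0 \<le> D \<Longrightarrow> (\<forall>k<n. \<forall>x\<in>V k. \<bar>g k x\<bar> \<le> D) \<Longrightarrow> energy_le (spline n g) (c * D powr p)"
      by blast
    obtain l where l: "0 < l" "\<And>g D. 0 \<le> D \<Longrightarrow> (\<forall>x\<in>V n. \<bar>g x\<bar> \<le> D) \<Longrightarrow> Lam n g \<le> l * D powr p" using Lam[of n] by blast
    show ?case
    proof (intro exI conjI allI impI)
      show "0 < 2 powr (p - 1) * (c + B * l)" using c(1) l(1) B(1) by (simp add: add_pos_pos)
      fix g :: "nat \<Rightarrow> 'a \<Rightarrow> real" and D :: real assume D: "0 \<le> D" "\<forall>k<Suc n. \<forall>x\<in>V k. \<bar>g k x\<bar> \<le> D"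
      have "energy_le (interpolation n (g n)) (B * (l * D powr p))"
        using l(2)[of D "g n"] D B(1) by (intro energy_le_mono[OF B(2)] mult_left_mono) auto
      from energy_le_add[OF c(2)[OF D(1), of g] this] D(2)
      show "energy_le (spline (Suc n) g) (2 powr (p - 1) * (c + B * l) * D powr p)"
        by (simp add: spline_def[abs_def] algebra_simps)
    qed
  qed
  then obtain c where c: "0 < c" "\<And>g D. 0 \<le> D \<Longrightarrow> (\<forall>k<n. \<forall>x\<in>V k. \<bar>g k x\<bar> \<le> D) \<Longrightarrow> energy_le (spline n g) (c * D powr p)"
    by blast
  show thesis
  proof (rule that[of "A * (real n powr p + C * c)"])
    show "0 < A * (real n powr p + C * c)" using A(1) C(1) c(1) by (simp add: add_nonneg_pos)
    fix g :: "nat \<Rightarrow> 'a \<Rightarrow> real" and D :: real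
    assume D: "0 \<le> D" "\<And>k x. k < n \<Longrightarrow> x \<in> V k \<Longrightarrow> \<bar>g k x\<bar> \<le> D"
    have "\<bar>spline n g base_vertex\<bar> \<le> (\<Sum>k<n. D)"
      unfolding spline_def using D(2) base_vertex(2) interpolation_vertex
      by (intro order_trans[OF sum_abs] sum_mono) simp
    then have "\<bar>spline n g base_vertex\<bar> powr p \<le> (real n * D) powr p" using p by (intro powr_mono2) auto
    then have 1: "\<bar>spline n g base_vertex\<bar> powr p \<le> real n powr p * D powr p" using D(1) by (simp add: powr_mult)
    have 2: "\<E> (spline n g) \<le> C * (c * D powr p)" using D by (intro C(2) c(2)) auto
    have "energy1 p \<mu> \<E> \<Psi> (spline n g) \<le> A * (\<bar>spline n g base_vertex\<bar> powr p + \<E> (spline n g))"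
      by (rule A(2)[OF spline_limit_domain])
    also have "\<dots> \<le> A * (real n powr p * D powr p + C * (c * D powr p))"
      using 1 2 A(1) by (intro mult_left_mono add_mono) auto
    finally show "energy1 p \<mu> \<E> \<Psi> (spline n g) \<le> A * (real n powr p + C * c) * D powr p"
      by (simp add: algebra_simps)
  qed
qed

text \<open>A triangle inequality up to a constant, obtained from the base vertex and
  \<open>limit_form_add_le\<close>; density arguments need no more.\<close>

lemma energy1_add_le:
  obtains Q where "0 < Q" "\<And>f g. f \<in> \<F> \<Longrightarrow> g \<in> \<F> \<Longrightarrow>
    energy1 p \<mu> \<E> \<Psi> (\<lambda>x. f x + g x) \<le> Q * (energy1 p \<mu> \<E> \<Psi> f + energy1 p \<mu> \<E> \<Psi> g)"
proof -
  let ?e = "\<lambda>f. energy1 p \<mu> \<E> \<Psi> f" and ?P = "2 powr (p - 1)"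
  obtain A where A: "0 < A"
    "\<And>f. f \<in> \<F> \<Longrightarrow> ?e f \<le> A * (\<bar>f base_vertex\<bar> powr p + \<E> f)"
    "\<And>f. f \<in> \<F> \<Longrightarrow> \<bar>f base_vertex\<bar> powr p \<le> A * ?e f"
    by (rule energy1_comparison) blast
  show thesis
  proof (rule that[of "A * (?P * (A + 1))"])
    show "0 < A * (?P * (A + 1))" using A(1) by simp
    fix f g assume fg: "f \<in> \<F>" "g \<in> \<F>"
    have "?e (\<lambda>x. f x + g x) \<le> A * (\<bar>f base_vertex + g base_vertex\<bar> powr p + \<E> (\<lambda>x. f x + g x))"
      by (rule A(2)[OF limit_domain_add[OF fg]])
    also have "\<dots> \<le> A * (?P * (A * ?e f + A * ?e g) + ?P * (?e f + ?e g))"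
    proof (intro mult_left_mono add_mono)
      have "?P * (\<bar>f base_vertex\<bar> powr p + \<bar>g base_vertex\<bar> powr p) \<le> ?P * (A * ?e f + A * ?e g)"
        using A(3)[OF fg(1)] A(3)[OF fg(2)] by (intro mult_left_mono add_mono) auto
      then show "\<bar>f base_vertex + g base_vertex\<bar> powr p \<le> ?P * (A * ?e f + A * ?e g)"
        using powr_abs_add_le[of "f base_vertex" "g base_vertex"] by linarith
      have "?P * (\<E> f + \<E> g) \<le> ?P * (?e f + ?e g)"
        using limit_form_le_energy1 by (intro mult_left_mono add_mono) auto
      then show "\<E> (\<lambda>x. f x + g x) \<le> ?P * (?e f + ?e g)" using limit_form_add_le[OF fg] by linarith
    qed (use A(1) in simp)
    finally show "?e (\<lambda>x. f x + g x) \<le> A * (?P * (A + 1)) * (?e f + ?e g)" by (simp add: algebra_simps)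
  qed
qed

lemma separable: "separable_for (energy1_dist p \<mu> \<E> \<Psi>) \<F>"
proof -
  let ?e = "\<lambda>f. energy1 p \<mu> \<E> \<Psi> f"
  \<comment> \<open>Rational data on finitely many finite sets; taking extensional functions makes
    this family countable.\<close>
  define S where "S = (\<Union>n. spline n ` (\<Pi>\<^sub>E k\<in>{..<n}. \<Pi>\<^sub>E x\<in>V k. \<rat>))"
  have "countable S" unfolding S_def
    using finite_V by (intro countable_UN countable_image countable_PiE countable_rat) auto
  moreover have "dense_for (energy1_dist p \<mu> \<E> \<Psi>) S \<F>"
    unfolding dense_for_def
  proof (intro conjI ballI allI impI)
    show "S \<subseteq> \<F>" unfolding S_def using spline_limit_domain by blast
    fix f and \<epsilon> :: real assume f: "f \<in> \<F>" and \<epsilon>: "0 < \<epsilon>"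
    obtain P where P: "0 < P" "\<And>f g. f \<in> \<F> \<Longrightarrow> g \<in> \<F> \<Longrightarrow> ?e (\<lambda>x. f x + g x) \<le> P * (?e f + ?e g)"
      using energy1_add_le by blast
    \<comment> \<open>So that P * (\<delta> + \<delta>) = \<epsilon> powr p, one share for the
      spline and one for the rounding.\<close>
    define \<delta> where "\<delta> = \<epsilon> powr p / (2 * P)"
    have \<delta>: "0 < \<delta>" using \<epsilon> P(1) by (simp add: \<delta>_def)
    obtain n g where g: "?e (\<lambda>x. f x - spline n g x) < \<delta>" using spline_approximation[OF f \<delta>] .
    obtain Q where Q: "0 < Q" "\<And>g D. 0 \<le> D \<Longrightarrow> (\<And>k x. k < n \<Longrightarrow> x \<in> V k \<Longrightarrow> \<bar>g k x\<bar> \<le> D) \<Longrightarrow>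
      ?e (spline n g) \<le> Q * D powr p"
      by (rule spline_energy1[of n]) blast
    define D where "D = (\<delta> / (2 * Q)) powr (1 / p)"
    have D: "0 < D" "Q * D powr p = \<delta> / 2" using \<delta> Q(1) p by (simp_all add: D_def powr_powr)
    have "\<forall>y. \<exists>q\<in>\<rat>. \<bar>y - q\<bar> \<le> D"
    proof
      fix y
      obtain q where "q \<in> \<rat>" "y < q" "q < y + D" using Rats_dense_in_real[of y "y + D"] D(1) by auto
      then show "\<exists>q\<in>\<rat>. \<bar>y - q\<bar> \<le> D" by (intro bexI[of _ q]) auto
    qed
    then obtain q where q: "\<And>y. q y \<in> \<rat>" "\<And>y. \<bar>y - q y\<bar> \<le> D" by metis
    define g' where "g' = (\<lambda>k\<in>{..<n}. \<lambda>x\<in>V k. q (g k x))"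
    have "g' \<in> (\<Pi>\<^sub>E k\<in>{..<n}. \<Pi>\<^sub>E x\<in>V k. \<rat>)" unfolding g'_def using q(1) by (auto intro!: restrict_PiE_iff[THEN iffD2])
    then have S: "spline n g' \<in> S" unfolding S_def by blast
    have "?e (spline n (\<lambda>k y. g k y - g' k y)) \<le> \<delta> / 2"
      unfolding D(2)[symmetric] using D(1) q(2) by (intro Q(2)) (auto simp: g'_def)
    then have g': "?e (\<lambda>x. spline n g x - spline n g' x) \<le> \<delta> / 2" by (simp add: spline_diff)
    have "?e (\<lambda>x. f x - spline n g' x) = ?e (\<lambda>x. (f x - spline n g x) + (spline n g x - spline n g' x))" by simp
    also have "\<dots> \<le> P * (?e (\<lambda>x. f x - spline n g x) + ?e (\<lambda>x. spline n g x - spline n g' x))"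
      using f spline_limit_domain by (intro P(2) limit_domain_diff)
    also have "\<dots> < P * (\<delta> + \<delta>)" using g g' \<delta> P(1) by (intro mult_strict_left_mono) auto
    also have "\<dots> = \<epsilon> powr p" using P(1) by (simp add: \<delta>_def)
    finally have "energy1_dist p \<mu> \<E> \<Psi> f (spline n g') < \<epsilon>"
      using f spline_limit_domain by (intro energy1_dist_less \<epsilon> limit_domain_diff)
    with S show "\<exists>g\<in>S. energy1_dist p \<mu> \<E> \<Psi> f g < \<epsilon>" by blast
  qed
  ultimately show ?thesis unfolding separable_for_def by blast
qed

lemma \<Psi>_continuous_core:
  assumes "f \<in> \<F>" "uniformly_continuous_on VS f"
  shows "\<Psi> f \<in> continuous_core K \<F>"
  using assms continuous_\<Psi>[of f] limit_domain_cong[of "\<Psi> f" f] by (simp add: continuous_core_def)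

text \<open>For uniform approximation, \<open>cell_extension\<close> stays between the corner values
  of u in each cell, which are close at a fine level. For the energy norm, splines are dense and
  extend continuously; replacing a spline by its extension does not change its values at the
  vertices.\<close>

lemma regular: "regular_form p K \<mu> \<F> \<E> \<Psi>"
  unfolding regular_form_def dense_for_def
proof (intro conjI allI impI ballI)
  fix u :: "'a \<Rightarrow> real" and \<epsilon> :: real assume u: "continuous_on K u" and \<epsilon>: "0 < \<epsilon>"
  have "uniformly_continuous_on VS u"
    using compact_uniformly_continuous[OF u compact] VS_subset_K
    unfolding uniformly_continuous_on_def by (meson subsetD)
  \<comment> \<open>Passing from the vertices to their closure K yields a weak inequality; half of
    \<epsilon> makes it strict.\<close>
  moreover have "0 < \<epsilon> / 2" using \<epsilon> by simp
  ultimately obtain n0 where n0: "\<And>n w. n0 \<le> n \<Longrightarrow> w \<in> W n \<Longrightarrow> osc_le VS (u \<circ> fw w) (\<epsilon> / 2)"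
    by (rule uniformly_continuous_osc) blast
  define v where "v = \<Psi> (cell_extension n0 u)"
  have core: "v \<in> continuous_core K \<F>" unfolding v_def
    by (intro \<Psi>_continuous_core cell_extension_limit_domain uniformly_continuous_cell_extension)
  have VS: "\<bar>u x - v x\<bar> \<le> \<epsilon> / 2" if x: "x \<in> VS" for x
  proof -
    obtain w y where w: "w \<in> W n0" "y \<in> VS" "x = fw w y" using VS_obtain[OF x] .
    have "u x - \<epsilon> / 2 \<le> u (fw w q) \<and> u (fw w q) \<le> u x + \<epsilon> / 2" if "q \<in> V 0" for q
    proof -
      have "q \<in> VS" using that V_subset_VS by blast
      then have "\<bar>u (fw w q) - u x\<bar> \<le> \<epsilon> / 2" using n0[OF order_refl w(1)] w(2,3) by (simp add: osc_le_def)
      then show ?thesis by linarith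
    qed
    then have "u x - \<epsilon> / 2 \<le> cell_extension n0 u (fw w y) \<and> cell_extension n0 u (fw w y) \<le> u x + \<epsilon> / 2"
      by (intro cell_extension_range[OF w(1,2)])
    then have "u x - \<epsilon> / 2 \<le> cell_extension n0 u x \<and> cell_extension n0 u x \<le> u x + \<epsilon> / 2" using w(3) by simp
    then have "\<bar>u x - cell_extension n0 u x\<bar> \<le> \<epsilon> / 2" by linarith
    then show ?thesis using x by (simp add: v_def)
  qed
  have cont: "continuous_on (closure VS) (\<lambda>x. \<bar>u x - v x\<bar>)"
    unfolding closure_VS using u core by (intro continuous_intros) (auto simp: continuous_core_def)
  have "\<bar>u x - v x\<bar> < \<epsilon>" if "x \<in> K" for x
    using continuous_le_on_closure[OF cont, of x "\<epsilon> / 2"] VS that \<epsilon> unfolding closure_VS by force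
  with core show "\<exists>v\<in>continuous_core K \<F>. \<forall>x\<in>K. \<bar>u x - v x\<bar> < \<epsilon>" by blast
next
  show "continuous_core K \<F> \<subseteq> \<F>" by (auto simp: continuous_core_def)
next
  fix f and \<epsilon> :: real assume f: "f \<in> \<F>" and \<epsilon>: "0 < \<epsilon>"
  have "0 < \<epsilon> powr p" using \<epsilon> by simp
  then obtain n g where g: "energy1 p \<mu> \<E> \<Psi> (\<lambda>x. f x - spline n g x) < \<epsilon> powr p"
    using spline_approximation[OF f] by metis
  let ?v = "\<Psi> (spline n g)"
  have core: "?v \<in> continuous_core K \<F>"
    by (intro \<Psi>_continuous_core spline_limit_domain uniformly_continuous_spline)
  then have v: "?v \<in> \<F>" by (simp add: continuous_core_def)
  have "energy1 p \<mu> \<E> \<Psi> (\<lambda>x. f x - ?v x) = energy1 p \<mu> \<E> \<Psi> (\<lambda>x. f x - spline n g x)"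
    by (rule energy1_cong) simp
  then have "energy1_dist p \<mu> \<E> \<Psi> f ?v < \<epsilon>"
    using g by (intro energy1_dist_less \<epsilon> limit_domain_diff f v) simp
  with core show "\<exists>g\<in>continuous_core K \<F>. energy1_dist p \<mu> \<E> \<Psi> f g < \<epsilon>" by blast
qed

end

theorem theorem5p2:
  fixes F :: "nat \<Rightarrow> 'a::euclidean_space \<Rightarrow> 'a"
    and K :: "'a set" and N :: nat and p :: real
    and r :: "nat \<Rightarrow> real" and \<mu> :: "'a measure"
    and s :: "nat \<Rightarrow> nat"
    and V0 Vs :: "'a set"
    and \<D> :: "('a \<Rightarrow> real) set" and \<E> :: "('a \<Rightarrow> real) \<Rightarrow> real"
  assumes p: "1 < p"
    and K: "self_similar_set N F K" "connected K" "pcf N F K"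
    and r: "\<forall>i\<in>{1..N}. 0 < r i"
    and V0: "V0 = vertices N F K 0"
    and Vs: "Vs = all_vertices N F K"
    and ratio: "\<exists>E\<in>energies_M p V0. (INF n. resistance_ratio V0 ((renorm N F K r ^^ n) E)) > 0"
    and fixed_form: "\<exists>E\<in>energies_Q p V0. renorm N F K r E = E"
    and \<mu>: "radon_probability_on K \<mu>"
    and kappa: "summable (\<lambda>m. kappa N F K r \<mu> m powr (1 / p))"
    and \<D>: "\<D> = limit_domain p N F K r"
    and s: "strict_mono s"
    and s_limit: "\<forall>f\<in>\<D>. convergent (\<lambda>l. cesaro_energy p N F K r (s l) f)"
    and \<E>: "\<E> = limit_form p N F K r s"
  shows "\<exists>\<Psi>. Lp_extension p K Vs \<mu> \<D> \<E> \<Psi>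
            \<and> self_similar_embedding N F \<mu> \<D> \<Psi>
            \<and> markov_property \<mu> \<D> \<E> \<Psi>
            \<and> uniformly_convex_form \<D> \<E>
            \<and> complete_for (energy1_dist p \<mu> \<E> \<Psi>) \<D>
            \<and> separable_for (energy1_dist p \<mu> \<E> \<Psi>) \<D>
            \<and> regular_form p K \<mu> \<D> \<E> \<Psi>
            \<and> strongly_local K \<D> \<E>"
proof -
  \<comment> \<open>E does not occur in the conclusion; it is the auxiliary monotone energy against
    which the limit form is measured.\<close>
  obtain E where E: "E \<in> energies_Q p (vertices N F K 0)" "renorm N F K r E = E"
    using fixed_form V0 by blast
  interpret pcf_measure F K N r p E s \<mu>
    by unfold_locales (use K r p E s s_limit \<mu> kappa \<D> in auto)
  show ?thesis unfolding Vs \<D> \<E>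
    using Lp_extension self_similar_embedding markov_property uniformly_convex complete separable
      regular strongly_local by blast
qed

end
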